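(* Let $k\ge 0$ be an integer and $r=k+1$. Let $u$ be the solution of the Burgers problem $u_t+uu_x-\nu u_{xx}=0$ in $I\times J$, $u(x,0)=g(x)$ for $x\in I$, $u(0,t)=u(1,t)=0$ for $t\in J$, and assume $u\in H^2(0,T;H^{1+r}(I))$. For a partition $I_h$ of $I$ with mesh size $h$ and a time step $\tau=T/M$ ($M$ a positive integer), $t_n=n\tau$, let $U_n\in S_h^0$ ($n=0,1,\dots,M$) be a solution of the fully-discrete weak Galerkin scheme $$(\bar\partial_tU_n^0,v^0)_h+\nu(d_{w,r}U_n,d_{w,r}v)_h+\tfrac13(U_n^0\,d_{w,r}U_n,v^0)_h-\tfrac13(U_n^0U_n^0,d_{w,r}v)_h=0,\quad\forall v\in S_h^0,\ n=1,\dots,M,$$ with $U_0=g_h=Q_hg$, where $\bar\partial_tU_n=(U_n-U_{n-1})/\tau$. Then there exists a constant $C$, independent of the partition $I_h$ (in particular of $h$), of $\tau$ and of $n$, such that for $n=1,\dots,M$ $$\|u(t_n)-U_n^0\|_h^2\le C\Big(h^{2(k+1)}\max_{1\le j\le n}\|u(t_j)\|_{k+2}^2+\tau^2\int_0^{t_n}\|u_{tt}(s)\|^2\,ds\Big).$$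
   Context: $I=(0,1)$, $J=(0,T]$ with $0<T<\infty$, and $\nu>0$ is a constant (inverse Reynolds number). $\|\cdot\|_s$ is the norm of the Sobolev space $H^s(I)$ and $\|\cdot\|$ is the $L^2(I)$ norm. $H^l(0,T;H^s(I))$ is the usual space of functions of $t\in(0,T)$ with values in $H^s(I)$ whose time derivatives up to order $l$ are square integrable in time with values in $H^s(I)$. Partition: $I_h:\ 0=x_1<x_2<\dots<x_N=1$, $I_i=(x_i,x_{i+1})$, $h_i=x_{i+1}-x_i$, $h=\max_i h_i$. $P_m(I_i)$ denotes polynomials of degree at most $m$ on $I_i$. Weak functions: $S_h$ is the space of $v$ consisting of an interior part $v^0$ with $v^0|_{I_i}\in P_k(I_i)$ for each $i=1,\dots,N-1$ (no continuity between elements required), together with one real nodal value $v^i$ at each node $x_i$, $i=1,\dots,N$ (not necessarily related to traces of $v^0$). $S_h^0=\{v\in S_h: v^1=v^N=0\}$. $U_n^0$ denotes the interior part of $U_n$. Discrete weak derivative: for $v\in S_h$, $d_{w,r}v$ is the piecewise polynomial with $d_{w,r}v|_{I_i}\in P_r(I_i)$ determined on each element by $\int_{I_i}(d_{w,r}v)\,q\,dx=-\int_{I_i}v^0q'\,dx+v^{i+1}q(x_{i+1})-v^iq(x_i)$ for all $q\in P_r(I_i)$. Discrete inner product: $(u,v)_h=\sum_{i=1}^{N-1}\int_{I_i}uv\,dx$, $\|u\|_h^2=(u,u)_h$. Projection: for $w\in H^1(I)$, $Q_hw\in S_h$ has interior part $Q_h^0w$ equal on each $I_i$ to the $L^2(I_i)$-orthogonal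 projection of $w$ onto $P_k(I_i)$, and nodal values $(Q_hw)^i=w(x_i)$. The constant $C$ may depend on $u$, $\nu$, $T$, $k$. *)

theory Defs
  imports "HOL-Analysis.Analysis" "HOL-Computational_Algebra.Polynomial"
begin

section \<open>Sobolev spaces on the unit interval\<close>

text \<open>
  Elements of a Sobolev space are represented by functions; two representatives of the same
  element agree almost everywhere on the interval. Integrals are taken with respect to
  Lebesgue measure (not Borel-Lebesgue measure), so that changing a representative on a null set
  never destroys measurability.
\<close>

definition test_function :: "real \<Rightarrow> real \<Rightarrow> (real \<Rightarrow> real) \<Rightarrow> bool" where
  "test_function a b \<phi> \<longleftrightarrow>
     (\<forall>n y. (deriv ^^ n) \<phi> differentiable (at y)) \<and>
     compact (closure {y. \<phi> y \<noteq> 0}) \<and> closure {y. \<phi> y \<noteq> 0} \<subseteq> {a<..<b}"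

abbreviation unit_ivl :: "real set" where
  "unit_ivl \<equiv> {0<..<1}"

definition L2 :: "(real \<Rightarrow> real) \<Rightarrow> bool" where
  "L2 f \<longleftrightarrow> set_borel_measurable lebesgue unit_ivl f \<and>
     set_integrable lebesgue unit_ivl (\<lambda>y. (f y)\<^sup>2)"

definition L2_norm :: "(real \<Rightarrow> real) \<Rightarrow> real" where
  "L2_norm f = sqrt (LINT y:unit_ivl|lebesgue. (f y)\<^sup>2)"

definition is_weak_deriv :: "nat \<Rightarrow> (real \<Rightarrow> real) \<Rightarrow> (real \<Rightarrow> real) \<Rightarrow> bool" where
  "is_weak_deriv j f g \<longleftrightarrow> L2 f \<and> L2 g \<and>
     (\<forall>\<phi>. test_function 0 1 \<phi> \<longrightarrow>
        (LINT y:unit_ivl|lebesgue. f y * (deriv ^^ j) \<phi> y) =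
        (-1) ^ j * (LINT y:unit_ivl|lebesgue. g y * \<phi> y))"

text \<open>The following choice is unique up to almost everywhere equality.\<close>

definition weak_deriv :: "nat \<Rightarrow> (real \<Rightarrow> real) \<Rightarrow> real \<Rightarrow> real" where
  "weak_deriv j f = (SOME g. is_weak_deriv j f g)"

definition sobolev :: "nat \<Rightarrow> (real \<Rightarrow> real) set" where
  "sobolev s = {f. \<forall>j\<le>s. \<exists>g. is_weak_deriv j f g}"

definition sobolev_norm :: "nat \<Rightarrow> (real \<Rightarrow> real) \<Rightarrow> real" where
  "sobolev_norm s f = sqrt (\<Sum>j\<le>s. (L2_norm (weak_deriv j f))\<^sup>2)"


section \<open>Sobolev spaces of functions of time with values in a Sobolev space\<close>

text \<open>
  The Bochner integral of the library is for functions with values in a Banach space that is a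
  type, whereas \<open>H\<^sup>s\<close> depends on \<open>s\<close> and is given by representatives. So strong measurability and
  the integral over \<open>(0,T)\<close> are defined here by the usual approximation with simple functions
  in the norm of \<open>H\<^sup>s\<close>.
\<close>

definition sob_simple :: "nat \<Rightarrow> real \<Rightarrow> (real \<Rightarrow> real \<Rightarrow> real) \<Rightarrow> bool" where
  "sob_simple s T S \<longleftrightarrow> finite (S ` {0<..<T}) \<and> S ` {0<..<T} \<subseteq> sobolev s \<and>
     (\<forall>f. {t \<in> {0<..<T}. S t = f} \<in> sets lebesgue)"

definition sob_simple_integral ::
    "real \<Rightarrow> (real \<Rightarrow> real \<Rightarrow> real) \<Rightarrow> real \<Rightarrow> real" where
  "sob_simple_integral T S =
     (\<lambda>y. \<Sum>f\<in>S ` {0<..<T}. measure lebesgue {t \<in> {0<..<T}. S t = f} * f y)"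

definition sob_strongly_measurable :: "nat \<Rightarrow> real \<Rightarrow> (real \<Rightarrow> real \<Rightarrow> real) \<Rightarrow> bool" where
  "sob_strongly_measurable s T v \<longleftrightarrow>
     (\<exists>S. (\<forall>n. sob_simple s T (S n)) \<and>
       (AE t in lebesgue. t \<in> {0<..<T} \<longrightarrow> v t \<in> sobolev s \<and>
          (\<lambda>n. sobolev_norm s (\<lambda>y. v t y - S n t y)) \<longlonglongrightarrow> 0))"

definition has_sob_integral ::
    "nat \<Rightarrow> real \<Rightarrow> (real \<Rightarrow> real \<Rightarrow> real) \<Rightarrow> (real \<Rightarrow> real) \<Rightarrow> bool" where
  "has_sob_integral s T v B \<longleftrightarrow> sob_strongly_measurable s T v \<and> B \<in> sobolev s \<and>
     (\<exists>S. (\<forall>n. sob_simple s T (S n)) \<and>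
       (\<lambda>n. \<integral>\<^sup>+t\<in>{0<..<T}. ennreal (sobolev_norm s (\<lambda>y. v t y - S n t y)) \<partial>lebesgue)
          \<longlonglongrightarrow> 0 \<and>
       (\<lambda>n. sobolev_norm s (\<lambda>y. B y - sob_simple_integral T (S n) y)) \<longlonglongrightarrow> 0)"

definition L2_time :: "nat \<Rightarrow> real \<Rightarrow> (real \<Rightarrow> real \<Rightarrow> real) \<Rightarrow> bool" where
  "L2_time s T v \<longleftrightarrow> sob_strongly_measurable s T v \<and>
     set_integrable lebesgue {0<..<T} (\<lambda>t. (sobolev_norm s (v t))\<^sup>2)"

definition is_time_deriv ::
    "nat \<Rightarrow> real \<Rightarrow> nat \<Rightarrow> (real \<Rightarrow> real \<Rightarrow> real) \<Rightarrow> (real \<Rightarrow> real \<Rightarrow> real) \<Rightarrow> bool" where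
  "is_time_deriv s T j v w \<longleftrightarrow> L2_time s T v \<and> L2_time s T w \<and>
     (\<forall>\<phi>. test_function 0 T \<phi> \<longrightarrow>
        (\<exists>B. has_sob_integral s T (\<lambda>t y. (deriv ^^ j) \<phi> t * v t y) B \<and>
             has_sob_integral s T (\<lambda>t y. (-1) ^ j * (\<phi> t * w t y)) B))"

definition time_deriv ::
    "nat \<Rightarrow> real \<Rightarrow> nat \<Rightarrow> (real \<Rightarrow> real \<Rightarrow> real) \<Rightarrow> real \<Rightarrow> real \<Rightarrow> real" where
  "time_deriv s T j v = (SOME w. is_time_deriv s T j v w)"

definition sobolev_time :: "nat \<Rightarrow> real \<Rightarrow> nat \<Rightarrow> (real \<Rightarrow> real \<Rightarrow> real) set" where
  "sobolev_time l T s = {v. \<forall>j\<le>l. \<exists>w. is_time_deriv s T j v w}"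


section \<open>The Burgers problem\<close>

text \<open>
  A function of time and space is written \<open>u t x\<close>. For \<open>s \<ge> 2\<close> an element of
  \<open>H\<^sup>2(0,T;H\<^sup>s(0,1))\<close> has exactly one representative that is continuous on
  \<open>[0,T] \<times> [0,1]\<close>; \<open>u\<close> is this representative, so that initial, boundary and
  nodal values and \<open>u t\<close> at a given time are meaningful. The equation is required almost
  everywhere, with weak derivatives.
\<close>

definition burgers_solution ::
    "nat \<Rightarrow> real \<Rightarrow> real \<Rightarrow> (real \<Rightarrow> real) \<Rightarrow> (real \<Rightarrow> real \<Rightarrow> real) \<Rightarrow> bool" where
  "burgers_solution s T \<nu> g u \<longleftrightarrow>
     u \<in> sobolev_time 2 T s \<and>
     continuous_on ({0..T} \<times> {0..1}) (\<lambda>(t, y). u t y) \<and>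
     (AE t in lebesgue. t \<in> {0<..T} \<longrightarrow>
        (AE y in lebesgue. y \<in> unit_ivl \<longrightarrow>
           time_deriv s T 1 u t y + u t y * weak_deriv 1 (u t) y
             - \<nu> * weak_deriv 2 (u t) y = 0)) \<and>
     (\<forall>y\<in>unit_ivl. u 0 y = g y) \<and>
     (\<forall>t\<in>{0<..T}. u t 0 = 0 \<and> u t 1 = 0)"


section \<open>Partitions and weak Galerkin functions\<close>

text \<open>The nodes are \<open>x 1, \<dots>, x N\<close> and the elements are indexed by \<open>1, \<dots>, N - 1\<close>.\<close>

definition is_partition :: "nat \<Rightarrow> (nat \<Rightarrow> real) \<Rightarrow> bool" where
  "is_partition N x \<longleftrightarrow> 2 \<le> N \<and> x 1 = 0 \<and> x N = 1 \<and> (\<forall>i\<in>{1..<N}. x i < x (Suc i))"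

definition elem :: "(nat \<Rightarrow> real) \<Rightarrow> nat \<Rightarrow> real set" where
  "elem x i = {x i<..<x (Suc i)}"

definition mesh_size :: "nat \<Rightarrow> (nat \<Rightarrow> real) \<Rightarrow> real" where
  "mesh_size N x = Max ((\<lambda>i. x (Suc i) - x i) ` {1..<N})"

text \<open>
  The restriction of the interior part to the \<open>i\<close>-th element is given by the polynomial
  \<open>inner_part v i\<close>; the value at the \<open>i\<close>-th node is \<open>node_val v i\<close>. Entries
  outside the index ranges of the partition are irrelevant.
\<close>

datatype weak_fun = Weak_Fun (inner_part: "nat \<Rightarrow> real poly") (node_val: "nat \<Rightarrow> real")

definition wg_space :: "nat \<Rightarrow> nat \<Rightarrow> weak_fun set" where
  "wg_space N k = {v. \<forall>i\<in>{1..<N}. degree (inner_part v i) \<le> k}"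

definition wg_space0 :: "nat \<Rightarrow> nat \<Rightarrow> weak_fun set" where
  "wg_space0 N k = {v \<in> wg_space N k. node_val v 1 = 0 \<and> node_val v N = 0}"

definition weak_diff :: "(nat \<Rightarrow> real) \<Rightarrow> nat \<Rightarrow> weak_fun \<Rightarrow> nat \<Rightarrow> real poly" where
  "weak_diff x r v i = (THE p. degree p \<le> r \<and>
     (\<forall>q. degree q \<le> r \<longrightarrow>
        (LINT y:elem x i|lebesgue. poly p y * poly q y) =
        - (LINT y:elem x i|lebesgue. poly (inner_part v i) y * poly (pderiv q) y)
        + node_val v (Suc i) * poly q (x (Suc i)) - node_val v i * poly q (x i)))"

text \<open>
  The arguments of the discrete inner product are elementwise functions: \<open>f i\<close> is the
  function on the \<open>i\<close>-th element.
\<close>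

definition inner_h ::
    "nat \<Rightarrow> (nat \<Rightarrow> real) \<Rightarrow> (nat \<Rightarrow> real \<Rightarrow> real) \<Rightarrow> (nat \<Rightarrow> real \<Rightarrow> real) \<Rightarrow> real" where
  "inner_h N x f g = (\<Sum>i\<in>{1..<N}. LINT y:elem x i|lebesgue. f i y * g i y)"

definition norm_h :: "nat \<Rightarrow> (nat \<Rightarrow> real) \<Rightarrow> (nat \<Rightarrow> real \<Rightarrow> real) \<Rightarrow> real" where
  "norm_h N x f = sqrt (inner_h N x f f)"

definition L2_proj :: "(nat \<Rightarrow> real) \<Rightarrow> nat \<Rightarrow> (real \<Rightarrow> real) \<Rightarrow> nat \<Rightarrow> real poly" where
  "L2_proj x k w i = (THE p. degree p \<le> k \<and>
     (\<forall>q. degree q \<le> k \<longrightarrow> (LINT y:elem x i|lebesgue. (w y - poly p y) * poly q y) = 0))"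

definition Q_h :: "(nat \<Rightarrow> real) \<Rightarrow> nat \<Rightarrow> (real \<Rightarrow> real) \<Rightarrow> weak_fun" where
  "Q_h x k w = Weak_Fun (L2_proj x k w) (\<lambda>i. w (x i))"

definition wg_scheme ::
    "nat \<Rightarrow> nat \<Rightarrow> real \<Rightarrow> real \<Rightarrow> (real \<Rightarrow> real) \<Rightarrow> nat \<Rightarrow> (nat \<Rightarrow> real) \<Rightarrow> nat \<Rightarrow>
       (nat \<Rightarrow> weak_fun) \<Rightarrow> bool" where
  "wg_scheme k r \<nu> \<tau> g N x M U \<longleftrightarrow>
     (\<forall>n\<le>M. U n \<in> wg_space0 N k) \<and>
     U 0 = Q_h x k g \<and>
     (\<forall>n\<in>{1..M}. \<forall>v\<in>wg_space0 N k.
        (let U\<^sub>0 = (\<lambda>i. poly (inner_part (U n) i));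
             Uold\<^sub>0 = (\<lambda>i. poly (inner_part (U (n - 1)) i));
             v\<^sub>0 = (\<lambda>i. poly (inner_part v i));
             dU = (\<lambda>i. poly (weak_diff x r (U n) i));
             dv = (\<lambda>i. poly (weak_diff x r v i))
         in inner_h N x (\<lambda>i y. (U\<^sub>0 i y - Uold\<^sub>0 i y) / \<tau>) v\<^sub>0
            + \<nu> * inner_h N x dU dv
            + 1/3 * inner_h N x (\<lambda>i y. U\<^sub>0 i y * dU i y) v\<^sub>0
            - 1/3 * inner_h N x (\<lambda>i y. U\<^sub>0 i y * U\<^sub>0 i y) dv = 0))"

end

theory Submission
  imports Defs
begin

text \<open>
  Let \<open>\<pi>\<close> be the elementwise \<open>L\<^sup>2\<close> projection and \<open>e = Q\<^sub>h u(t\<^sub>n) - U\<^sub>n\<close>, so that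
  \<open>d\<^sub>w Q\<^sub>h u = \<pi> u\<^sub>x\<close>. The fluxes \<open>u\<^sub>x\<close> and \<open>u\<^sup>2\<close> are replaced by continuous piecewise polynomials \<open>P w\<close>
  with \<open>(w', v\<^sup>0) = - (P w, d\<^sub>w v)\<close>. Testing the difference of the equation and the scheme with \<open>e\<close>, the
  terms cubic in \<open>e\<close> cancel because of the skew symmetric form of the nonlinearity, and Young's
  inequality leaves \<open>\<parallel>e\<^sub>n\<parallel>\<^sup>2 - \<parallel>e\<^sub>n\<^sub>-\<^sub>1\<parallel>\<^sup>2 \<le> \<tau> (L \<parallel>e\<^sub>n\<parallel>\<^sup>2 + \<dots>)\<close>. Gronwall's lemma gives the estimate if \<open>L \<tau> \<le> 1/2\<close>.

  For larger \<open>\<tau>\<close> the left hand side is bounded by the stability of the scheme, and the right hand side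
  is bounded below by a multiple of the integral of \<open>\<parallel>u\<^sub>t\<^sub>t\<parallel>\<^sup>2\<close> over a fixed interval \<open>(0, \<delta>)\<close>. If this
  integral is zero, \<open>u\<close> is affine in time on \<open>(0, \<delta>)\<close>, hence \<open>u = 0\<close> by the energy identity.

  Membership of \<open>u(t)\<close> in \<open>H\<^sup>k\<^sup>+\<^sup>2\<close> and the equation at every single time \<open>t\<close> are obtained from scalar functions:
  for a test function \<open>\<phi>\<close>, the pairings of \<open>u(t)\<close> with \<open>\<phi>\<close> and its derivatives are \<open>H\<^sup>2\<close> functions of \<open>t\<close>.
\<close>

section \<open>Square integrable functions\<close>

text \<open>The constant is fixed before partition, step and discrete solution, and the scheme is
  implicit, so nothing may rest on quasi-uniform meshes, inverse inequalities or uniqueness of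
  \<open>U\<close>. Sup norms are therefore taken only of \<open>u\<close>, \<open>u_x\<close> and
  their projections, where an affine change of variables gives bounds free of the element length.
  The error enters only through its norm and that of its weak derivative, which the viscosity
  absorbs.

  Interior parts are discontinuous, so the equation, first known against smooth functions, has to be
  carried to bounded measurable ones. A flux derivative with \<open>k\<close> further derivatives is
  approximated to order \<open>k\<close>; its primitive gains the missing power of \<open>h\<close>.
  The flux \<open>u^2\<close> is quadratic in the Sobolev norm; one factor is replaced by a bound
  uniform in time, so that the squared consistency error stays quadratic in the norm, as the claim
  demands.

  In the degenerate case of large steps only \<open>u = 0\<close> at the start follows directly.
  That \<open>u\<close> stays zero up to time \<open>T\<close> is drawn from the small-step estimate
  itself, applied to the zero discrete functions.\<close>

definition square_integrable :: "'a measure \<Rightarrow> ('a \<Rightarrow> real) \<Rightarrow> bool" where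
  "square_integrable M f \<longleftrightarrow> f \<in> borel_measurable M \<and> integrable M (\<lambda>x. (f x)\<^sup>2)"

definition l2n :: "'a measure \<Rightarrow> ('a \<Rightarrow> real) \<Rightarrow> real" where
  "l2n M f = sqrt (\<integral>x. (f x)\<^sup>2 \<partial>M)"

lemma square_integrable_measurable: "square_integrable M f \<Longrightarrow> f \<in> borel_measurable M"
  by (simp add: square_integrable_def)

lemma square_integrable_square: "square_integrable M f \<Longrightarrow> integrable M (\<lambda>x. (f x)\<^sup>2)"
  by (simp add: square_integrable_def)

lemma l2n_nonneg [simp]: "0 \<le> l2n M f"
  by (simp add: l2n_def integral_nonneg_AE)

lemma l2n_square: "(l2n M f)\<^sup>2 = (\<integral>x. (f x)\<^sup>2 \<partial>M)"
  by (simp add: l2n_def integral_nonneg_AE)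

lemma square_integrable_mult:
  assumes f: "square_integrable M f" and g: "square_integrable M g"
  shows "integrable M (\<lambda>x. f x * g x)"
proof (rule Bochner_Integration.integrable_bound)
  show "integrable M (\<lambda>x. (f x)\<^sup>2 + (g x)\<^sup>2)"
    using f g by (simp add: square_integrable_def)
  show "(\<lambda>x. f x * g x) \<in> borel_measurable M"
    using f g by (auto simp: square_integrable_def)
  have "\<bar>f x * g x\<bar> \<le> (f x)\<^sup>2 + (g x)\<^sup>2" for x
    using sum_squares_bound[of "\<bar>f x\<bar>" "\<bar>g x\<bar>"] mult_nonneg_nonneg[of "\<bar>f x\<bar>" "\<bar>g x\<bar>"]
    unfolding abs_mult power2_abs by linarith
  then show "AE x in M. norm (f x * g x) \<le> norm ((f x)\<^sup>2 + (g x)\<^sup>2)"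
    by simp
qed

lemma square_integrable_zero [simp]: "square_integrable M (\<lambda>x. 0)"
  by (simp add: square_integrable_def)

lemma square_integrable_add:
  assumes f: "square_integrable M f" and g: "square_integrable M g"
  shows "square_integrable M (\<lambda>x. f x + g x)"
  unfolding square_integrable_def
proof
  show "(\<lambda>x. f x + g x) \<in> borel_measurable M"
    using f g by (auto simp: square_integrable_def)
  have "integrable M (\<lambda>x. (f x)\<^sup>2 + (g x)\<^sup>2 + 2 * (f x * g x))"
    using f g square_integrable_mult[OF f g] by (simp add: square_integrable_def)
  then show "integrable M (\<lambda>x. (f x + g x)\<^sup>2)"
    by (simp add: power2_sum algebra_simps)
qed

lemma square_integrable_scale:
  assumes f: "square_integrable M f"
  shows "square_integrable M (\<lambda>x. c * f x)"
  using f by (auto simp: square_integrable_def power_mult_distrib)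

lemma square_integrable_uminus:
  "square_integrable M f \<Longrightarrow> square_integrable M (\<lambda>x. - f x)"
  using square_integrable_scale[of M f "-1"] by simp

lemma square_integrable_diff:
  assumes f: "square_integrable M f" and g: "square_integrable M g"
  shows "square_integrable M (\<lambda>x. f x - g x)"
  using square_integrable_add[OF f square_integrable_uminus[OF g]] by simp

lemma square_integrable_bounded_mult:
  assumes f: "square_integrable M f" and g: "g \<in> borel_measurable M"
    and b: "AE x in M. \<bar>g x\<bar> \<le> B"
  shows "square_integrable M (\<lambda>x. g x * f x)"
  unfolding square_integrable_def
proof
  show "(\<lambda>x. g x * f x) \<in> borel_measurable M"
    using f g by (auto simp: square_integrable_def)
  show "integrable M (\<lambda>x. (g x * f x)\<^sup>2)"
  proof (rule Bochner_Integration.integrable_bound)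
    show "integrable M (\<lambda>x. B\<^sup>2 * (f x)\<^sup>2)"
      using f by (simp add: square_integrable_def)
    show "(\<lambda>x. (g x * f x)\<^sup>2) \<in> borel_measurable M"
      using f g by (auto simp: square_integrable_def)
    show "AE x in M. norm ((g x * f x)\<^sup>2) \<le> norm (B\<^sup>2 * (f x)\<^sup>2)"
      using b
    proof eventually_elim
      case (elim x)
      then have "(g x)\<^sup>2 \<le> B\<^sup>2" by (metis abs_le_square_iff abs_of_nonneg abs_ge_zero order_trans)
      then show ?case by (simp add: power_mult_distrib mult_right_mono)
    qed
  qed
qed

lemma l2n_bounded_mult:
  assumes f: "square_integrable M f" and g: "g \<in> borel_measurable M"
    and b: "AE x in M. \<bar>g x\<bar> \<le> B" and B: "0 \<le> B"
  shows "l2n M (\<lambda>x. g x * f x) \<le> B * l2n M f"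
proof -
  have "(\<integral>x. (g x * f x)\<^sup>2 \<partial>M) \<le> (\<integral>x. B\<^sup>2 * (f x)\<^sup>2 \<partial>M)"
  proof (rule integral_mono_AE)
    show "integrable M (\<lambda>x. (g x * f x)\<^sup>2)"
      using square_integrable_bounded_mult[OF f g b] by (simp add: square_integrable_def)
    show "integrable M (\<lambda>x. B\<^sup>2 * (f x)\<^sup>2)"
      using f by (simp add: square_integrable_def)
    show "AE x in M. (g x * f x)\<^sup>2 \<le> B\<^sup>2 * (f x)\<^sup>2"
      using b
    proof eventually_elim
      case (elim x)
      then have "(g x)\<^sup>2 \<le> B\<^sup>2" by (metis abs_le_square_iff abs_of_nonneg abs_ge_zero order_trans)
      then show ?case by (simp add: power_mult_distrib mult_right_mono)
    qed
  qed
  then have "(l2n M (\<lambda>x. g x * f x))\<^sup>2 \<le> (B * l2n M f)\<^sup>2"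
    by (simp add: l2n_square power_mult_distrib)
  then show ?thesis by (rule power2_le_imp_le) (use B in simp)
qed

lemma square_integrable_bounded:
  assumes M: "finite_measure M" and f: "f \<in> borel_measurable M"
    and b: "AE x in M. \<bar>f x\<bar> \<le> B"
  shows "square_integrable M f"
proof -
  interpret finite_measure M by fact
  have "square_integrable M (\<lambda>x. 1)" by (simp add: square_integrable_def)
  from square_integrable_bounded_mult[OF this f b] show ?thesis by simp
qed

lemma square_integrable_integrable:
  assumes M: "finite_measure M" and f: "square_integrable M f"
  shows "integrable M f"
proof -
  interpret finite_measure M by fact
  have "square_integrable M (\<lambda>x. 1)" by (simp add: square_integrable_def)
  from square_integrable_mult[OF f this] show ?thesis by simp
qed

lemma l2n_cong_AE:
  assumes "f \<in> borel_measurable M" "g \<in> borel_measurable M" "AE x in M. f x = g x"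
  shows "l2n M f = l2n M g"
  unfolding l2n_def using assms by (intro arg_cong[where f=sqrt] integral_cong_AE) auto

lemma l2n_cong: "(\<And>x. x \<in> space M \<Longrightarrow> f x = g x) \<Longrightarrow> l2n M f = l2n M g"
  unfolding l2n_def by (intro arg_cong[where f=sqrt] Bochner_Integration.integral_cong) auto

lemma square_integrable_cong_AE:
  assumes "square_integrable M f" "g \<in> borel_measurable M" "AE x in M. f x = g x"
  shows "square_integrable M g"
proof -
  have "integrable M (\<lambda>x. (g x)\<^sup>2)"
    by (rule integrable_cong_AE_imp[OF square_integrable_square[OF assms(1)]])
       (use assms in auto)
  then show ?thesis using assms by (simp add: square_integrable_def)
qed

lemma Cauchy_Schwarz_l2:
  assumes f: "square_integrable M f" and g: "square_integrable M g"
  shows "\<bar>\<integral>x. f x * g x \<partial>M\<bar> \<le> l2n M f * l2n M g"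
proof -
  define a where "a = (\<integral>x. (f x)\<^sup>2 \<partial>M)"
  define b where "b = (\<integral>x. f x * g x \<partial>M)"
  define c where "c = (\<integral>x. (g x)\<^sup>2 \<partial>M)"
  have nonneg: "0 \<le> a * t\<^sup>2 - 2 * b * t + c" for t
  proof -
    have "0 \<le> (\<integral>x. (t * f x - g x)\<^sup>2 \<partial>M)" by (simp add: integral_nonneg_AE)
    also have "\<dots> = (\<integral>x. t\<^sup>2 * (f x)\<^sup>2 - 2 * t * (f x * g x) + (g x)\<^sup>2 \<partial>M)"
      by (rule Bochner_Integration.integral_cong) (auto simp: power2_diff power_mult_distrib)
    also have "\<dots> = t\<^sup>2 * a - 2 * t * b + c"
      using square_integrable_mult[OF f g] f g
      by (simp add: square_integrable_def a_def b_def c_def)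
    finally show ?thesis by (simp add: mult_ac)
  qed
  have a0: "0 \<le> a" and c0: "0 \<le> c" by (simp_all add: a_def c_def integral_nonneg_AE)
  have "b\<^sup>2 \<le> a * c"
  proof (cases "a = 0")
    case True
    have "b = 0"
    proof (rule ccontr)
      assume "b \<noteq> 0"
      \<comment> \<open>With \<open>a = 0\<close> the expression is linear in \<open>t\<close>; this
        argument makes it equal to \<open>-1\<close>.\<close>
      with nonneg[of "(c + 1) / (2 * b)"] True show False by (simp add: field_simps)
    qed
    with True show ?thesis by simp
  next
    case False
    then have "a > 0" using a0 by simp
    have "0 \<le> a * (a * (b / a)\<^sup>2 - 2 * b * (b / a) + c)"
      by (rule mult_nonneg_nonneg[OF a0 nonneg])
    also have "\<dots> = a * c - b\<^sup>2"
      using \<open>a > 0\<close> by (simp add: field_simps power2_eq_square)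
    finally show ?thesis by simp
  qed
  then have "\<bar>b\<bar> \<le> sqrt (a * c)" by (metis real_sqrt_abs real_sqrt_le_iff)
  then show ?thesis by (simp add: l2n_def a_def b_def c_def real_sqrt_mult)
qed

lemma l2n_scale: "l2n M (\<lambda>x. c * f x) = \<bar>c\<bar> * l2n M f"
  by (simp add: l2n_def power_mult_distrib real_sqrt_mult)

lemma l2n_minus_commute: "l2n M (\<lambda>x. f x - g x) = l2n M (\<lambda>x. g x - f x)"
  by (simp add: l2n_def power2_commute)

lemma l2n_triangle:
  assumes f: "square_integrable M f" and g: "square_integrable M g"
  shows "l2n M (\<lambda>x. f x + g x) \<le> l2n M f + l2n M g"
proof -
  have "(l2n M (\<lambda>x. f x + g x))\<^sup>2 = (\<integral>x. (f x)\<^sup>2 + 2 * (f x * g x) + (g x)\<^sup>2 \<partial>M)"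
    unfolding l2n_square by (rule Bochner_Integration.integral_cong) (auto simp: power2_sum)
  also have "\<dots> = (l2n M f)\<^sup>2 + 2 * (\<integral>x. f x * g x \<partial>M) + (l2n M g)\<^sup>2"
    using square_integrable_mult[OF f g] f g by (simp add: square_integrable_def l2n_square)
  also have "\<dots> \<le> (l2n M f)\<^sup>2 + 2 * (l2n M f * l2n M g) + (l2n M g)\<^sup>2"
    using Cauchy_Schwarz_l2[OF f g] by simp
  also have "\<dots> = (l2n M f + l2n M g)\<^sup>2" by (simp add: power2_sum)
  finally show ?thesis by (rule power2_le_imp_le) simp
qed

lemma l2n_abs_diff:
  assumes f: "square_integrable M f" and g: "square_integrable M g"
  shows "\<bar>l2n M f - l2n M g\<bar> \<le> l2n M (\<lambda>x. f x - g x)"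
  using l2n_triangle[OF square_integrable_diff[OF f g] g]
    l2n_triangle[OF square_integrable_diff[OF g f] f] l2n_minus_commute[of M f g] by simp

lemma l2n_mono:
  assumes f: "f \<in> borel_measurable M" and g: "square_integrable M g"
    and le: "AE x in M. \<bar>f x\<bar> \<le> \<bar>g x\<bar>"
  shows "l2n M f \<le> l2n M g" and "square_integrable M f"
proof -
  have le2: "AE x in M. (f x)\<^sup>2 \<le> (g x)\<^sup>2"
    using le by eventually_elim (simp add: abs_le_square_iff)
  show f2: "square_integrable M f"
    unfolding square_integrable_def using f
    by (auto intro!: Bochner_Integration.integrable_bound[OF square_integrable_square[OF g]] le2)
  show "l2n M f \<le> l2n M g"
    unfolding l2n_def
    by (intro real_sqrt_le_mono integral_mono_AE square_integrable_square f2 g le2)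
qed

lemma integral_le_l2n:
  assumes M: "finite_measure M" and f: "square_integrable M f"
  shows "(\<integral>x. \<bar>f x\<bar> \<partial>M) \<le> sqrt (measure M (space M)) * l2n M f"
proof -
  interpret finite_measure M by fact
  have 1: "square_integrable M (\<lambda>x. 1)" by (simp add: square_integrable_def)
  have 2: "square_integrable M (\<lambda>x. \<bar>f x\<bar>)" using f by (auto simp: square_integrable_def)
  show ?thesis using Cauchy_Schwarz_l2[OF 1 2] by (simp add: l2n_def)
qed

text \<open>Riesz--Fischer: a subsequence converges almost everywhere, and Fatou's lemma identifies
  the limit.\<close>

lemma l2n_complete:
  assumes M: "finite_measure M" and f: "\<And>n. square_integrable M (f n)"
    and cauchy: "\<And>e. e > 0 \<Longrightarrow> \<exists>N. \<forall>i\<ge>N. \<forall>j\<ge>N. l2n M (\<lambda>x. f i x - f j x) < e"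
  shows "\<exists>g. square_integrable M g \<and> (\<lambda>n. l2n M (\<lambda>x. f n x - g x)) \<longlonglongrightarrow> 0"
proof -
  interpret finite_measure M by fact
  have int: "integrable M (f n)" for n by (rule square_integrable_integrable[OF M f])
  have [measurable]: "f n \<in> borel_measurable M" for n using f by (simp add: square_integrable_def)
  \<comment> \<open>The \<open>+ 1\<close> keeps \<open>s\<close> positive when the space has
    measure zero.\<close>
  define s where "s = sqrt (measure M (space M)) + 1"
  have s: "s > 0" by (simp add: s_def add_nonneg_pos)
  have L1: "\<exists>N. \<forall>i\<ge>N. \<forall>j\<ge>N. (\<integral>x. norm (f i x - f j x) \<partial>M) < e" if e: "e > 0" for e
  proof -
    obtain N where N: "\<And>i j. i \<ge> N \<Longrightarrow> j \<ge> N \<Longrightarrow> l2n M (\<lambda>x. f i x - f j x) < e / s"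
      using cauchy[of "e / s"] e s by auto
    have "(\<integral>x. norm (f i x - f j x) \<partial>M) < e" if "i \<ge> N" "j \<ge> N" for i j
    proof -
      have "(\<integral>x. norm (f i x - f j x) \<partial>M) \<le> sqrt (measure M (space M)) * l2n M (\<lambda>x. f i x - f j x)"
        using integral_le_l2n[OF M square_integrable_diff[OF f f]] by simp
      also have "\<dots> \<le> s * l2n M (\<lambda>x. f i x - f j x)"
        by (simp add: s_def mult_right_mono)
      also have "\<dots> < e" using N[OF that] s by (simp add: field_simps)
      finally show ?thesis .
    qed
    then show ?thesis by blast
  qed
  obtain r where r: "strict_mono r" and C: "AE x in M. Cauchy (\<lambda>i. f (r i) x)"
    using cauchy_L1_AE_cauchy_subseq[OF int L1] by blast
  define g where "g x = lim (\<lambda>i. f (r i) x)" for x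
  have [measurable]: "g \<in> borel_measurable M" unfolding g_def by measurable
  have lim: "AE x in M. (\<lambda>i. f (r i) x) \<longlonglongrightarrow> g x"
    using C by eventually_elim (simp add: g_def Cauchy_convergent_iff convergent_LIMSEQ_iff)
  \<comment> \<open>One estimate serves twice: with \<open>e = 1\<close> it puts \<open>g\<close>
    into the space, with small \<open>e\<close> it gives the convergence.\<close>
  have key: "square_integrable M (\<lambda>x. f n x - g x) \<and> l2n M (\<lambda>x. f n x - g x) \<le> e"
    if n: "\<And>j. j \<ge> N \<Longrightarrow> l2n M (\<lambda>x. f n x - f j x) < e" and e: "e > 0" for n N e
  proof -
    have "(\<integral>\<^sup>+x. ennreal ((f n x - g x)\<^sup>2) \<partial>M)
        = (\<integral>\<^sup>+x. liminf (\<lambda>i. ennreal ((f n x - f (r i) x)\<^sup>2)) \<partial>M)"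
    proof (rule nn_integral_cong_AE)
      show "AE x in M. ennreal ((f n x - g x)\<^sup>2) = liminf (\<lambda>i. ennreal ((f n x - f (r i) x)\<^sup>2))"
        using lim
      proof eventually_elim
        case (elim x)
        have "(\<lambda>i. ennreal ((f n x - f (r i) x)\<^sup>2)) \<longlonglongrightarrow> ennreal ((f n x - g x)\<^sup>2)"
          by (intro tendsto_ennrealI tendsto_intros elim)
        then show ?case by (rule lim_imp_Liminf[OF sequentially_bot, symmetric])
      qed
    qed
    also have "\<dots> \<le> liminf (\<lambda>i. \<integral>\<^sup>+x. ennreal ((f n x - f (r i) x)\<^sup>2) \<partial>M)"
      by (rule nn_integral_liminf) measurable
    also have "\<dots> \<le> liminf (\<lambda>i::nat. ennreal (e\<^sup>2))"
    proof (rule Liminf_mono, rule eventually_mono[OF eventually_ge_at_top[of N]])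
      fix i assume "N \<le> i"
      then have "r i \<ge> N" using seq_suble[OF r, of i] by simp
      have "(\<integral>\<^sup>+x. ennreal ((f n x - f (r i) x)\<^sup>2) \<partial>M) = ennreal (\<integral>x. (f n x - f (r i) x)\<^sup>2 \<partial>M)"
        by (rule nn_integral_eq_integral)
           (use square_integrable_diff[OF f f] in \<open>auto simp: square_integrable_def\<close>)
      also have "\<dots> \<le> ennreal (e\<^sup>2)"
        unfolding l2n_square[symmetric]
        by (intro ennreal_leI power_mono l2n_nonneg less_imp_le[OF n[OF \<open>r i \<ge> N\<close>]])
      finally show "(\<integral>\<^sup>+x. ennreal ((f n x - f (r i) x)\<^sup>2) \<partial>M) \<le> ennreal (e\<^sup>2)" .
    qed
    also have "\<dots> = ennreal (e\<^sup>2)" by (simp add: Liminf_const)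
    finally have le: "(\<integral>\<^sup>+x. ennreal ((f n x - g x)\<^sup>2) \<partial>M) \<le> ennreal (e\<^sup>2)" .
    have int: "integrable M (\<lambda>x. (f n x - g x)\<^sup>2)"
      using le by (intro integrableI_bounded) (auto simp: le_less_trans ennreal_less_top)
    then have "(\<integral>x. (f n x - g x)\<^sup>2 \<partial>M) \<le> e\<^sup>2"
      using le nn_integral_eq_integral[OF int] by (simp add: ennreal_le_iff)
    then have "l2n M (\<lambda>x. f n x - g x) \<le> e"
      unfolding l2n_def using e by (simp add: real_le_lsqrt)
    with int show ?thesis by (simp add: square_integrable_def)
  qed
  have sq: "square_integrable M g"
  proof -
    obtain N where N: "\<And>j. j \<ge> N \<Longrightarrow> l2n M (\<lambda>x. f N x - f j x) < 1"
      using cauchy[of 1] by auto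
    have "square_integrable M (\<lambda>x. f N x - (f N x - g x))"
      by (rule square_integrable_diff[OF f]) (use key[of N N 1] N in auto)
    then show ?thesis by simp
  qed
  have "(\<lambda>n. l2n M (\<lambda>x. f n x - g x)) \<longlonglongrightarrow> 0"
  proof (rule LIMSEQ_I)
    fix e :: real assume e: "e > 0"
    obtain N where N: "\<And>i j. i \<ge> N \<Longrightarrow> j \<ge> N \<Longrightarrow> l2n M (\<lambda>x. f i x - f j x) < e / 2"
      using cauchy[of "e / 2"] e by auto
    have "l2n M (\<lambda>x. f n x - g x) \<le> e / 2" if "n \<ge> N" for n
      using key[of N n "e/2"] N that e by auto
    then show "\<exists>N. \<forall>n\<ge>N. norm (l2n M (\<lambda>x. f n x - g x) - 0) < e"
      using e by (intro exI[of _ N]) (fastforce simp: l2n_nonneg)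
  qed
  with sq show ?thesis by blast
qed

section \<open>Lebesgue integration over bounded open intervals\<close>

abbreviation lebI :: "real \<Rightarrow> real \<Rightarrow> real measure" where
  "lebI a b \<equiv> lebesgue_on {a<..<b}"

lemma finite_measure_lebI: "finite_measure (lebI a b)"
  by (rule finite_measure_lebesgue_on) simp

lemma measure_lebI: "a \<le> b \<Longrightarrow> measure (lebI a b) {a<..<b} = b - a"
  by (simp add: measure_restrict_space)

lemma set_integral_lebesgue_on:
  "(LINT y:A|lebesgue. (f y::real)) = (\<integral>y. f y \<partial>lebesgue_on A)" if "A \<in> sets lebesgue"
  using that by (simp add: set_lebesgue_integral_def integral_restrict_space)

lemma set_integrable_lebesgue_on:
  "set_integrable lebesgue A (f :: real \<Rightarrow> real) \<longleftrightarrow> integrable (lebesgue_on A) f" if "A \<in> sets lebesgue"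
  using that by (simp add: set_integrable_def integrable_restrict_space)

lemma set_borel_measurable_lebesgue_on:
  "set_borel_measurable lebesgue A (f :: real \<Rightarrow> real) \<longleftrightarrow> f \<in> borel_measurable (lebesgue_on A)"
  if "A \<in> sets lebesgue"
  using that by (simp add: set_borel_measurable_def borel_measurable_restrict_space_iff)

lemma L2_iff: "L2 f \<longleftrightarrow> square_integrable (lebI 0 1) f"
  by (simp add: L2_def square_integrable_def set_integrable_lebesgue_on set_borel_measurable_lebesgue_on)

lemma L2_norm_eq: "L2_norm f = l2n (lebI 0 1) f"
  by (simp add: L2_norm_def l2n_def set_integral_lebesgue_on)

lemma AE_lebI_iff: "(AE y in lebI a b. P y) \<longleftrightarrow> (AE y in lebesgue. y \<in> {a<..<b} \<longrightarrow> P y)"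
  by (subst AE_restrict_space_iff) auto

lemma continuous_measurable_lebI:
  "continuous_on {a..b} f \<Longrightarrow> f \<in> borel_measurable (lebI a b)"
  for f :: "real \<Rightarrow> real"
  by (intro continuous_imp_measurable_on_sets_lebesgue) (auto elim: continuous_on_subset)

lemma continuous_bounded_interval:
  fixes f :: "real \<Rightarrow> real"
  assumes "continuous_on {a..b} f"
  obtains B where "0 \<le> B" "\<And>x. x \<in> {a..b} \<Longrightarrow> \<bar>f x\<bar> \<le> B"
proof -
  have "bounded (f ` {a..b})" by (intro compact_imp_bounded compact_continuous_image assms) simp
  then obtain B where "\<forall>y\<in>f ` {a..b}. norm y \<le> B" unfolding bounded_iff by blast
  then have "\<And>x. x \<in> {a..b} \<Longrightarrow> \<bar>f x\<bar> \<le> B" by simp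
  then show ?thesis using that[of "max 0 B"] by force
qed

lemma square_integrable_continuous:
  "continuous_on {a..b} f \<Longrightarrow> square_integrable (lebI a b) f"
proof -
  assume f: "continuous_on {a..b} f"
  obtain B where B: "\<And>x. x \<in> {a..b} \<Longrightarrow> \<bar>f x\<bar> \<le> B" using continuous_bounded_interval[OF f] by blast
  have "AE x in lebI a b. \<bar>f x\<bar> \<le> B" by (rule AE_I2) (use B in force)
  then show ?thesis
    by (intro square_integrable_bounded[OF finite_measure_lebI continuous_measurable_lebI[OF f]])
qed

lemma integrable_continuous_lebI:
  "continuous_on {a..b} f \<Longrightarrow> integrable (lebI a b) f"
  for f :: "real \<Rightarrow> real"
  by (intro square_integrable_integrable finite_measure_lebI square_integrable_continuous)

lemma integral_lebI_eq:
  fixes f :: "real \<Rightarrow> real"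
  assumes "integrable (lebI a b) f"
  shows "(\<integral>x. f x \<partial>lebI a b) = integral {a..b} f"
proof -
  have "set_integrable lebesgue {a<..<b} f" using assms by (simp add: set_integrable_lebesgue_on)
  from set_lebesgue_integral_eq_integral(2)[OF this] show ?thesis
    by (simp add: set_integral_lebesgue_on integral_open_interval_real)
qed

lemma integrable_lebI_subset:
  fixes f :: "real \<Rightarrow> real"
  assumes "integrable (lebI a b) f" "a \<le> c" "d \<le> b"
  shows "integrable (lebI c d) f"
proof -
  have "set_integrable lebesgue {c<..<d} f"
    by (rule set_integrable_subset[of _ "{a<..<b}"])
       (use assms in \<open>auto simp: set_integrable_lebesgue_on\<close>)
  then show ?thesis by (simp add: set_integrable_lebesgue_on)
qed

lemma measurable_lebI_subset:
  fixes f :: "real \<Rightarrow> real"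
  assumes "f \<in> borel_measurable (lebI a b)" "a \<le> c" "d \<le> b"
  shows "f \<in> borel_measurable (lebI c d)"
proof -
  have "set_borel_measurable lebesgue {c<..<d} f"
    by (rule set_borel_measurable_subset[of _ "{a<..<b}"])
       (use assms in \<open>auto simp: set_borel_measurable_lebesgue_on\<close>)
  then show ?thesis by (simp add: set_borel_measurable_lebesgue_on)
qed

lemma square_integrable_lebI_subset:
  assumes "square_integrable (lebI a b) f" "a \<le> c" "d \<le> b"
  shows "square_integrable (lebI c d) f"
  unfolding square_integrable_def
  by (intro conjI integrable_lebI_subset[OF square_integrable_square[OF assms(1)] assms(2,3)]
      measurable_lebI_subset[OF square_integrable_measurable[OF assms(1)] assms(2,3)])

lemma AE_lebI_subset:
  assumes "AE x in lebI a b. P x" "a \<le> c" "d \<le> b"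
  shows "AE x in lebI c d. P x"
  using assms(1) unfolding AE_lebI_iff by eventually_elim (use assms in auto)

lemma has_integral_lebI:
  fixes f :: "real \<Rightarrow> real"
  assumes "integrable (lebI a b) f"
  shows "f integrable_on {a..b}"
proof -
  have "set_integrable lebesgue {a<..<b} f" using assms by (simp add: set_integrable_lebesgue_on)
  from set_lebesgue_integral_eq_integral(1)[OF this] show ?thesis
    by (simp add: integrable_on_open_interval_real)
qed

lemma integral_lebI_combine:
  fixes f :: "real \<Rightarrow> real"
  assumes "integrable (lebI a b) f" "a \<le> c" "c \<le> b"
  shows "(\<integral>x. f x \<partial>lebI a b) = (\<integral>x. f x \<partial>lebI a c) + (\<integral>x. f x \<partial>lebI c b)"
proof -
  have 1: "integrable (lebI a c) f" "integrable (lebI c b) f"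
    using assms by (auto intro: integrable_lebI_subset)
  show ?thesis
    unfolding integral_lebI_eq[OF assms(1)] 1[THEN integral_lebI_eq]
    using Henstock_Kurzweil_Integration.integral_combine[OF assms(2,3) has_integral_lebI[OF assms(1)]] by simp
qed

lemma integral_lebI_le:
  fixes f :: "real \<Rightarrow> real"
  assumes f: "integrable (lebI a b) f" and nn: "\<And>x. 0 \<le> f x" and "a \<le> c" "d \<le> b"
  shows "(\<integral>x. f x \<partial>lebI c d) \<le> (\<integral>x. f x \<partial>lebI a b)"
proof -
  have "(LINT x:{c<..<d}|lebesgue. f x) \<le> (LINT x:{a<..<b}|lebesgue. f x)"
    unfolding set_lebesgue_integral_def
  proof (rule integral_mono)
    show "integrable lebesgue (\<lambda>x. indicator {c<..<d} x *\<^sub>R f x)"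
      using integrable_lebI_subset[OF assms(1,3,4)]
      by (subst (asm) set_integrable_lebesgue_on[symmetric]) (auto simp: set_integrable_def)
    show "integrable lebesgue (\<lambda>x. indicator {a<..<b} x *\<^sub>R f x)"
      using f by (subst (asm) set_integrable_lebesgue_on[symmetric]) (auto simp: set_integrable_def)
    show "indicator {c<..<d} x *\<^sub>R f x \<le> indicator {a<..<b} x *\<^sub>R f x" for x
      using nn[of x] assms(3,4) by (auto simp: indicator_def)
  qed
  then show ?thesis by (simp add: set_integral_lebesgue_on)
qed

lemma FTC_lebI:
  fixes f :: "real \<Rightarrow> real"
  assumes ab: "a \<le> b" and f: "\<And>x. x \<in> {a..b} \<Longrightarrow> (f has_real_derivative f' x) (at x within {a..b})"
    and f': "continuous_on {a..b} f'"
  shows "(\<integral>x. f' x \<partial>lebI a b) = f b - f a"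
proof -
  have "(f' has_integral (f b - f a)) {a..b}"
    by (rule fundamental_theorem_of_calculus[OF ab])
       (use f in \<open>auto simp: has_real_derivative_iff_has_vector_derivative\<close>)
  then show ?thesis
    using integral_lebI_eq[OF integrable_continuous_lebI[OF f']] by (simp add: integral_unique)
qed

section \<open>Test functions and the du Bois-Reymond lemma\<close>

definition smooth :: "(real \<Rightarrow> real) \<Rightarrow> bool" where
  "smooth f \<longleftrightarrow> (\<forall>n y. (deriv ^^ n) f differentiable (at y))"

text \<open>Smoothness is coinductive: it suffices to exhibit a class of functions containing
  \<open>f\<close> whose members all have a derivative in the class. The closure properties below
  amount to the choice of such a class.\<close>

lemma smoothI_family:
  assumes f: "P f"
    and step: "\<And>h. P h \<Longrightarrow> \<exists>h'. P h' \<and> (\<forall>y. (h has_real_derivative h' y) (at y))"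
  shows "smooth f"
proof -
  have P: "P ((deriv ^^ n) f)" for n
  proof (induction n)
    case 0
    show ?case using f by simp
  next
    case (Suc n)
    obtain h' where h': "P h'" "\<And>y. ((deriv ^^ n) f has_real_derivative h' y) (at y)"
      using step[OF Suc] by blast
    then have "deriv ((deriv ^^ n) f) = h'" by (auto intro: DERIV_imp_deriv)
    with h' show ?case by simp
  qed
  show ?thesis
    unfolding smooth_def
  proof (intro allI)
    fix n y
    obtain h' where "((deriv ^^ n) f has_real_derivative h' y) (at y)" using step[OF P] by blast
    then show "(deriv ^^ n) f differentiable (at y)" by (auto simp: real_differentiable_def)
  qed
qed

lemma smooth_has_deriv: "smooth f \<Longrightarrow> (f has_real_derivative deriv f y) (at y)"
  unfolding smooth_def by (metis DERIV_deriv_iff_real_differentiable funpow_0)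

lemma smooth_deriv: "smooth f \<Longrightarrow> smooth (deriv f)"
  unfolding smooth_def by (metis comp_apply funpow_Suc_right)

lemma smooth_continuous: "smooth f \<Longrightarrow> continuous_on S f"
  by (meson DERIV_isCont continuous_at_imp_continuous_on smooth_has_deriv)

lemma smooth_const: "smooth (\<lambda>x. c)"
  by (rule smoothI_family[where P="\<lambda>h. \<exists>c. h = (\<lambda>x. c)"]) (auto intro!: derivative_eq_intros exI)

lemma smooth_add:
  assumes "smooth f" "smooth g" shows "smooth (\<lambda>x. f x + g x)"
proof (rule smoothI_family[where P="\<lambda>h. \<exists>f g. smooth f \<and> smooth g \<and> h = (\<lambda>x. f x + g x)"])
  show "\<exists>f' g'. smooth f' \<and> smooth g' \<and> (\<lambda>x. f x + g x) = (\<lambda>x. f' x + g' x)" using assms by blast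
next
  fix h :: "real \<Rightarrow> real" assume "\<exists>f g. smooth f \<and> smooth g \<and> h = (\<lambda>x. f x + g x)"
  then obtain f g where fg: "smooth f" "smooth g" "h = (\<lambda>x. f x + g x)" by blast
  show "\<exists>h'. (\<exists>f g. smooth f \<and> smooth g \<and> h' = (\<lambda>x. f x + g x)) \<and> (\<forall>y. (h has_real_derivative h' y) (at y))"
    using fg by (intro exI[of _ "\<lambda>x. deriv f x + deriv g x"])
      (auto intro!: smooth_deriv DERIV_add smooth_has_deriv)
qed

text \<open>Products alone are not visibly closed under differentiation, since the product rule
  yields a sum; finite sums of products are.\<close>

inductive sum_of_smooth_products :: "(real \<Rightarrow> real) \<Rightarrow> bool" where
  prod: "smooth f \<Longrightarrow> smooth g \<Longrightarrow> sum_of_smooth_products (\<lambda>x. f x * g x)"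
| add: "sum_of_smooth_products f \<Longrightarrow> sum_of_smooth_products g \<Longrightarrow> sum_of_smooth_products (\<lambda>x. f x + g x)"

lemma smooth_mult:
  assumes "smooth f" "smooth g" shows "smooth (\<lambda>x. f x * g x)"
proof (rule smoothI_family[where P=sum_of_smooth_products])
  show "sum_of_smooth_products (\<lambda>x. f x * g x)" using assms by (rule prod)
next
  fix h assume "sum_of_smooth_products h"
  then show "\<exists>h'. sum_of_smooth_products h' \<and> (\<forall>y. (h has_real_derivative h' y) (at y))"
  proof induction
    case (prod f g)
    then show ?case
      by (intro exI[of _ "\<lambda>x. deriv f x * g x + f x * deriv g x"])
         (auto intro!: sum_of_smooth_products.intros smooth_deriv derivative_eq_intros smooth_has_deriv)
  next
    case (add f g)
    then obtain f' g' where "sum_of_smooth_products f'" "\<forall>y. (f has_real_derivative f' y) (at y)"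
      "sum_of_smooth_products g'" "\<forall>y. (g has_real_derivative g' y) (at y)" by blast
    then show ?case
      by (intro exI[of _ "\<lambda>x. f' x + g' x"])
         (auto intro!: sum_of_smooth_products.intros derivative_eq_intros)
  qed
qed

lemma smooth_affine:
  assumes "smooth f" shows "smooth (\<lambda>x. f (c * x + d))"
\<comment> \<open>The factor \<open>k\<close> collects the powers of \<open>c\<close> produced by
  the chain rule.\<close>
proof (rule smoothI_family[where P="\<lambda>h. \<exists>f k. smooth f \<and> h = (\<lambda>x. k * f (c * x + d))"])
  show "\<exists>f' k. smooth f' \<and> (\<lambda>x. f (c * x + d)) = (\<lambda>x. k * f' (c * x + d))"
    using assms by (intro exI[of _ f] exI[of _ 1]) simp
next
  fix h :: "real \<Rightarrow> real" assume "\<exists>f k. smooth f \<and> h = (\<lambda>x. k * f (c * x + d))"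
  then obtain f k where fk: "smooth f" "h = (\<lambda>x. k * f (c * x + d))" by blast
  have "(h has_real_derivative (k * c) * deriv f (c * y + d)) (at y)" for y
    unfolding fk(2) by (rule derivative_eq_intros DERIV_chain2[OF smooth_has_deriv[OF fk(1)]] refl | simp)+
  then show "\<exists>h'. (\<exists>f k. smooth f \<and> h' = (\<lambda>x. k * f (c * x + d))) \<and> (\<forall>y. (h has_real_derivative h' y) (at y))"
    using smooth_deriv[OF fk(1)] by (intro exI[of _ "\<lambda>x. (k * c) * deriv f (c * x + d)"]) blast
qed

lemma smooth_real_polynomial_function:
  "real_polynomial_function p \<Longrightarrow> smooth p"
  by (rule smoothI_family[where P=real_polynomial_function])
     (auto dest: has_real_derivative_polynomial_function)

lemma poly_times_exp_minus_tendsto: "((\<lambda>y. poly p y * exp (- y)) \<longlongrightarrow> 0) at_top" for p :: "real poly"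
proof -
  have "((\<lambda>y. \<Sum>i\<le>degree p. coeff p i * (y ^ i / exp y)) \<longlongrightarrow> (\<Sum>i\<le>degree p. coeff p i * 0)) at_top"
    by (intro tendsto_intros tendsto_power_div_exp_0)
  moreover have "(\<lambda>y. \<Sum>i\<le>degree p. coeff p i * (y ^ i / exp y)) = (\<lambda>y. poly p y * exp (- y))"
    by (rule ext) (simp add: poly_altdef sum_distrib_right exp_minus divide_inverse mult.assoc)
  ultimately show ?thesis by simp
qed

text \<open>Polynomials in \<open>1/x\<close> times \<open>exp (- (1 / x))\<close> on the positive
  axis, extended by zero, form a class closed under differentiation, because the exponential beats
  every such polynomial at 0.\<close>

lemma smooth_exp_bump: "smooth (\<lambda>x. if x > 0 then exp (- (1 / x)) else 0)"
proof (rule smoothI_family[where P="\<lambda>h. \<exists>p::real poly. h = (\<lambda>x. if x > 0 then poly p (1 / x) * exp (- (1 / x)) else 0)"])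
  show "\<exists>p::real poly. (\<lambda>x. if x > 0 then exp (- (1 / x)) else 0)
      = (\<lambda>x. if x > 0 then poly p (1 / x) * exp (- (1 / x)) else 0)"
    by (rule exI[of _ 1]) auto
next
  fix h :: "real \<Rightarrow> real"
  assume "\<exists>p::real poly. h = (\<lambda>x. if x > 0 then poly p (1 / x) * exp (- (1 / x)) else 0)"
  then obtain p :: "real poly" where h: "h = (\<lambda>x. if x > 0 then poly p (1 / x) * exp (- (1 / x)) else 0)"
    by blast
  \<comment> \<open>With \<open>y = 1/x\<close>, the derivative of \<open>p(y) * exp (- y)\<close>
    with respect to \<open>x\<close> is \<open>y^2 * (p - p')(y) * exp (- y)\<close>.\<close>
  define q where "q = [:0, 0, 1:] * (p - pderiv p)"
  define h' where "h' = (\<lambda>x. if x > 0 then poly q (1 / x) * exp (- (1 / x)) else 0)"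
  have "(h has_real_derivative h' y) (at y)" for y
  proof -
    consider "y > 0" | "y < 0" | "y = 0" by linarith
    then show ?thesis
    proof cases
      case 1
      have "((\<lambda>x. poly p (1 / x) * exp (- (1 / x))) has_real_derivative h' y) (at y)"
        using 1 by (auto intro!: derivative_eq_intros DERIV_chain2[OF poly_DERIV]
            simp: h'_def q_def field_simps power2_eq_square)
      then show ?thesis
        by (rule has_field_derivative_transform_within_open[of _ _ _ "{0<..}"]) (use 1 in \<open>auto simp: h\<close>)
    next
      case 2
      have "((\<lambda>x. 0) has_real_derivative h' y) (at y)"
        using 2 by (auto simp: h'_def)
      then show ?thesis
        by (rule has_field_derivative_transform_within_open[of _ _ _ "{..<0}"]) (use 2 in \<open>auto simp: h\<close>)
    next
      case 3
      have "((\<lambda>x. (h x - h 0) / (x - 0)) \<longlongrightarrow> 0) (at 0)"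
      proof (rule filterlim_split_at_real)
        show "((\<lambda>x. (h x - h 0) / (x - 0)) \<longlongrightarrow> 0) (at_left 0)"
          by (rule tendsto_eventually) (auto simp: h eventually_at_filter)
        \<comment> \<open>The difference quotient at 0 is \<open>h x / x\<close>; the extra factor
          \<open>1/x\<close> is the one encoded by \<open>pCons 0 p\<close>.\<close>
        have "((\<lambda>x. poly (pCons 0 p) (inverse x) * exp (- (inverse x))) \<longlongrightarrow> 0) (at_right (0::real))"
          by (rule filterlim_compose[OF poly_times_exp_minus_tendsto filterlim_inverse_at_top_right])
        then show "((\<lambda>x. (h x - h 0) / (x - 0)) \<longlongrightarrow> 0) (at_right 0)"
          by (rule Lim_transform_eventually) (auto simp: h eventually_at_filter field_simps)
      qed
      then show ?thesis using 3 by (simp add: has_field_derivative_iff h'_def)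
    qed
  qed
  then show "\<exists>h'. (\<exists>p::real poly. h' = (\<lambda>x. if x > 0 then poly p (1 / x) * exp (- (1 / x)) else 0))
      \<and> (\<forall>y. (h has_real_derivative h' y) (at y))"
    unfolding h'_def by blast
qed

lemma test_function_smooth: "test_function a b \<phi> \<Longrightarrow> smooth \<phi>"
  by (simp add: test_function_def smooth_def)

lemma test_functionI:
  assumes "smooth \<phi>" "a < c" "d < b" "\<And>x. x \<notin> {c..d} \<Longrightarrow> \<phi> x = 0"
  shows "test_function a b \<phi>"
proof -
  have "{y. \<phi> y \<noteq> 0} \<subseteq> {c..d}" using assms(4) by blast
  then have "closure {y. \<phi> y \<noteq> 0} \<subseteq> {c..d}" by (rule closure_minimal) simp
  moreover from this have "bounded (closure {y. \<phi> y \<noteq> 0})"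
    using bounded_closed_interval bounded_subset by blast
  ultimately show ?thesis
    using assms by (auto simp: test_function_def smooth_def compact_eq_bounded_closed)
qed

lemma test_function_support:
  assumes "test_function a b \<phi>" "a < b"
  obtains c d where "a < c" "d < b" "c \<le> d" "\<And>x. x \<notin> {c..d} \<Longrightarrow> \<phi> x = 0"
proof -
  define K where "K = closure {y. \<phi> y \<noteq> 0}"
  have K: "compact K" "K \<subseteq> {a<..<b}" using assms by (auto simp: test_function_def K_def)
  have out: "\<phi> x = 0" if "x \<notin> K" for x
    using that closure_subset[of "{y. \<phi> y \<noteq> 0}"] by (auto simp: K_def)
  show ?thesis
  proof (cases "K = {}")
    case True
    then show ?thesis using out assms(2) that[of "(a+b)/2" "(a+b)/2"] by auto
  next
    case False
    obtain c where c: "c \<in> K" "\<And>x. x \<in> K \<Longrightarrow> c \<le> x" using compact_attains_inf[OF K(1) False] by blast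
    obtain d where d: "d \<in> K" "\<And>x. x \<in> K \<Longrightarrow> x \<le> d" using compact_attains_sup[OF K(1) False] by blast
    show ?thesis
    proof (rule that[of c d])
      show "a < c" "d < b" using c(1) d(1) K(2) by auto
      show "c \<le> d" using c d by blast
      show "\<phi> x = 0" if "x \<notin> {c..d}" for x
        using out[of x] c(2)[of x] d(2)[of x] that by auto
    qed
  qed
qed

lemma test_function_outside:
  assumes "test_function a b \<phi>" "x \<notin> {a<..<b}"
  shows "\<phi> x = 0"
  using assms closure_subset[of "{y. \<phi> y \<noteq> 0}"] by (auto simp: test_function_def)

lemma test_function_deriv:
  assumes "test_function a b \<phi>" "a < b"
  shows "test_function a b (deriv \<phi>)"
proof -
  obtain c d where cd: "a < c" "d < b" "c \<le> d" "\<And>x. x \<notin> {c..d} \<Longrightarrow> \<phi> x = 0"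
    using test_function_support[OF assms] by blast
  show ?thesis
  proof (rule test_functionI[OF smooth_deriv[OF test_function_smooth[OF assms(1)]] cd(1,2)])
    fix x assume x: "x \<notin> {c..d}"
    have "((\<lambda>x. 0) has_real_derivative 0) (at x)" by simp
    then have "(\<phi> has_real_derivative 0) (at x)"
      by (rule has_field_derivative_transform_within_open[of _ _ _ "- {c..d}"]) (use x cd in auto)
    then show "deriv \<phi> x = 0" by (rule DERIV_imp_deriv)
  qed
qed

lemma test_function_deriv_funpow:
  "test_function a b \<phi> \<Longrightarrow> a < b \<Longrightarrow> test_function a b ((deriv ^^ j) \<phi>)"
  by (induction j) (auto intro: test_function_deriv)

lemma test_function_smooth_mult:
  assumes "test_function a b \<phi>" "a < b" "smooth f"
  shows "test_function a b (\<lambda>x. \<phi> x * f x)"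
proof -
  obtain c d where cd: "a < c" "d < b" "c \<le> d" "\<And>x. x \<notin> {c..d} \<Longrightarrow> \<phi> x = 0"
    using test_function_support[OF assms(1,2)] by blast
  show ?thesis
    by (rule test_functionI[of _ _ c d]) (use cd smooth_mult[OF test_function_smooth[OF assms(1)] assms(3)] in auto)
qed

lemma test_function_add:
  assumes "test_function a b \<phi>" "test_function a b \<psi>" "a < b"
  shows "test_function a b (\<lambda>x. \<phi> x + \<psi> x)"
proof -
  obtain c d where cd: "a < c" "d < b" "c \<le> d" "\<And>x. x \<notin> {c..d} \<Longrightarrow> \<phi> x = 0"
    using test_function_support[OF assms(1,3)] by blast
  obtain c' d' where cd': "a < c'" "d' < b" "c' \<le> d'" "\<And>x. x \<notin> {c'..d'} \<Longrightarrow> \<psi> x = 0"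
    using test_function_support[OF assms(2,3)] by blast
  show ?thesis
  proof (rule test_functionI[of _ _ "min c c'" "max d d'"])
    show "smooth (\<lambda>x. \<phi> x + \<psi> x)"
      by (intro smooth_add test_function_smooth[OF assms(1)] test_function_smooth[OF assms(2)])
    show "\<phi> x + \<psi> x = 0" if "x \<notin> {min c c'..max d d'}" for x
    proof -
      have "x \<notin> {c..d}" "x \<notin> {c'..d'}" using that by auto
      then show ?thesis using cd(4) cd'(4) by simp
    qed
  qed (use cd cd' in auto)
qed

lemma test_function_scale: "test_function a b \<phi> \<Longrightarrow> a < b \<Longrightarrow> test_function a b (\<lambda>x. c * \<phi> x)"
  using test_function_smooth_mult[OF _ _ smooth_const[of c]] by (simp add: mult.commute)

lemma test_function_continuous: "test_function a b \<phi> \<Longrightarrow> continuous_on S \<phi>"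
  by (intro smooth_continuous test_function_smooth)

lemma test_function_has_deriv: "test_function a b \<phi> \<Longrightarrow> (\<phi> has_real_derivative deriv \<phi> x) (at x)"
  by (intro smooth_has_deriv test_function_smooth)

section \<open>Density of test functions and duality\<close>

lemma smooth_cutoffs:
  assumes ab: "a < b"
  obtains ct :: "nat \<Rightarrow> real \<Rightarrow> real" where "\<And>n. test_function a b (ct n)" "\<And>n x. 0 \<le> ct n x \<and> ct n x \<le> 1"
    "\<And>x. x \<in> {a<..<b} \<Longrightarrow> (\<lambda>n. ct n x) \<longlonglongrightarrow> 1"
proof -
  define B :: "real \<Rightarrow> real" where "B = (\<lambda>x. if x > 0 then exp (- (1 / x)) else 0)"
  have sB: "smooth B" unfolding B_def by (rule smooth_exp_bump)
  have B01: "0 \<le> B x \<and> B x \<le> 1" for x by (simp add: B_def)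
  have Blim: "(B \<longlongrightarrow> 1) at_top"
  proof -
    have "((\<lambda>x::real. exp (- (inverse x))) \<longlongrightarrow> exp (- 0)) at_top"
      by (intro tendsto_intros tendsto_inverse_0_at_top filterlim_ident)
    then have "((\<lambda>x::real. exp (- (inverse x))) \<longlongrightarrow> 1) at_top" by simp
    then show ?thesis
      by (rule Lim_transform_eventually)
         (use eventually_gt_at_top[of 0] in eventually_elim, simp add: B_def field_simps)
  qed
  \<comment> \<open>After rearrangement the arguments are \<open>(n+1)(x - a) - 1\<close> and
    \<open>(n+1)(b - x) - 1\<close>; the shift by 1 keeps the support at distance
    \<open>1/(n+1)\<close> from the end points.\<close>
  define ct where "ct n x = B (real (Suc n) * x + (- real (Suc n) * a - 1)) * B (- real (Suc n) * x + (real (Suc n) * b - 1))" for n x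
  show ?thesis
  proof (rule that[of ct])
    fix n
    have s: "smooth (ct n)" unfolding ct_def by (intro smooth_mult smooth_affine sB)
    show "test_function a b (ct n)"
    proof (rule test_functionI[OF s, of a "a + 1 / real (Suc n)" "b - 1 / real (Suc n)" b])
      fix x assume "x \<notin> {a + 1 / real (Suc n)..b - 1 / real (Suc n)}"
      then have "real (Suc n) * x + (- real (Suc n) * a - 1) \<le> 0 \<or> - real (Suc n) * x + (real (Suc n) * b - 1) \<le> 0"
        by (auto simp: field_simps not_le)
      then show "ct n x = 0" by (auto simp: ct_def B_def)
    qed auto
  next
    fix n x show "0 \<le> ct n x \<and> ct n x \<le> 1"
      using B01 by (auto simp: ct_def intro: mult_le_one)
  next
    fix x assume x: "x \<in> {a<..<b}"
    have lin: "filterlim (\<lambda>n. -1 + real (Suc n) * c) at_top sequentially" if "c > 0" for c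
      by (intro filterlim_tendsto_add_at_top[OF tendsto_const] filterlim_at_top_mult_tendsto_pos[OF tendsto_const that]
          filterlim_compose[OF filterlim_real_sequentially filterlim_Suc])
    have "(\<lambda>n. B (-1 + real (Suc n) * (x - a)) * B (-1 + real (Suc n) * (b - x))) \<longlonglongrightarrow> 1 * 1"
      by (intro tendsto_mult filterlim_compose[OF Blim lin]) (use x in auto)
    then show "(\<lambda>n. ct n x) \<longlonglongrightarrow> 1"
      by (simp add: ct_def algebra_simps)
  qed
qed

text \<open>No mollifier is involved: off a null set a measurable function is a limit of continuous
  ones. These are clipped to \<open>[-B, B]\<close>, replaced by polynomials by Stone-Weierstrass,
  and cut off near the end points. The bound \<open>B + 1\<close> leaves room for the polynomial
  error.\<close>

lemma test_function_dense_AE: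
  assumes ab: "a < b" and \<psi>: "\<psi> \<in> borel_measurable (lebI a b)"
    and B: "0 \<le> B" "\<And>x. x \<in> {a<..<b} \<Longrightarrow> \<bar>\<psi> x\<bar> \<le> B"
  obtains \<phi> where "\<And>n. test_function a b (\<phi> n)" "\<And>n x. \<bar>\<phi> n x\<bar> \<le> B + 1"
    "AE x in lebI a b. (\<lambda>n. \<phi> n x) \<longlonglongrightarrow> \<psi> x"
proof -
  have "\<psi> measurable_on {a<..<b}"
    using \<psi> by (subst measurable_on_iff_borel_measurable) auto
  then obtain N g where N: "negligible N" and g: "\<And>n::nat. continuous_on UNIV (g n)"
    and gl: "\<And>x. x \<notin> N \<Longrightarrow> (\<lambda>n. g n x) \<longlonglongrightarrow> (if x \<in> {a<..<b} then \<psi> x else 0)"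
    unfolding measurable_on_def by blast
  define g' where "g' n x = max (- B) (min B (g n x))" for n x
  have g'c: "continuous_on {a..b} (g' n)" for n
    unfolding g'_def by (intro continuous_intros continuous_on_subset[OF g]) auto
  have "\<exists>p. real_polynomial_function p \<and> (\<forall>x\<in>{a..b}. \<bar>g' n x - p x\<bar> < 1 / real (Suc n))" for n
  proof -
    obtain p where "real_polynomial_function p" "\<And>x. x \<in> {a..b} \<Longrightarrow> \<bar>g' n x - p x\<bar> < 1 / real (Suc n)"
      by (rule Stone_Weierstrass_real_polynomial_function[OF compact_Icc g'c[of n], of "1 / real (Suc n)"]) auto
    then show ?thesis by blast
  qed
  then obtain p where p: "\<And>n. real_polynomial_function (p n)"
      "\<And>n x. x \<in> {a..b} \<Longrightarrow> \<bar>g' n x - p n x\<bar> < 1 / real (Suc n)"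
    by metis
  obtain ct where ct: "\<And>n. test_function a b (ct n)" "\<And>n x. 0 \<le> ct n x \<and> ct n x \<le> 1"
    "\<And>x. x \<in> {a<..<b} \<Longrightarrow> (\<lambda>n. ct n x) \<longlonglongrightarrow> 1"
    using smooth_cutoffs[OF ab] by blast
  define \<phi> where "\<phi> n x = ct n x * p n x" for n x
  have pB: "\<bar>p n x\<bar> \<le> B + 1" if "x \<in> {a..b}" for n x
  proof -
    have "1 / real (Suc n) \<le> 1" by simp
    moreover have "\<bar>g' n x\<bar> \<le> B" using B(1) by (auto simp: g'_def)
    ultimately show ?thesis using p(2)[OF that, of n] by linarith
  qed
  show ?thesis
  proof (rule that[of \<phi>])
    show "test_function a b (\<phi> n)" for n
      unfolding \<phi>_def by (intro test_function_smooth_mult ct ab smooth_real_polynomial_function p)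
    show "\<bar>\<phi> n x\<bar> \<le> B + 1" for n x
    proof (cases "x \<in> {a..b}")
      case True
      have "\<bar>\<phi> n x\<bar> \<le> 1 * (B + 1)"
        unfolding \<phi>_def abs_mult by (intro mult_mono) (use ct(2)[of n x] pB[OF True] in auto)
      then show ?thesis by simp
    next
      case False
      then show ?thesis using test_function_outside[OF ct(1), of x n] B by (auto simp: \<phi>_def)
    qed
    have "AE x in lebesgue. x \<notin> N"
      using N by (simp add: AE_not_in negligible_iff_null_sets)
    then show "AE x in lebI a b. (\<lambda>n. \<phi> n x) \<longlonglongrightarrow> \<psi> x"
      unfolding AE_lebI_iff
    proof eventually_elim
      case (elim x)
      show ?case
      proof
        assume x: "x \<in> {a<..<b}"
        have "(\<lambda>n. g n x) \<longlonglongrightarrow> \<psi> x" using gl[OF elim] x by simp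
        then have 1: "(\<lambda>n. g' n x) \<longlonglongrightarrow> max (- B) (min B (\<psi> x))"
          unfolding g'_def by (intro tendsto_intros)
        have 2: "max (- B) (min B (\<psi> x)) = \<psi> x" using B(2)[OF x] by auto
        have "(\<lambda>n. p n x - g' n x) \<longlonglongrightarrow> 0"
        proof (rule Lim_null_comparison)
          show "\<forall>\<^sub>F n in sequentially. norm (p n x - g' n x) \<le> inverse (real (Suc n))"
            using p(2)[of x] x by (intro always_eventually allI) (auto simp: inverse_eq_divide abs_minus_commute less_imp_le)
          show "(\<lambda>n. inverse (real (Suc n))) \<longlonglongrightarrow> 0" by (rule LIMSEQ_inverse_real_of_nat)
        qed
        from tendsto_add[OF this 1] have "(\<lambda>n. p n x) \<longlonglongrightarrow> \<psi> x" by (simp add: 2)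
        from tendsto_mult[OF ct(3)[OF x] this] show "(\<lambda>n. \<phi> n x) \<longlonglongrightarrow> \<psi> x" by (simp add: \<phi>_def)
      qed
    qed
  qed
qed

text \<open>The uniform bound on the approximants permits dominated convergence, so one sequence
  serves every integrable \<open>f\<close> and the norm together. Estimates that are linear in the
  norm of a test function thus pass to \<open>\<psi>\<close>.\<close>

lemma test_function_dense:
  assumes ab: "a < b" and \<psi>: "\<psi> \<in> borel_measurable (lebI a b)"
    and B: "\<And>x. x \<in> {a<..<b} \<Longrightarrow> \<bar>\<psi> x\<bar> \<le> B"
  obtains \<phi> where "\<And>n. test_function a b (\<phi> n)"
    "\<And>f. integrable (lebI a b) f \<Longrightarrow> (\<lambda>n. \<integral>x. f x * \<phi> n x \<partial>lebI a b) \<longlonglongrightarrow> (\<integral>x. f x * \<psi> x \<partial>lebI a b)"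
    "(\<lambda>n. l2n (lebI a b) (\<phi> n)) \<longlonglongrightarrow> l2n (lebI a b) \<psi>"
proof -
  interpret finite_measure "lebI a b" by (rule finite_measure_lebI)
  have B0: "0 \<le> B" using B[of "(a+b)/2"] ab by auto
  obtain \<phi> where \<phi>: "\<And>n. test_function a b (\<phi> n)" "\<And>n x. \<bar>\<phi> n x\<bar> \<le> B + 1"
    "AE x in lebI a b. (\<lambda>n. \<phi> n x) \<longlonglongrightarrow> \<psi> x"
    using test_function_dense_AE[OF ab \<psi> B0 B] by blast
  have \<phi>m [measurable]: "\<phi> n \<in> borel_measurable (lebI a b)" for n
    by (intro continuous_measurable_lebI test_function_continuous[OF \<phi>(1)])
  note [measurable] = \<psi>
  show ?thesis
  proof (rule that[of \<phi>, OF \<phi>(1)])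
    fix f :: "real \<Rightarrow> real" assume f: "integrable (lebI a b) f"
    then have [measurable]: "f \<in> borel_measurable (lebI a b)" by simp
    show "(\<lambda>n. \<integral>x. f x * \<phi> n x \<partial>lebI a b) \<longlonglongrightarrow> (\<integral>x. f x * \<psi> x \<partial>lebI a b)"
    proof (rule integral_dominated_convergence[where w="\<lambda>x. (B + 1) * \<bar>f x\<bar>"])
      show "integrable (lebI a b) (\<lambda>x. (B + 1) * \<bar>f x\<bar>)" using f by simp
      show "AE x in lebI a b. (\<lambda>n. f x * \<phi> n x) \<longlonglongrightarrow> f x * \<psi> x"
        using \<phi>(3) by eventually_elim (intro tendsto_intros)
      show "AE x in lebI a b. norm (f x * \<phi> n x) \<le> (B + 1) * \<bar>f x\<bar>" for n
      proof (rule AE_I2)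
        fix x show "norm (f x * \<phi> n x) \<le> (B + 1) * \<bar>f x\<bar>"
          using mult_right_mono[OF \<phi>(2)[of n x], of "\<bar>f x\<bar>"] by (simp add: abs_mult mult.commute)
      qed
    qed measurable
  next
    have "(\<lambda>n. \<integral>x. (\<phi> n x)\<^sup>2 \<partial>lebI a b) \<longlonglongrightarrow> (\<integral>x. (\<psi> x)\<^sup>2 \<partial>lebI a b)"
    proof (rule integral_dominated_convergence[where w="\<lambda>x. (B + 1)\<^sup>2"])
      show "AE x in lebI a b. (\<lambda>n. (\<phi> n x)\<^sup>2) \<longlonglongrightarrow> (\<psi> x)\<^sup>2"
        using \<phi>(3) by eventually_elim (intro tendsto_intros)
      show "AE x in lebI a b. norm ((\<phi> n x)\<^sup>2) \<le> (B + 1)\<^sup>2" for n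
        using \<phi>(2) B0 by (intro AE_I2) (simp add: abs_le_square_iff[symmetric])
    qed auto
    then show "(\<lambda>n. l2n (lebI a b) (\<phi> n)) \<longlonglongrightarrow> l2n (lebI a b) \<psi>"
      unfolding l2n_def by (intro tendsto_intros)
  qed
qed

text \<open>The sign of \<open>f\<close> is bounded and measurable, hence admissible by density, and
  testing with it yields the integral of the absolute value.\<close>

lemma fundamental_lemma:
  assumes ab: "a < b" and f: "integrable (lebI a b) f"
    and 0: "\<And>\<phi>. test_function a b \<phi> \<Longrightarrow> (\<integral>x. f x * \<phi> x \<partial>lebI a b) = 0"
  shows "AE x in lebI a b. f x = 0"
proof -
  have [measurable]: "f \<in> borel_measurable (lebI a b)" using f by simp
  have m: "(\<lambda>x. if f x \<ge> 0 then 1 else - 1 :: real) \<in> borel_measurable (lebI a b)" by measurable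
  have bd: "\<bar>if f x \<ge> 0 then 1 else - 1 :: real\<bar> \<le> 1" for x by simp
  obtain \<phi> where \<phi>: "\<And>n. test_function a b (\<phi> n)"
    "\<And>h. integrable (lebI a b) h \<Longrightarrow> (\<lambda>n. \<integral>x. h x * \<phi> n x \<partial>lebI a b)
      \<longlonglongrightarrow> (\<integral>x. h x * (if f x \<ge> 0 then 1 else - 1) \<partial>lebI a b)"
    by (rule test_function_dense[OF ab m bd]) blast
  have "(\<integral>x. f x * (if f x \<ge> 0 then 1 else - 1) \<partial>lebI a b) = 0"
    using \<phi>(2)[OF f] 0[OF \<phi>(1)] by (simp add: LIMSEQ_const_iff)
  moreover have "(\<lambda>x. f x * (if f x \<ge> 0 then 1 else - 1)) = (\<lambda>x. \<bar>f x\<bar>)" by auto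
  ultimately have "(\<integral>x. \<bar>f x\<bar> \<partial>lebI a b) = 0" by simp
  then have "AE x in lebI a b. \<bar>f x\<bar> = 0"
    using integral_nonneg_eq_0_iff_AE[of "lebI a b" "\<lambda>x. \<bar>f x\<bar>"] f by simp
  then show ?thesis by simp
qed

text \<open>Truncations of \<open>f\<close> are bounded, so they are admissible by density, and
  \<open>f\<close> times its truncation is the square of the truncation; then the height tends to
  infinity. Norms of weak derivatives are later bounded through pairings in this way.\<close>

lemma l2n_le_by_duality:
  assumes ab: "a < b" and f: "square_integrable (lebI a b) f"
    and K: "\<And>\<phi>. test_function a b \<phi> \<Longrightarrow> \<bar>\<integral>x. f x * \<phi> x \<partial>lebI a b\<bar> \<le> K * l2n (lebI a b) \<phi>"
    and K0: "0 \<le> K"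
  shows "l2n (lebI a b) f \<le> K"
proof -
  note fi = square_integrable_integrable[OF finite_measure_lebI f]
  have [measurable]: "f \<in> borel_measurable (lebI a b)" using fi by simp
  define \<psi> where "\<psi> m x = (if \<bar>f x\<bar> \<le> real m then f x else 0)" for m x
  have \<psi>m[measurable]: "\<psi> m \<in> borel_measurable (lebI a b)" for m unfolding \<psi>_def by measurable
  have bd: "\<bar>\<psi> m x\<bar> \<le> real m" for m x by (simp add: \<psi>_def)
  have le: "(\<integral>x. (\<psi> m x)\<^sup>2 \<partial>lebI a b) \<le> K\<^sup>2" for m
  proof -
    obtain \<phi> where \<phi>: "\<And>n. test_function a b (\<phi> n)"
      "\<And>h. integrable (lebI a b) h \<Longrightarrow> (\<lambda>n. \<integral>x. h x * \<phi> n x \<partial>lebI a b) \<longlonglongrightarrow> (\<integral>x. h x * \<psi> m x \<partial>lebI a b)"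
      "(\<lambda>n. l2n (lebI a b) (\<phi> n)) \<longlonglongrightarrow> l2n (lebI a b) (\<psi> m)"
      by (rule test_function_dense[OF ab \<psi>m bd[of m]]) blast
    have "\<bar>\<integral>x. f x * \<psi> m x \<partial>lebI a b\<bar> \<le> K * l2n (lebI a b) (\<psi> m)"
      by (rule LIMSEQ_le[OF tendsto_rabs[OF \<phi>(2)[OF fi]] tendsto_mult[OF tendsto_const \<phi>(3)]])
         (use K \<phi>(1) in auto)
    moreover have "(\<lambda>x. f x * \<psi> m x) = (\<lambda>x. (\<psi> m x)\<^sup>2)"
      by (auto simp: \<psi>_def power2_eq_square)
    ultimately have "(l2n (lebI a b) (\<psi> m))\<^sup>2 \<le> K * l2n (lebI a b) (\<psi> m)"
      by (simp add: l2n_square)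
    then have "l2n (lebI a b) (\<psi> m) \<le> K"
      using K0 l2n_nonneg[of "lebI a b" "\<psi> m"] by (cases "l2n (lebI a b) (\<psi> m) = 0") (auto simp: power2_eq_square)
    then show ?thesis unfolding l2n_square[symmetric] by (rule power_mono) simp
  qed
  have "(\<lambda>m. \<integral>x. (\<psi> m x)\<^sup>2 \<partial>lebI a b) \<longlonglongrightarrow> (\<integral>x. (f x)\<^sup>2 \<partial>lebI a b)"
  proof (rule integral_dominated_convergence[where w="\<lambda>x. (f x)\<^sup>2"])
    show "integrable (lebI a b) (\<lambda>x. (f x)\<^sup>2)" by (rule square_integrable_square[OF f])
    show "AE x in lebI a b. (\<lambda>m. (\<psi> m x)\<^sup>2) \<longlonglongrightarrow> (f x)\<^sup>2"
    proof (rule AE_I2)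
      fix x
      obtain M where "\<bar>f x\<bar> \<le> real M" using real_arch_simple by blast
      then have "\<forall>\<^sub>F m in sequentially. (\<psi> m x)\<^sup>2 = (f x)\<^sup>2"
        by (intro eventually_sequentiallyI[of M]) (auto simp: \<psi>_def)
      then show "(\<lambda>m. (\<psi> m x)\<^sup>2) \<longlonglongrightarrow> (f x)\<^sup>2" by (rule tendsto_eventually)
    qed
    show "AE x in lebI a b. norm ((\<psi> m x)\<^sup>2) \<le> (f x)\<^sup>2" for m by (auto simp: \<psi>_def)
  qed auto
  then have "(\<integral>x. (f x)\<^sup>2 \<partial>lebI a b) \<le> K\<^sup>2" by (rule LIMSEQ_le_const2) (use le in auto)
  then have "(l2n (lebI a b) f)\<^sup>2 \<le> K\<^sup>2" by (simp add: l2n_square)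
  then show ?thesis by (rule power2_le_imp_le[OF _ K0])
qed

section \<open>Primitives, integration by parts and the du Bois-Reymond lemma\<close>

lemma indefinite_integral_continuous:
  fixes f :: "real \<Rightarrow> real"
  assumes f: "integrable (lebI a b) f"
  shows "continuous_on {a..b} (\<lambda>x. \<integral>y. f y \<partial>lebI a x)"
proof -
  have "continuous_on {a..b} (\<lambda>x. integral {a..x} f)"
    by (rule indefinite_integral_continuous_1[OF has_integral_lebI[OF f]])
  then show ?thesis
    by (rule continuous_on_eq) (auto intro!: integral_lebI_eq[symmetric] integrable_lebI_subset[OF f])
qed

text \<open>The limiting step shared by two extensions: from continuous to bounded measurable
  \<open>f\<close>, and from there to integrable \<open>f\<close>. As \<open>g\<close> and
  \<open>g'\<close> are bounded, a single majorant \<open>w\<close> of the sequence controls all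
  three terms.\<close>

lemma integral_by_parts_limit:
  fixes f g g' w :: "real \<Rightarrow> real"
  assumes g: "continuous_on {a..b} g" and g': "continuous_on {a..b} g'"
    and fn: "\<And>n. integrable (lebI a b) (fn n)" and f: "f \<in> borel_measurable (lebI a b)"
    and w: "integrable (lebI a b) w" "\<And>n x. \<bar>fn n x\<bar> \<le> w x"
    and lim: "AE x in lebI a b. (\<lambda>n. fn n x) \<longlonglongrightarrow> f x"
    and parts: "\<And>n. (\<integral>x. (\<integral>y. fn n y \<partial>lebI a x) * g' x \<partial>lebI a b) = (\<integral>y. fn n y \<partial>lebI a b) * g b - (\<integral>x. fn n x * g x \<partial>lebI a b)"
  shows "(\<integral>x. (\<integral>y. f y \<partial>lebI a x) * g' x \<partial>lebI a b) = (\<integral>y. f y \<partial>lebI a b) * g b - (\<integral>x. f x * g x \<partial>lebI a b)"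
proof -
  have fi: "integrable (lebI a b) f"
  proof (rule integrable_dominated_convergence[OF f _ w(1) lim])
    show "fn n \<in> borel_measurable (lebI a b)" for n using fn by simp
  qed (use w(2) in auto)
  obtain Bg where Bg: "0 \<le> Bg" "\<And>x. x \<in> {a..b} \<Longrightarrow> \<bar>g x\<bar> \<le> Bg"
    using continuous_bounded_interval[OF g] by blast
  obtain Bg' where Bg': "0 \<le> Bg'" "\<And>x. x \<in> {a..b} \<Longrightarrow> \<bar>g' x\<bar> \<le> Bg'"
    using continuous_bounded_interval[OF g'] by blast
  have [measurable]: "fn n \<in> borel_measurable (lebI a b)" for n using fn by simp
  note [measurable] = f continuous_measurable_lebI[OF g] continuous_measurable_lebI[OF g']
  have sub: "(\<lambda>n. \<integral>y. fn n y \<partial>lebI a x) \<longlonglongrightarrow> (\<integral>y. f y \<partial>lebI a x)" if "x \<le> b" for x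
  proof (rule integral_dominated_convergence[where w=w])
    show "f \<in> borel_measurable (lebI a x)" by (rule measurable_lebI_subset[OF f order_refl that])
    show "fn n \<in> borel_measurable (lebI a x)" for n
      by (rule measurable_lebI_subset[of _ a b]) (use that in auto)
    show "integrable (lebI a x) w" by (rule integrable_lebI_subset[OF w(1) order_refl that])
    show "AE y in lebI a x. (\<lambda>n. fn n y) \<longlonglongrightarrow> f y" by (rule AE_lebI_subset[OF lim order_refl that])
  qed (use w(2) in auto)
  have [measurable]: "(\<lambda>x. \<integral>y. fn n y \<partial>lebI a x) \<in> borel_measurable (lebI a b)" for n
    by (intro continuous_measurable_lebI indefinite_integral_continuous fn)
  have [measurable]: "(\<lambda>x. \<integral>y. f y \<partial>lebI a x) \<in> borel_measurable (lebI a b)"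
    by (intro continuous_measurable_lebI indefinite_integral_continuous fi)
  interpret finite_measure "lebI a b" by (rule finite_measure_lebI)
  have w0: "0 \<le> w x" for x using w(2)[of 0 x] by simp
  have L: "(\<lambda>n. \<integral>x. (\<integral>y. fn n y \<partial>lebI a x) * g' x \<partial>lebI a b) \<longlonglongrightarrow> (\<integral>x. (\<integral>y. f y \<partial>lebI a x) * g' x \<partial>lebI a b)"
  proof (rule integral_dominated_convergence[where w="\<lambda>x. (\<integral>y. w y \<partial>lebI a b) * Bg'"])
    show "AE x in lebI a b. (\<lambda>n. (\<integral>y. fn n y \<partial>lebI a x) * g' x) \<longlonglongrightarrow> (\<integral>y. f y \<partial>lebI a x) * g' x"
      by (intro AE_I2 tendsto_intros sub) auto
    show "AE x in lebI a b. norm ((\<integral>y. fn n y \<partial>lebI a x) * g' x) \<le> (\<integral>y. w y \<partial>lebI a b) * Bg'" for n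
    proof (rule AE_I2)
      fix x assume "x \<in> space (lebI a b)"
      then have x: "x \<in> {a..b}" by auto
      have wx: "integrable (lebI a x) w" by (rule integrable_lebI_subset[OF w(1)]) (use x in auto)
      have "\<bar>\<integral>y. fn n y \<partial>lebI a x\<bar> \<le> (\<integral>y. \<bar>fn n y\<bar> \<partial>lebI a x)" by (rule integral_abs_bound)
      also have "\<dots> \<le> (\<integral>y. w y \<partial>lebI a x)"
        by (rule integral_mono[OF _ wx])
           (use w(2) x in \<open>auto intro!: integrable_abs integrable_lebI_subset[OF fn]\<close>)
      also have "\<dots> \<le> (\<integral>y. w y \<partial>lebI a b)" by (rule integral_lebI_le[OF w(1) w0]) (use x in auto)
      finally show "norm ((\<integral>y. fn n y \<partial>lebI a x) * g' x) \<le> (\<integral>y. w y \<partial>lebI a b) * Bg'"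
        using Bg'(2)[OF x] by (simp add: abs_mult mult_mono)
    qed
  qed auto
  have R1: "(\<lambda>n. \<integral>y. fn n y \<partial>lebI a b) \<longlonglongrightarrow> (\<integral>y. f y \<partial>lebI a b)" by (rule sub) simp
  have R2: "(\<lambda>n. \<integral>x. fn n x * g x \<partial>lebI a b) \<longlonglongrightarrow> (\<integral>x. f x * g x \<partial>lebI a b)"
  proof (rule integral_dominated_convergence[where w="\<lambda>x. w x * Bg"])
    show "AE x in lebI a b. (\<lambda>n. fn n x * g x) \<longlonglongrightarrow> f x * g x"
      using lim by eventually_elim (intro tendsto_intros)
    show "AE x in lebI a b. norm (fn n x * g x) \<le> w x * Bg" for n
      using w(2) w0 Bg by (intro AE_I2) (auto simp: abs_mult intro!: mult_mono)
  qed (use w in auto)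
  have "(\<lambda>n. \<integral>x. (\<integral>y. fn n y \<partial>lebI a x) * g' x \<partial>lebI a b) \<longlonglongrightarrow> (\<integral>y. f y \<partial>lebI a b) * g b - (\<integral>x. f x * g x \<partial>lebI a b)"
    unfolding parts by (intro tendsto_intros R1 R2)
  with L show ?thesis by (rule LIMSEQ_unique)
qed

text \<open>In place of Fubini: the fundamental theorem for continuous \<open>f\<close>, almost
  everywhere convergent test functions for bounded \<open>f\<close>, and truncation for the rest.
  The generality matters because \<open>f\<close> will be a weak derivative without
  continuity.\<close>

lemma integral_by_parts_AC:
  fixes f g g' :: "real \<Rightarrow> real"
  assumes ab: "a < b" and f: "integrable (lebI a b) f"
    and g: "\<And>x. x \<in> {a..b} \<Longrightarrow> (g has_real_derivative g' x) (at x within {a..b})"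
    and g': "continuous_on {a..b} g'"
  shows "(\<integral>x. (\<integral>y. f y \<partial>lebI a x) * g' x \<partial>lebI a b) = (\<integral>y. f y \<partial>lebI a b) * g b - (\<integral>x. f x * g x \<partial>lebI a b)"
proof -
  have gc: "continuous_on {a..b} g" using g by (meson DERIV_continuous continuous_on_eq_continuous_within)
  interpret finite_measure "lebI a b" by (rule finite_measure_lebI)
  have cont: "(\<integral>x. (\<integral>y. f y \<partial>lebI a x) * g' x \<partial>lebI a b) = (\<integral>y. f y \<partial>lebI a b) * g b - (\<integral>x. f x * g x \<partial>lebI a b)"
    if f: "continuous_on {a..b} f" for f :: "real \<Rightarrow> real"
  proof -
    define F where "F x = (\<integral>y. f y \<partial>lebI a x)" for x
    have F: "(F has_real_derivative f x) (at x within {a..b})" if "x \<in> {a..b}" for x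
    proof -
      have "((\<lambda>x. integral {a..x} f) has_real_derivative f x) (at x within {a..b})"
        by (rule integral_has_real_derivative[OF f that])
      then show ?thesis
        by (rule has_field_derivative_transform_within[of _ _ _ _ 1])
           (use that in \<open>auto simp: F_def intro!: integral_lebI_eq[symmetric] integrable_lebI_subset[OF integrable_continuous_lebI[OF f]]\<close>)
    qed
    have Fc: "continuous_on {a..b} F" using F by (meson DERIV_continuous continuous_on_eq_continuous_within)
    have "(\<integral>x. f x * g x + F x * g' x \<partial>lebI a b) = F b * g b - F a * g a"
      by (rule FTC_lebI) (use ab in \<open>auto intro!: derivative_eq_intros F g continuous_intros f gc Fc g'\<close>)
    moreover have "F a = 0" by (simp add: F_def)
    moreover have "(\<integral>x. f x * g x + F x * g' x \<partial>lebI a b) = (\<integral>x. f x * g x \<partial>lebI a b) + (\<integral>x. F x * g' x \<partial>lebI a b)"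
      by (intro Bochner_Integration.integral_add integrable_continuous_lebI continuous_intros f gc Fc g')
    ultimately show ?thesis by (simp add: F_def)
  qed
  have bdd: "(\<integral>x. (\<integral>y. f y \<partial>lebI a x) * g' x \<partial>lebI a b) = (\<integral>y. f y \<partial>lebI a b) * g b - (\<integral>x. f x * g x \<partial>lebI a b)"
    if f: "f \<in> borel_measurable (lebI a b)" and B: "0 \<le> B" "\<And>x. \<bar>f x\<bar> \<le> B" for f :: "real \<Rightarrow> real" and B
  proof -
    obtain \<phi> where \<phi>: "\<And>n. test_function a b (\<phi> n)" "\<And>n x. \<bar>\<phi> n x\<bar> \<le> B + 1"
      "AE x in lebI a b. (\<lambda>n. \<phi> n x) \<longlonglongrightarrow> f x"
      using test_function_dense_AE[OF ab f B] by blast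
    show ?thesis
      by (rule integral_by_parts_limit[OF gc g' _ f _ _ \<phi>(3) cont, of "\<lambda>_. B + 1"])
         (use \<phi> in \<open>auto intro!: integrable_continuous_lebI test_function_continuous\<close>)
  qed
  have [measurable]: "f \<in> borel_measurable (lebI a b)" using f by simp
  define fm where "fm m x = (if \<bar>f x\<bar> \<le> real m then f x else 0)" for m x
  have fm [measurable]: "fm m \<in> borel_measurable (lebI a b)" for m unfolding fm_def by measurable
  show ?thesis
  proof (rule integral_by_parts_limit[OF gc g', of fm _ "\<lambda>x. \<bar>f x\<bar>"])
    show "integrable (lebI a b) (fm m)" for m
      by (rule Bochner_Integration.integrable_bound[OF f fm]) (auto simp: fm_def)
    show "f \<in> borel_measurable (lebI a b)" by measurable
    show "integrable (lebI a b) (\<lambda>x. \<bar>f x\<bar>)" using f by simp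
    show "\<bar>fm n x\<bar> \<le> \<bar>f x\<bar>" for n x by (auto simp: fm_def)
    show "AE x in lebI a b. (\<lambda>n. fm n x) \<longlonglongrightarrow> f x"
    proof (rule AE_I2)
      fix x
      obtain M where "\<bar>f x\<bar> \<le> real M" using real_arch_simple by blast
      then have "\<forall>\<^sub>F m in sequentially. fm m x = f x"
        by (intro eventually_sequentiallyI[of M]) (auto simp: fm_def)
      then show "(\<lambda>m. fm m x) \<longlonglongrightarrow> f x" by (rule tendsto_eventually)
    qed
    show "(\<integral>x. (\<integral>y. fm n y \<partial>lebI a x) * g' x \<partial>lebI a b) = (\<integral>y. fm n y \<partial>lebI a b) * g b - (\<integral>x. fm n x * g x \<partial>lebI a b)" for n
      by (rule bdd[OF fm, of "real n"]) (auto simp: fm_def)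
  qed
qed

lemma test_function_antiderivative:
  assumes ab: "a < b" and \<theta>: "test_function a b \<theta>" and 0: "(\<integral>x. \<theta> x \<partial>lebI a b) = 0"
  obtains \<Theta> where "test_function a b \<Theta>" "deriv \<Theta> = \<theta>"
proof -
  obtain c d where cd: "a < c" "d < b" "c \<le> d" "\<And>x. x \<notin> {c..d} \<Longrightarrow> \<theta> x = 0"
    using test_function_support[OF \<theta> ab] by blast
  have cont: "continuous_on S \<theta>" for S by (rule test_function_continuous[OF \<theta>])
  \<comment> \<open>For \<open>x < a\<close> the interval is empty and the value is 0, as it should
    be; beyond \<open>d\<close> the vanishing mean of \<open>\<theta>\<close> does the same.\<close>
  define \<Theta> where "\<Theta> x = integral {a..x} \<theta>" for x
  have int: "\<theta> integrable_on {x..y}" for x y by (rule integrable_continuous_real[OF cont])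
  have zero: "\<Theta> x = 0" if "x \<notin> {c..d}" for x
  proof (cases "x < c")
    case True
    have "integral {a..x} \<theta> = integral {a..x} (\<lambda>_. 0)"
      by (rule Henstock_Kurzweil_Integration.integral_cong) (use True cd in auto)
    then show ?thesis by (simp add: \<Theta>_def)
  next
    case False
    then have x: "x > d" using that by auto
    have "integral {a..d} \<theta> = 0"
    proof -
      have "integral {a..d} \<theta> + integral {d..b} \<theta> = integral {a..b} \<theta>"
        by (rule Henstock_Kurzweil_Integration.integral_combine[OF _ _ int]) (use cd in auto)
      moreover have "integral {d..b} \<theta> = integral {d..b} (\<lambda>_. 0)"
        by (rule integral_spike[of "{d}"]) (use cd in auto)
      moreover have "integral {a..b} \<theta> = 0"
        using 0 integral_lebI_eq[OF integrable_continuous_lebI[OF cont], of a b] by simp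
      ultimately show ?thesis by simp
    qed
    moreover have "integral {a..d} \<theta> + integral {d..x} \<theta> = integral {a..x} \<theta>"
      by (rule Henstock_Kurzweil_Integration.integral_combine[OF _ _ int]) (use cd x in auto)
    moreover have "integral {d..x} \<theta> = integral {d..x} (\<lambda>_. 0)"
      by (rule integral_spike[of "{d}"]) (use cd in auto)
    ultimately show ?thesis by (simp add: \<Theta>_def)
  qed
  have deriv: "(\<Theta> has_real_derivative \<theta> x) (at x)" for x
  proof (cases "x < c")
    case True
    have "((\<lambda>x. 0) has_real_derivative 0) (at x)" by simp
    then have "(\<Theta> has_real_derivative 0) (at x)"
      by (rule has_field_derivative_transform_within_open[of _ _ _ "{..<c}"]) (use True zero in auto)
    moreover have "\<theta> x = 0" using cd True by auto
    ultimately show ?thesis by simp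
  next
    case False
    then have x: "x \<in> {a<..<x + 1}" using cd by auto
    have "((\<lambda>x. integral {a..x} \<theta>) has_real_derivative \<theta> x) (at x within {a..x+1})"
      by (rule integral_has_real_derivative[OF cont]) (use x in auto)
    then show ?thesis
      using x at_within_Icc_at[of a x "x+1"] by (simp add: \<Theta>_def[abs_def])
  qed
  have sm: "smooth \<Theta>"
  proof (rule smoothI_family[where P="\<lambda>h. h = \<Theta> \<or> smooth h"])
    fix h assume "h = \<Theta> \<or> smooth h"
    then show "\<exists>h'. (h' = \<Theta> \<or> smooth h') \<and> (\<forall>y. (h has_real_derivative h' y) (at y))"
      using deriv test_function_smooth[OF \<theta>] smooth_deriv smooth_has_deriv by blast
  qed simp
  show ?thesis
    by (rule that[OF test_functionI[OF sm cd(1,2) zero]]) (use deriv in \<open>auto intro: DERIV_imp_deriv\<close>)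
qed

lemma exists_test_function_integral_one:
  assumes ab: "a < b"
  obtains \<theta> where "test_function a b \<theta>" "(\<integral>x. \<theta> x \<partial>lebI a b) = 1"
proof -
  interpret finite_measure "lebI a b" by (rule finite_measure_lebI)
  obtain \<phi> where \<phi>: "\<And>n. test_function a b (\<phi> n)"
    "\<And>f. integrable (lebI a b) f \<Longrightarrow> (\<lambda>n. \<integral>x. f x * \<phi> n x \<partial>lebI a b) \<longlonglongrightarrow> (\<integral>x. f x * 1 \<partial>lebI a b)"
    by (rule test_function_dense[OF ab, of "\<lambda>_. 1" 1, OF borel_measurable_const]) auto
  have "(\<lambda>n. \<integral>x. \<phi> n x \<partial>lebI a b) \<longlonglongrightarrow> b - a"
    using \<phi>(2)[of "\<lambda>_. 1"] ab by (simp add: measure_lebI)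
  then have "\<exists>n. (\<integral>x. \<phi> n x \<partial>lebI a b) > 0"
    using ab order_tendstoD(1)[of _ "b - a" sequentially 0] eventually_happens'[OF sequentially_bot] by fastforce
  then obtain n where n: "(\<integral>x. \<phi> n x \<partial>lebI a b) > 0" by blast
  show ?thesis
    by (rule that[of "\<lambda>x. (1 / (\<integral>x. \<phi> n x \<partial>lebI a b)) * \<phi> n x"])
       (use n test_function_scale[OF \<phi>(1) ab, of "1 / (\<integral>x. \<phi> n x \<partial>lebI a b)" n] in \<open>simp_all\<close>)
qed

text \<open>Subtracting the primitive of \<open>g\<close> leaves a function orthogonal to all
  derivatives of test functions. A test function is such a derivative once a multiple of a fixed
  \<open>\<theta>\<close> with integral 1 is removed to make its mean zero, so only a constant
  survives.\<close>

lemma du_Bois_Reymond: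
  assumes ab: "a < b" and f: "integrable (lebI a b) f" and g: "integrable (lebI a b) g"
    and weak: "\<And>\<phi>. test_function a b \<phi> \<Longrightarrow> (\<integral>x. f x * deriv \<phi> x \<partial>lebI a b) = - (\<integral>x. g x * \<phi> x \<partial>lebI a b)"
  obtains c where "AE x in lebI a b. f x = c + (\<integral>y. g y \<partial>lebI a x)"
proof -
  interpret finite_measure "lebI a b" by (rule finite_measure_lebI)
  define G where "G x = (\<integral>y. g y \<partial>lebI a x)" for x
  have Gc: "continuous_on {a..b} G" unfolding G_def by (rule indefinite_integral_continuous[OF g])
  define h where "h x = f x - G x" for x
  have Gi: "integrable (lebI a b) G" by (rule integrable_continuous_lebI[OF Gc])
  have hi: "integrable (lebI a b) h" unfolding h_def using f Gi by simp
  have bm: "integrable (lebI a b) (\<lambda>x. k x * \<phi> x)" if "integrable (lebI a b) k" "test_function a b \<phi>" for k \<phi>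
  proof -
    have c: "continuous_on {a..b} \<phi>" by (rule test_function_continuous[OF that(2)])
    obtain B where B: "0 \<le> B" "\<And>x. x \<in> {a..b} \<Longrightarrow> \<bar>\<phi> x\<bar> \<le> B" using continuous_bounded_interval[OF c] by blast
    show ?thesis
      by (rule Bochner_Integration.integrable_bound[of _ "\<lambda>x. B * \<bar>k x\<bar>"])
         (use that continuous_measurable_lebI[OF c] B in \<open>auto simp: abs_mult mult.commute intro!: mult_right_mono AE_I2\<close>)
  qed
  have h0: "(\<integral>x. h x * deriv \<phi> x \<partial>lebI a b) = 0" if \<phi>: "test_function a b \<phi>" for \<phi>
  proof -
    have d\<phi>: "test_function a b (deriv \<phi>)" by (rule test_function_deriv[OF \<phi> ab])
    have "(\<integral>x. G x * deriv \<phi> x \<partial>lebI a b) = (\<integral>y. g y \<partial>lebI a b) * \<phi> b - (\<integral>x. g x * \<phi> x \<partial>lebI a b)"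
      unfolding G_def
      by (rule integral_by_parts_AC[OF ab g])
         (auto intro: has_field_derivative_at_within test_function_has_deriv[OF \<phi>] test_function_continuous[OF d\<phi>])
    moreover have "\<phi> b = 0" by (rule test_function_outside[OF \<phi>]) simp
    ultimately show ?thesis
      using weak[OF \<phi>] bm[OF f d\<phi>] bm[OF Gi d\<phi>] by (simp add: h_def left_diff_distrib)
  qed
  obtain \<theta> where \<theta>: "test_function a b \<theta>" "(\<integral>x. \<theta> x \<partial>lebI a b) = 1"
    using exists_test_function_integral_one[OF ab] by blast
  define c where "c = (\<integral>x. h x * \<theta> x \<partial>lebI a b)"
  have ti: "integrable (lebI a b) \<phi>" if "test_function a b \<phi>" for \<phi>
    by (rule integrable_continuous_lebI[OF test_function_continuous[OF that]])
  have "AE x in lebI a b. h x - c = 0"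
  proof (rule fundamental_lemma[OF ab])
    show "integrable (lebI a b) (\<lambda>x. h x - c)" using hi by simp
    fix \<psi> assume \<psi>: "test_function a b \<psi>"
    define s where "s = (\<integral>x. \<psi> x \<partial>lebI a b)"
    have t: "test_function a b (\<lambda>x. \<psi> x + (- s) * \<theta> x)"
      by (intro test_function_add test_function_scale \<psi> \<theta> ab)
    have "(\<integral>x. \<psi> x + (- s) * \<theta> x \<partial>lebI a b) = 0"
      using ti[OF \<psi>] ti[OF \<theta>(1)] \<theta>(2) by (simp add: s_def)
    then obtain \<Theta> where \<Theta>: "test_function a b \<Theta>" "deriv \<Theta> = (\<lambda>x. \<psi> x + (- s) * \<theta> x)"
      using test_function_antiderivative[OF ab t] by blast
    have "0 = (\<integral>x. h x * (\<psi> x + (- s) * \<theta> x) \<partial>lebI a b)" using h0[OF \<Theta>(1)] \<Theta>(2) by simp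
    also have "\<dots> = (\<integral>x. h x * \<psi> x + (- s) * (h x * \<theta> x) \<partial>lebI a b)" by (simp add: algebra_simps)
    also have "\<dots> = (\<integral>x. h x * \<psi> x \<partial>lebI a b) - s * c"
      using bm[OF hi \<psi>] bm[OF hi \<theta>(1)] by (simp add: c_def)
    finally have "(\<integral>x. h x * \<psi> x \<partial>lebI a b) = s * c" by simp
    then show "(\<integral>x. (h x - c) * \<psi> x \<partial>lebI a b) = 0"
      using bm[OF hi \<psi>] ti[OF \<psi>] by (simp add: left_diff_distrib s_def)
  qed
  then have "AE x in lebI a b. f x = c + (\<integral>y. g y \<partial>lebI a x)"
    by eventually_elim (simp add: h_def G_def)
  then show ?thesis by (rule that)
qed

lemma AE_eq_continuous:
  fixes f g :: "real \<Rightarrow> real"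
  assumes "a < b" and f: "continuous_on {a..b} f" and g: "continuous_on {a..b} g"
    and ae: "AE x in lebI a b. f x = g x" and x: "x \<in> {a..b}"
  shows "f x = g x"
proof -
  have c: "continuous_on {a..b} (\<lambda>x. (f x - g x)\<^sup>2)" by (intro continuous_intros f g)
  have "(\<integral>x. (f x - g x)\<^sup>2 \<partial>lebI a b) = 0"
    by (rule integral_eq_zero_AE) (use ae in auto)
  then have 0: "integral {a..b} (\<lambda>x. (f x - g x)\<^sup>2) = 0"
    using integral_lebI_eq[OF integrable_continuous_lebI[OF c]] by simp
  have "\<forall>x\<in>{a..b}. (f x - g x)\<^sup>2 = 0"
    using integral_eq_0_iff[OF c] 0 assms(1) by auto
  then show ?thesis using x by auto
qed

text \<open>Continuity removes the exceptional null set. Applied to scalar pairings as functions of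
  time, this is what turns statements at almost every time into statements at given times.\<close>

lemma du_Bois_Reymond_continuous:
  assumes ab: "a < b" and f: "continuous_on {a..b} f" and g: "integrable (lebI a b) g"
    and weak: "\<And>\<phi>. test_function a b \<phi> \<Longrightarrow> (\<integral>x. f x * deriv \<phi> x \<partial>lebI a b) = - (\<integral>x. g x * \<phi> x \<partial>lebI a b)"
    and xy: "a \<le> x" "x \<le> y" "y \<le> b"
  shows "f y - f x = (\<integral>z. g z \<partial>lebI x y)"
proof -
  obtain c where c: "AE x in lebI a b. f x = c + (\<integral>y. g y \<partial>lebI a x)"
    using du_Bois_Reymond[OF ab integrable_continuous_lebI[OF f] g weak] by blast
  have "f z = c + (\<integral>y. g y \<partial>lebI a z)" if "z \<in> {a..b}" for z
    by (rule AE_eq_continuous[OF ab f _ c that]) (intro continuous_intros indefinite_integral_continuous[OF g])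
  moreover have "(\<integral>z. g z \<partial>lebI a y) = (\<integral>z. g z \<partial>lebI a x) + (\<integral>z. g z \<partial>lebI x y)"
    by (rule integral_lebI_combine[OF integrable_lebI_subset[OF g]]) (use xy in auto)
  ultimately show ?thesis using xy by simp
qed

section \<open>Sobolev functions on the unit interval\<close>

lemma is_weak_deriv_iff:
  "is_weak_deriv j f g \<longleftrightarrow> square_integrable (lebI 0 1) f \<and> square_integrable (lebI 0 1) g \<and>
     (\<forall>\<phi>. test_function 0 1 \<phi> \<longrightarrow>
        (\<integral>y. f y * (deriv ^^ j) \<phi> y \<partial>lebI 0 1) = (-1) ^ j * (\<integral>y. g y * \<phi> y \<partial>lebI 0 1))"
  by (simp add: is_weak_deriv_def L2_iff set_integral_lebesgue_on)

lemma square_integrable_test_function: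
  "test_function a b \<phi> \<Longrightarrow> square_integrable (lebI c d) \<phi>"
  by (intro square_integrable_continuous test_function_continuous)

lemma is_weak_derivD:
  assumes "is_weak_deriv j f g"
  shows "square_integrable (lebI 0 1) f" "square_integrable (lebI 0 1) g"
    "test_function 0 1 \<phi> \<Longrightarrow>
      (\<integral>y. f y * (deriv ^^ j) \<phi> y \<partial>lebI 0 1) = (-1) ^ j * (\<integral>y. g y * \<phi> y \<partial>lebI 0 1)"
  using assms by (auto simp: is_weak_deriv_iff)

lemma is_weak_deriv_weak_deriv:
  "f \<in> sobolev s \<Longrightarrow> j \<le> s \<Longrightarrow> is_weak_deriv j f (weak_deriv j f)"
  unfolding weak_deriv_def by (rule someI_ex[of "is_weak_deriv j f"]) (simp add: sobolev_def)

lemma sobolev_square_integrable: "f \<in> sobolev s \<Longrightarrow> square_integrable (lebI 0 1) f"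
  using is_weak_deriv_weak_deriv[of f s 0] is_weak_derivD(1) by blast

lemma weak_deriv_square_integrable:
  "f \<in> sobolev s \<Longrightarrow> j \<le> s \<Longrightarrow> square_integrable (lebI 0 1) (weak_deriv j f)"
  using is_weak_deriv_weak_deriv is_weak_derivD(2) by blast

lemma square_integrable_eq_AE:
  assumes "square_integrable (lebI 0 1) g" "square_integrable (lebI 0 1) h"
    and eq: "\<And>\<phi>. test_function 0 1 \<phi> \<Longrightarrow> (\<integral>y. g y * \<phi> y \<partial>lebI 0 1) = (\<integral>y. h y * \<phi> y \<partial>lebI 0 1)"
  shows "AE y in lebI 0 1. g y = h y"
proof -
  have "AE y in lebI 0 1. g y - h y = 0"
  proof (rule fundamental_lemma)
    show "integrable (lebI 0 1) (\<lambda>y. g y - h y)"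
      by (intro square_integrable_integrable finite_measure_lebI square_integrable_diff assms)
    fix \<phi> assume \<phi>: "test_function 0 1 \<phi>"
    have "(\<integral>y. (g y - h y) * \<phi> y \<partial>lebI 0 1) = (\<integral>y. g y * \<phi> y - h y * \<phi> y \<partial>lebI 0 1)"
      by (simp add: left_diff_distrib)
    also have "\<dots> = 0"
      using eq[OF \<phi>] square_integrable_mult[OF assms(1) square_integrable_test_function[OF \<phi>]]
        square_integrable_mult[OF assms(2) square_integrable_test_function[OF \<phi>]] by simp
    finally show "(\<integral>y. (g y - h y) * \<phi> y \<partial>lebI 0 1) = 0" .
  qed simp
  then show ?thesis by eventually_elim simp
qed

lemma is_weak_deriv_unique:
  assumes "is_weak_deriv j f g" "is_weak_deriv j f h"
  shows "AE y in lebI 0 1. g y = h y"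
  by (rule square_integrable_eq_AE)
     (use is_weak_derivD[OF assms(1)] is_weak_derivD[OF assms(2)] in auto)

lemma l2n_is_weak_deriv_unique:
  assumes "is_weak_deriv j f g" "is_weak_deriv j f h"
  shows "l2n (lebI 0 1) g = l2n (lebI 0 1) h"
  by (intro l2n_cong_AE is_weak_deriv_unique[OF assms] square_integrable_measurable is_weak_derivD(2)[OF assms(1)]
      is_weak_derivD(2)[OF assms(2)])

lemma is_weak_deriv_0: "square_integrable (lebI 0 1) f \<Longrightarrow> is_weak_deriv 0 f f"
  by (simp add: is_weak_deriv_iff)

lemma is_weak_deriv_diff:
  assumes f: "is_weak_deriv j f g" and f': "is_weak_deriv j f' g'"
  shows "is_weak_deriv j (\<lambda>y. f y - f' y) (\<lambda>y. g y - g' y)"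
  unfolding is_weak_deriv_iff
proof (intro conjI allI impI square_integrable_diff is_weak_derivD(1)[OF f] is_weak_derivD(1)[OF f']
    is_weak_derivD(2)[OF f] is_weak_derivD(2)[OF f'])
  fix \<phi> assume \<phi>: "test_function 0 1 \<phi>"
  note \<phi>j = square_integrable_test_function[OF test_function_deriv_funpow[OF \<phi> zero_less_one]]
  note \<phi>0 = square_integrable_test_function[OF \<phi>]
  show "(\<integral>y. (f y - f' y) * (deriv ^^ j) \<phi> y \<partial>lebI 0 1) = (-1) ^ j * (\<integral>y. (g y - g' y) * \<phi> y \<partial>lebI 0 1)"
    using is_weak_derivD(3)[OF f \<phi>] is_weak_derivD(3)[OF f' \<phi>]
      square_integrable_mult[OF is_weak_derivD(1)[OF f] \<phi>j] square_integrable_mult[OF is_weak_derivD(1)[OF f'] \<phi>j]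
      square_integrable_mult[OF is_weak_derivD(2)[OF f] \<phi>0] square_integrable_mult[OF is_weak_derivD(2)[OF f'] \<phi>0]
    by (simp add: left_diff_distrib right_diff_distrib)
qed

lemma is_weak_deriv_scale:
  assumes f: "is_weak_deriv j f g"
  shows "is_weak_deriv j (\<lambda>y. c * f y) (\<lambda>y. c * g y)"
  unfolding is_weak_deriv_iff
  using is_weak_derivD(3)[OF f]
  by (auto intro!: square_integrable_scale is_weak_derivD(1)[OF f] is_weak_derivD(2)[OF f] simp: mult.assoc)

lemma sobolev_scale: "f \<in> sobolev s \<Longrightarrow> (\<lambda>y. c * f y) \<in> sobolev s"
  unfolding sobolev_def using is_weak_deriv_scale by blast

lemma sobolev_diff: "f \<in> sobolev s \<Longrightarrow> g \<in> sobolev s \<Longrightarrow> (\<lambda>y. f y - g y) \<in> sobolev s"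
  unfolding sobolev_def using is_weak_deriv_diff by blast

lemma sobolev_zero: "(\<lambda>y. 0) \<in> sobolev s"
proof -
  have "is_weak_deriv j (\<lambda>y. 0) (\<lambda>y. 0)" for j by (simp add: is_weak_deriv_iff)
  then show ?thesis unfolding sobolev_def by blast
qed

lemma sobolev_add: "f \<in> sobolev s \<Longrightarrow> g \<in> sobolev s \<Longrightarrow> (\<lambda>y. f y + g y) \<in> sobolev s"
  using sobolev_diff[of f s "\<lambda>y. (-1) * g y"] sobolev_scale[of g s "-1"] by simp

lemma sobolev_sum: "(\<And>i. i \<in> I \<Longrightarrow> f i \<in> sobolev s) \<Longrightarrow> (\<lambda>y. \<Sum>i\<in>I. f i y) \<in> sobolev s"
  by (induction I rule: infinite_finite_induct) (auto intro: sobolev_add sobolev_zero)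

text \<open>Weak derivatives of every order are defined from \<open>f\<close> itself; testing the
  lower order with \<open>deriv \<phi>\<close> links two consecutive ones.\<close>

lemma is_weak_deriv_step:
  assumes f: "is_weak_deriv j f g" and f': "is_weak_deriv (Suc j) f h" and \<phi>: "test_function 0 1 \<phi>"
  shows "(\<integral>y. g y * deriv \<phi> y \<partial>lebI 0 1) = - (\<integral>y. h y * \<phi> y \<partial>lebI 0 1)"
proof -
  have "(-1) ^ j * (\<integral>y. g y * deriv \<phi> y \<partial>lebI 0 1) = (\<integral>y. f y * (deriv ^^ j) (deriv \<phi>) y \<partial>lebI 0 1)"
    using is_weak_derivD(3)[OF f test_function_deriv[OF \<phi> zero_less_one]] by simp
  also have "\<dots> = (\<integral>y. f y * (deriv ^^ Suc j) \<phi> y \<partial>lebI 0 1)" by (simp add: funpow_swap1)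
  also have "\<dots> = (-1) ^ j * (- (\<integral>y. h y * \<phi> y \<partial>lebI 0 1))"
    using is_weak_derivD(3)[OF f' \<phi>] by simp
  finally show ?thesis by (subst (asm) mult_left_cancel) auto
qed

lemma sobolev_norm_nonneg [simp]: "0 \<le> sobolev_norm s f"
  by (simp add: sobolev_norm_def sum_nonneg)

lemma weak_deriv_le_sobolev_norm: "j \<le> s \<Longrightarrow> l2n (lebI 0 1) (weak_deriv j f) \<le> sobolev_norm s f"
  unfolding sobolev_norm_def L2_norm_eq
  by (rule real_le_rsqrt) (intro member_le_sum, auto)

lemma l2n_le_sobolev_norm: "f \<in> sobolev s \<Longrightarrow> l2n (lebI 0 1) f \<le> sobolev_norm s f"
  using weak_deriv_le_sobolev_norm[of 0 s f] is_weak_deriv_weak_deriv[of f s 0]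
    l2n_is_weak_deriv_unique[OF is_weak_deriv_0[OF sobolev_square_integrable], of f s] by simp

lemma sobolev_norm_le:
  assumes "\<And>j. j \<le> s \<Longrightarrow> l2n (lebI 0 1) (weak_deriv j f) \<le> K" "0 \<le> K"
  shows "sobolev_norm s f \<le> real (Suc s) * K"
proof -
  have "(\<Sum>j\<le>s. (L2_norm (weak_deriv j f))\<^sup>2) \<le> (\<Sum>j\<le>s. K\<^sup>2)"
    by (intro sum_mono) (use assms in \<open>auto simp: L2_norm_eq intro: power_mono\<close>)
  also have "\<dots> = 1 * (real (Suc s) * K\<^sup>2)" by simp
  also have "\<dots> \<le> real (Suc s) * (real (Suc s) * K\<^sup>2)" by (intro mult_right_mono) auto
  also have "\<dots> = (real (Suc s) * K)\<^sup>2" by (simp add: power2_eq_square)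
  finally show ?thesis
    unfolding sobolev_norm_def using assms(2) by (intro real_le_lsqrt) (auto simp: sum_nonneg)
qed

lemma sobolev_test_bound:
  assumes f: "f \<in> sobolev s" and j: "j \<le> s" and \<phi>: "test_function 0 1 \<phi>"
  shows "\<bar>\<integral>y. f y * (deriv ^^ j) \<phi> y \<partial>lebI 0 1\<bar> \<le> sobolev_norm s f * l2n (lebI 0 1) \<phi>"
proof -
  have "\<bar>\<integral>y. f y * (deriv ^^ j) \<phi> y \<partial>lebI 0 1\<bar> = \<bar>\<integral>y. weak_deriv j f y * \<phi> y \<partial>lebI 0 1\<bar>"
    unfolding is_weak_derivD(3)[OF is_weak_deriv_weak_deriv[OF f j] \<phi>] by (simp add: abs_mult power_abs)
  also have "\<dots> \<le> l2n (lebI 0 1) (weak_deriv j f) * l2n (lebI 0 1) \<phi>"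
    by (intro Cauchy_Schwarz_l2 weak_deriv_square_integrable[OF f j] square_integrable_test_function[OF \<phi>])
  also have "\<dots> \<le> sobolev_norm s f * l2n (lebI 0 1) \<phi>"
    by (intro mult_right_mono weak_deriv_le_sobolev_norm j) simp
  finally show ?thesis .
qed

lemma is_weak_deriv_norm_by_duality:
  assumes g: "is_weak_deriv j f g" and K: "0 \<le> K"
    and le: "\<And>\<phi>. test_function 0 1 \<phi> \<Longrightarrow> \<bar>\<integral>y. f y * (deriv ^^ j) \<phi> y \<partial>lebI 0 1\<bar> \<le> K * l2n (lebI 0 1) \<phi>"
  shows "l2n (lebI 0 1) g \<le> K"
  by (rule l2n_le_by_duality[OF zero_less_one is_weak_derivD(2)[OF g] _ K])
     (use le in \<open>simp add: is_weak_derivD(3)[OF g] abs_mult power_abs\<close>)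

text \<open>The convergence of \<open>fm\<close> is only weak, but the scalar sequence
  \<open>N\<close> controls, by duality, the differences of all weak derivatives in norm.
  Completeness supplies limits, and pairing with test functions identifies them as weak derivatives
  of \<open>f\<close>.\<close>

lemma sobolev_limit:
  assumes f: "square_integrable (lebI 0 1) f" and fm: "\<And>m. fm m \<in> sobolev s"
    and lim: "\<And>\<phi>. test_function 0 1 \<phi> \<Longrightarrow>
       (\<lambda>m. \<integral>y. fm m y * \<phi> y \<partial>lebI 0 1) \<longlonglongrightarrow> (\<integral>y. f y * \<phi> y \<partial>lebI 0 1)"
    and cauchy: "Cauchy (N :: nat \<Rightarrow> real)"
    and bound: "\<And>m n j \<phi>. j \<le> s \<Longrightarrow> test_function 0 1 \<phi> \<Longrightarrow>
       \<bar>\<integral>y. (fm m y - fm n y) * (deriv ^^ j) \<phi> y \<partial>lebI 0 1\<bar> \<le> \<bar>N m - N n\<bar> * l2n (lebI 0 1) \<phi>"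
  shows "f \<in> sobolev s"
  unfolding sobolev_def
proof (clarify)
  fix j assume j: "j \<le> s"
  note wd = is_weak_deriv_weak_deriv[OF fm j]
  have sq: "square_integrable (lebI 0 1) (weak_deriv j (fm m))" for m
    by (rule weak_deriv_square_integrable[OF fm j])
  have C: "l2n (lebI 0 1) (\<lambda>y. weak_deriv j (fm m) y - weak_deriv j (fm n) y) \<le> \<bar>N m - N n\<bar>" for m n
    by (rule is_weak_deriv_norm_by_duality[OF is_weak_deriv_diff[OF wd wd]]) (auto intro: bound[OF j])
  have "\<exists>M. \<forall>m\<ge>M. \<forall>n\<ge>M. l2n (lebI 0 1) (\<lambda>y. weak_deriv j (fm m) y - weak_deriv j (fm n) y) < e"
    if "e > 0" for e
  proof -
    obtain M where "\<forall>m\<ge>M. \<forall>n\<ge>M. \<bar>N m - N n\<bar> < e"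
      using metric_CauchyD[OF cauchy \<open>e > 0\<close>] unfolding dist_real_def by blast
    then show ?thesis using le_less_trans[OF C] by blast
  qed
  from l2n_complete[OF finite_measure_lebI sq this]
  obtain g where g: "square_integrable (lebI 0 1) g"
    "(\<lambda>m. l2n (lebI 0 1) (\<lambda>y. weak_deriv j (fm m) y - g y)) \<longlonglongrightarrow> 0" by blast
  have "is_weak_deriv j f g"
    unfolding is_weak_deriv_iff
  proof (intro conjI allI impI f g(1))
    fix \<phi> assume \<phi>: "test_function 0 1 \<phi>"
    note \<phi>2 = square_integrable_test_function[OF \<phi>]
    have "(\<lambda>m. (\<integral>y. weak_deriv j (fm m) y * \<phi> y \<partial>lebI 0 1) - (\<integral>y. g y * \<phi> y \<partial>lebI 0 1)) \<longlonglongrightarrow> 0"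
    proof (rule Lim_null_comparison)
      show "\<forall>\<^sub>F m in sequentially. norm ((\<integral>y. weak_deriv j (fm m) y * \<phi> y \<partial>lebI 0 1) - (\<integral>y. g y * \<phi> y \<partial>lebI 0 1))
          \<le> l2n (lebI 0 1) (\<lambda>y. weak_deriv j (fm m) y - g y) * l2n (lebI 0 1) \<phi>"
      proof (intro always_eventually allI)
        fix m
        have "(\<integral>y. weak_deriv j (fm m) y * \<phi> y \<partial>lebI 0 1) - (\<integral>y. g y * \<phi> y \<partial>lebI 0 1)
            = (\<integral>y. (weak_deriv j (fm m) y - g y) * \<phi> y \<partial>lebI 0 1)"
          using square_integrable_mult[OF sq \<phi>2, of m] square_integrable_mult[OF g(1) \<phi>2]
          by (simp add: left_diff_distrib)
        then show "norm ((\<integral>y. weak_deriv j (fm m) y * \<phi> y \<partial>lebI 0 1) - (\<integral>y. g y * \<phi> y \<partial>lebI 0 1))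
          \<le> l2n (lebI 0 1) (\<lambda>y. weak_deriv j (fm m) y - g y) * l2n (lebI 0 1) \<phi>"
          using Cauchy_Schwarz_l2[OF square_integrable_diff[OF sq g(1)] \<phi>2] by simp
      qed
      show "(\<lambda>m. l2n (lebI 0 1) (\<lambda>y. weak_deriv j (fm m) y - g y) * l2n (lebI 0 1) \<phi>) \<longlonglongrightarrow> 0"
        by (rule tendsto_mult_left_zero[OF g(2)])
    qed
    then have "(\<lambda>m. (\<integral>y. weak_deriv j (fm m) y * \<phi> y \<partial>lebI 0 1)) \<longlonglongrightarrow> (\<integral>y. g y * \<phi> y \<partial>lebI 0 1)"
      by (simp add: LIM_zero_iff)
    then have "(\<lambda>m. (-1) ^ j * (\<integral>y. weak_deriv j (fm m) y * \<phi> y \<partial>lebI 0 1)) \<longlonglongrightarrow> (-1) ^ j * (\<integral>y. g y * \<phi> y \<partial>lebI 0 1)"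
      by (intro tendsto_intros)
    then have "(\<lambda>m. \<integral>y. fm m y * (deriv ^^ j) \<phi> y \<partial>lebI 0 1) \<longlonglongrightarrow> (-1) ^ j * (\<integral>y. g y * \<phi> y \<partial>lebI 0 1)"
      by (simp only: is_weak_derivD(3)[OF wd \<phi>])
    then show "(\<integral>y. f y * (deriv ^^ j) \<phi> y \<partial>lebI 0 1) = (-1) ^ j * (\<integral>y. g y * \<phi> y \<partial>lebI 0 1)"
      by (rule LIMSEQ_unique[OF lim[OF test_function_deriv_funpow[OF \<phi> zero_less_one]]])
  qed
  then show "\<exists>g. is_weak_deriv j f g" by blast
qed

text \<open>\<open>H^s\<close> in one dimension, in pointwise form: continuous representatives of
  the derivatives below order \<open>s\<close>, each a primitive of the next. Increments are used
  instead of pointwise derivatives since \<open>F s\<close> is merely square integrable.\<close>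

definition sobolev_chain :: "nat \<Rightarrow> (nat \<Rightarrow> real \<Rightarrow> real) \<Rightarrow> bool" where
  "sobolev_chain s F \<longleftrightarrow> (\<forall>j\<le>s. square_integrable (lebI 0 1) (F j)) \<and>
     (\<forall>j<s. continuous_on {0..1} (F j) \<and>
        (\<forall>x y. 0 \<le> x \<longrightarrow> x \<le> y \<longrightarrow> y \<le> 1 \<longrightarrow> F j y - F j x = (\<integral>z. F (Suc j) z \<partial>lebI x y)))"

lemma sobolev_chain_square_integrable:
  "sobolev_chain s F \<Longrightarrow> j \<le> s \<Longrightarrow> square_integrable (lebI 0 1) (F j)"
  by (simp add: sobolev_chain_def)

lemma sobolev_chain_continuous: "sobolev_chain s F \<Longrightarrow> j < s \<Longrightarrow> continuous_on {0..1} (F j)"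
  by (simp add: sobolev_chain_def)

lemma sobolev_chain_integral:
  "sobolev_chain s F \<Longrightarrow> j < s \<Longrightarrow> 0 \<le> x \<Longrightarrow> x \<le> y \<Longrightarrow> y \<le> 1 \<Longrightarrow> F j y - F j x = (\<integral>z. F (Suc j) z \<partial>lebI x y)"
  by (simp add: sobolev_chain_def)

lemma sobolev_chain_shift: "sobolev_chain (i + s) F \<Longrightarrow> sobolev_chain s (\<lambda>j. F (i + j))"
  by (simp add: sobolev_chain_def)

lemma exists_sobolev_chain:
  assumes f: "f \<in> sobolev s" and fc: "continuous_on {0..1} f"
  obtains F where "F 0 = f" "sobolev_chain s F"
    "\<And>j. j \<le> s \<Longrightarrow> AE y in lebI 0 1. F j y = weak_deriv j f y"
proof -
  note wd = is_weak_deriv_weak_deriv[OF f]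
  have sq: "square_integrable (lebI 0 1) (weak_deriv j f)" if "j \<le> s" for j
    by (rule weak_deriv_square_integrable[OF f that])
  note int = square_integrable_integrable[OF finite_measure_lebI sq]
  have "\<exists>c. AE x in lebI 0 1. weak_deriv j f x = c + (\<integral>y. weak_deriv (Suc j) f y \<partial>lebI 0 x)" if "j < s" for j
  proof -
    have j: "j \<le> s" "Suc j \<le> s" using that by auto
    show ?thesis
      by (rule du_Bois_Reymond[OF zero_less_one int[OF j(1)] int[OF j(2)] is_weak_deriv_step[OF wd[OF j(1)] wd[OF j(2)]]])
         blast+
  qed
  then obtain c where c: "\<And>j. j < s \<Longrightarrow> AE x in lebI 0 1. weak_deriv j f x = c j + (\<integral>y. weak_deriv (Suc j) f y \<partial>lebI 0 x)"
    by metis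
  \<comment> \<open>At index 0 the given function is kept, not a representative, so that nodal and
    boundary values refer to \<open>f\<close> itself.\<close>
  define F where "F j = (if j = 0 then f else if j < s then (\<lambda>x. c j + (\<integral>y. weak_deriv (Suc j) f y \<partial>lebI 0 x)) else weak_deriv j f)" for j
  have cont: "continuous_on {0..1} (\<lambda>x. c j + (\<integral>y. weak_deriv (Suc j) f y \<partial>lebI 0 x))" if "j < s" for j
    by (intro continuous_intros indefinite_integral_continuous int) (use that in auto)
  have f0: "AE x in lebI 0 1. f x = weak_deriv 0 f x"
    by (rule is_weak_deriv_unique[OF is_weak_deriv_0[OF sobolev_square_integrable[OF f]] wd]) simp
  have f0': "f x = c 0 + (\<integral>y. weak_deriv (Suc 0) f y \<partial>lebI 0 x)" if "s > 0" "x \<in> {0..1}" for x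
  proof (rule AE_eq_continuous[OF zero_less_one fc cont[OF that(1)] _ that(2)])
    show "AE x in lebI 0 1. f x = c 0 + (\<integral>y. weak_deriv (Suc 0) f y \<partial>lebI 0 x)"
      using f0 c[OF that(1)] by eventually_elim (erule (1) trans)
  qed
  have Feq: "F j x = c j + (\<integral>y. weak_deriv (Suc j) f y \<partial>lebI 0 x)" if "j < s" "x \<in> {0..1}" for j x
    using f0'[of x] that by (auto simp: F_def)
  have FAE: "AE x in lebI 0 1. F j x = weak_deriv j f x" if "j \<le> s" for j
  proof (cases "j = 0 \<or> j = s")
    case True
    then show ?thesis using f0 by (auto simp: F_def)
  next
    case False
    then have "j < s" "j \<noteq> 0" using that by auto
    then show ?thesis using c[OF \<open>j < s\<close>] by (auto simp: F_def)
  qed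
  have Fc: "continuous_on {0..1} (F j)" if "j < s" for j
    using cont[OF that] by (rule continuous_on_eq) (use Feq that in auto)
  have Fm: "F j \<in> borel_measurable (lebI 0 1)" if "j \<le> s" for j
  proof (cases "j < s")
    case True
    then show ?thesis by (rule continuous_measurable_lebI[OF Fc])
  next
    case False
    then have "j = s" using that by simp
    then show ?thesis using square_integrable_measurable[OF sq[of s]] continuous_measurable_lebI[OF fc] by (auto simp: F_def)
  qed
  have "sobolev_chain s F"
    unfolding sobolev_chain_def
  proof (intro conjI allI impI Fc)
    fix j assume j: "j \<le> s"
    have "AE y in lebI 0 1. weak_deriv j f y = F j y" using FAE[OF j] by eventually_elim simp
    then show "square_integrable (lebI 0 1) (F j)"
      by (rule square_integrable_cong_AE[OF sq[OF j] Fm[OF j]])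
  next
    fix j x y assume j: "j < s" and xy: "0 \<le> x" "x \<le> y" "y \<le> (1::real)"
    have i: "integrable (lebI 0 1) (weak_deriv (Suc j) f)" by (rule int) (use j in auto)
    have "F j y - F j x = (\<integral>z. weak_deriv (Suc j) f z \<partial>lebI 0 y) - (\<integral>z. weak_deriv (Suc j) f z \<partial>lebI 0 x)"
      using Feq[OF j] xy by simp
    also have "\<dots> = (\<integral>z. weak_deriv (Suc j) f z \<partial>lebI x y)"
      using integral_lebI_combine[OF integrable_lebI_subset[OF i], of 0 y x] xy by simp
    also have "\<dots> = (\<integral>z. F (Suc j) z \<partial>lebI x y)"
    proof (rule integral_cong_AE)
      show "weak_deriv (Suc j) f \<in> borel_measurable (lebI x y)"
        by (rule measurable_lebI_subset[of _ 0 1]) (use i xy in auto)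
      show "F (Suc j) \<in> borel_measurable (lebI x y)"
        by (rule measurable_lebI_subset[OF Fm]) (use j xy in auto)
      have "AE z in lebI x y. F (Suc j) z = weak_deriv (Suc j) f z"
        by (rule AE_lebI_subset[OF FAE]) (use j xy in auto)
      then show "AE z in lebI x y. weak_deriv (Suc j) f z = F (Suc j) z" by eventually_elim simp
    qed
    finally show "F j y - F j x = (\<integral>z. F (Suc j) z \<partial>lebI x y)" .
  qed
  then show ?thesis by (intro that[of F] FAE) (simp_all add: F_def)
qed

text \<open>Sobolev embedding: two values differ by at most the norm of the derivative, and
  averaging over the second point brings in the norm of \<open>F j\<close>.\<close>

lemma sobolev_chain_sup:
  assumes F: "sobolev_chain s F" and j: "j < s" and y: "y \<in> {0..1}"
  shows "\<bar>F j y\<bar> \<le> l2n (lebI 0 1) (F j) + l2n (lebI 0 1) (F (Suc j))"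
proof -
  interpret finite_measure "lebI 0 1" by (rule finite_measure_lebI)
  have m1: "measure (lebI 0 1) {0<..<1} = 1" by (simp add: measure_lebI)
  have sq: "square_integrable (lebI 0 1) (F j)" "square_integrable (lebI 0 1) (F (Suc j))"
    using F j by (auto intro: sobolev_chain_square_integrable)
  have i: "integrable (lebI 0 1) (F (Suc j))" by (rule square_integrable_integrable[OF finite_measure_lebI sq(2)])
  have i0: "integrable (lebI 0 1) (F j)" by (rule square_integrable_integrable[OF finite_measure_lebI sq(1)])
  have d: "\<bar>F j b - F j a\<bar> \<le> l2n (lebI 0 1) (F (Suc j))" if "0 \<le> a" "a \<le> b" "b \<le> 1" for a b
  proof -
    have "\<bar>F j b - F j a\<bar> \<le> (\<integral>z. \<bar>F (Suc j) z\<bar> \<partial>lebI a b)"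
      unfolding sobolev_chain_integral[OF F j that] by (rule integral_abs_bound)
    also have "\<dots> \<le> (\<integral>z. \<bar>F (Suc j) z\<bar> \<partial>lebI 0 1)"
      by (rule integral_lebI_le) (use i that in auto)
    also have "\<dots> \<le> l2n (lebI 0 1) (F (Suc j))"
      using integral_le_l2n[OF finite_measure_lebI sq(2)] m1 by simp
    finally show ?thesis .
  qed
  have pt: "\<bar>F j y\<bar> \<le> \<bar>F j x\<bar> + l2n (lebI 0 1) (F (Suc j))" if "x \<in> {0..1}" for x
    using d[of x y] d[of y x] that y by (cases "x \<le> y") auto
  have "\<bar>F j y\<bar> = (\<integral>x. \<bar>F j y\<bar> \<partial>lebI 0 1)" using m1 by simp
  also have "\<dots> \<le> (\<integral>x. \<bar>F j x\<bar> + l2n (lebI 0 1) (F (Suc j)) \<partial>lebI 0 1)"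
    by (rule integral_mono) (use i0 pt in auto)
  also have "\<dots> = (\<integral>x. \<bar>F j x\<bar> \<partial>lebI 0 1) + l2n (lebI 0 1) (F (Suc j))"
    using i0 m1 by simp
  also have "\<dots> \<le> l2n (lebI 0 1) (F j) + l2n (lebI 0 1) (F (Suc j))"
    using integral_le_l2n[OF finite_measure_lebI sq(1)] m1 by simp
  finally show ?thesis .
qed

lemma sobolev_chain_has_deriv:
  assumes F: "sobolev_chain s F" and j: "Suc j < s" and x: "x \<in> {0..1}"
  shows "(F j has_real_derivative F (Suc j) x) (at x within {0..1})"
proof -
  have c: "continuous_on {0..1} (F (Suc j))" by (rule sobolev_chain_continuous[OF F j])
  have i: "integrable (lebI 0 1) (F (Suc j))" by (rule integrable_continuous_lebI[OF c])
  have "((\<lambda>x. integral {0..x} (F (Suc j))) has_real_derivative F (Suc j) x) (at x within {0..1})"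
    by (rule integral_has_real_derivative[OF c x])
  then have "((\<lambda>x. F j 0 + integral {0..x} (F (Suc j))) has_real_derivative F (Suc j) x) (at x within {0..1})"
    by (auto intro!: derivative_eq_intros)
  then show ?thesis
  proof (rule has_field_derivative_transform_within[of _ _ _ _ 1])
    fix y :: real assume y: "y \<in> {0..1}"
    have "F j y - F j 0 = integral {0..y} (F (Suc j))"
      using sobolev_chain_integral[OF F, of j 0 y] j y
      by (simp add: integral_lebI_eq[OF integrable_lebI_subset[OF i]])
    then show "F j 0 + integral {0..y} (F (Suc j)) = F j y" by simp
  qed (use x in auto)
qed

text \<open>\<open>F 2\<close> is only square integrable, so the first identity integrates by parts
  against its primitive \<open>F 1 x - F 1 0\<close>; the constant drops out because
  \<open>F 1\<close> has mean zero by the boundary values. In the second the integrand is the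
  derivative of a third of the cube of \<open>F 0\<close>.\<close>

lemma sobolev_chain_energy:
  assumes F: "sobolev_chain s F" and s: "2 \<le> s" and bc: "F 0 0 = 0" "F 0 1 = 0"
  shows "(\<integral>y. F 2 y * F 0 y \<partial>lebI 0 1) = - (\<integral>y. (F 1 y)\<^sup>2 \<partial>lebI 0 1)"
    and "(\<integral>y. (F 0 y * F 1 y) * F 0 y \<partial>lebI 0 1) = 0"
proof -
  interpret finite_measure "lebI 0 1" by (rule finite_measure_lebI)
  have "0 < s" "1 < s" using s by auto
  note c = sobolev_chain_continuous[OF F \<open>0 < s\<close>] sobolev_chain_continuous[OF F \<open>1 < s\<close>]
    sobolev_chain_continuous[OF F \<open>1 < s\<close>, simplified]
  have d: "(F 0 has_real_derivative F 1 x) (at x within {0..1})" if "x \<in> {0..1}" for x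
    using sobolev_chain_has_deriv[OF F, of 0 x] s that by simp
  have i2: "integrable (lebI 0 1) (F 2)"
    by (intro square_integrable_integrable finite_measure_lebI sobolev_chain_square_integrable[OF F] s)
  have e: "(\<integral>y. F 2 y \<partial>lebI 0 x) = F 1 x - F 1 0" if "x \<in> {0..1}" for x
    using sobolev_chain_integral[OF F, of 1 0 x] s that by (simp add: numeral_2_eq_2)
  have i11: "integrable (lebI 0 1) (\<lambda>x. (F 1 x)\<^sup>2)" and i1: "integrable (lebI 0 1) (F 1)"
    by (intro integrable_continuous_lebI continuous_intros c)+
  have "(\<integral>x. (\<integral>y. F 2 y \<partial>lebI 0 x) * F 1 x \<partial>lebI 0 1) = (\<integral>y. F 2 y \<partial>lebI 0 1) * F 0 1 - (\<integral>x. F 2 x * F 0 x \<partial>lebI 0 1)"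
    by (rule integral_by_parts_AC[OF zero_less_one i2 d c(2)])
  moreover have "(\<integral>x. (\<integral>y. F 2 y \<partial>lebI 0 x) * F 1 x \<partial>lebI 0 1) = (\<integral>x. (F 1 x)\<^sup>2 - F 1 0 * F 1 x \<partial>lebI 0 1)"
    by (rule Bochner_Integration.integral_cong) (auto simp: e power2_eq_square algebra_simps)
  moreover have "\<dots> = (\<integral>x. (F 1 x)\<^sup>2 \<partial>lebI 0 1) - F 1 0 * (\<integral>x. F 1 x \<partial>lebI 0 1)"
    using i1 i11 by simp
  moreover have "(\<integral>x. F 1 x \<partial>lebI 0 1) = 0"
    using FTC_lebI[OF _ d c(2)] bc by simp
  ultimately show "(\<integral>y. F 2 y * F 0 y \<partial>lebI 0 1) = - (\<integral>y. (F 1 y)\<^sup>2 \<partial>lebI 0 1)"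
    using bc by simp
  have "(\<integral>y. (F 0 y * F 1 y) * F 0 y \<partial>lebI 0 1) = (F 0 1)^3 / 3 - (F 0 0)^3 / 3"
    by (rule FTC_lebI)
       (auto intro!: derivative_eq_intros d continuous_intros c simp: power2_eq_square)
  then show "(\<integral>y. (F 0 y * F 1 y) * F 0 y \<partial>lebI 0 1) = 0" using bc by simp
qed

text \<open>With the derivative moved to \<open>\<phi>\<close>, only values of \<open>F 0\<close>
  remain. For \<open>u\<close> this makes the convective pairing continuous in time without any
  continuity of \<open>u_x\<close> in time.\<close>

lemma sobolev_chain_burgers_flux:
  assumes F: "sobolev_chain s F" and s: "2 \<le> s" and \<phi>: "test_function 0 1 \<phi>"
  shows "(\<integral>y. (F 0 y * F 1 y) * \<phi> y \<partial>lebI 0 1) = - (1/2) * (\<integral>y. (F 0 y)\<^sup>2 * deriv \<phi> y \<partial>lebI 0 1)"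
proof -
  have "0 < s" "1 < s" using s by auto
  note c = sobolev_chain_continuous[OF F \<open>0 < s\<close>] sobolev_chain_continuous[OF F \<open>1 < s\<close>]
    sobolev_chain_continuous[OF F \<open>1 < s\<close>, simplified]
  have d: "(F 0 has_real_derivative F 1 x) (at x within {0..1})" if "x \<in> {0..1}" for x
    using sobolev_chain_has_deriv[OF F, of 0 x] s that by simp
  have d\<phi>: "(\<phi> has_real_derivative deriv \<phi> x) (at x within S)" for x S
    by (rule has_field_derivative_at_within[OF test_function_has_deriv[OF \<phi>]])
  note c\<phi> = test_function_continuous[OF \<phi>] test_function_continuous[OF test_function_deriv[OF \<phi> zero_less_one]]
  have "(\<integral>y. 2 * ((F 0 y * F 1 y) * \<phi> y) + (F 0 y)\<^sup>2 * deriv \<phi> y \<partial>lebI 0 1) = (F 0 1)\<^sup>2 * \<phi> 1 - (F 0 0)\<^sup>2 * \<phi> 0"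
    by (rule FTC_lebI) (auto intro!: derivative_eq_intros d d\<phi> continuous_intros c c\<phi>)
  moreover have "\<phi> 1 = 0" "\<phi> 0 = 0" using test_function_outside[OF \<phi>] by auto
  moreover have "(\<integral>y. 2 * ((F 0 y * F 1 y) * \<phi> y) + (F 0 y)\<^sup>2 * deriv \<phi> y \<partial>lebI 0 1)
      = 2 * (\<integral>y. (F 0 y * F 1 y) * \<phi> y \<partial>lebI 0 1) + (\<integral>y. (F 0 y)\<^sup>2 * deriv \<phi> y \<partial>lebI 0 1)"
    by (subst Bochner_Integration.integral_add)
       (auto intro!: integrable_continuous_lebI continuous_intros c c\<phi>)
  ultimately show ?thesis by simp
qed

section \<open>Pairings with time dependent functions\<close>

abbreviation pair :: "(real \<Rightarrow> real) \<Rightarrow> (real \<Rightarrow> real) \<Rightarrow> real" where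
  "pair f \<psi> \<equiv> (\<integral>y. f y * \<psi> y \<partial>lebI 0 1)"

lemma pair_diff:
  assumes "square_integrable (lebI 0 1) f" "square_integrable (lebI 0 1) g" "square_integrable (lebI 0 1) \<psi>"
  shows "pair (\<lambda>y. f y - g y) \<psi> = pair f \<psi> - pair g \<psi>"
  using square_integrable_mult[OF assms(1,3)] square_integrable_mult[OF assms(2,3)]
  by (simp add: left_diff_distrib)

lemma pair_sobolev_bound:
  assumes "f \<in> sobolev s" "square_integrable (lebI 0 1) \<psi>"
  shows "\<bar>pair f \<psi>\<bar> \<le> sobolev_norm s f * l2n (lebI 0 1) \<psi>"
  by (rule order_trans[OF Cauchy_Schwarz_l2[OF sobolev_square_integrable[OF assms(1)] assms(2)]])
     (intro mult_right_mono l2n_le_sobolev_norm assms l2n_nonneg)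

text \<open>\<open>G\<close> is arbitrary: with finitely many values and measurable level sets, any
  functional of \<open>S t\<close> is a simple function of time. The uses are pairings and
  norms.\<close>

lemma sob_simple_integrable:
  fixes G :: "(real \<Rightarrow> real) \<Rightarrow> real"
  assumes S: "sob_simple s T S"
  shows "integrable (lebI 0 T) (\<lambda>t. G (S t))"
    and "(\<integral>t. G (S t) \<partial>lebI 0 T) = (\<Sum>f\<in>S ` {0<..<T}. measure lebesgue {t \<in> {0<..<T}. S t = f} * G f)"
proof -
  interpret finite_measure "lebI 0 T" by (rule finite_measure_lebI)
  define A where "A f = {t \<in> {0<..<T}. S t = f}" for f
  have fin: "finite (S ` {0<..<T})" using S by (simp add: sob_simple_def)
  have A: "A f \<in> sets lebesgue" for f using S by (auto simp: sob_simple_def A_def)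
  have A': "A f \<in> sets (lebI 0 T)" for f using A[of f] by (auto simp: sets_restrict_space_iff A_def)
  have eq: "G (S t) = (\<Sum>f\<in>S ` {0<..<T}. indicator (A f) t * G f)" if "t \<in> {0<..<T}" for t
  proof -
    have "(\<Sum>f\<in>S ` {0<..<T}. indicator (A f) t * G f) = (\<Sum>f\<in>S ` {0<..<T}. if f = S t then G f else 0)"
      by (rule sum.cong) (use that in \<open>auto simp: A_def indicator_def\<close>)
    then show ?thesis using fin that by (simp add: sum.delta)
  qed
  have i: "integrable (lebI 0 T) (\<lambda>t. indicator (A f) t * G f)" for f
    using A' by (auto intro!: integrable_mult_left integrable_real_indicator simp: emeasure_finite less_top[symmetric])
  have iS: "integrable (lebI 0 T) (\<lambda>t. \<Sum>f\<in>S ` {0<..<T}. indicator (A f) t * G f)"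
    by (intro Bochner_Integration.integrable_sum i)
  show "integrable (lebI 0 T) (\<lambda>t. G (S t))"
    by (rule Bochner_Integration.integrable_cong[THEN iffD1, OF refl _ iS]) (use eq in auto)
  have m: "(\<integral>t. indicator (A f) t * G f \<partial>lebI 0 T) = measure lebesgue (A f) * G f" for f
  proof -
    have "measure (lebI 0 T) (A f) = measure lebesgue (A f)"
      by (rule measure_restrict_space) (auto simp: A_def)
    moreover have "A f \<inter> {0<..<T} = A f" by (auto simp: A_def)
    ultimately show ?thesis using A' by simp
  qed
  have "(\<integral>t. G (S t) \<partial>lebI 0 T) = (\<integral>t. (\<Sum>f\<in>S ` {0<..<T}. indicator (A f) t * G f) \<partial>lebI 0 T)"
    by (rule Bochner_Integration.integral_cong) (use eq in auto)
  also have "\<dots> = (\<Sum>f\<in>S ` {0<..<T}. measure lebesgue (A f) * G f)"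
    by (subst Bochner_Integration.integral_sum[OF i]) (simp only: m)
  finally show "(\<integral>t. G (S t) \<partial>lebI 0 T) = (\<Sum>f\<in>S ` {0<..<T}. measure lebesgue {t \<in> {0<..<T}. S t = f} * G f)"
    by (simp add: A_def)
qed

lemma sob_simple_sobolev: "sob_simple s T S \<Longrightarrow> t \<in> {0<..<T} \<Longrightarrow> S t \<in> sobolev s"
  by (auto simp: sob_simple_def)

lemma sob_simple_integral_sobolev: "sob_simple s T S \<Longrightarrow> sob_simple_integral T S \<in> sobolev s"
  unfolding sob_simple_integral_def
  by (intro sobolev_sum sobolev_scale) (auto simp: sob_simple_def)

lemma pair_sob_simple_integral:
  assumes S: "sob_simple s T S" and \<psi>: "square_integrable (lebI 0 1) \<psi>"
  shows "pair (sob_simple_integral T S) \<psi> = (\<integral>t. pair (S t) \<psi> \<partial>lebI 0 T)"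
proof -
  have "pair (sob_simple_integral T S) \<psi>
      = (\<integral>y. (\<Sum>f\<in>S ` {0<..<T}. measure lebesgue {t \<in> {0<..<T}. S t = f} * (f y * \<psi> y)) \<partial>lebI 0 1)"
    by (simp add: sob_simple_integral_def sum_distrib_right mult.assoc)
  also have "\<dots> = (\<Sum>f\<in>S ` {0<..<T}. measure lebesgue {t \<in> {0<..<T}. S t = f} * pair f \<psi>)"
    by (subst Bochner_Integration.integral_sum)
       (auto intro!: integrable_mult_right square_integrable_mult[OF _ \<psi>] sobolev_square_integrable[of _ s]
         sob_simple_sobolev[OF S])
  also have "\<dots> = (\<integral>t. pair (S t) \<psi> \<partial>lebI 0 T)" using sob_simple_integrable(2)[OF S, where G="\<lambda>f. pair f \<psi>"] by simp
  finally show ?thesis .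
qed

text \<open>The pointwise \<open>lim\<close> is measurable, and by completeness of Lebesgue measure
  it may be changed on a null set; extension by zero moves the question to the whole line.\<close>

lemma measurable_AE_limit:
  fixes h :: "nat \<Rightarrow> real \<Rightarrow> real"
  assumes h: "\<And>n. h n \<in> borel_measurable (lebI a b)"
    and lim: "AE t in lebI a b. (\<lambda>n. h n t) \<longlonglongrightarrow> f t"
  shows "f \<in> borel_measurable (lebI a b)"
proof -
  have l: "(\<lambda>t. lim (\<lambda>n. h n t)) \<in> borel_measurable (lebI a b)" using h by measurable
  have "(\<lambda>t. if t \<in> {a<..<b} then lim (\<lambda>n. h n t) else 0) \<in> borel_measurable lebesgue"
    by (rule borel_measurable_if[THEN iffD2, OF _ l]) simp
  moreover have "AE t in lebesgue. (if t \<in> {a<..<b} then lim (\<lambda>n. h n t) else 0) = (if t \<in> {a<..<b} then f t else 0)"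
    using lim unfolding AE_lebI_iff by eventually_elim (auto intro: limI)
  ultimately have "(\<lambda>t. if t \<in> {a<..<b} then f t else 0) \<in> borel_measurable lebesgue"
    by (rule borel_measurable_AE)
  then show ?thesis by (rule borel_measurable_if[THEN iffD1, rotated]) simp
qed

lemma sob_strongly_measurable_sobolev:
  "sob_strongly_measurable s T v \<Longrightarrow> AE t in lebI 0 T. v t \<in> sobolev s"
  unfolding sob_strongly_measurable_def AE_lebI_iff by (auto elim: AE_mp)

lemma sob_strongly_measurable_pair:
  assumes v: "sob_strongly_measurable s T v" and \<psi>: "square_integrable (lebI 0 1) \<psi>"
  shows "(\<lambda>t. pair (v t) \<psi>) \<in> borel_measurable (lebI 0 T)"
    and "(\<lambda>t. l2n (lebI 0 1) (v t)) \<in> borel_measurable (lebI 0 T)"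
proof -
  obtain S where S: "\<And>n. sob_simple s T (S n)"
    and AE: "AE t in lebesgue. t \<in> {0<..<T} \<longrightarrow> v t \<in> sobolev s \<and> (\<lambda>n. sobolev_norm s (\<lambda>y. v t y - S n t y)) \<longlonglongrightarrow> 0"
    using v unfolding sob_strongly_measurable_def by blast
  have AE': "AE t in lebI 0 T. t \<in> {0<..<T} \<and> v t \<in> sobolev s \<and> (\<lambda>n. sobolev_norm s (\<lambda>y. v t y - S n t y)) \<longlonglongrightarrow> 0"
    unfolding AE_lebI_iff using AE by eventually_elim auto
  show "(\<lambda>t. pair (v t) \<psi>) \<in> borel_measurable (lebI 0 T)"
  proof (rule measurable_AE_limit[where h="\<lambda>n t. pair (S n t) \<psi>"])
    show "(\<lambda>t. pair (S n t) \<psi>) \<in> borel_measurable (lebI 0 T)" for n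
      by (rule borel_measurable_integrable[OF sob_simple_integrable(1)[OF S, where G="\<lambda>f. pair f \<psi>"]])
    show "AE t in lebI 0 T. (\<lambda>n. pair (S n t) \<psi>) \<longlonglongrightarrow> pair (v t) \<psi>"
      using AE'
    proof eventually_elim
      case (elim t)
      then have sob: "v t \<in> sobolev s" "\<And>n. S n t \<in> sobolev s" using sob_simple_sobolev[OF S] by auto
      have "(\<lambda>n. pair (v t) \<psi> - pair (S n t) \<psi>) \<longlonglongrightarrow> 0"
      proof (rule Lim_null_comparison)
        show "\<forall>\<^sub>F n in sequentially. norm (pair (v t) \<psi> - pair (S n t) \<psi>)
            \<le> sobolev_norm s (\<lambda>y. v t y - S n t y) * l2n (lebI 0 1) \<psi>"
          using pair_sobolev_bound[OF sobolev_diff[OF sob] \<psi>]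
            pair_diff[OF sob[THEN sobolev_square_integrable] \<psi>] by simp
        show "(\<lambda>n. sobolev_norm s (\<lambda>y. v t y - S n t y) * l2n (lebI 0 1) \<psi>) \<longlonglongrightarrow> 0"
          using elim by (intro tendsto_mult_left_zero) auto
      qed
      then have "(\<lambda>n. pair (v t) \<psi> - (pair (v t) \<psi> - pair (S n t) \<psi>)) \<longlonglongrightarrow> pair (v t) \<psi> - 0"
        by (intro tendsto_intros)
      then show ?case by simp
    qed
  qed
  show "(\<lambda>t. l2n (lebI 0 1) (v t)) \<in> borel_measurable (lebI 0 T)"
  proof (rule measurable_AE_limit[where h="\<lambda>n t. l2n (lebI 0 1) (S n t)"])
    show "(\<lambda>t. l2n (lebI 0 1) (S n t)) \<in> borel_measurable (lebI 0 T)" for n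
      by (rule borel_measurable_integrable[OF sob_simple_integrable(1)[OF S, where G="\<lambda>f. l2n (lebI 0 1) f"]])
    show "AE t in lebI 0 T. (\<lambda>n. l2n (lebI 0 1) (S n t)) \<longlonglongrightarrow> l2n (lebI 0 1) (v t)"
      using AE'
    proof eventually_elim
      case (elim t)
      then have sob: "v t \<in> sobolev s" "\<And>n. S n t \<in> sobolev s" using sob_simple_sobolev[OF S] by auto
      have "(\<lambda>n. l2n (lebI 0 1) (v t) - l2n (lebI 0 1) (S n t)) \<longlonglongrightarrow> 0"
      proof (rule Lim_null_comparison)
        show "\<forall>\<^sub>F n in sequentially. norm (l2n (lebI 0 1) (v t) - l2n (lebI 0 1) (S n t))
            \<le> sobolev_norm s (\<lambda>y. v t y - S n t y)"
          using order_trans[OF l2n_abs_diff[OF sob[THEN sobolev_square_integrable]] l2n_le_sobolev_norm[OF sobolev_diff[OF sob]]]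
          by simp
        show "(\<lambda>n. sobolev_norm s (\<lambda>y. v t y - S n t y)) \<longlonglongrightarrow> 0" using elim by auto
      qed
      then have "(\<lambda>n. l2n (lebI 0 1) (v t) - (l2n (lebI 0 1) (v t) - l2n (lebI 0 1) (S n t))) \<longlonglongrightarrow> l2n (lebI 0 1) (v t) - 0"
        by (intro tendsto_intros)
      then show ?case by simp
    qed
  qed
qed

text \<open>Reduces integrals with values in \<open>H^s\<close> to scalar ones: for
  \<open>\<psi>\<close> of norm at most 1 a pairing is dominated by the Sobolev norm, so
  approximation by simple functions becomes \<open>L1\<close> convergence in time. The normalization
  avoids a factor in a nonnegative integral whose integrand has not been shown measurable; rescaling
  removes it afterwards.\<close>

lemma has_sob_integral_pair_aux:
  assumes B: "has_sob_integral s T v B" and \<psi>: "square_integrable (lebI 0 1) \<psi>" and le1: "l2n (lebI 0 1) \<psi> \<le> 1"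
  shows "integrable (lebI 0 T) (\<lambda>t. pair (v t) \<psi>) \<and> (\<integral>t. pair (v t) \<psi> \<partial>lebI 0 T) = pair B \<psi>"
proof -
  have sm: "sob_strongly_measurable s T v" and Bs: "B \<in> sobolev s"
    using B by (auto simp: has_sob_integral_def)
  obtain S where S: "\<And>n. sob_simple s T (S n)"
    and L: "(\<lambda>n. \<integral>\<^sup>+t\<in>{0<..<T}. ennreal (sobolev_norm s (\<lambda>y. v t y - S n t y)) \<partial>lebesgue) \<longlonglongrightarrow> 0"
    and BL: "(\<lambda>n. sobolev_norm s (\<lambda>y. B y - sob_simple_integral T (S n) y)) \<longlonglongrightarrow> 0"
    using B unfolding has_sob_integral_def by blast
  note [measurable] = sob_strongly_measurable_pair(1)[OF sm \<psi>]
  have Si: "integrable (lebI 0 T) (\<lambda>t. pair (S n t) \<psi>)" for n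
    by (rule sob_simple_integrable(1)[OF S, where G="\<lambda>f. pair f \<psi>"])
  have le: "(\<integral>\<^sup>+t. norm (pair (S n t) \<psi> - pair (v t) \<psi>) \<partial>lebI 0 T)
      \<le> (\<integral>\<^sup>+t\<in>{0<..<T}. ennreal (sobolev_norm s (\<lambda>y. v t y - S n t y)) \<partial>lebesgue)" for n
  proof -
    have "(\<integral>\<^sup>+t. norm (pair (S n t) \<psi> - pair (v t) \<psi>) \<partial>lebI 0 T)
        = (\<integral>\<^sup>+t. ennreal (norm (pair (S n t) \<psi> - pair (v t) \<psi>)) * indicator {0<..<T} t \<partial>lebesgue)"
      by (rule nn_integral_restrict_space) simp
    also have "\<dots> \<le> (\<integral>\<^sup>+t\<in>{0<..<T}. ennreal (sobolev_norm s (\<lambda>y. v t y - S n t y)) \<partial>lebesgue)"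
    proof (rule nn_integral_mono_AE)
      show "AE t in lebesgue. ennreal (norm (pair (S n t) \<psi> - pair (v t) \<psi>)) * indicator {0<..<T} t
          \<le> ennreal (sobolev_norm s (\<lambda>y. v t y - S n t y)) * indicator {0<..<T} t"
        using sob_strongly_measurable_sobolev[OF sm] unfolding AE_lebI_iff
      proof eventually_elim
        case (elim t)
        show ?case
        proof (cases "t \<in> {0<..<T}")
          case True
          then have sob: "v t \<in> sobolev s" "S n t \<in> sobolev s" using elim sob_simple_sobolev[OF S] by auto
          have "norm (pair (S n t) \<psi> - pair (v t) \<psi>) = \<bar>pair (\<lambda>y. v t y - S n t y) \<psi>\<bar>"
            using pair_diff[OF sob[THEN sobolev_square_integrable] \<psi>] by simp
          also have "\<dots> \<le> sobolev_norm s (\<lambda>y. v t y - S n t y) * l2n (lebI 0 1) \<psi>"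
            by (rule pair_sobolev_bound[OF sobolev_diff[OF sob] \<psi>])
          also have "\<dots> \<le> sobolev_norm s (\<lambda>y. v t y - S n t y) * 1"
            by (intro mult_left_mono le1) simp
          finally show ?thesis by (intro mult_right_mono ennreal_leI) auto
        qed simp
      qed
    qed
    finally show ?thesis .
  qed
  have L1: "(\<lambda>n. \<integral>\<^sup>+t. norm (pair (S n t) \<psi> - pair (v t) \<psi>) \<partial>lebI 0 T) \<longlonglongrightarrow> 0"
    by (rule tendsto_sandwich[OF always_eventually always_eventually tendsto_const L]) (intro allI zero_le le)+
  have "\<forall>\<^sub>F n in sequentially. (\<integral>\<^sup>+t. norm (pair (S n t) \<psi> - pair (v t) \<psi>) \<partial>lebI 0 T) < 1"
    using order_tendstoD(2)[OF L1, of 1] by simp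
  then obtain n where n: "(\<integral>\<^sup>+t. norm (pair (S n t) \<psi> - pair (v t) \<psi>) \<partial>lebI 0 T) < 1"
    using eventually_happens'[OF sequentially_bot] by blast
  \<comment> \<open>A single approximant at finite distance already makes the pairing
    integrable.\<close>
  have "integrable (lebI 0 T) (\<lambda>t. pair (S n t) \<psi> - pair (v t) \<psi>)"
  proof (rule integrableI_bounded)
    show "(\<lambda>t. pair (S n t) \<psi> - pair (v t) \<psi>) \<in> borel_measurable (lebI 0 T)"
      using borel_measurable_integrable[OF Si[of n]] by measurable
    show "(\<integral>\<^sup>+t. ennreal (norm (pair (S n t) \<psi> - pair (v t) \<psi>)) \<partial>lebI 0 T) < \<infinity>"
      using n less_trans[OF _ ennreal_one_less_top] by simp
  qed
  from Bochner_Integration.integrable_diff[OF Si[of n] this]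
  have i: "integrable (lebI 0 T) (\<lambda>t. pair (v t) \<psi>)" by simp
  have lim1: "(\<lambda>n. \<integral>t. pair (S n t) \<psi> \<partial>lebI 0 T) \<longlonglongrightarrow> (\<integral>t. pair (v t) \<psi> \<partial>lebI 0 T)"
    by (rule tendsto_L1_int[OF Si i L1])
  have "(\<lambda>n. pair B \<psi> - pair (sob_simple_integral T (S n)) \<psi>) \<longlonglongrightarrow> 0"
  proof (rule Lim_null_comparison[OF always_eventually BL], rule allI)
    fix n
    note I = sob_simple_integral_sobolev[OF S, of n]
    have "norm (pair B \<psi> - pair (sob_simple_integral T (S n)) \<psi>) = \<bar>pair (\<lambda>y. B y - sob_simple_integral T (S n) y) \<psi>\<bar>"
      using pair_diff[OF sobolev_square_integrable[OF Bs] sobolev_square_integrable[OF I] \<psi>] by simp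
    also have "\<dots> \<le> sobolev_norm s (\<lambda>y. B y - sob_simple_integral T (S n) y) * l2n (lebI 0 1) \<psi>"
      by (rule pair_sobolev_bound[OF sobolev_diff[OF Bs I] \<psi>])
    also have "\<dots> \<le> sobolev_norm s (\<lambda>y. B y - sob_simple_integral T (S n) y) * 1"
      by (intro mult_left_mono le1) simp
    finally show "norm (pair B \<psi> - pair (sob_simple_integral T (S n)) \<psi>)
        \<le> sobolev_norm s (\<lambda>y. B y - sob_simple_integral T (S n) y)" by simp
  qed
  then have "(\<lambda>n. pair B \<psi> - (\<integral>t. pair (S n t) \<psi> \<partial>lebI 0 T)) \<longlonglongrightarrow> 0"
    by (simp add: pair_sob_simple_integral[OF S \<psi>])
  moreover have "(\<lambda>n. pair B \<psi> - (\<integral>t. pair (S n t) \<psi> \<partial>lebI 0 T)) \<longlonglongrightarrow> pair B \<psi> - (\<integral>t. pair (v t) \<psi> \<partial>lebI 0 T)"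
    by (intro tendsto_intros lim1)
  ultimately have "0 = pair B \<psi> - (\<integral>t. pair (v t) \<psi> \<partial>lebI 0 T)" by (rule LIMSEQ_unique)
  with i show ?thesis by simp
qed

lemma has_sob_integral_pair:
  assumes B: "has_sob_integral s T v B" and \<psi>: "square_integrable (lebI 0 1) \<psi>"
  shows "(\<integral>t. pair (v t) \<psi> \<partial>lebI 0 T) = pair B \<psi>"
proof -
  \<comment> \<open>The \<open>+ 1\<close> makes \<open>c\<close> positive even when
    \<open>\<psi>\<close> has norm zero.\<close>
  define c where "c = l2n (lebI 0 1) \<psi> + 1"
  have c: "c > 0" by (simp add: c_def add_nonneg_pos)
  have "(\<integral>t. pair (v t) (\<lambda>y. (1 / c) * \<psi> y) \<partial>lebI 0 T) = pair B (\<lambda>y. (1 / c) * \<psi> y)"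
  proof (rule has_sob_integral_pair_aux[OF B square_integrable_scale[OF \<psi>], THEN conjunct2])
    show "l2n (lebI 0 1) (\<lambda>y. (1 / c) * \<psi> y) \<le> 1"
      unfolding l2n_scale using c by (simp add: c_def field_simps)
  qed
  moreover have "pair f (\<lambda>y. (1 / c) * \<psi> y) = (1 / c) * pair f \<psi>" for f
    by (subst mult.left_commute) (rule integral_mult_right_zero)
  ultimately show ?thesis using c by simp
qed

text \<open>Both vector integrals share the value \<open>B\<close>, so pairing with any square
  integrable \<open>\<psi>\<close> turns the weak time derivative into a scalar one.\<close>

lemma is_time_deriv_pair:
  assumes d: "is_time_deriv s T j v w" and \<psi>: "square_integrable (lebI 0 1) \<psi>" and \<phi>: "test_function 0 T \<phi>"
  shows "(\<integral>t. (deriv ^^ j) \<phi> t * pair (v t) \<psi> \<partial>lebI 0 T) = (-1) ^ j * (\<integral>t. \<phi> t * pair (w t) \<psi> \<partial>lebI 0 T)"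
proof -
  obtain B where B1: "has_sob_integral s T (\<lambda>t y. (deriv ^^ j) \<phi> t * v t y) B"
    and B2: "has_sob_integral s T (\<lambda>t y. (-1) ^ j * (\<phi> t * w t y)) B"
    using d \<phi> unfolding is_time_deriv_def by blast
  have "(\<integral>t. (deriv ^^ j) \<phi> t * pair (v t) \<psi> \<partial>lebI 0 T) = pair B \<psi>"
    using has_sob_integral_pair[OF B1 \<psi>] by (simp add: mult.assoc)
  moreover have "(\<integral>t. (-1) ^ j * (\<phi> t * pair (w t) \<psi>) \<partial>lebI 0 T) = pair B \<psi>"
    using has_sob_integral_pair[OF B2 \<psi>] by (simp add: mult.assoc)
  ultimately show ?thesis by simp
qed

lemma L2_time_norm:
  assumes v: "L2_time s T v"
  shows "square_integrable (lebI 0 T) (\<lambda>t. sobolev_norm s (v t))"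
    and "square_integrable (lebI 0 T) (\<lambda>t. l2n (lebI 0 1) (v t))"
    and "square_integrable (lebI 0 1) \<psi> \<Longrightarrow> integrable (lebI 0 T) (\<lambda>t. pair (v t) \<psi>)"
    and "AE t in lebI 0 T. v t \<in> sobolev s"
proof -
  have sm: "sob_strongly_measurable s T v" using v by (simp add: L2_time_def)
  have i: "integrable (lebI 0 T) (\<lambda>t. (sobolev_norm s (v t))\<^sup>2)"
    using v by (simp add: L2_time_def set_integrable_lebesgue_on)
  have "(\<lambda>t. sqrt ((sobolev_norm s (v t))\<^sup>2)) \<in> borel_measurable (lebI 0 T)"
    using borel_measurable_integrable[OF i] by measurable
  then show sq: "square_integrable (lebI 0 T) (\<lambda>t. sobolev_norm s (v t))"
    using i by (simp add: square_integrable_def)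
  show AE: "AE t in lebI 0 T. v t \<in> sobolev s" by (rule sob_strongly_measurable_sobolev[OF sm])
  show "square_integrable (lebI 0 T) (\<lambda>t. l2n (lebI 0 1) (v t))"
  proof (rule l2n_mono(2)[OF _ sq])
    show "(\<lambda>t. l2n (lebI 0 1) (v t)) \<in> borel_measurable (lebI 0 T)"
      by (rule sob_strongly_measurable_pair(2)[OF sm square_integrable_zero])
    show "AE t in lebI 0 T. \<bar>l2n (lebI 0 1) (v t)\<bar> \<le> \<bar>sobolev_norm s (v t)\<bar>"
      using AE by eventually_elim (simp add: l2n_le_sobolev_norm)
  qed
  show "integrable (lebI 0 T) (\<lambda>t. pair (v t) \<psi>)" if \<psi>: "square_integrable (lebI 0 1) \<psi>"
  proof (rule Bochner_Integration.integrable_bound)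
    show "integrable (lebI 0 T) (\<lambda>t. sobolev_norm s (v t) * l2n (lebI 0 1) \<psi>)"
      by (intro integrable_mult_left square_integrable_integrable[OF finite_measure_lebI] sq)
    show "(\<lambda>t. pair (v t) \<psi>) \<in> borel_measurable (lebI 0 T)"
      by (rule sob_strongly_measurable_pair(1)[OF sm \<psi>])
    show "AE t in lebI 0 T. norm (pair (v t) \<psi>) \<le> norm (sobolev_norm s (v t) * l2n (lebI 0 1) \<psi>)"
      using AE by eventually_elim (use pair_sobolev_bound[OF _ \<psi>] in \<open>simp add: abs_mult\<close>)
  qed
qed

lemma AE_lebI_exists:
  assumes "a < b" "AE t in lebI a b. P t"
  shows "\<exists>t\<in>{a<..<b}. P t"
proof (rule ccontr)
  assume "\<not> ?thesis"
  then have "AE t in lebI a b. False" using assms(2) by (auto simp: AE_lebI_iff elim!: AE_mp)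
  then have "emeasure (lebI a b) (space (lebI a b)) = 0"
    by (simp only: eventually_False ae_filter_eq_bot_iff)
  then have "measure (lebI a b) {a<..<b} = 0" by (simp add: measure_def)
  then show False using measure_lebI[of a b] assms(1) by simp
qed

text \<open>A set of full measure is dense, also at the two end points, so limits along good times
  reach every time of the closed interval.\<close>

lemma AE_lebI_sequence:
  assumes ab: "a < b" and P: "AE t in lebI a b. P t" and t: "t \<in> {a..b}"
  obtains r where "\<And>m::nat. r m \<in> {a<..<b}" "\<And>m. P (r m)" "r \<longlonglongrightarrow> t"
proof -
  have "\<exists>x. x \<in> {a<..<b} \<and> P x \<and> \<bar>x - t\<bar> \<le> inverse (real (Suc m))" for m :: nat
  proof -
    define e where "e = inverse (real (Suc m))"
    define c d where "c = max a (t - e)" and "d = min b (t + e)"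
    have pos: "e > 0" by (simp add: e_def)
    have "c < d" "a \<le> c" "d \<le> b" using t ab pos unfolding c_def d_def by auto
    then obtain x where "x \<in> {c<..<d}" "P x"
      using AE_lebI_exists[OF _ AE_lebI_subset[OF P]] by blast
    then show ?thesis unfolding e_def[symmetric] by (intro exI[of _ x]) (auto simp: c_def d_def abs_le_iff)
  qed
  then obtain r where r: "\<And>m. r m \<in> {a<..<b}" "\<And>m. P (r m)" "\<And>m. \<bar>r m - t\<bar> \<le> inverse (real (Suc m))" by metis
  have "(\<lambda>m. r m - t) \<longlonglongrightarrow> 0"
    by (rule Lim_null_comparison[OF always_eventually LIMSEQ_inverse_real_of_nat]) (use r(3) in simp)
  then have "r \<longlonglongrightarrow> t" by (simp add: LIM_zero_iff)
  with r show ?thesis using that by blast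
qed

text \<open>Joint continuity bounds \<open>q\<close> on the compact rectangle, and dominated
  convergence then asks only for integrability of \<open>\<psi>\<close>.\<close>

lemma continuous_on_pair:
  fixes q :: "real \<Rightarrow> real \<Rightarrow> real"
  assumes q: "continuous_on ({0..T} \<times> {0..1}) (\<lambda>(t, y). q t y)" and \<psi>: "integrable (lebI 0 1) \<psi>"
  shows "continuous_on {0..T} (\<lambda>t. pair (q t) \<psi>)"
proof -
  have qy: "continuous_on {0..1} (q t)" if "t \<in> {0..T}" for t
  proof -
    have "continuous_on {0..1} ((\<lambda>(t, y). q t y) \<circ> (\<lambda>y. (t, y)))"
      by (rule continuous_on_compose) (use that in \<open>auto intro!: continuous_intros continuous_on_subset[OF q]\<close>)
    then show ?thesis by (simp add: o_def)
  qed
  have qt: "continuous_on {0..T} (\<lambda>t. q t y)" if "y \<in> {0..1}" for y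
  proof -
    have "continuous_on {0..T} ((\<lambda>(t, y). q t y) \<circ> (\<lambda>t. (t, y)))"
      by (rule continuous_on_compose) (use that in \<open>auto intro!: continuous_intros continuous_on_subset[OF q]\<close>)
    then show ?thesis by (simp add: o_def)
  qed
  have "bounded ((\<lambda>(t, y). q t y) ` ({0..T} \<times> {0..1}))"
    by (intro compact_imp_bounded compact_continuous_image q compact_Times) auto
  then obtain B where "\<forall>x\<in>(\<lambda>(t, y). q t y) ` ({0..T} \<times> {0..1}). norm x \<le> B" unfolding bounded_iff by blast
  then have B: "\<bar>q t y\<bar> \<le> B" if "t \<in> {0..T}" "y \<in> {0..1}" for t y using that by force
  have [measurable]: "\<psi> \<in> borel_measurable (lebI 0 1)" using \<psi> by simp
  show ?thesis
    unfolding continuous_on_sequentially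
  proof (intro allI ballI impI, elim conjE)
    fix x :: "nat \<Rightarrow> real" and a
    assume a: "a \<in> {0..T}" and x: "\<forall>n. x n \<in> {0..T}" and lim: "x \<longlonglongrightarrow> a"
    have [measurable]: "q a \<in> borel_measurable (lebI 0 1)" "q (x n) \<in> borel_measurable (lebI 0 1)" for n
      using a x by (auto intro: continuous_measurable_lebI[OF qy])
    have "(\<lambda>n. pair (q (x n)) \<psi>) \<longlonglongrightarrow> pair (q a) \<psi>"
    proof (rule integral_dominated_convergence[where w="\<lambda>y. B * \<bar>\<psi> y\<bar>"])
      show "integrable (lebI 0 1) (\<lambda>y. B * \<bar>\<psi> y\<bar>)" using \<psi> by simp
      show "AE y in lebI 0 1. (\<lambda>n. q (x n) y * \<psi> y) \<longlonglongrightarrow> q a y * \<psi> y"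
      proof (intro AE_I2 tendsto_intros)
        fix y assume "y \<in> space (lebI 0 1)"
        then show "(\<lambda>n. q (x n) y) \<longlonglongrightarrow> q a y"
          using qt[of y] a x lim unfolding continuous_on_sequentially by (auto simp: o_def)
      qed
      show "AE y in lebI 0 1. norm (q (x n) y * \<psi> y) \<le> B * \<bar>\<psi> y\<bar>" for n
        by (rule AE_I2) (use x B in \<open>auto simp: abs_mult intro!: mult_right_mono\<close>)
    qed measurable
    then show "((\<lambda>t. pair (q t) \<psi>) \<circ> x) \<longlonglongrightarrow> pair (q a) \<psi>" by (simp add: o_def)
  qed
qed

section \<open>Regularity of the Burgers solution\<close>

locale burgers_regular =
  fixes s :: nat and T \<nu> :: real and g :: "real \<Rightarrow> real" and u :: "real \<Rightarrow> real \<Rightarrow> real"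
  assumes T: "T > 0" and nu: "\<nu> > 0" and s: "2 \<le> s" and sol: "burgers_solution s T \<nu> g u"
begin

definition "u_t = time_deriv s T 1 u"
definition "u_tt = time_deriv s T 2 u"

lemma time_derivs:
  "is_time_deriv s T 0 u (time_deriv s T 0 u)" "is_time_deriv s T 1 u u_t" "is_time_deriv s T 2 u u_tt"
proof -
  have ex: "\<exists>w. is_time_deriv s T j u w" if "j \<le> 2" for j
    using sol that by (auto simp: burgers_solution_def sobolev_time_def)
  have "is_time_deriv s T j u (time_deriv s T j u)" if "j \<le> 2" for j
    unfolding time_deriv_def using ex[OF that] by (rule someI_ex[of "is_time_deriv s T j u"])
  then show "is_time_deriv s T 0 u (time_deriv s T 0 u)" "is_time_deriv s T 1 u u_t" "is_time_deriv s T 2 u u_tt"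
    by (simp_all add: u_t_def u_tt_def)
qed

lemma L2_time: "L2_time s T u" "L2_time s T u_t" "L2_time s T u_tt"
  using time_derivs by (auto simp: is_time_deriv_def)

lemma continuous_u: "continuous_on ({0..T} \<times> {0..1}) (\<lambda>(t, y). u t y)"
  using sol by (simp add: burgers_solution_def)

lemma continuous_u_space: "t \<in> {0..T} \<Longrightarrow> continuous_on {0..1} (u t)"
proof -
  assume t: "t \<in> {0..T}"
  have "continuous_on {0..1} ((\<lambda>(t, y). u t y) \<circ> (\<lambda>y. (t, y)))"
    by (rule continuous_on_compose) (use t in \<open>auto intro!: continuous_intros continuous_on_subset[OF continuous_u]\<close>)
  then show ?thesis by (simp add: o_def)
qed

lemma square_integrable_u: "t \<in> {0..T} \<Longrightarrow> square_integrable (lebI 0 1) (u t)"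
  by (rule square_integrable_continuous[OF continuous_u_space])

lemma pair_u_diff:
  assumes \<psi>: "square_integrable (lebI 0 1) \<psi>" and rt: "0 \<le> r" "r \<le> t" "t \<le> T"
  shows "pair (u t) \<psi> - pair (u r) \<psi> = (\<integral>\<sigma>. pair (u_t \<sigma>) \<psi> \<partial>lebI r t)"
proof (rule du_Bois_Reymond_continuous[OF T _ _ _ rt])
  show "continuous_on {0..T} (\<lambda>t. pair (u t) \<psi>)"
    by (rule continuous_on_pair[OF continuous_u square_integrable_integrable[OF finite_measure_lebI \<psi>]])
  show "integrable (lebI 0 T) (\<lambda>\<sigma>. pair (u_t \<sigma>) \<psi>)" by (rule L2_time_norm(3)[OF L2_time(2) \<psi>])
  fix \<phi> assume \<phi>: "test_function 0 T \<phi>"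
  show "(\<integral>x. pair (u x) \<psi> * deriv \<phi> x \<partial>lebI 0 T) = - (\<integral>x. pair (u_t x) \<psi> * \<phi> x \<partial>lebI 0 T)"
    using is_time_deriv_pair[OF time_derivs(2) \<psi> \<phi>] by (simp add: mult.commute)
qed

text \<open>A scalar clock whose increments dominate those of \<open>u\<close> in all weak
  derivatives up to order \<open>s\<close>.\<close>

definition "speed_integral t = (\<integral>\<sigma>. sobolev_norm s (u_t \<sigma>) \<partial>lebI 0 t)"

lemma integrable_speed: "integrable (lebI 0 T) (\<lambda>\<sigma>. sobolev_norm s (u_t \<sigma>))"
  by (rule square_integrable_integrable[OF finite_measure_lebI L2_time_norm(1)[OF L2_time(2)]])

lemma speed_integral_continuous: "continuous_on {0..T} speed_integral"
  unfolding speed_integral_def[abs_def] by (rule indefinite_integral_continuous[OF integrable_speed])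

text \<open>The \<open>j\<close> derivatives rest on \<open>\<phi>\<close> while time is integrated,
  so regularity of \<open>u\<close> at the two given times is not presupposed; what enters is the
  regularity of \<open>u_t\<close> at almost every time.\<close>

lemma pair_u_diff_deriv_bound:
  assumes \<phi>: "test_function 0 1 \<phi>" and j: "j \<le> s" and r: "r \<in> {0..T}" and t: "t \<in> {0..T}"
  shows "\<bar>pair (\<lambda>y. u t y - u r y) ((deriv ^^ j) \<phi>)\<bar> \<le> \<bar>speed_integral t - speed_integral r\<bar> * l2n (lebI 0 1) \<phi>"
proof -
  note \<psi> = square_integrable_test_function[OF test_function_deriv_funpow[OF \<phi> zero_less_one, of j], of 0 1]
  have *: "\<bar>pair (u t) ((deriv ^^ j) \<phi>) - pair (u r) ((deriv ^^ j) \<phi>)\<bar> \<le> \<bar>speed_integral t - speed_integral r\<bar> * l2n (lebI 0 1) \<phi>"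
    if rt: "0 \<le> r" "r \<le> t" "t \<le> T" for r t
  proof -
    have i: "integrable (lebI r t) (\<lambda>\<sigma>. sobolev_norm s (u_t \<sigma>))"
      by (rule integrable_lebI_subset[OF integrable_speed]) (use rt in auto)
    have i2: "integrable (lebI r t) (\<lambda>\<sigma>. pair (u_t \<sigma>) ((deriv ^^ j) \<phi>))"
      by (rule integrable_lebI_subset[OF L2_time_norm(3)[OF L2_time(2) \<psi>]]) (use rt in auto)
    have "\<bar>pair (u t) ((deriv ^^ j) \<phi>) - pair (u r) ((deriv ^^ j) \<phi>)\<bar> \<le> (\<integral>\<sigma>. \<bar>pair (u_t \<sigma>) ((deriv ^^ j) \<phi>)\<bar> \<partial>lebI r t)"
      unfolding pair_u_diff[OF \<psi> rt] by (rule integral_abs_bound)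
    also have "\<dots> \<le> (\<integral>\<sigma>. sobolev_norm s (u_t \<sigma>) * l2n (lebI 0 1) \<phi> \<partial>lebI r t)"
    proof (rule integral_mono_AE)
      have "AE \<sigma> in lebI r t. u_t \<sigma> \<in> sobolev s"
        by (rule AE_lebI_subset[OF L2_time_norm(4)[OF L2_time(2)]]) (use rt in auto)
      then show "AE \<sigma> in lebI r t. \<bar>pair (u_t \<sigma>) ((deriv ^^ j) \<phi>)\<bar> \<le> sobolev_norm s (u_t \<sigma>) * l2n (lebI 0 1) \<phi>"
        by eventually_elim (rule sobolev_test_bound[OF _ j \<phi>])
    qed (use i i2 in auto)
    also have "\<dots> = (\<integral>\<sigma>. sobolev_norm s (u_t \<sigma>) \<partial>lebI r t) * l2n (lebI 0 1) \<phi>" by simp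
    also have "(\<integral>\<sigma>. sobolev_norm s (u_t \<sigma>) \<partial>lebI r t) = speed_integral t - speed_integral r"
      using integral_lebI_combine[OF integrable_lebI_subset[OF integrable_speed], of 0 t r] rt
      by (simp add: speed_integral_def)
    finally show ?thesis by (smt (verit) l2n_nonneg mult_right_mono)
  qed
  have "pair (\<lambda>y. u t y - u r y) ((deriv ^^ j) \<phi>) = pair (u t) ((deriv ^^ j) \<phi>) - pair (u r) ((deriv ^^ j) \<phi>)"
    by (rule pair_diff[OF square_integrable_u[OF t] square_integrable_u[OF r] \<psi>])
  then show ?thesis
    using *[of r t] *[of t r] r t by (cases "r \<le> t") (auto simp: abs_minus_commute)
qed

text \<open>Almost every time is good. Along good times tending to \<open>t\<close> the weak
  derivatives are Cauchy, because \<open>speed_integral\<close> is continuous.\<close>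

lemma u_sobolev: "t \<in> {0..T} \<Longrightarrow> u t \<in> sobolev s"
proof -
  assume t: "t \<in> {0..T}"
  obtain r where r: "\<And>m::nat. r m \<in> {0<..<T}" "\<And>m. u (r m) \<in> sobolev s" "r \<longlonglongrightarrow> t"
    using AE_lebI_sequence[OF T L2_time_norm(4)[OF L2_time(1)] t] by blast
  have r': "r m \<in> {0..T}" for m using r(1)[of m] by auto
  have conv: "(\<lambda>m. h (r m)) \<longlonglongrightarrow> h t" if "continuous_on {0..T} h" for h :: "real \<Rightarrow> real"
    using that r' r(3) t unfolding continuous_on_sequentially o_def by blast
  show "u t \<in> sobolev s"
  proof (rule sobolev_limit[OF square_integrable_u[OF t] r(2)])
    fix \<phi> assume "test_function 0 1 \<phi>"
    then show "(\<lambda>m. pair (u (r m)) \<phi>) \<longlonglongrightarrow> pair (u t) \<phi>"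
      by (intro conv continuous_on_pair[OF continuous_u] integrable_continuous_lebI test_function_continuous)
  next
    show "Cauchy (\<lambda>m. speed_integral (r m))"
      by (rule LIMSEQ_imp_Cauchy[OF conv[OF speed_integral_continuous]])
  next
    fix m n j and \<phi> :: "real \<Rightarrow> real" assume "j \<le> s" "test_function 0 1 \<phi>"
    then show "\<bar>pair (\<lambda>y. u (r m) y - u (r n) y) ((deriv ^^ j) \<phi>)\<bar> \<le> \<bar>speed_integral (r m) - speed_integral (r n)\<bar> * l2n (lebI 0 1) \<phi>"
      by (intro pair_u_diff_deriv_bound r')
  qed
qed

text \<open>The norm at time 0 plus the total variation in time bounds each single weak derivative;
  the factor \<open>Suc s\<close> passes from these to the full norm.\<close>

definition "norm_bound = real (Suc s) * (sobolev_norm s (u 0) + speed_integral T)"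

lemma speed_integral_mono: "r \<in> {0..T} \<Longrightarrow> 0 \<le> speed_integral r \<and> speed_integral r \<le> speed_integral T"
  unfolding speed_integral_def by (auto intro!: integral_nonneg_AE integral_lebI_le[OF integrable_speed])

lemma norm_bound_nonneg: "0 \<le> norm_bound"
  using speed_integral_mono[of T] T by (simp add: norm_bound_def)

lemma u_norm_bound: "t \<in> {0..T} \<Longrightarrow> sobolev_norm s (u t) \<le> norm_bound"
proof -
  assume t: "t \<in> {0..T}"
  have z: "0 \<in> {0..T}" using T by simp
  show ?thesis
    unfolding norm_bound_def
  proof (rule sobolev_norm_le)
    show K0: "0 \<le> sobolev_norm s (u 0) + speed_integral T" using speed_integral_mono[of T] T by simp
    fix j assume j: "j \<le> s"
    show "l2n (lebI 0 1) (weak_deriv j (u t)) \<le> sobolev_norm s (u 0) + speed_integral T"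
    proof (rule is_weak_deriv_norm_by_duality[OF is_weak_deriv_weak_deriv[OF u_sobolev[OF t] j] K0])
      fix \<phi> assume \<phi>: "test_function 0 1 \<phi>"
      note \<psi> = square_integrable_test_function[OF test_function_deriv_funpow[OF \<phi> zero_less_one, of j], of 0 1]
      have eq: "pair (u t) ((deriv ^^ j) \<phi>) = pair (u 0) ((deriv ^^ j) \<phi>) + pair (\<lambda>y. u t y - u 0 y) ((deriv ^^ j) \<phi>)"
        using pair_diff[OF square_integrable_u[OF t] square_integrable_u[OF z] \<psi>] by simp
      have "\<bar>pair (u t) ((deriv ^^ j) \<phi>)\<bar> \<le> sobolev_norm s (u 0) * l2n (lebI 0 1) \<phi> + \<bar>speed_integral t - speed_integral 0\<bar> * l2n (lebI 0 1) \<phi>"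
        unfolding eq by (intro order_trans[OF abs_triangle_ineq] add_mono sobolev_test_bound[OF u_sobolev[OF z] j \<phi>]
            pair_u_diff_deriv_bound[OF \<phi> j z t])
      also have "\<dots> \<le> sobolev_norm s (u 0) * l2n (lebI 0 1) \<phi> + speed_integral T * l2n (lebI 0 1) \<phi>"
        using speed_integral_mono[OF t] speed_integral_mono[OF z]
        by (intro add_left_mono mult_right_mono) (auto simp: speed_integral_def)
      finally show "\<bar>pair (u t) ((deriv ^^ j) \<phi>)\<bar> \<le> (sobolev_norm s (u 0) + speed_integral T) * l2n (lebI 0 1) \<phi>"
        by (simp add: distrib_right)
    qed
  qed
qed

lemma exists_u_chain:
  "\<exists>F. \<forall>t\<in>{0..T}. F t 0 = u t \<and> sobolev_chain s (F t) \<and>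
     (\<forall>j\<le>s. AE y in lebI 0 1. F t j y = weak_deriv j (u t) y)"
proof -
  have "\<forall>t\<in>{0..T}. \<exists>F. F 0 = u t \<and> sobolev_chain s F \<and> (\<forall>j\<le>s. AE y in lebI 0 1. F j y = weak_deriv j (u t) y)"
  proof
    fix t assume t: "t \<in> {0..T}"
    obtain F where "F 0 = u t" "sobolev_chain s F" "\<And>j. j \<le> s \<Longrightarrow> AE y in lebI 0 1. F j y = weak_deriv j (u t) y"
      using exists_sobolev_chain[OF u_sobolev[OF t] continuous_u_space[OF t]] by blast
    then show "\<exists>F. F 0 = u t \<and> sobolev_chain s F \<and> (\<forall>j\<le>s. AE y in lebI 0 1. F j y = weak_deriv j (u t) y)" by blast
  qed
  then show ?thesis by (rule bchoice)
qed

text \<open>\<open>D t j\<close> stands for the \<open>j\<close>-th space derivative, with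
  meaningful point values below order \<open>s\<close>. The choice is made for each time separately
  and carries no regularity in \<open>t\<close>.\<close>

definition "D = (SOME F. \<forall>t\<in>{0..T}. F t 0 = u t \<and> sobolev_chain s (F t) \<and>
     (\<forall>j\<le>s. AE y in lebI 0 1. F t j y = weak_deriv j (u t) y))"

lemma D: assumes t: "t \<in> {0..T}"
  shows D_0: "D t 0 = u t" and D_chain: "sobolev_chain s (D t)"
    and D_AE: "j \<le> s \<Longrightarrow> AE y in lebI 0 1. D t j y = weak_deriv j (u t) y"
  using someI_ex[OF exists_u_chain] t unfolding D_def by blast+

lemma D_norm: assumes t: "t \<in> {0..T}" and j: "j \<le> s"
  shows "l2n (lebI 0 1) (D t j) \<le> sobolev_norm s (u t)"
proof -
  have "l2n (lebI 0 1) (D t j) = l2n (lebI 0 1) (weak_deriv j (u t))"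
    by (intro l2n_cong_AE D_AE t j square_integrable_measurable sobolev_chain_square_integrable[OF D_chain]
        weak_deriv_square_integrable[OF u_sobolev])
  also have "\<dots> \<le> sobolev_norm s (u t)" by (rule weak_deriv_le_sobolev_norm[OF j])
  finally show ?thesis .
qed

lemma D_sup: assumes t: "t \<in> {0..T}" and j: "j < s" and y: "y \<in> {0..1}"
  shows "\<bar>D t j y\<bar> \<le> 2 * sobolev_norm s (u t)"
  using sobolev_chain_sup[OF D_chain[OF t] j y] D_norm[OF t, of j] D_norm[OF t, of "Suc j"] j by simp

text \<open>Weak form of \<open>u u_x - \<nu> u_xx\<close>. Through \<open>D t\<close> it makes
  sense at every time and for discontinuous \<open>\<psi>\<close>. For test functions and almost all
  times the equation reads \<open>pair (u_t t) \<psi> = - flux_pair t \<psi>\<close>.\<close>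

definition "flux_pair t \<psi> = pair (\<lambda>y. u t y * D t 1 y) \<psi> - \<nu> * pair (D t 2) \<psi>"

lemma flux_pair_test:
  assumes t: "t \<in> {0..T}" and \<phi>: "test_function 0 1 \<phi>"
  shows "flux_pair t \<phi> = - (1/2) * pair (\<lambda>y. (u t y)\<^sup>2) (deriv \<phi>) - \<nu> * pair (u t) ((deriv ^^ 2) \<phi>)"
proof -
  have 1: "pair (\<lambda>y. u t y * D t 1 y) \<phi> = - (1/2) * pair (\<lambda>y. (u t y)\<^sup>2) (deriv \<phi>)"
    using sobolev_chain_burgers_flux[OF D_chain[OF t] s \<phi>] by (simp add: D_0[OF t])
  have m: "D t 2 \<in> borel_measurable (lebI 0 1)" "weak_deriv 2 (u t) \<in> borel_measurable (lebI 0 1)"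
    "\<phi> \<in> borel_measurable (lebI 0 1)"
    by (auto intro!: square_integrable_measurable sobolev_chain_square_integrable[OF D_chain[OF t] s]
        weak_deriv_square_integrable[OF u_sobolev[OF t] s] square_integrable_test_function[OF \<phi>])
  have "pair (D t 2) \<phi> = pair (weak_deriv 2 (u t)) \<phi>"
  proof (rule integral_cong_AE)
    show "AE y in lebI 0 1. D t 2 y * \<phi> y = weak_deriv 2 (u t) y * \<phi> y"
      using D_AE[OF t s] by eventually_elim simp
  qed (use m in measurable)
  also have "\<dots> = pair (u t) ((deriv ^^ 2) \<phi>)"
    using is_weak_derivD(3)[OF is_weak_deriv_weak_deriv[OF u_sobolev[OF t] s] \<phi>] by simp
  finally show ?thesis using 1 by (simp add: flux_pair_def)
qed

lemma pair_u_t: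
  assumes \<phi>: "test_function 0 1 \<phi>"
  shows "AE t in lebI 0 T. pair (u_t t) \<phi> = - flux_pair t \<phi>"
proof -
  have pde: "AE t in lebesgue. t \<in> {0<..T} \<longrightarrow>
        (AE y in lebesgue. y \<in> unit_ivl \<longrightarrow> u_t t y + u t y * weak_deriv 1 (u t) y - \<nu> * weak_deriv 2 (u t) y = 0)"
    using sol by (simp add: burgers_solution_def u_t_def)
  have pde': "AE t in lebI 0 T. t \<in> {0<..<T} \<and> (AE y in lebI 0 1. u_t t y + u t y * weak_deriv 1 (u t) y - \<nu> * weak_deriv 2 (u t) y = 0)"
    unfolding AE_lebI_iff using pde by eventually_elim auto
  show ?thesis
    using pde' L2_time_norm(4)[OF L2_time(2)]
  proof eventually_elim
    case (elim t)
    then have t: "t \<in> {0..T}" by auto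
    have s1: "1 \<le> s" using s by simp
    have c0: "continuous_on {0..1} (u t)" by (rule continuous_u_space[OF t])
    obtain B where B: "\<And>y. y \<in> {0..1} \<Longrightarrow> \<bar>u t y\<bar> \<le> B" using continuous_bounded_interval[OF c0] by blast
    have sq2: "square_integrable (lebI 0 1) (D t 2)" by (rule sobolev_chain_square_integrable[OF D_chain[OF t] s])
    have sq1: "square_integrable (lebI 0 1) (\<lambda>y. u t y * D t 1 y)"
      by (rule square_integrable_bounded_mult[OF sobolev_chain_square_integrable[OF D_chain[OF t] s1] continuous_measurable_lebI[OF c0], of B])
         (rule AE_I2, rule B, simp)
    note sq\<phi> = square_integrable_test_function[OF \<phi>, of 0 1]
    have sqt: "square_integrable (lebI 0 1) (u_t t)" using elim sobolev_square_integrable by blast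
    have "pair (u_t t) \<phi> = (\<integral>y. - ((u t y * D t 1 y) * \<phi> y) + \<nu> * (D t 2 y * \<phi> y) \<partial>lebI 0 1)"
    proof (rule integral_cong_AE)
      show "AE y in lebI 0 1. u_t t y * \<phi> y = - ((u t y * D t 1 y) * \<phi> y) + \<nu> * (D t 2 y * \<phi> y)"
        using conjunct2[OF elim(1)] D_AE[OF t s1] D_AE[OF t s]
      proof eventually_elim
        case (elim y)
        then have "u_t t y = - (u t y * D t 1 y) + \<nu> * D t 2 y" by simp
        then show ?case by (simp only: distrib_right mult.assoc minus_mult_left)
      qed
      show "(\<lambda>y. u_t t y * \<phi> y) \<in> borel_measurable (lebI 0 1)"
        by (rule borel_measurable_integrable[OF square_integrable_mult[OF sqt sq\<phi>]])
      show "(\<lambda>y. - ((u t y * D t 1 y) * \<phi> y) + \<nu> * (D t 2 y * \<phi> y)) \<in> borel_measurable (lebI 0 1)"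
        by (rule borel_measurable_integrable)
           (use square_integrable_mult[OF sq1 sq\<phi>] square_integrable_mult[OF sq2 sq\<phi>] in auto)
    qed
    also have "\<dots> = - flux_pair t \<phi>"
      using square_integrable_mult[OF sq1 sq\<phi>] square_integrable_mult[OF sq2 sq\<phi>]
      by (simp add: flux_pair_def)
    finally show ?case .
  qed
qed

lemma flux_pair_continuous:
  assumes \<phi>: "test_function 0 1 \<phi>"
  shows "continuous_on {0..T} (\<lambda>t. flux_pair t \<phi>)"
proof -
  have "continuous_on ({0..T} \<times> {0..1}) (\<lambda>x. ((\<lambda>(t, y). u t y) x)\<^sup>2)" by (intro continuous_intros continuous_u)
  then have q2: "continuous_on ({0..T} \<times> {0..1}) (\<lambda>(t, y). (u t y)\<^sup>2)" by (simp add: case_prod_unfold)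
  have i: "integrable (lebI 0 1) ((deriv ^^ j) \<phi>)" for j
    by (rule integrable_continuous_lebI[OF test_function_continuous[OF test_function_deriv_funpow[OF \<phi> zero_less_one]]])
  have "continuous_on {0..T} (\<lambda>t. - (1/2) * pair (\<lambda>y. (u t y)\<^sup>2) (deriv \<phi>) - \<nu> * pair (u t) ((deriv ^^ 2) \<phi>))"
    using i[of 1] i[of 2] by (intro continuous_intros continuous_on_pair[OF continuous_u] continuous_on_pair[OF q2]) simp_all
  then show ?thesis by (rule continuous_on_eq) (simp add: flux_pair_test[OF _ \<phi>])
qed

text \<open>\<open>- flux_pair\<close> is the continuous representative of the pairing with
  \<open>u_t\<close>, so its weak time derivative is the pairing with \<open>u_tt\<close>.\<close>

lemma flux_pair_diff:
  assumes \<phi>: "test_function 0 1 \<phi>" and rt: "0 \<le> r" "r \<le> t" "t \<le> T"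
  shows "- flux_pair t \<phi> - - flux_pair r \<phi> = (\<integral>\<sigma>. pair (u_tt \<sigma>) \<phi> \<partial>lebI r t)"
proof (rule du_Bois_Reymond_continuous[OF T _ _ _ rt])
  note \<phi>2 = square_integrable_test_function[OF \<phi>, of 0 1]
  show "continuous_on {0..T} (\<lambda>t. - flux_pair t \<phi>)" by (intro continuous_intros flux_pair_continuous[OF \<phi>])
  show "integrable (lebI 0 T) (\<lambda>\<sigma>. pair (u_tt \<sigma>) \<phi>)" by (rule L2_time_norm(3)[OF L2_time(3) \<phi>2])
  fix \<theta> assume \<theta>: "test_function 0 T \<theta>"
  note d\<theta> = test_function_deriv[OF \<theta> T]
  have mth: "deriv \<theta> \<in> borel_measurable (lebI 0 T)"
    by (rule continuous_measurable_lebI[OF test_function_continuous[OF d\<theta>]])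
  have "(\<integral>x. - flux_pair x \<phi> * deriv \<theta> x \<partial>lebI 0 T) = (\<integral>x. deriv \<theta> x * pair (u_t x) \<phi> \<partial>lebI 0 T)"
  proof (rule integral_cong_AE)
    show "AE x in lebI 0 T. - flux_pair x \<phi> * deriv \<theta> x = deriv \<theta> x * pair (u_t x) \<phi>"
      using pair_u_t[OF \<phi>] by eventually_elim simp
    show "(\<lambda>x. - flux_pair x \<phi> * deriv \<theta> x) \<in> borel_measurable (lebI 0 T)"
      by (intro continuous_measurable_lebI continuous_intros flux_pair_continuous[OF \<phi>] test_function_continuous[OF d\<theta>])
    show "(\<lambda>x. deriv \<theta> x * pair (u_t x) \<phi>) \<in> borel_measurable (lebI 0 T)"
      by (rule borel_measurable_times[OF mth borel_measurable_integrable[OF L2_time_norm(3)[OF L2_time(2) \<phi>2]]])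
  qed
  \<comment> \<open>The first order relation is tested with \<open>deriv \<theta>\<close> and the
    second order one with \<open>\<theta>\<close>; both express the same integral of
    \<open>u\<close> against the second derivative of \<open>\<theta>\<close>.\<close>
  also have "\<dots> = - (\<integral>t. (deriv ^^ 2) \<theta> t * pair (u t) \<phi> \<partial>lebI 0 T)"
    using is_time_deriv_pair[OF time_derivs(2) \<phi>2 d\<theta>] by (simp add: numeral_2_eq_2)
  also have "\<dots> = - (\<integral>x. pair (u_tt x) \<phi> * \<theta> x \<partial>lebI 0 T)"
    using is_time_deriv_pair[OF time_derivs(3) \<phi>2 \<theta>] by (simp add: mult.commute)
  finally show "(\<integral>x. - flux_pair x \<phi> * deriv \<theta> x \<partial>lebI 0 T) = - (\<integral>x. pair (u_tt x) \<phi> * \<theta> x \<partial>lebI 0 T)" .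
qed

lemma u_tt_square_integrable: "integrable (lebI 0 T) (\<lambda>\<sigma>. (l2n (lebI 0 1) (u_tt \<sigma>))\<^sup>2)"
  by (rule square_integrable_square[OF L2_time_norm(2)[OF L2_time(3)]])

text \<open>Truncation error of a backward Euler step: the left side is the integral of
  \<open>flux_pair t - flux_pair \<sigma>\<close> over the step, and Cauchy-Schwarz in time bounds
  each difference by \<open>sqrt (t - r)\<close> times the space-time norm of \<open>u_tt\<close> on
  the step and the norm of \<open>\<phi>\<close>.\<close>

lemma time_consistency_test:
  assumes \<phi>: "test_function 0 1 \<phi>" and rt: "0 \<le> r" "r < t" "t \<le> T"
  shows "\<bar>pair (\<lambda>y. u t y - u r y) \<phi> + (t - r) * flux_pair t \<phi>\<bar>
     \<le> (t - r) * (sqrt (t - r) * sqrt (\<integral>\<sigma>. (l2n (lebI 0 1) (u_tt \<sigma>))\<^sup>2 \<partial>lebI r t)) * l2n (lebI 0 1) \<phi>"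
proof -
  interpret finite_measure "lebI r t" by (rule finite_measure_lebI)
  note \<phi>2 = square_integrable_test_function[OF \<phi>, of 0 1]
  define Q where "Q = sqrt (t - r) * sqrt (\<integral>\<sigma>. (l2n (lebI 0 1) (u_tt \<sigma>))\<^sup>2 \<partial>lebI r t) * l2n (lebI 0 1) \<phi>"
  have tT: "t \<in> {0..T}" "r \<in> {0..T}" using rt by auto
  have sqtt: "square_integrable (lebI r t) (\<lambda>\<sigma>. l2n (lebI 0 1) (u_tt \<sigma>))"
    by (rule square_integrable_lebI_subset[OF L2_time_norm(2)[OF L2_time(3)]]) (use rt in auto)
  have fd: "\<bar>flux_pair \<sigma> \<phi> - flux_pair t \<phi>\<bar> \<le> Q" if \<sigma>: "\<sigma> \<in> {r<..<t}" for \<sigma>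
  proof -
    have rs: "0 \<le> \<sigma>" "\<sigma> \<le> t" using \<sigma> rt by auto
    have i: "integrable (lebI r t) (\<lambda>\<sigma>. pair (u_tt \<sigma>) \<phi>)"
      by (rule integrable_lebI_subset[OF L2_time_norm(3)[OF L2_time(3) \<phi>2]]) (use rt in auto)
    have "\<bar>flux_pair \<sigma> \<phi> - flux_pair t \<phi>\<bar> = \<bar>\<integral>\<sigma>. pair (u_tt \<sigma>) \<phi> \<partial>lebI \<sigma> t\<bar>"
      using flux_pair_diff[OF \<phi> rs rt(3)] by simp
    also have "\<dots> \<le> (\<integral>\<sigma>. \<bar>pair (u_tt \<sigma>) \<phi>\<bar> \<partial>lebI \<sigma> t)" by (rule integral_abs_bound)
    also have "\<dots> \<le> (\<integral>\<sigma>. \<bar>pair (u_tt \<sigma>) \<phi>\<bar> \<partial>lebI r t)"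
      by (rule integral_lebI_le) (use i \<sigma> in auto)
    also have "\<dots> \<le> (\<integral>\<sigma>. l2n (lebI 0 1) (u_tt \<sigma>) * l2n (lebI 0 1) \<phi> \<partial>lebI r t)"
    proof (rule integral_mono_AE)
      have "AE \<sigma> in lebI r t. u_tt \<sigma> \<in> sobolev s"
        by (rule AE_lebI_subset[OF L2_time_norm(4)[OF L2_time(3)]]) (use rt in auto)
      then show "AE \<sigma> in lebI r t. \<bar>pair (u_tt \<sigma>) \<phi>\<bar> \<le> l2n (lebI 0 1) (u_tt \<sigma>) * l2n (lebI 0 1) \<phi>"
        by eventually_elim (rule Cauchy_Schwarz_l2[OF sobolev_square_integrable \<phi>2])
    qed (use i square_integrable_integrable[OF finite_measure_lebI sqtt] in auto)
    also have "\<dots> = (\<integral>\<sigma>. \<bar>l2n (lebI 0 1) (u_tt \<sigma>)\<bar> \<partial>lebI r t) * l2n (lebI 0 1) \<phi>" by simp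
    also have "\<dots> \<le> sqrt (measure (lebI r t) (space (lebI r t))) * l2n (lebI r t) (\<lambda>\<sigma>. l2n (lebI 0 1) (u_tt \<sigma>)) * l2n (lebI 0 1) \<phi>"
      by (intro mult_right_mono integral_le_l2n finite_measure_lebI sqtt) simp
    also have "\<dots> = Q" using rt by (simp add: Q_def measure_lebI l2n_def)
    finally show ?thesis .
  qed
  have fc: "continuous_on {r..t} (\<lambda>\<sigma>. flux_pair \<sigma> \<phi>)"
    by (rule continuous_on_subset[OF flux_pair_continuous[OF \<phi>]]) (use rt in auto)
  note fi = integrable_continuous_lebI[OF fc]
  have "pair (\<lambda>y. u t y - u r y) \<phi> = (\<integral>\<sigma>. pair (u_t \<sigma>) \<phi> \<partial>lebI r t)"
    using pair_u_diff[OF \<phi>2, of r t] pair_diff[OF square_integrable_u square_integrable_u \<phi>2, of t r] rt tT by simp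
  also have "\<dots> = (\<integral>\<sigma>. - flux_pair \<sigma> \<phi> \<partial>lebI r t)"
  proof (rule integral_cong_AE)
    show "AE \<sigma> in lebI r t. pair (u_t \<sigma>) \<phi> = - flux_pair \<sigma> \<phi>"
      by (rule AE_lebI_subset[OF pair_u_t[OF \<phi>]]) (use rt in auto)
    show "(\<lambda>\<sigma>. pair (u_t \<sigma>) \<phi>) \<in> borel_measurable (lebI r t)"
      by (rule measurable_lebI_subset[OF borel_measurable_integrable[OF L2_time_norm(3)[OF L2_time(2) \<phi>2]]]) (use rt in auto)
  qed (use fi in auto)
  finally have eq: "pair (\<lambda>y. u t y - u r y) \<phi> + (t - r) * flux_pair t \<phi> = - (\<integral>\<sigma>. flux_pair \<sigma> \<phi> - flux_pair t \<phi> \<partial>lebI r t)"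
    using fi rt by (simp add: measure_lebI)
  have "\<bar>pair (\<lambda>y. u t y - u r y) \<phi> + (t - r) * flux_pair t \<phi>\<bar> \<le> (\<integral>\<sigma>. \<bar>flux_pair \<sigma> \<phi> - flux_pair t \<phi>\<bar> \<partial>lebI r t)"
    unfolding eq abs_minus_cancel by (rule integral_abs_bound)
  also have "\<dots> \<le> (\<integral>\<sigma>. Q \<partial>lebI r t)"
    by (rule integral_mono) (use fi fd in auto)
  also have "\<dots> = (t - r) * Q" using rt by (simp add: measure_lebI)
  finally show ?thesis by (simp add: Q_def mult.assoc)
qed

text \<open>Extension by density, made for the interior parts of weak functions, which jump at the
  nodes.\<close>

lemma time_consistency:
  assumes \<psi>: "\<psi> \<in> borel_measurable (lebI 0 1)" "\<And>y. y \<in> {0<..<1} \<Longrightarrow> \<bar>\<psi> y\<bar> \<le> B"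
    and rt: "0 \<le> r" "r < t" "t \<le> T"
  shows "\<bar>pair (\<lambda>y. u t y - u r y) \<psi> + (t - r) * flux_pair t \<psi>\<bar>
     \<le> (t - r) * (sqrt (t - r) * sqrt (\<integral>\<sigma>. (l2n (lebI 0 1) (u_tt \<sigma>))\<^sup>2 \<partial>lebI r t)) * l2n (lebI 0 1) \<psi>"
proof -
  have tT: "t \<in> {0..T}" "r \<in> {0..T}" using rt by auto
  have s1: "1 \<le> s" using s by simp
  obtain \<phi> where \<phi>: "\<And>n. test_function 0 1 (\<phi> n)"
    "\<And>h. integrable (lebI 0 1) h \<Longrightarrow> (\<lambda>n. pair h (\<phi> n)) \<longlonglongrightarrow> pair h \<psi>"
    "(\<lambda>n. l2n (lebI 0 1) (\<phi> n)) \<longlonglongrightarrow> l2n (lebI 0 1) \<psi>"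
  proof (rule test_function_dense[OF zero_less_one \<psi>])
    fix \<phi> :: "nat \<Rightarrow> real \<Rightarrow> real"
    assume *: "\<And>n. test_function 0 1 (\<phi> n)"
      "\<And>h. integrable (lebI 0 1) h \<Longrightarrow> (\<lambda>n. pair h (\<phi> n)) \<longlonglongrightarrow> pair h \<psi>"
      "(\<lambda>n. l2n (lebI 0 1) (\<phi> n)) \<longlonglongrightarrow> l2n (lebI 0 1) \<psi>"
    show thesis by (rule that[OF *])
  qed
  have c0: "continuous_on {0..1} (u t)" by (rule continuous_u_space[OF tT(1)])
  have i0: "integrable (lebI 0 1) (\<lambda>y. u t y - u r y)"
    by (intro integrable_continuous_lebI continuous_intros continuous_u_space tT)
  have i1: "integrable (lebI 0 1) (\<lambda>y. u t y * D t 1 y)"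
    by (rule square_integrable_mult[OF square_integrable_u[OF tT(1)] sobolev_chain_square_integrable[OF D_chain[OF tT(1)] s1]])
  have i2: "integrable (lebI 0 1) (D t 2)"
    by (rule square_integrable_integrable[OF finite_measure_lebI sobolev_chain_square_integrable[OF D_chain[OF tT(1)] s]])
  show ?thesis
  proof (rule LIMSEQ_le[OF _ _ exI[of _ 0]])
    show "(\<lambda>n. \<bar>pair (\<lambda>y. u t y - u r y) (\<phi> n) + (t - r) * flux_pair t (\<phi> n)\<bar>) \<longlonglongrightarrow>
       \<bar>pair (\<lambda>y. u t y - u r y) \<psi> + (t - r) * flux_pair t \<psi>\<bar>"
      unfolding flux_pair_def by (intro tendsto_intros \<phi>(2) i0 i1 i2)
    show "(\<lambda>n. (t - r) * (sqrt (t - r) * sqrt (\<integral>\<sigma>. (l2n (lebI 0 1) (u_tt \<sigma>))\<^sup>2 \<partial>lebI r t)) * l2n (lebI 0 1) (\<phi> n))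
      \<longlonglongrightarrow> (t - r) * (sqrt (t - r) * sqrt (\<integral>\<sigma>. (l2n (lebI 0 1) (u_tt \<sigma>))\<^sup>2 \<partial>lebI r t)) * l2n (lebI 0 1) \<psi>"
      by (intro tendsto_intros \<phi>(3))
  qed (use time_consistency_test[OF \<phi>(1) rt] in auto)
qed

lemma u_initial: "y \<in> unit_ivl \<Longrightarrow> u 0 y = g y"
  using sol by (simp add: burgers_solution_def)

lemma u_boundary: "t \<in> {0<..T} \<Longrightarrow> u t 0 = 0 \<and> u t 1 = 0"
  using sol by (simp add: burgers_solution_def)

end

section \<open>Polynomials on an element\<close>

lemma continuous_on_poly_real: "continuous_on S (\<lambda>y. poly p y)" for p :: "real poly"
  by (intro continuous_intros)

lemma square_integrable_poly: "square_integrable (lebI a b) (poly p)"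
  by (rule square_integrable_continuous[OF continuous_on_poly_real])

lemma integrable_poly_mult: "integrable (lebI a b) (\<lambda>y. poly p y * poly q y)"
  by (rule square_integrable_mult[OF square_integrable_poly square_integrable_poly])

lemma poly_zero_if_l2n_zero:
  assumes ab: "a < b" and z: "(\<integral>y. (poly p y)\<^sup>2 \<partial>lebI a b) = 0"
  shows "p = 0"
proof (rule ccontr)
  assume p: "p \<noteq> 0"
  have c: "continuous_on {a..b} (\<lambda>y. (poly p y)\<^sup>2)" by (intro continuous_intros)
  have "integral {a..b} (\<lambda>y. (poly p y)\<^sup>2) = 0"
    using integral_lebI_eq[OF integrable_continuous_lebI[OF c]] z by simp
  then have "\<forall>y\<in>{a..b}. (poly p y)\<^sup>2 = 0" using integral_eq_0_iff[OF c] ab by auto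
  then have "{a..b} \<subseteq> {y. poly p y = 0}" by auto
  then have "finite {a..b}" using poly_roots_finite[OF p] finite_subset by blast
  then show False using ab infinite_Icc by blast
qed

lemma pairs_sum:
  fixes c :: "nat \<Rightarrow> real" and f :: "nat \<Rightarrow> 'a \<Rightarrow> real" and g :: "'a \<Rightarrow> real"
  assumes "\<And>j. j \<in> J \<Longrightarrow> integrable M (\<lambda>y. f j y * g y)"
  shows "(\<integral>y. (\<Sum>j\<in>J. c j * f j y) * g y \<partial>M) = (\<Sum>j\<in>J. c j * (\<integral>y. f j y * g y \<partial>M))"
proof -
  have "(\<integral>y. (\<Sum>j\<in>J. c j * f j y) * g y \<partial>M) = (\<integral>y. (\<Sum>j\<in>J. c j * (f j y * g y)) \<partial>M)"
    by (simp add: sum_distrib_right mult.assoc)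
  also have "\<dots> = (\<Sum>j\<in>J. c j * (\<integral>y. f j y * g y \<partial>M))"
    by (subst Bochner_Integration.integral_sum) (use assms in auto)
  finally show ?thesis .
qed

definition orthonormal_basis :: "real \<Rightarrow> real \<Rightarrow> nat \<Rightarrow> (nat \<Rightarrow> real poly) \<Rightarrow> bool" where
  "orthonormal_basis a b k e \<longleftrightarrow> (\<forall>j\<le>k. degree (e j) \<le> k) \<and>
     (\<forall>i\<le>k. \<forall>j\<le>k. (\<integral>y. poly (e i) y * poly (e j) y \<partial>lebI a b) = (if i = j then 1 else 0)) \<and>
     (\<forall>p. degree p \<le> k \<longrightarrow> (\<exists>c. p = (\<Sum>j\<le>k. smult (c j) (e j))))"

lemma poly_sum_smult: "poly (\<Sum>j\<in>J. smult (c j) (e j)) y = (\<Sum>j\<in>J. c j * poly (e j) y)"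
  for c :: "nat \<Rightarrow> real"
  by (simp add: poly_sum)

lemma degree_sum_smult_le:
  fixes e :: "nat \<Rightarrow> real poly"
  shows "(\<And>j. j \<in> J \<Longrightarrow> degree (e j) \<le> k) \<Longrightarrow> degree (\<Sum>j\<in>J. smult (c j) (e j)) \<le> k"
  by (induction J rule: infinite_finite_induct)
     (auto intro!: degree_add_le intro: order_trans[OF degree_smult_le])

text \<open>One Gram--Schmidt step: the residual of \<open>x\<^sup>k\<^sup>+\<^sup>1\<close> is nonzero, as it has degree \<open>k + 1\<close>.\<close>

lemma exists_orthonormal_basis: "\<exists>e. orthonormal_basis 0 1 k e"
proof (induction k)
  case 0
  have "measure (lebI 0 1) {0<..<1::real} = 1" by (simp add: measure_lebI)
  then have "(\<integral>y. poly 1 y * poly 1 y \<partial>lebI 0 1) = (1::real)" by simp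
  moreover have "\<exists>c::nat \<Rightarrow> real. p = smult (c 0) 1" if d: "degree p = 0" for p :: "real poly"
  proof -
    obtain c where "p = [:c:]" using d by (rule degree_eq_zeroE)
    then show ?thesis by (intro exI[of _ "\<lambda>_. c"]) (simp add: one_pCons)
  qed
  ultimately show ?case
    unfolding orthonormal_basis_def by (intro exI[of _ "\<lambda>_. 1"]) (auto simp del: smult_one)
next
  case (Suc k)
  then obtain e where e: "orthonormal_basis 0 1 k e" by blast
  have deg: "\<And>j. j \<le> k \<Longrightarrow> degree (e j) \<le> k"
    and on: "\<And>i j. i \<le> k \<Longrightarrow> j \<le> k \<Longrightarrow> (\<integral>y. poly (e i) y * poly (e j) y \<partial>lebI 0 1) = (if i = j then 1 else 0)"
    and span: "\<And>p. degree p \<le> k \<Longrightarrow> \<exists>c. p = (\<Sum>j\<le>k. smult (c j) (e j))"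
    using e by (auto simp: orthonormal_basis_def)
  define X :: "real poly" where "X = monom 1 (Suc k)"
  define c where "c j = (\<integral>y. poly X y * poly (e j) y \<partial>lebI 0 1)" for j
  define S where "S = (\<Sum>j\<le>k. smult (c j) (e j))"
  define q where "q = X - S"
  have degS: "degree S \<le> k" unfolding S_def by (rule degree_sum_smult_le) (use deg in auto)
  have degX: "degree X = Suc k" by (simp add: X_def degree_monom_eq)
  have degq: "degree q = Suc k"
  proof -
    have "degree (X + (- S)) = degree X" by (rule degree_add_eq_left) (use degS degX in simp)
    then show ?thesis by (simp add: q_def degX)
  qed
  have coq: "coeff q (Suc k) = 1"
    using degS by (simp add: q_def X_def coeff_eq_0)
  have orth: "(\<integral>y. poly q y * poly (e i) y \<partial>lebI 0 1) = 0" if i: "i \<le> k" for i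
  proof -
    have "(\<integral>y. poly S y * poly (e i) y \<partial>lebI 0 1) = (\<Sum>j\<le>k. c j * (\<integral>y. poly (e j) y * poly (e i) y \<partial>lebI 0 1))"
      unfolding S_def poly_sum_smult by (rule pairs_sum[OF integrable_poly_mult])
    also have "\<dots> = (\<Sum>j\<le>k. if j = i then c j else 0)"
      by (rule sum.cong) (use i on in auto)
    also have "\<dots> = c i" using i by simp
    finally have "(\<integral>y. poly S y * poly (e i) y \<partial>lebI 0 1) = c i" .
    moreover have "(\<integral>y. poly q y * poly (e i) y \<partial>lebI 0 1) = c i - (\<integral>y. poly S y * poly (e i) y \<partial>lebI 0 1)"
      unfolding q_def poly_diff left_diff_distrib c_def
      by (rule Bochner_Integration.integral_diff[OF integrable_poly_mult integrable_poly_mult])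
    ultimately show ?thesis by simp
  qed
  define n where "n = (\<integral>y. (poly q y)\<^sup>2 \<partial>lebI 0 1)"
  have "n \<noteq> 0"
  proof
    assume "n = 0"
    then have "q = 0" by (intro poly_zero_if_l2n_zero[of 0 1 q]) (simp_all add: n_def)
    then show False using degq by simp
  qed
  moreover have "n \<ge> 0" by (simp add: n_def)
  ultimately have n: "n > 0" by simp
  define f where "f = smult (1 / sqrt n) q"
  define e' where "e' j = (if j \<le> k then e j else f)" for j
  have ff: "(\<integral>y. poly f y * poly f y \<partial>lebI 0 1) = 1"
  proof -
    have "(\<integral>y. poly f y * poly f y \<partial>lebI 0 1) = (\<integral>y. (1 / n) * (poly q y)\<^sup>2 \<partial>lebI 0 1)"
      using n by (simp add: f_def power2_eq_square field_simps)
    also have "\<dots> = (1 / n) * n" unfolding n_def by (rule integral_mult_right_zero)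
    finally show ?thesis using n by simp
  qed
  have fe: "(\<integral>y. poly f y * poly (e i) y \<partial>lebI 0 1) = 0" if "i \<le> k" for i
    using orth[OF that] by (simp add: f_def mult.assoc)
  have ef: "(\<integral>y. poly (e i) y * poly f y \<partial>lebI 0 1) = 0" if "i \<le> k" for i
    using fe[OF that] by (simp add: mult.commute)
  have "orthonormal_basis 0 1 (Suc k) e'"
    unfolding orthonormal_basis_def
  proof (intro conjI allI impI)
    fix j assume "j \<le> Suc k"
    then show "degree (e' j) \<le> Suc k" using deg[of j] degq by (auto simp: e'_def f_def le_SucI)
  next
    fix i j assume "i \<le> Suc k" "j \<le> Suc k"
    then show "(\<integral>y. poly (e' i) y * poly (e' j) y \<partial>lebI 0 1) = (if i = j then 1 else 0)"
      using on[of i j] ff fe[of j] ef[of i] by (auto simp: e'_def le_Suc_eq)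
  next
    fix p :: "real poly" assume p: "degree p \<le> Suc k"
    define d where "d = coeff p (Suc k)"
    have "degree (p - smult d q) \<le> k"
    proof (rule degree_le, intro allI impI)
      fix i assume "k < i"
      then show "coeff (p - smult d q) i = 0"
        using p degq coq by (cases "i = Suc k") (auto simp: d_def coeff_eq_0)
    qed
    then obtain c where "p - smult d q = (\<Sum>j\<le>k. smult (c j) (e j))" using span by blast
    then have c: "p = (\<Sum>j\<le>k. smult (c j) (e j)) + smult (d * sqrt n) f"
      using n by (simp add: f_def algebra_simps)
    have "p = (\<Sum>j\<le>Suc k. smult ((if j \<le> k then c j else d * sqrt n)) (e' j))"
      unfolding c by (simp add: e'_def)
    then show "\<exists>c. p = (\<Sum>j\<le>Suc k. smult (c j) (e' j))"
      by (rule exI[of _ "\<lambda>j. if j \<le> k then c j else d * sqrt n"])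
  qed
  then show ?case by blast
qed

lemma integral_lebI_affine:
  assumes ab: "a < b" and f: "continuous_on UNIV f"
  shows "(\<integral>y. f ((y - a) / (b - a)) \<partial>lebI a b) = (b - a) * (\<integral>y. f y \<partial>lebI 0 1)"
proof -
  define F where "F x = integral {0..x} f" for x
  have fc: "continuous_on S f" for S by (rule continuous_on_subset[OF f]) simp
  have F: "(F has_real_derivative f x) (at x within {0..1})" if "x \<in> {0..1}" for x
    unfolding F_def by (rule integral_has_real_derivative[OF fc that])
  define G where "G y = (b - a) * F ((y - a) / (b - a))" for y
  have G: "(G has_real_derivative f ((y - a) / (b - a))) (at y within {a..b})" if y: "y \<in> {a..b}" for y
  proof -
    have m: "(y - a) / (b - a) \<in> {0..1}" using y ab by (auto simp: field_simps)
    have im: "(\<lambda>y. (y - a) / (b - a)) ` {a..b} \<subseteq> {0..1}" using ab by (auto simp: field_simps)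
    have "((\<lambda>y. (y - a) / (b - a)) has_real_derivative 1 / (b - a)) (at y within {a..b})"
      using ab by (auto intro!: derivative_eq_intros)
    from DERIV_image_chain[OF has_field_derivative_subset[OF F[OF m] im] this]
    have "((\<lambda>y. F ((y - a) / (b - a))) has_real_derivative f ((y - a) / (b - a)) * (1 / (b - a))) (at y within {a..b})"
      by (simp add: o_def)
    from DERIV_cmult[OF this, of "b - a"] show ?thesis using ab by (simp add: G_def[abs_def])
  qed
  have "(\<integral>y. f ((y - a) / (b - a)) \<partial>lebI a b) = G b - G a"
    by (rule FTC_lebI[OF _ G]) (use ab in \<open>auto intro!: continuous_on_compose2[OF f] continuous_intros\<close>)
  also have "\<dots> = (b - a) * F 1" using ab by (simp add: G_def F_def)
  also have "F 1 = (\<integral>y. f y \<partial>lebI 0 1)"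
    using integral_lebI_eq[OF integrable_continuous_lebI[OF fc], of 0 1] by (simp add: F_def)
  finally show ?thesis .
qed

text \<open>An affine map transports a basis from the unit interval to \<open>[a, b]\<close>.
  Orthonormality forces the factor \<open>1 / sqrt (b - a)\<close>, and the remaining constant
  depends on \<open>k\<close> only; the later sup bounds owe their independence of the mesh to
  this.\<close>

lemma exists_scaled_orthonormal_basis:
  "\<exists>C\<ge>0. \<forall>a b. a < b \<longrightarrow> (\<exists>e. orthonormal_basis a b k e \<and> (\<forall>j\<le>k. \<forall>y\<in>{a..b}. \<bar>poly (e j) y\<bar> \<le> C / sqrt (b - a)))"
proof -
  obtain e where e: "orthonormal_basis 0 1 k e" using exists_orthonormal_basis by blast
  have "\<exists>B\<ge>0. \<forall>y\<in>{0..1}. \<bar>poly (e j) y\<bar> \<le> B" for j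
    by (rule continuous_bounded_interval[OF continuous_on_poly_real[of "{0..1}" "e j"]]) blast
  then obtain B where B: "\<And>j. 0 \<le> B j" "\<And>j y. y \<in> {0..1} \<Longrightarrow> \<bar>poly (e j) y\<bar> \<le> B j" by metis
  define C where "C = (\<Sum>j\<le>k. B j)"
  have C0: "C \<ge> 0" by (simp add: C_def sum_nonneg B)
  have BC: "B j \<le> C" if "j \<le> k" for j
    unfolding C_def by (rule member_le_sum) (use that B in auto)
  have "\<exists>e'. orthonormal_basis a b k e' \<and> (\<forall>j\<le>k. \<forall>y\<in>{a..b}. \<bar>poly (e' j) y\<bar> \<le> C / sqrt (b - a))" if ab: "a < b" for a b
  proof -
    define h where "h = b - a"
    have h: "h > 0" using ab by (simp add: h_def)
    define L where "L = [:- a / h, 1 / h:]"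
    define e' where "e' j = smult (1 / sqrt h) (pcompose (e j) L)" for j
    have pL: "poly L y = (y - a) / h" for y using h by (simp add: L_def field_simps)
    have pe: "poly (e' j) y = poly (e j) ((y - a) / h) / sqrt h" for j y
      by (simp add: e'_def poly_pcompose pL)
    have "orthonormal_basis a b k e'"
      unfolding orthonormal_basis_def
    proof (intro conjI allI impI)
      fix j assume "j \<le> k"
      then have "degree (e j) \<le> k" using e by (auto simp: orthonormal_basis_def)
      moreover have "degree (pcompose (e j) L) \<le> degree (e j) * degree L" by (rule degree_pcompose_le)
      moreover have "degree L \<le> 1" by (simp add: L_def)
      ultimately have "degree (pcompose (e j) L) \<le> k"
      proof -
        assume 1: "degree (e j) \<le> k" "degree (pcompose (e j) L) \<le> degree (e j) * degree L" "degree L \<le> 1"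
        have "degree (e j) * degree L \<le> degree (e j) * 1" by (rule mult_le_mono2[OF 1(3)])
        then show ?thesis using 1 by linarith
      qed
      then show "degree (e' j) \<le> k"
        unfolding e'_def by (rule order_trans[OF degree_smult_le])
    next
      fix i j assume ij: "i \<le> k" "j \<le> k"
      have "(\<integral>y. poly (e' i) y * poly (e' j) y \<partial>lebI a b)
          = (\<integral>y. (\<lambda>z. (1 / h) * (poly (e i) z * poly (e j) z)) ((y - a) / (b - a)) \<partial>lebI a b)"
        using h by (simp add: pe h_def field_simps)
      also have "\<dots> = (b - a) * (\<integral>z. (1 / h) * (poly (e i) z * poly (e j) z) \<partial>lebI 0 1)"
        by (rule integral_lebI_affine[OF ab]) (intro continuous_intros)
      also have "\<dots> = h * (1 / h) * (\<integral>z. poly (e i) z * poly (e j) z \<partial>lebI 0 1)"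
        by (simp add: h_def)
      also have "\<dots> = (if i = j then 1 else 0)"
        using e ij h by (simp add: orthonormal_basis_def)
      finally show "(\<integral>y. poly (e' i) y * poly (e' j) y \<partial>lebI a b) = (if i = j then 1 else 0)" .
    next
      fix p :: "real poly" assume p: "degree p \<le> k"
      \<comment> \<open>\<open>[:a, h:]\<close> is the inverse of \<open>L\<close>: the polynomial
        is pulled back to the unit interval and expanded there.\<close>
      have "degree (pcompose p [:a, h:]) \<le> k"
        using degree_pcompose_le[of p "[:a, h:]"] p h by simp
      then obtain c where c: "pcompose p [:a, h:] = (\<Sum>j\<le>k. smult (c j) (e j))"
        using e by (auto simp: orthonormal_basis_def)
      have "p = (\<Sum>j\<le>k. smult (c j * sqrt h) (e' j))"
      proof (rule poly_eq_poly_eq_iff[THEN iffD1], rule ext)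
        fix y
        have "poly p y = poly (pcompose p [:a, h:]) ((y - a) / h)" using h by (simp add: poly_pcompose)
        also have "\<dots> = (\<Sum>j\<le>k. c j * poly (e j) ((y - a) / h))" unfolding c poly_sum_smult ..
        also have "\<dots> = (\<Sum>j\<le>k. (c j * sqrt h) * poly (e' j) y)"
          by (rule sum.cong) (use h in \<open>auto simp: pe\<close>)
        finally show "poly p y = poly (\<Sum>j\<le>k. smult (c j * sqrt h) (e' j)) y" by (simp add: poly_sum_smult)
      qed
      then show "\<exists>c. p = (\<Sum>j\<le>k. smult (c j) (e' j))" by (rule exI[of _ "\<lambda>j. c j * sqrt h"])
    qed
    moreover have "\<bar>poly (e' j) y\<bar> \<le> C / sqrt (b - a)" if "j \<le> k" "y \<in> {a..b}" for j y
    proof -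
      have "(y - a) / h \<in> {0..1}" using that h by (auto simp: h_def field_simps)
      then have "\<bar>poly (e j) ((y - a) / h)\<bar> \<le> C" using B(2) BC[OF that(1)] order_trans by blast
      then show ?thesis unfolding pe h_def[symmetric] using h by (simp add: divide_right_mono)
    qed
    ultimately show ?thesis by blast
  qed
  with C0 show ?thesis by blast
qed

definition basis_bound :: "nat \<Rightarrow> real" where
  "basis_bound k = (SOME C. C \<ge> 0 \<and> (\<forall>a b. a < b \<longrightarrow> (\<exists>e. orthonormal_basis a b k e \<and>
     (\<forall>j\<le>k. \<forall>y\<in>{a..b}. \<bar>poly (e j) y\<bar> \<le> C / sqrt (b - a)))))"

lemma basis_bound_nonneg: "0 \<le> basis_bound k"
  and obtain_orthonormal_basis: "a < b \<Longrightarrow> \<exists>e. orthonormal_basis a b k e \<and>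
     (\<forall>j\<le>k. \<forall>y\<in>{a..b}. \<bar>poly (e j) y\<bar> \<le> basis_bound k / sqrt (b - a))"
proof -
  have "basis_bound k \<ge> 0 \<and> (\<forall>a b. a < b \<longrightarrow> (\<exists>e. orthonormal_basis a b k e \<and>
     (\<forall>j\<le>k. \<forall>y\<in>{a..b}. \<bar>poly (e j) y\<bar> \<le> basis_bound k / sqrt (b - a))))"
    unfolding basis_bound_def by (rule someI_ex) (use exists_scaled_orthonormal_basis[of k] in blast)
  then show "0 \<le> basis_bound k" "a < b \<Longrightarrow> \<exists>e. orthonormal_basis a b k e \<and>
     (\<forall>j\<le>k. \<forall>y\<in>{a..b}. \<bar>poly (e j) y\<bar> \<le> basis_bound k / sqrt (b - a))" by blast+
qed

lemma orthonormal_expansion: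
  assumes e: "orthonormal_basis a b k e" and p: "degree p \<le> k"
  shows "p = (\<Sum>j\<le>k. smult (\<integral>y. poly p y * poly (e j) y \<partial>lebI a b) (e j))"
proof -
  obtain c where c: "p = (\<Sum>j\<le>k. smult (c j) (e j))" using e p by (auto simp: orthonormal_basis_def)
  have "(\<integral>y. poly p y * poly (e i) y \<partial>lebI a b) = c i" if i: "i \<le> k" for i
  proof -
    have "(\<integral>y. poly p y * poly (e i) y \<partial>lebI a b) = (\<Sum>j\<le>k. c j * (\<integral>y. poly (e j) y * poly (e i) y \<partial>lebI a b))"
      unfolding c poly_sum_smult by (rule pairs_sum[OF integrable_poly_mult])
    also have "\<dots> = (\<Sum>j\<le>k. if j = i then c j else 0)"
      by (rule sum.cong) (use i e in \<open>auto simp: orthonormal_basis_def\<close>)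
    also have "\<dots> = c i" using i by simp
    finally show ?thesis .
  qed
  then show ?thesis by (subst c) (auto intro!: sum.cong)
qed

text \<open>Riesz representation in the space of polynomials of degree at most \<open>k\<close>. It
  makes the \<open>THE\<close> in the projection and in the discrete weak derivative denote.\<close>

lemma poly_riesz:
  fixes l :: "real poly \<Rightarrow> real"
  assumes ab: "a < b" and add: "\<And>p q. l (p + q) = l p + l q" and scale: "\<And>c p. l (smult c p) = c * l p"
  shows "\<exists>!p. degree p \<le> k \<and> (\<forall>q. degree q \<le> k \<longrightarrow> (\<integral>y. poly p y * poly q y \<partial>lebI a b) = l q)"
proof -
  obtain e where e: "orthonormal_basis a b k e" using obtain_orthonormal_basis[OF ab] by blast
  have l0: "l 0 = 0" using add[of 0 0] by simp
  have lsum: "l (\<Sum>j\<in>J. smult (c j) (e j)) = (\<Sum>j\<in>J. c j * l (e j))" for J c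
    by (induction J rule: infinite_finite_induct) (auto simp: l0 add scale)
  show ?thesis
  proof (rule ex_ex1I)
    define p where "p = (\<Sum>j\<le>k. smult (l (e j)) (e j))"
    have "degree p \<le> k" unfolding p_def by (rule degree_sum_smult_le) (use e in \<open>auto simp: orthonormal_basis_def\<close>)
    moreover have "(\<integral>y. poly p y * poly q y \<partial>lebI a b) = l q" if q: "degree q \<le> k" for q
    proof -
      have "(\<integral>y. poly p y * poly q y \<partial>lebI a b) = (\<Sum>j\<le>k. l (e j) * (\<integral>y. poly (e j) y * poly q y \<partial>lebI a b))"
        unfolding p_def poly_sum_smult by (rule pairs_sum[OF integrable_poly_mult])
      also have "\<dots> = l (\<Sum>j\<le>k. smult (\<integral>y. poly q y * poly (e j) y \<partial>lebI a b) (e j))"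
        by (simp add: lsum mult.commute)
      also have "\<dots> = l q" using orthonormal_expansion[OF e q] by simp
      finally show ?thesis .
    qed
    ultimately show "\<exists>p. degree p \<le> k \<and> (\<forall>q. degree q \<le> k \<longrightarrow> (\<integral>y. poly p y * poly q y \<partial>lebI a b) = l q)" by blast
  next
    fix p p' assume p: "degree p \<le> k \<and> (\<forall>q. degree q \<le> k \<longrightarrow> (\<integral>y. poly p y * poly q y \<partial>lebI a b) = l q)"
      and p': "degree p' \<le> k \<and> (\<forall>q. degree q \<le> k \<longrightarrow> (\<integral>y. poly p' y * poly q y \<partial>lebI a b) = l q)"
    have "(\<integral>y. poly p y * poly (e j) y \<partial>lebI a b) = (\<integral>y. poly p' y * poly (e j) y \<partial>lebI a b)" if "j \<le> k" for j
      using p p' e that by (simp add: orthonormal_basis_def)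
    then have "(\<Sum>j\<le>k. smult (\<integral>y. poly p y * poly (e j) y \<partial>lebI a b) (e j)) = (\<Sum>j\<le>k. smult (\<integral>y. poly p' y * poly (e j) y \<partial>lebI a b) (e j))"
      by (intro sum.cong) auto
    then show "p = p'" using orthonormal_expansion[OF e, of p] orthonormal_expansion[OF e, of p'] p p' by simp
  qed
qed

section \<open>The projection onto polynomials on one element\<close>

definition poly_proj :: "nat \<Rightarrow> real \<Rightarrow> real \<Rightarrow> (real \<Rightarrow> real) \<Rightarrow> real poly" where
  "poly_proj k a b w = (THE p. degree p \<le> k \<and>
     (\<forall>q. degree q \<le> k \<longrightarrow> (\<integral>y. (w y - poly p y) * poly q y \<partial>lebI a b) = 0))"

lemma poly_proj:
  assumes ab: "a < b" and w: "square_integrable (lebI a b) w"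
  shows degree_poly_proj: "degree (poly_proj k a b w) \<le> k"
    and poly_proj_inner: "degree q \<le> k \<Longrightarrow> (\<integral>y. poly (poly_proj k a b w) y * poly q y \<partial>lebI a b) = (\<integral>y. w y * poly q y \<partial>lebI a b)"
proof -
  have i: "integrable (lebI a b) (\<lambda>y. w y * poly q y)" for q
    by (rule square_integrable_mult[OF w square_integrable_poly])
  have eq: "(\<integral>y. (w y - poly p y) * poly q y \<partial>lebI a b) = 0 \<longleftrightarrow>
      (\<integral>y. poly p y * poly q y \<partial>lebI a b) = (\<integral>y. w y * poly q y \<partial>lebI a b)" for p q
    using i integrable_poly_mult[of a b p q] by (auto simp: left_diff_distrib)
  have "\<exists>!p. degree p \<le> k \<and> (\<forall>q. degree q \<le> k \<longrightarrow> (\<integral>y. poly p y * poly q y \<partial>lebI a b) = (\<integral>y. w y * poly q y \<partial>lebI a b))"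
    by (rule poly_riesz[OF ab])
       (use i in \<open>simp_all add: distrib_left mult.left_commute\<close>)
  from theI'[OF this] show "degree (poly_proj k a b w) \<le> k"
    "degree q \<le> k \<Longrightarrow> (\<integral>y. poly (poly_proj k a b w) y * poly q y \<partial>lebI a b) = (\<integral>y. w y * poly q y \<partial>lebI a b)"
    unfolding poly_proj_def eq by auto
qed

lemma poly_proj_cong:
  "(\<And>y. y \<in> {a<..<b} \<Longrightarrow> w y = w' y) \<Longrightarrow> poly_proj k a b w = poly_proj k a b w'"
  unfolding poly_proj_def
  by (intro arg_cong[where f=The] ext conj_cong refl all_cong1 imp_cong arg_cong[where f="\<lambda>x. x = _"] Bochner_Integration.integral_cong) auto

text \<open>Pythagoras: the projection error is orthogonal to the difference of the two polynomials,
  which again has degree at most \<open>k\<close>.\<close>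

lemma poly_proj_best:
  assumes ab: "a < b" and w: "square_integrable (lebI a b) w" and q: "degree q \<le> k"
  shows "l2n (lebI a b) (\<lambda>y. w y - poly (poly_proj k a b w) y) \<le> l2n (lebI a b) (\<lambda>y. w y - poly q y)"
proof -
  define P where "P = poly_proj k a b w"
  have d: "square_integrable (lebI a b) (\<lambda>y. w y - poly P y)"
    by (intro square_integrable_diff w square_integrable_poly)
  have d': "square_integrable (lebI a b) (\<lambda>y. poly (P - q) y)" by (rule square_integrable_poly)
  have deg: "degree (P - q) \<le> k"
    using degree_diff_le[of P k q] degree_poly_proj[OF ab w] q by (simp add: P_def)
  have 0: "(\<integral>y. (w y - poly P y) * poly (P - q) y \<partial>lebI a b) = 0"
    using poly_proj_inner[OF ab w deg] square_integrable_mult[OF w square_integrable_poly, of "P - q"]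
      integrable_poly_mult[of a b P "P - q"]
    by (subst left_diff_distrib, subst Bochner_Integration.integral_diff) (auto simp: P_def simp del: poly_diff)
  have "(l2n (lebI a b) (\<lambda>y. w y - poly q y))\<^sup>2
      = (\<integral>y. (w y - poly P y)\<^sup>2 + 2 * ((w y - poly P y) * poly (P - q) y) + (poly (P - q) y)\<^sup>2 \<partial>lebI a b)"
    unfolding l2n_square by (rule Bochner_Integration.integral_cong) (auto simp: power2_eq_square algebra_simps)
  also have "\<dots> = (l2n (lebI a b) (\<lambda>y. w y - poly P y))\<^sup>2 + (l2n (lebI a b) (poly (P - q)))\<^sup>2"
    using square_integrable_square[OF d] square_integrable_square[OF d'] square_integrable_mult[OF d d'] 0
    by (simp add: l2n_square del: poly_diff)
  finally have "(l2n (lebI a b) (\<lambda>y. w y - poly P y))\<^sup>2 \<le> (l2n (lebI a b) (\<lambda>y. w y - poly q y))\<^sup>2" by simp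
  then show ?thesis unfolding P_def[symmetric] by (rule power2_le_imp_le) simp
qed

lemma poly_proj_l2n_le:
  assumes ab: "a < b" and w: "square_integrable (lebI a b) w"
  shows "l2n (lebI a b) (poly (poly_proj k a b w)) \<le> l2n (lebI a b) w"
proof -
  define P where "P = poly_proj k a b w"
  have "(l2n (lebI a b) (poly P))\<^sup>2 = (\<integral>y. w y * poly P y \<partial>lebI a b)"
    using poly_proj_inner[OF ab w degree_poly_proj[OF ab w], of k] by (simp add: P_def l2n_square flip: power2_eq_square)
  also have "\<dots> \<le> l2n (lebI a b) w * l2n (lebI a b) (poly P)"
    using Cauchy_Schwarz_l2[OF w square_integrable_poly[of a b P]] by simp
  finally show ?thesis unfolding P_def[symmetric] using l2n_nonneg[of "lebI a b" "poly P"]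
    by (cases "l2n (lebI a b) (poly P) = 0") (auto simp: power2_eq_square mult_le_cancel_right)
qed

definition proj_bound :: "nat \<Rightarrow> real" where
  "proj_bound k = real (Suc k) * basis_bound k"

lemma proj_bound_nonneg: "0 \<le> proj_bound k"
  by (simp add: proj_bound_def basis_bound_nonneg)

text \<open>The coefficients in the orthonormal basis are at most \<open>B * sqrt h\<close> and the
  basis functions at most \<open>basis_bound k / sqrt h\<close>, with \<open>h\<close> the length of
  the interval. The length cancels; the number \<open>Suc k\<close> of terms remains.\<close>

lemma poly_proj_sup:
  assumes ab: "a < b" and w: "w \<in> borel_measurable (lebI a b)" and B: "\<And>y. y \<in> {a<..<b} \<Longrightarrow> \<bar>w y\<bar> \<le> B" and y: "y \<in> {a..b}"
  shows "\<bar>poly (poly_proj k a b w) y\<bar> \<le> proj_bound k * B"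
proof -
  define P where "P = poly_proj k a b w"
  define h where "h = b - a"
  have h: "h > 0" using ab by (simp add: h_def)
  have B0: "0 \<le> B" using B[of "(a+b)/2"] ab by auto
  have w2: "square_integrable (lebI a b) w"
    by (rule square_integrable_bounded[OF finite_measure_lebI w, of B]) (auto intro!: AE_I2 B)
  interpret finite_measure "lebI a b" by (rule finite_measure_lebI)
  have "l2n (lebI a b) w \<le> l2n (lebI a b) (\<lambda>_. B)"
    by (rule l2n_mono(1)[OF w]) (use B B0 in \<open>auto intro!: AE_I2 square_integrable_continuous\<close>)
  also have "\<dots> = B * sqrt h" using B0 ab by (simp add: l2n_def measure_lebI h_def real_sqrt_mult)
  finally have wB: "l2n (lebI a b) w \<le> B * sqrt h" .
  obtain e where e: "orthonormal_basis a b k e" and eb: "\<And>j y. j \<le> k \<Longrightarrow> y \<in> {a..b} \<Longrightarrow> \<bar>poly (e j) y\<bar> \<le> basis_bound k / sqrt (b - a)"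
    using obtain_orthonormal_basis[OF ab] by blast
  have summand: "\<bar>(\<integral>y. poly P y * poly (e j) y \<partial>lebI a b) * poly (e j) y\<bar> \<le> basis_bound k * B" if j: "j \<le> k" for j
  proof -
    have ej: "degree (e j) \<le> k" and nj: "l2n (lebI a b) (poly (e j)) = 1"
      using e j by (auto simp: orthonormal_basis_def l2n_def power2_eq_square)
    have "\<bar>\<integral>y. poly P y * poly (e j) y \<partial>lebI a b\<bar> \<le> B * sqrt h"
      using Cauchy_Schwarz_l2[OF w2 square_integrable_poly[of a b "e j"]] poly_proj_inner[OF ab w2 ej] wB
      by (simp add: P_def nj)
    then have "\<bar>(\<integral>y. poly P y * poly (e j) y \<partial>lebI a b) * poly (e j) y\<bar> \<le> (B * sqrt h) * (basis_bound k / sqrt h)"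
      unfolding abs_mult using eb[OF j y] B0 h by (intro mult_mono) (auto simp: h_def)
    then show ?thesis using h by (simp add: mult.commute)
  qed
  have "poly P y = (\<Sum>j\<le>k. (\<integral>y. poly P y * poly (e j) y \<partial>lebI a b) * poly (e j) y)"
    using arg_cong[OF orthonormal_expansion[OF e degree_poly_proj[OF ab w2]], of "\<lambda>p. poly p y"]
    by (simp add: P_def poly_sum_smult)
  then have "\<bar>poly P y\<bar> \<le> (\<Sum>j\<le>k. \<bar>(\<integral>y. poly P y * poly (e j) y \<partial>lebI a b) * poly (e j) y\<bar>)"
    by (simp add: sum_abs)
  also have "\<dots> \<le> (\<Sum>j\<le>k. basis_bound k * B)" by (intro sum_mono summand) simp
  finally show ?thesis by (simp add: P_def proj_bound_def mult.assoc)
qed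

section \<open>Order of polynomial approximation on an interval\<close>

lemma poly_antiderivative:
  fixes q :: "real poly"
  obtains Q where "pderiv Q = q" "poly Q a = c" "q \<noteq> 0 \<Longrightarrow> degree Q \<le> Suc (degree q)" "q = 0 \<Longrightarrow> degree Q = 0"
proof -
  define R where "R = (\<Sum>i\<le>degree q. monom (coeff q i / real (Suc i)) (Suc i))"
  have "pderiv R = (\<Sum>i\<le>degree q. monom (coeff q i) i)"
    unfolding R_def higher_pderiv_sum[of "Suc 0", simplified] by (intro sum.cong) (auto simp: pderiv_monom)
  also have "\<dots> = q" by (simp add: poly_as_sum_of_monoms)
  finally have dR: "pderiv R = q" .
  have degR: "degree R \<le> Suc (degree q)"
    unfolding R_def by (rule degree_sum_le) (auto intro: order_trans[OF degree_monom_le])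
  define Q where "Q = R + [:c - poly R a:]"
  have "pderiv Q = q" by (simp add: Q_def pderiv_add dR pderiv_pCons)
  moreover have "poly Q a = c" by (simp add: Q_def)
  moreover have "degree Q \<le> Suc (degree q)" unfolding Q_def by (rule degree_add_le[OF degR]) simp
  \<comment> \<open>The zero polynomial has degree 0, so \<open>Suc (degree q)\<close> would
    overestimate here; the start of the induction on the order of approximation relies on the sharp
    value.\<close>
  moreover have "degree Q = 0" if "q = 0" using pderiv_eq_0_iff[of Q] \<open>pderiv Q = q\<close> that by simp
  ultimately show ?thesis using that by blast
qed

text \<open>The sup of \<open>F\<close> is at most \<open>sqrt (b - a)\<close> times the norm of
  \<open>f\<close>, and the passage from sup to norm costs the same factor again.\<close>

lemma l2n_primitive:
  assumes ab: "a < b" and f: "square_integrable (lebI a b) f"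
    and F: "\<And>y. y \<in> {a..b} \<Longrightarrow> F y = (\<integral>z. f z \<partial>lebI a y)"
  shows "l2n (lebI a b) F \<le> (b - a) * l2n (lebI a b) f"
proof -
  interpret finite_measure "lebI a b" by (rule finite_measure_lebI)
  note fi = square_integrable_integrable[OF finite_measure_lebI f]
  have Fc: "continuous_on {a..b} F"
    using indefinite_integral_continuous[OF fi] by (rule continuous_on_eq) (simp add: F)
  define K where "K = sqrt (b - a) * l2n (lebI a b) f"
  have K0: "0 \<le> K" using ab by (simp add: K_def)
  have b: "\<bar>F y\<bar> \<le> K" if "y \<in> {a..b}" for y
  proof -
    have "\<bar>F y\<bar> \<le> (\<integral>z. \<bar>f z\<bar> \<partial>lebI a y)" unfolding F[OF that] by (rule integral_abs_bound)
    also have "\<dots> \<le> (\<integral>z. \<bar>f z\<bar> \<partial>lebI a b)" by (rule integral_lebI_le) (use fi that in auto)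
    also have "\<dots> \<le> K" using integral_le_l2n[OF finite_measure_lebI f] ab by (simp add: K_def measure_lebI)
    finally show ?thesis .
  qed
  have "l2n (lebI a b) F \<le> l2n (lebI a b) (\<lambda>_. K)"
    by (rule l2n_mono(1)[OF continuous_measurable_lebI[OF Fc]])
       (use b K0 in \<open>auto intro!: AE_I2 square_integrable_continuous\<close>)
  also have "\<dots> = K * sqrt (b - a)" using K0 ab by (simp add: l2n_def measure_lebI real_sqrt_mult)
  also have "\<dots> = (b - a) * l2n (lebI a b) f" using ab by (simp add: K_def mult_ac)
  finally show ?thesis .
qed

lemma poly_integral_deriv:
  fixes Q :: "real poly"
  assumes "a \<le> y" shows "(\<integral>z. poly (pderiv Q) z \<partial>lebI a y) = poly Q y - poly Q a"
  by (rule FTC_lebI[OF assms]) (auto intro!: has_field_derivative_at_within[OF poly_DERIV] continuous_on_poly_real)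

text \<open>Recursive construction: approximate \<open>F 1\<close>, then take the primitive that
  agrees with \<open>F 0\<close> at \<open>a\<close>; each integration gains a factor
  \<open>b - a\<close>. The alternative \<open>p = 0\<close> is there for \<open>m = 0\<close>,
  where no degree lies below \<open>m\<close>.\<close>

lemma sobolev_chain_poly_approx:
  assumes "sobolev_chain m F" "0 \<le> a" "a < b" "b \<le> 1"
  shows "\<exists>p. (p = 0 \<or> degree p < m) \<and> l2n (lebI a b) (\<lambda>y. F 0 y - poly p y) \<le> (b - a) ^ m * l2n (lebI a b) (F m)"
  using assms(1)
proof (induction m arbitrary: F)
  case 0
  then show ?case by (intro exI[of _ 0]) simp
next
  case (Suc m)
  have "sobolev_chain m (\<lambda>j. F (Suc j))" using sobolev_chain_shift[of 1 m F] Suc.prems by simp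
  from Suc.IH[OF this] obtain q where q: "q = 0 \<or> degree q < m"
    "l2n (lebI a b) (\<lambda>y. F 1 y - poly q y) \<le> (b - a) ^ m * l2n (lebI a b) (F (Suc m))" by auto
  obtain Q where Q: "pderiv Q = q" "poly Q a = F 0 a" "q \<noteq> 0 \<Longrightarrow> degree Q \<le> Suc (degree q)" "q = 0 \<Longrightarrow> degree Q = 0"
    using poly_antiderivative by blast
  have sq1: "square_integrable (lebI a b) (F 1)"
    by (rule square_integrable_lebI_subset[OF sobolev_chain_square_integrable[OF Suc.prems]]) (use assms in auto)
  have sq: "square_integrable (lebI a b) (\<lambda>y. F 1 y - poly q y)"
    by (intro square_integrable_diff sq1 square_integrable_poly)
  have "l2n (lebI a b) (\<lambda>y. F 0 y - poly Q y) \<le> (b - a) * l2n (lebI a b) (\<lambda>y. F 1 y - poly q y)"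
  proof (rule l2n_primitive[OF assms(3) sq])
    fix y assume y: "y \<in> {a..b}"
    have i1: "integrable (lebI a y) (F 1)"
      by (rule integrable_lebI_subset[OF square_integrable_integrable[OF finite_measure_lebI sq1]]) (use y in auto)
    have "(\<integral>z. F 1 z - poly q z \<partial>lebI a y) = (\<integral>z. F 1 z \<partial>lebI a y) - (\<integral>z. poly q z \<partial>lebI a y)"
      by (intro Bochner_Integration.integral_diff i1 integrable_continuous_lebI continuous_on_poly_real)
    also have "(\<integral>z. F 1 z \<partial>lebI a y) = F 0 y - F 0 a"
      using sobolev_chain_integral[OF Suc.prems, of 0 a y] y assms by simp
    also have "(\<integral>z. poly q z \<partial>lebI a y) = poly Q y - poly Q a"
      using poly_integral_deriv[of a y Q] y Q(1) by simp
    finally show "F 0 y - poly Q y = (\<integral>z. F 1 z - poly q z \<partial>lebI a y)" using Q(2) by simp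
  qed
  also have "\<dots> \<le> (b - a) * ((b - a) ^ m * l2n (lebI a b) (F (Suc m)))"
    by (intro mult_left_mono q) (use assms in auto)
  finally have "l2n (lebI a b) (\<lambda>y. F 0 y - poly Q y) \<le> (b - a) ^ Suc m * l2n (lebI a b) (F (Suc m))"
    by (simp add: mult.assoc)
  moreover have "degree Q < Suc m" using q(1) Q(3,4) by (cases "q = 0") auto
  ultimately show ?case by blast
qed

text \<open>The interpolant is a primitive of the projection of the derivative; it matches \<open>w\<close> at
  both end points because the projection preserves the mean.\<close>

lemma exists_flux_interpolant:
  assumes ab: "a < b" and w': "square_integrable (lebI a b) w'"
    and w: "\<And>y. y \<in> {a..b} \<Longrightarrow> w y - w a = (\<integral>z. w' z \<partial>lebI a y)"
  obtains P where "degree P \<le> Suc k" "poly P a = w a" "poly P b = w b" "pderiv P = poly_proj k a b w'"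
    "\<And>q. degree q \<le> k \<Longrightarrow> l2n (lebI a b) (\<lambda>y. w y - poly P y) \<le> (b - a) * l2n (lebI a b) (\<lambda>y. w' y - poly q y)"
proof -
  note w'i = square_integrable_integrable[OF finite_measure_lebI w']
  define p where "p = poly_proj k a b w'"
  obtain P where P: "pderiv P = p" "poly P a = w a" "p \<noteq> 0 \<Longrightarrow> degree P \<le> Suc (degree p)" "p = 0 \<Longrightarrow> degree P = 0"
    using poly_antiderivative by blast
  have "degree P \<le> Suc k" using P(3,4) degree_poly_proj[OF ab w', of k] by (cases "p = 0") (auto simp: p_def)
  moreover have Pb: "poly P b = w b"
  proof -
    have "(\<integral>z. poly p z \<partial>lebI a b) = (\<integral>z. w' z \<partial>lebI a b)"
      using poly_proj_inner[OF ab w', of 1 k] by (simp add: p_def)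
    then show ?thesis using w[of b] poly_integral_deriv[of a b P] P ab by simp
  qed
  moreover have "l2n (lebI a b) (\<lambda>y. w y - poly P y) \<le> (b - a) * l2n (lebI a b) (\<lambda>y. w' y - poly q y)" if q: "degree q \<le> k" for q
  proof -
    have "l2n (lebI a b) (\<lambda>y. w y - poly P y) \<le> (b - a) * l2n (lebI a b) (\<lambda>y. w' y - poly p y)"
    proof (rule l2n_primitive[OF ab])
      show "square_integrable (lebI a b) (\<lambda>y. w' y - poly p y)"
        by (intro square_integrable_diff w' square_integrable_poly)
      fix y assume y: "y \<in> {a..b}"
      have "(\<integral>z. w' z - poly p z \<partial>lebI a y) = (\<integral>z. w' z \<partial>lebI a y) - (\<integral>z. poly p z \<partial>lebI a y)"
        by (intro Bochner_Integration.integral_diff integrable_lebI_subset[OF w'i] integrable_continuous_lebI continuous_on_poly_real)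
           (use y in auto)
      also have "\<dots> = w y - poly P y" using w[OF y] poly_integral_deriv[of a y P] y P by simp
      finally show "w y - poly P y = (\<integral>z. w' z - poly p z \<partial>lebI a y)" by simp
    qed
    also have "\<dots> \<le> (b - a) * l2n (lebI a b) (\<lambda>y. w' y - poly q y)"
      unfolding p_def by (intro mult_left_mono poly_proj_best[OF ab w' q]) (use ab in simp)
    finally show ?thesis .
  qed
  ultimately show ?thesis using that P by (simp add: p_def)
qed

text \<open>Classical derivatives under one common bound, a form in which products are easy to
  handle; the flux \<open>u^2\<close> calls for it. A function in \<open>H^(k+2)\<close> supplies
  \<open>k\<close> such derivatives both for \<open>u\<close> and for \<open>u_x\<close>.\<close>

primrec derivs_bounded :: "nat \<Rightarrow> (real \<Rightarrow> real) \<Rightarrow> real \<Rightarrow> bool" where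
  "derivs_bounded 0 f B \<longleftrightarrow> continuous_on {0..1} f \<and> (\<forall>y\<in>{0..1}. \<bar>f y\<bar> \<le> B)"
| "derivs_bounded (Suc m) f B \<longleftrightarrow> (\<forall>y\<in>{0..1}. \<bar>f y\<bar> \<le> B) \<and>
     (\<exists>f'. (\<forall>y\<in>{0..1}. (f has_real_derivative f' y) (at y within {0..1})) \<and> derivs_bounded m f' B)"

lemma derivs_bounded_Suc: "derivs_bounded (Suc m) f B \<Longrightarrow> derivs_bounded m f B"
proof (induction m arbitrary: f)
  case 0
  then show ?case by (auto simp: continuous_on_eq_continuous_within intro: DERIV_continuous)
next
  case (Suc m)
  then show ?case by (metis derivs_bounded.simps(2))
qed

lemma derivs_bounded_le: "derivs_bounded m f B \<Longrightarrow> y \<in> {0..1} \<Longrightarrow> \<bar>f y\<bar> \<le> B"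
  by (cases m) auto

lemma derivs_bounded_continuous: "derivs_bounded m f B \<Longrightarrow> continuous_on {0..1} f"
  by (cases m) (auto simp: continuous_on_eq_continuous_within intro: DERIV_continuous)

lemma derivs_bounded_add:
  "derivs_bounded m f A \<Longrightarrow> derivs_bounded m g B \<Longrightarrow> derivs_bounded m (\<lambda>y. f y + g y) (A + B)"
proof (induction m arbitrary: f g)
  case 0
  then show ?case by (auto intro!: continuous_intros order_trans[OF abs_triangle_ineq] add_mono)
next
  case (Suc m)
  then obtain f' g' where "\<forall>y\<in>{0..1}. (f has_real_derivative f' y) (at y within {0..1})" "derivs_bounded m f' A"
    "\<forall>y\<in>{0..1}. (g has_real_derivative g' y) (at y within {0..1})" "derivs_bounded m g' B" by auto
  then show ?case using Suc
    by (auto intro!: exI[of _ "\<lambda>y. f' y + g' y"] derivative_intros order_trans[OF abs_triangle_ineq] add_mono)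
qed

text \<open>Each order costs a factor 2, one for each term of the product rule, both terms being
  covered by the induction hypothesis.\<close>

lemma derivs_bounded_mult:
  "derivs_bounded m f A \<Longrightarrow> derivs_bounded m g B \<Longrightarrow> derivs_bounded m (\<lambda>y. f y * g y) (2 ^ m * (A * B))"
proof (induction m arbitrary: f g)
  case 0
  then show ?case by (auto intro!: continuous_intros simp: abs_mult intro!: mult_mono')
next
  case (Suc m)
  have A0: "0 \<le> A" "0 \<le> B" using derivs_bounded_le[OF Suc.prems(1), of 0] derivs_bounded_le[OF Suc.prems(2), of 0] by auto
  obtain f' where f'0: "\<forall>y\<in>{0..1}. (f has_real_derivative f' y) (at y within {0..1})" "derivs_bounded m f' A"
    using Suc.prems(1) by (elim derivs_bounded.simps(2)[THEN iffD1, elim_format] conjE exE)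
  obtain g' where g'0: "\<forall>y\<in>{0..1}. (g has_real_derivative g' y) (at y within {0..1})" "derivs_bounded m g' B"
    using Suc.prems(2) by (elim derivs_bounded.simps(2)[THEN iffD1, elim_format] conjE exE)
  note f' = f'0(1)[rule_format] f'0(2) and g' = g'0(1)[rule_format] g'0(2)
  have "derivs_bounded m (\<lambda>y. f' y * g y + f y * g' y) (2 ^ m * (A * B) + 2 ^ m * (A * B))"
    by (rule derivs_bounded_add[OF Suc.IH[OF f'(2) derivs_bounded_Suc[OF Suc.prems(2)]]
          Suc.IH[OF derivs_bounded_Suc[OF Suc.prems(1)] g'(2)]])
  then have d: "derivs_bounded m (\<lambda>y. f' y * g y + f y * g' y) (2 ^ Suc m * (A * B))" by (simp add: mult_ac)
  have "\<bar>f y * g y\<bar> \<le> 2 ^ Suc m * (A * B)" if y: "y \<in> {0..1}" for y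
  proof -
    have "\<bar>f y * g y\<bar> \<le> 1 * (A * B)"
      unfolding abs_mult mult_1 using derivs_bounded_le[OF Suc.prems(1) y] derivs_bounded_le[OF Suc.prems(2) y] A0
      by (intro mult_mono) auto
    also have "\<dots> \<le> 2 ^ Suc m * (A * B)" by (intro mult_right_mono one_le_power) (use A0 in auto)
    finally show ?thesis .
  qed
  moreover have "((\<lambda>y. f y * g y) has_real_derivative f' y * g y + f y * g' y) (at y within {0..1})" if "y \<in> {0..1}" for y
    using DERIV_mult[OF f'(1)[OF that] g'(1)[OF that]] by (simp add: mult.commute)
  ultimately show ?case using d unfolding derivs_bounded.simps
    by (intro conjI ballI exI[of _ "\<lambda>y. f' y * g y + f y * g' y"]) auto
qed

lemma derivs_bounded_sobolev_chain:
  "derivs_bounded m f B \<Longrightarrow> \<exists>F. F 0 = f \<and> sobolev_chain m F \<and> (\<forall>y\<in>{0..1}. \<bar>F m y\<bar> \<le> B)"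
proof (induction m arbitrary: f)
  case 0
  then show ?case
    by (intro exI[of _ "\<lambda>_. f"]) (auto simp: sobolev_chain_def intro: square_integrable_continuous)
next
  case (Suc m)
  obtain f' where ff: "\<forall>y\<in>{0..1}. (f has_real_derivative f' y) (at y within {0..1})" "derivs_bounded m f' B"
    using Suc.prems by (elim derivs_bounded.simps(2)[THEN iffD1, elim_format] conjE exE)
  note f' = ff(1)[rule_format] ff(2)
  obtain F where F: "F 0 = f'" "sobolev_chain m F" "\<forall>y\<in>{0..1}. \<bar>F m y\<bar> \<le> B" using Suc.IH[OF f'(2)] by blast
  have fc: "continuous_on {0..1} f" by (rule derivs_bounded_continuous[OF Suc.prems])
  have step: "f y - f x = (\<integral>z. f' z \<partial>lebI x y)" if xy: "0 \<le> x" "x \<le> y" "y \<le> 1" for x y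
  proof -
    have sub: "{x..y} \<subseteq> {0..1}" using xy by auto
    have "(\<integral>z. f' z \<partial>lebI x y) = f y - f x"
      by (rule FTC_lebI[OF xy(2)])
         (use sub in \<open>auto intro!: has_field_derivative_subset[OF f'(1) sub]
            continuous_on_subset[OF derivs_bounded_continuous[OF f'(2)] sub]\<close>)
    then show ?thesis by simp
  qed
  \<comment> \<open>\<open>case_nat f F\<close> puts \<open>f\<close> in front of the chain of its
    derivative.\<close>
  have "sobolev_chain (Suc m) (case_nat f F)"
    unfolding sobolev_chain_def
  proof (intro conjI allI impI)
    fix j assume "j \<le> Suc m"
    then show "square_integrable (lebI 0 1) (case_nat f F j)"
      using sobolev_chain_square_integrable[OF F(2)] square_integrable_continuous[OF fc] by (auto split: nat.split)
  next
    fix j assume "j < Suc m"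
    then show "continuous_on {0..1} (case_nat f F j)"
      using sobolev_chain_continuous[OF F(2)] fc by (auto split: nat.split)
  next
    fix j x y assume "j < Suc m" "0 \<le> x" "x \<le> y" "y \<le> (1::real)"
    then show "case_nat f F j y - case_nat f F j x = (\<integral>z. case_nat f F (Suc j) z \<partial>lebI x y)"
      using sobolev_chain_integral[OF F(2)] step F(1) by (auto split: nat.split)
  qed
  then show ?case using F(3) by (intro exI[of _ "case_nat f F"]) simp
qed

lemma sobolev_chain_derivs_bounded:
  assumes F: "sobolev_chain s F" and A: "\<And>j y. j < s \<Longrightarrow> y \<in> {0..1} \<Longrightarrow> \<bar>F j y\<bar> \<le> A"
  shows "i + m < s \<Longrightarrow> derivs_bounded m (F i) A"
proof (induction m arbitrary: i)
  case 0
  then show ?case using A sobolev_chain_continuous[OF F] by auto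
next
  case (Suc m)
  then have "derivs_bounded m (F (Suc i)) A" by simp
  moreover have "Suc i < s" "i < s" using Suc.prems by auto
  ultimately show ?case using A[OF \<open>i < s\<close>] sobolev_chain_has_deriv[OF F \<open>Suc i < s\<close>]
    by (auto intro: exI[of _ "F (Suc i)"])
qed

section \<open>Weak functions on a mesh\<close>

locale mesh =
  fixes N :: nat and x :: "nat \<Rightarrow> real"
  assumes partition: "is_partition N x"
begin

abbreviation E :: "nat \<Rightarrow> real measure" where "E i \<equiv> lebI (x i) (x (Suc i))"

definition "h = mesh_size N x"

lemma ends: "x 1 = 0" "x N = 1" "2 \<le> N"
  using partition by (auto simp: is_partition_def)

lemma elem_less: "i \<in> {1..<N} \<Longrightarrow> x i < x (Suc i)"
  using partition by (simp add: is_partition_def)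

lemma node_mono:
  assumes "1 \<le> i" "i \<le> j" "j \<le> N" shows "x i \<le> x j"
  using assms(2,1,3)
proof (induction j rule: dec_induct)
  case (step n)
  then show ?case using elem_less[of n] by simp
qed simp

lemma node_bounds: "1 \<le> i \<Longrightarrow> i \<le> N \<Longrightarrow> 0 \<le> x i \<and> x i \<le> 1"
  using node_mono[of 1 i] node_mono[of i N] ends by simp

lemma elem_bounds:
  assumes "i \<in> {1..<N}" shows "0 \<le> x i" "x i < x (Suc i)" "x (Suc i) \<le> 1"
  using node_bounds[of i] node_bounds[of "Suc i"] elem_less[OF assms] assms by auto

lemma elem_le_h: "i \<in> {1..<N} \<Longrightarrow> x (Suc i) - x i \<le> h"
  unfolding h_def mesh_size_def by (rule Max_ge) auto

lemma h_pos: "0 < h"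
  using elem_le_h[of 1] elem_less[of 1] ends by simp

lemma sum_elements:
  fixes f :: "real \<Rightarrow> real"
  assumes f: "integrable (lebI 0 1) f"
  shows "(\<Sum>i\<in>{1..<N}. \<integral>y. f y \<partial>E i) = (\<integral>y. f y \<partial>lebI 0 1)"
proof -
  have "(\<Sum>i\<in>{1..<n}. \<integral>y. f y \<partial>E i) = (\<integral>y. f y \<partial>lebI 0 (x n))" if "1 \<le> n" "n \<le> N" for n
    using that
  proof (induction n rule: dec_induct)
    case base
    have "(\<integral>y. f y \<partial>lebI 0 0) = 0" by (rule integral_eq_zero_AE) (simp add: AE_lebI_iff)
    then show ?case using ends by simp
  next
    case (step n)
    have "{1..<Suc n} = insert n {1..<n}" using step by auto
    then have "(\<Sum>i\<in>{1..<Suc n}. \<integral>y. f y \<partial>E i) = (\<integral>y. f y \<partial>E n) + (\<integral>y. f y \<partial>lebI 0 (x n))"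
      using step by simp
    also have "\<dots> = (\<integral>y. f y \<partial>lebI 0 (x (Suc n)))"
      using integral_lebI_combine[OF integrable_lebI_subset[OF f], of 0 "x (Suc n)" "x n"] step elem_bounds[of n] by simp
    finally show ?case .
  qed
  from this[of N] show ?thesis using ends by simp
qed

section \<open>Elementwise inner product and norm\<close>

definition bl2 :: "(nat \<Rightarrow> real \<Rightarrow> real) \<Rightarrow> bool" where
  "bl2 f \<longleftrightarrow> (\<forall>i\<in>{1..<N}. square_integrable (E i) (f i))"

definition bcont :: "(nat \<Rightarrow> real \<Rightarrow> real) \<Rightarrow> bool" where
  "bcont f \<longleftrightarrow> (\<forall>i\<in>{1..<N}. continuous_on {x i..x (Suc i)} (f i))"

lemma bl2D: "bl2 f \<Longrightarrow> i \<in> {1..<N} \<Longrightarrow> square_integrable (E i) (f i)"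
  by (simp add: bl2_def)

lemma bcont_bl2: "bcont f \<Longrightarrow> bl2 f"
  unfolding bcont_def bl2_def by (intro ballI square_integrable_continuous) auto

lemma bcont_poly: "bcont (\<lambda>i y. poly (p i) y)"
  unfolding bcont_def by (intro ballI continuous_on_poly_real)

lemma bcont_poly': "bcont (\<lambda>i. poly (p i))"
  by (rule bcont_poly)

lemma bcont_global:
  assumes "continuous_on {0..1} f" shows "bcont (\<lambda>i. f)"
  unfolding bcont_def
proof
  fix i assume i: "i \<in> {1..<N}"
  show "continuous_on {x i..x (Suc i)} f"
    by (rule continuous_on_subset[OF assms]) (use elem_bounds[OF i] in auto)
qed

lemma bcont_mult: "bcont f \<Longrightarrow> bcont g \<Longrightarrow> bcont (\<lambda>i y. f i y * g i y)"
  unfolding bcont_def by (intro ballI continuous_intros) auto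

lemma bcont_diff: "bcont f \<Longrightarrow> bcont g \<Longrightarrow> bcont (\<lambda>i y. f i y - g i y)"
  unfolding bcont_def by (intro ballI continuous_intros) auto

lemma bcont_add: "bcont f \<Longrightarrow> bcont g \<Longrightarrow> bcont (\<lambda>i y. f i y + g i y)"
  unfolding bcont_def by (intro ballI continuous_intros) auto

lemma bl2_global: "square_integrable (lebI 0 1) f \<Longrightarrow> bl2 (\<lambda>i. f)"
  unfolding bl2_def using elem_bounds by (auto intro: square_integrable_lebI_subset)

lemma inner_h_eq: "inner_h N x f g = (\<Sum>i\<in>{1..<N}. \<integral>y. f i y * g i y \<partial>E i)"
  by (simp add: inner_h_def elem_def set_integral_lebesgue_on)

lemma inner_h_cong:
  "(\<And>i y. i \<in> {1..<N} \<Longrightarrow> y \<in> {x i<..<x (Suc i)} \<Longrightarrow> f i y * g i y = f' i y * g' i y) \<Longrightarrow>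
    inner_h N x f g = inner_h N x f' g'"
  unfolding inner_h_eq by (intro sum.cong refl Bochner_Integration.integral_cong) auto

lemma inner_h_add:
  assumes "bl2 f" "bl2 g" "bl2 w"
  shows "inner_h N x (\<lambda>i y. f i y + g i y) w = inner_h N x f w + inner_h N x g w"
  unfolding inner_h_eq sum.distrib[symmetric] distrib_right
  by (intro sum.cong refl Bochner_Integration.integral_add square_integrable_mult bl2D assms)

lemma inner_h_diff:
  assumes "bl2 f" "bl2 g" "bl2 w"
  shows "inner_h N x (\<lambda>i y. f i y - g i y) w = inner_h N x f w - inner_h N x g w"
  unfolding inner_h_eq sum_subtractf[symmetric] left_diff_distrib
  by (intro sum.cong refl Bochner_Integration.integral_diff square_integrable_mult bl2D assms)

lemma inner_h_scale: "inner_h N x (\<lambda>i y. c * f i y) w = c * inner_h N x f w"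
  by (simp add: inner_h_eq sum_distrib_left mult.assoc)

lemma norm_h_square: "(norm_h N x f)\<^sup>2 = inner_h N x f f"
proof -
  have "0 \<le> inner_h N x f f" unfolding inner_h_eq by (intro sum_nonneg integral_nonneg_AE) auto
  then show ?thesis by (simp add: norm_h_def)
qed

lemma norm_h_eq: "norm_h N x f = L2_set (\<lambda>i. l2n (E i) (f i)) {1..<N}"
  by (simp add: norm_h_def inner_h_eq L2_set_def l2n_square power2_eq_square[symmetric])

lemma norm_h_nonneg [simp]: "0 \<le> norm_h N x f"
  by (simp add: norm_h_eq)

lemma Cauchy_Schwarz_h:
  assumes "bl2 f" "bl2 g"
  shows "\<bar>inner_h N x f g\<bar> \<le> norm_h N x f * norm_h N x g"
proof -
  have "\<bar>inner_h N x f g\<bar> \<le> (\<Sum>i\<in>{1..<N}. \<bar>\<integral>y. f i y * g i y \<partial>E i\<bar>)" unfolding inner_h_eq by (rule sum_abs)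
  also have "\<dots> \<le> (\<Sum>i\<in>{1..<N}. \<bar>l2n (E i) (f i)\<bar> * \<bar>l2n (E i) (g i)\<bar>)"
    using Cauchy_Schwarz_l2[OF bl2D[OF assms(1)] bl2D[OF assms(2)]] by (intro sum_mono) simp
  also have "\<dots> \<le> norm_h N x f * norm_h N x g" unfolding norm_h_eq by (rule L2_set_mult_ineq)
  finally show ?thesis .
qed

lemma norm_h_mono:
  assumes "\<And>i. i \<in> {1..<N} \<Longrightarrow> l2n (E i) (f i) \<le> c * l2n (E i) (g i)" "0 \<le> c"
  shows "norm_h N x f \<le> c * norm_h N x g"
proof -
  have "norm_h N x f \<le> L2_set (\<lambda>i. c * l2n (E i) (g i)) {1..<N}"
    unfolding norm_h_eq by (rule L2_set_mono) (use assms in auto)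
  also have "\<dots> = c * norm_h N x g" unfolding norm_h_eq by (rule L2_set_right_distrib[symmetric, OF assms(2)])
  finally show ?thesis .
qed

lemma norm_h_triangle:
  assumes "bl2 f" "bl2 g"
  shows "norm_h N x (\<lambda>i y. f i y + g i y) \<le> norm_h N x f + norm_h N x g"
proof -
  have "norm_h N x (\<lambda>i y. f i y + g i y) \<le> L2_set (\<lambda>i. l2n (E i) (f i) + l2n (E i) (g i)) {1..<N}"
    unfolding norm_h_eq by (rule L2_set_mono, rule l2n_triangle[OF bl2D[OF assms(1)] bl2D[OF assms(2)]]) auto
  also have "\<dots> \<le> norm_h N x f + norm_h N x g" unfolding norm_h_eq by (rule L2_set_triangle_ineq)
  finally show ?thesis .
qed

lemma norm_h_minus_commute: "norm_h N x (\<lambda>i y. f i y - g i y) = norm_h N x (\<lambda>i y. g i y - f i y)"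
  unfolding norm_h_eq by (rule L2_set_cong[OF refl l2n_minus_commute])

lemma norm_h_bounded_mult:
  assumes f: "bl2 f" and g: "bcont g" and B: "0 \<le> B" "\<And>i y. i \<in> {1..<N} \<Longrightarrow> y \<in> {x i..x (Suc i)} \<Longrightarrow> \<bar>g i y\<bar> \<le> B"
  shows "norm_h N x (\<lambda>i y. g i y * f i y) \<le> B * norm_h N x f" and "bl2 (\<lambda>i y. g i y * f i y)"
proof -
  have m: "g i \<in> borel_measurable (E i)" if "i \<in> {1..<N}" for i
    using g that by (intro continuous_measurable_lebI) (auto simp: bcont_def)
  have ae: "AE y in E i. \<bar>g i y\<bar> \<le> B" if "i \<in> {1..<N}" for i
    using B(2)[OF that] by (intro AE_I2) auto
  show "norm_h N x (\<lambda>i y. g i y * f i y) \<le> B * norm_h N x f"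
    by (rule norm_h_mono[OF l2n_bounded_mult[OF bl2D[OF f] m ae B(1)] B(1)])
  show "bl2 (\<lambda>i y. g i y * f i y)"
    unfolding bl2_def by (intro ballI square_integrable_bounded_mult[OF bl2D[OF f] m ae])
qed

lemma norm_h_global:
  assumes "square_integrable (lebI 0 1) f"
  shows "norm_h N x (\<lambda>i. f) = l2n (lebI 0 1) f"
  unfolding norm_h_def inner_h_eq l2n_def
  using sum_elements[OF square_integrable_square[OF assms]] by (simp add: power2_eq_square)

text \<open>An elementwise polynomial as one function on the unit interval, zero at the nodes, so
  that estimates for functions on the whole interval apply to interior parts.\<close>

definition glue :: "(nat \<Rightarrow> real poly) \<Rightarrow> real \<Rightarrow> real" where
  "glue p y = (\<Sum>i\<in>{1..<N}. indicator {x i<..<x (Suc i)} y * poly (p i) y)"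

lemma glue_elem:
  assumes i: "i \<in> {1..<N}" and y: "y \<in> {x i<..<x (Suc i)}"
  shows "glue p y = poly (p i) y"
proof -
  have "indicator {x j<..<x (Suc j)} y * poly (p j) y = (if j = i then poly (p i) y else 0)" if j: "j \<in> {1..<N}" for j
  proof -
    have "y \<notin> {x j<..<x (Suc j)}" if "j \<noteq> i"
      using node_mono[of "Suc j" i] node_mono[of "Suc i" j] i j y that by (cases "j < i") auto
    then show ?thesis using y by (auto simp: indicator_def)
  qed
  then have "glue p y = (\<Sum>j\<in>{1..<N}. if j = i then poly (p i) y else 0)"
    unfolding glue_def by (intro sum.cong) auto
  then show ?thesis using i by simp
qed

lemma glue_measurable: "glue p \<in> borel_measurable (lebI 0 1)"
proof -
  have "glue p \<in> borel_measurable borel" unfolding glue_def by (intro borel_measurable_sum borel_measurable_times borel_measurable_indicator borel_measurable_continuous_onI continuous_on_poly_real) auto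
  then have "glue p \<in> borel_measurable lborel" by simp
  then show ?thesis by (intro measurable_restrict_space1 measurable_completion)
qed

lemma glue_bounded: "\<exists>B\<ge>0. \<forall>y. \<bar>glue p y\<bar> \<le> B"
proof -
  have "\<exists>B\<ge>0. \<forall>y\<in>{0..1}. \<bar>poly (p i) y\<bar> \<le> B" for i
    by (rule continuous_bounded_interval[OF continuous_on_poly_real]) blast
  then obtain B where B: "\<And>i. 0 \<le> B i" "\<And>i y. y \<in> {0..1} \<Longrightarrow> \<bar>poly (p i) y\<bar> \<le> B i" by metis
  have "\<bar>glue p y\<bar> \<le> (\<Sum>i\<in>{1..<N}. B i)" for y
    unfolding glue_def
  proof (rule order_trans[OF sum_abs sum_mono])
    fix i assume i: "i \<in> {1..<N}"
    show "\<bar>indicator {x i<..<x (Suc i)} y * poly (p i) y\<bar> \<le> B i"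
      using B(1)[of i] B(2)[of y i] elem_bounds[OF i] by (auto simp: indicator_def)
  qed
  then show ?thesis using B(1) by (meson sum_nonneg)
qed

lemma square_integrable_glue: "square_integrable (lebI 0 1) (glue p)"
  using glue_bounded[of p] by (auto intro: square_integrable_bounded[OF finite_measure_lebI glue_measurable])

lemma inner_h_glue:
  assumes f: "square_integrable (lebI 0 1) f"
  shows "inner_h N x (\<lambda>i. f) (\<lambda>i. poly (p i)) = pair f (glue p)"
proof -
  have "inner_h N x (\<lambda>i. f) (\<lambda>i. poly (p i)) = (\<Sum>i\<in>{1..<N}. \<integral>y. f y * glue p y \<partial>E i)"
    unfolding inner_h_eq by (intro sum.cong refl Bochner_Integration.integral_cong) (auto simp: glue_elem)
  also have "\<dots> = pair f (glue p)" by (rule sum_elements[OF square_integrable_mult[OF f square_integrable_glue]])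
  finally show ?thesis .
qed

lemma norm_h_glue: "l2n (lebI 0 1) (glue p) = norm_h N x (\<lambda>i. poly (p i))"
proof -
  have "norm_h N x (\<lambda>i. poly (p i)) = norm_h N x (\<lambda>i. glue p)"
    unfolding norm_h_eq by (intro L2_set_cong refl l2n_cong) (auto simp: glue_elem)
  then show ?thesis using norm_h_global[OF square_integrable_glue] by simp
qed

section \<open>Projection, discrete weak derivative and interpolated fluxes\<close>

lemma L2_proj_eq: "L2_proj x k w i = poly_proj k (x i) (x (Suc i)) w"
  by (simp add: L2_proj_def poly_proj_def elem_def set_integral_lebesgue_on)

text \<open>The uniqueness clause is the working tool: linearity and the value on \<open>Q_h\<close>
  are obtained by checking a candidate against the defining identity.\<close>

lemma weak_diff_spec:
  assumes i: "i \<in> {1..<N}"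
  shows degree_weak_diff: "degree (weak_diff x r v i) \<le> r"
    and weak_diff_inner: "degree q \<le> r \<Longrightarrow> (\<integral>y. poly (weak_diff x r v i) y * poly q y \<partial>E i) =
        - (\<integral>y. poly (inner_part v i) y * poly (pderiv q) y \<partial>E i)
        + node_val v (Suc i) * poly q (x (Suc i)) - node_val v i * poly q (x i)"
    and weak_diff_unique: "degree p \<le> r \<Longrightarrow> (\<And>q. degree q \<le> r \<Longrightarrow> (\<integral>y. poly p y * poly q y \<partial>E i) =
        - (\<integral>y. poly (inner_part v i) y * poly (pderiv q) y \<partial>E i)
        + node_val v (Suc i) * poly q (x (Suc i)) - node_val v i * poly q (x i)) \<Longrightarrow> weak_diff x r v i = p"
proof -
  define l where "l q = - (\<integral>y. poly (inner_part v i) y * poly (pderiv q) y \<partial>E i)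
        + node_val v (Suc i) * poly q (x (Suc i)) - node_val v i * poly q (x i)" for q
  have ex: "\<exists>!p. degree p \<le> r \<and> (\<forall>q. degree q \<le> r \<longrightarrow> (\<integral>y. poly p y * poly q y \<partial>E i) = l q)"
  proof (rule poly_riesz[OF elem_less[OF i]])
    show "l (p + q) = l p + l q" for p q
      using integrable_poly_mult[of "x i" "x (Suc i)" "inner_part v i" "pderiv p"]
        integrable_poly_mult[of "x i" "x (Suc i)" "inner_part v i" "pderiv q"]
      by (simp add: l_def pderiv_add distrib_left)
    show "l (smult c p) = c * l p" for c p
    proof -
      have "(\<integral>y. poly (inner_part v i) y * (c * poly (pderiv p) y) \<partial>E i) = c * (\<integral>y. poly (inner_part v i) y * poly (pderiv p) y \<partial>E i)"
        by (subst mult.left_commute) (rule integral_mult_right_zero)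
      then show ?thesis by (simp add: l_def pderiv_smult algebra_simps)
    qed
  qed
  have eq: "weak_diff x r v i = (THE p. degree p \<le> r \<and> (\<forall>q. degree q \<le> r \<longrightarrow> (\<integral>y. poly p y * poly q y \<partial>E i) = l q))"
    by (simp add: weak_diff_def l_def elem_def set_integral_lebesgue_on)
  show "degree (weak_diff x r v i) \<le> r" unfolding eq using theI'[OF ex] by blast
  show "degree q \<le> r \<Longrightarrow> (\<integral>y. poly (weak_diff x r v i) y * poly q y \<partial>E i) =
        - (\<integral>y. poly (inner_part v i) y * poly (pderiv q) y \<partial>E i)
        + node_val v (Suc i) * poly q (x (Suc i)) - node_val v i * poly q (x i)"
    unfolding eq l_def[symmetric] using theI'[OF ex] by blast
  show "weak_diff x r v i = p" if "degree p \<le> r" "\<And>q. degree q \<le> r \<Longrightarrow> (\<integral>y. poly p y * poly q y \<partial>E i) =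
        - (\<integral>y. poly (inner_part v i) y * poly (pderiv q) y \<partial>E i)
        + node_val v (Suc i) * poly q (x (Suc i)) - node_val v i * poly q (x i)"
    unfolding eq by (rule the1_equality[OF ex]) (use that in \<open>simp add: l_def\<close>)
qed

lemma weak_diff_diff:
  assumes i: "i \<in> {1..<N}"
  shows "weak_diff x r (Weak_Fun (\<lambda>i. inner_part v i - inner_part w i) (\<lambda>i. node_val v i - node_val w i)) i
    = weak_diff x r v i - weak_diff x r w i"
proof (rule weak_diff_unique[OF i])
  show "degree (weak_diff x r v i - weak_diff x r w i) \<le> r"
    by (rule degree_diff_le[OF degree_weak_diff[OF i] degree_weak_diff[OF i]])
  fix q :: "real poly" assume q: "degree q \<le> r"
  have "(\<integral>y. poly (weak_diff x r v i - weak_diff x r w i) y * poly q y \<partial>E i)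
     = (\<integral>y. poly (weak_diff x r v i) y * poly q y \<partial>E i) - (\<integral>y. poly (weak_diff x r w i) y * poly q y \<partial>E i)"
    unfolding poly_diff left_diff_distrib by (rule Bochner_Integration.integral_diff[OF integrable_poly_mult integrable_poly_mult])
  moreover have "(\<integral>y. poly (inner_part v i - inner_part w i) y * poly (pderiv q) y \<partial>E i)
     = (\<integral>y. poly (inner_part v i) y * poly (pderiv q) y \<partial>E i) - (\<integral>y. poly (inner_part w i) y * poly (pderiv q) y \<partial>E i)"
    unfolding poly_diff left_diff_distrib by (rule Bochner_Integration.integral_diff[OF integrable_poly_mult integrable_poly_mult])
  ultimately show "(\<integral>y. poly (weak_diff x r v i - weak_diff x r w i) y * poly q y \<partial>E i) =
        - (\<integral>y. poly (inner_part (Weak_Fun (\<lambda>i. inner_part v i - inner_part w i) (\<lambda>i. node_val v i - node_val w i)) i) y * poly (pderiv q) y \<partial>E i)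
        + node_val (Weak_Fun (\<lambda>i. inner_part v i - inner_part w i) (\<lambda>i. node_val v i - node_val w i)) (Suc i) * poly q (x (Suc i))
        - node_val (Weak_Fun (\<lambda>i. inner_part v i - inner_part w i) (\<lambda>i. node_val v i - node_val w i)) i * poly q (x i)"
    by (simp only: weak_diff_inner[OF i q] weak_fun.sel) (simp add: algebra_simps)
qed

text \<open>For \<open>q\<close> of degree at most \<open>k + 1\<close> the derivative has degree at
  most \<open>k\<close>, so the interior projection in the defining identity may be replaced by
  \<open>w\<close>; integration by parts turns the rest into the pairing of \<open>w'\<close> with
  \<open>q\<close>. Here the choice \<open>r = k + 1\<close> fits the interior degree
  \<open>k\<close>.\<close>

lemma weak_diff_Q_h:
  assumes i: "i \<in> {1..<N}" and w: "\<And>y. y \<in> {0..1} \<Longrightarrow> (w has_real_derivative w' y) (at y within {0..1})"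
    and w': "continuous_on {0..1} w'"
  shows "weak_diff x (Suc k) (Q_h x k w) i = poly_proj (Suc k) (x i) (x (Suc i)) w'"
proof (rule weak_diff_unique[OF i])
  have sub: "{x i..x (Suc i)} \<subseteq> {0..1}" using elem_bounds[OF i] by auto
  have wc: "continuous_on {0..1} w" using w by (meson DERIV_continuous continuous_on_eq_continuous_within)
  note wc' = continuous_on_subset[OF wc sub] and w'c = continuous_on_subset[OF w' sub]
  show "degree (poly_proj (Suc k) (x i) (x (Suc i)) w') \<le> Suc k"
    by (rule degree_poly_proj[OF elem_less[OF i] square_integrable_continuous[OF w'c]])
  fix q :: "real poly" assume q: "degree q \<le> Suc k"
  have dq: "degree (pderiv q) \<le> k" using q by (simp add: degree_pderiv)
  have "(\<integral>y. w' y * poly q y + w y * poly (pderiv q) y \<partial>E i) = w (x (Suc i)) * poly q (x (Suc i)) - w (x i) * poly q (x i)"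
  proof (rule FTC_lebI)
    fix y assume y: "y \<in> {x i..x (Suc i)}"
    have "(w has_real_derivative w' y) (at y within {x i..x (Suc i)})"
      by (rule has_field_derivative_subset[OF w sub]) (use y sub in auto)
    from DERIV_mult[OF this has_field_derivative_at_within[OF poly_DERIV]]
    show "((\<lambda>y. w y * poly q y) has_real_derivative w' y * poly q y + w y * poly (pderiv q) y) (at y within {x i..x (Suc i)})"
      by (simp add: mult.commute)
  qed (use elem_less[OF i] in \<open>auto intro!: continuous_intros wc' w'c\<close>)
  moreover have "(\<integral>y. w' y * poly q y + w y * poly (pderiv q) y \<partial>E i) = (\<integral>y. w' y * poly q y \<partial>E i) + (\<integral>y. w y * poly (pderiv q) y \<partial>E i)"
    by (intro Bochner_Integration.integral_add integrable_continuous_lebI continuous_intros wc' w'c)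
  moreover have "(\<integral>y. poly (poly_proj (Suc k) (x i) (x (Suc i)) w') y * poly q y \<partial>E i) = (\<integral>y. w' y * poly q y \<partial>E i)"
    by (rule poly_proj_inner[OF elem_less[OF i] square_integrable_continuous[OF w'c] q])
  moreover have "(\<integral>y. poly (L2_proj x k w i) y * poly (pderiv q) y \<partial>E i) = (\<integral>y. w y * poly (pderiv q) y \<partial>E i)"
    unfolding L2_proj_eq by (rule poly_proj_inner[OF elem_less[OF i] square_integrable_continuous[OF wc'] dq])
  ultimately show "(\<integral>y. poly (poly_proj (Suc k) (x i) (x (Suc i)) w') y * poly q y \<partial>E i) =
        - (\<integral>y. poly (inner_part (Q_h x k w) i) y * poly (pderiv q) y \<partial>E i)
        + node_val (Q_h x k w) (Suc i) * poly q (x (Suc i)) - node_val (Q_h x k w) i * poly q (x i)"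
    by (simp add: Q_h_def)
qed

text \<open>Interpolating the flux turns \<open>(w', v\<^sup>0)\<close> into \<open>- (P, d\<^sub>w v)\<close>: the nodal terms telescope since
  \<open>P\<close> is continuous across the nodes.\<close>

lemma flux_interpolant:
  assumes w': "square_integrable (lebI 0 1) w'"
    and w: "\<And>a b. 0 \<le> a \<Longrightarrow> a \<le> b \<Longrightarrow> b \<le> 1 \<Longrightarrow> w b - w a = (\<integral>z. w' z \<partial>lebI a b)"
    and chain: "sobolev_chain k F" "F 0 = w'"
  obtains P where "\<And>i. i \<in> {1..<N} \<Longrightarrow> degree (P i) \<le> Suc k"
    "\<And>v. v \<in> wg_space0 N k \<Longrightarrow> inner_h N x (\<lambda>i. w') (\<lambda>i. poly (inner_part v i)) = - inner_h N x (\<lambda>i. poly (P i)) (\<lambda>i. poly (weak_diff x (Suc k) v i))"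
    "norm_h N x (\<lambda>i y. w y - poly (P i) y) \<le> h ^ Suc k * l2n (lebI 0 1) (F k)"
proof -
  have sq: "square_integrable (E i) w'" if "i \<in> {1..<N}" for i
    by (rule square_integrable_lebI_subset[OF w']) (use elem_bounds[OF that] in auto)
  define interp where "interp i P \<longleftrightarrow> degree P \<le> Suc k \<and> poly P (x i) = w (x i) \<and> poly P (x (Suc i)) = w (x (Suc i)) \<and>
      pderiv P = poly_proj k (x i) (x (Suc i)) w' \<and>
      (\<forall>q. degree q \<le> k \<longrightarrow> l2n (E i) (\<lambda>y. w y - poly P y) \<le> (x (Suc i) - x i) * l2n (E i) (\<lambda>y. w' y - poly q y))" for i P
  have "\<exists>P. interp i P" if i: "i \<in> {1..<N}" for i
  proof -
    have w1: "w y - w (x i) = (\<integral>z. w' z \<partial>lebI (x i) y)" if "y \<in> {x i..x (Suc i)}" for y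
      by (rule w) (use elem_bounds[OF i] that in auto)
    show ?thesis
    proof (rule exists_flux_interpolant[OF elem_less[OF i] sq[OF i] w1, of k])
      fix P assume *: "degree P \<le> Suc k" "poly P (x i) = w (x i)" "poly P (x (Suc i)) = w (x (Suc i))"
        "pderiv P = poly_proj k (x i) (x (Suc i)) w'"
        "\<And>q. degree q \<le> k \<Longrightarrow> l2n (E i) (\<lambda>y. w y - poly P y) \<le> (x (Suc i) - x i) * l2n (E i) (\<lambda>y. w' y - poly q y)"
      show ?thesis unfolding interp_def by (intro exI[of _ P] conjI allI impI *)
    qed
  qed
  then obtain P where P0: "\<And>i. i \<in> {1..<N} \<Longrightarrow> interp i (P i)"
    by metis
  note P = P0[unfolded interp_def]
  show ?thesis
  proof (rule that[of P])
    show "degree (P i) \<le> Suc k" if "i \<in> {1..<N}" for i using P[OF that] by simp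
  next
    fix v assume v: "v \<in> wg_space0 N k"
    have el: "(\<integral>y. poly (P i) y * poly (weak_diff x (Suc k) v i) y \<partial>E i)
        = - (\<integral>y. w' y * poly (inner_part v i) y \<partial>E i) + (node_val v (Suc i) * w (x (Suc i)) - node_val v i * w (x i))"
      if i: "i \<in> {1..<N}" for i
    proof -
      have vd: "degree (inner_part v i) \<le> k" using v i by (auto simp: wg_space0_def wg_space_def)
      have "(\<integral>y. poly (P i) y * poly (weak_diff x (Suc k) v i) y \<partial>E i) = (\<integral>y. poly (weak_diff x (Suc k) v i) y * poly (P i) y \<partial>E i)"
        by (simp add: mult.commute)
      \<comment> \<open>\<open>P i\<close> has degree at most \<open>k + 1\<close>, so it may be
        tested in the weak derivative; its own derivative is the projection of \<open>w'\<close>,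
        which acts on the interior part like \<open>w'\<close>.\<close>
      also have "\<dots> = - (\<integral>y. poly (inner_part v i) y * poly (pderiv (P i)) y \<partial>E i)
        + node_val v (Suc i) * poly (P i) (x (Suc i)) - node_val v i * poly (P i) (x i)"
        by (rule weak_diff_inner[OF i]) (use P[OF i] in simp)
      also have "(\<integral>y. poly (inner_part v i) y * poly (pderiv (P i)) y \<partial>E i) = (\<integral>y. w' y * poly (inner_part v i) y \<partial>E i)"
        using poly_proj_inner[OF elem_less[OF i] sq[OF i] vd] P[OF i] by (simp add: mult.commute)
      finally show ?thesis using P[OF i] by simp
    qed
    have "inner_h N x (\<lambda>i. poly (P i)) (\<lambda>i. poly (weak_diff x (Suc k) v i))
        = - inner_h N x (\<lambda>i. w') (\<lambda>i. poly (inner_part v i)) + (\<Sum>i\<in>{1..<N}. node_val v (Suc i) * w (x (Suc i)) - node_val v i * w (x i))"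
      unfolding inner_h_eq using el by (simp add: sum_subtractf)
    also have "(\<Sum>i\<in>{1..<N}. node_val v (Suc i) * w (x (Suc i)) - node_val v i * w (x i)) = node_val v N * w (x N) - node_val v 1 * w (x 1)"
      by (rule sum_Suc_diff') (use ends in simp)
    also have "\<dots> = 0" using v by (simp add: wg_space0_def)
    finally show "inner_h N x (\<lambda>i. w') (\<lambda>i. poly (inner_part v i)) = - inner_h N x (\<lambda>i. poly (P i)) (\<lambda>i. poly (weak_diff x (Suc k) v i))"
      by simp
  next
    have "norm_h N x (\<lambda>i y. w y - poly (P i) y) \<le> h ^ Suc k * norm_h N x (\<lambda>i. F k)"
    proof (rule norm_h_mono)
      fix i assume i: "i \<in> {1..<N}"
      note eb = elem_bounds[OF i]
      define d where "d = x (Suc i) - x i"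
      have d: "0 < d" "d \<le> h" using eb elem_le_h[OF i] by (auto simp: d_def)
      obtain p where p: "p = 0 \<or> degree p < k" "l2n (E i) (\<lambda>y. F 0 y - poly p y) \<le> d ^ k * l2n (E i) (F k)"
        using sobolev_chain_poly_approx[OF chain(1) eb] unfolding d_def by blast
      have "degree p \<le> k" using p(1) by auto
      \<comment> \<open>One power of the length \<open>d\<close> comes from the interpolation, the
        other \<open>k\<close> from the polynomial approximation of \<open>w'\<close>.\<close>
      then have "l2n (E i) (\<lambda>y. w y - poly (P i) y) \<le> d * l2n (E i) (\<lambda>y. w' y - poly p y)"
        using P[OF i] by (simp add: d_def)
      also have "\<dots> \<le> d * (d ^ k * l2n (E i) (F k))"
        using p(2) d unfolding chain(2) by (intro mult_left_mono) auto
      also have "\<dots> = d ^ Suc k * l2n (E i) (F k)" by simp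
      also have "\<dots> \<le> h ^ Suc k * l2n (E i) (F k)"
        by (intro mult_right_mono power_mono) (use d in auto)
      finally show "l2n (E i) (\<lambda>y. w y - poly (P i) y) \<le> h ^ Suc k * l2n (E i) (F k)" .
    qed (use h_pos in simp)
    then show "norm_h N x (\<lambda>i y. w y - poly (P i) y) \<le> h ^ Suc k * l2n (lebI 0 1) (F k)"
      using norm_h_global[OF sobolev_chain_square_integrable[OF chain(1)], of k] by simp
  qed
qed

lemma projection_error:
  assumes F: "sobolev_chain (Suc k) F"
  shows "norm_h N x (\<lambda>i y. F 0 y - poly (L2_proj x k (F 0) i) y) \<le> h ^ Suc k * l2n (lebI 0 1) (F (Suc k))"
proof -
  have "norm_h N x (\<lambda>i y. F 0 y - poly (L2_proj x k (F 0) i) y) \<le> h ^ Suc k * norm_h N x (\<lambda>i. F (Suc k))"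
  proof (rule norm_h_mono)
    fix i assume i: "i \<in> {1..<N}"
    note eb = elem_bounds[OF i]
    obtain p where p: "p = 0 \<or> degree p < Suc k" "l2n (E i) (\<lambda>y. F 0 y - poly p y) \<le> (x (Suc i) - x i) ^ Suc k * l2n (E i) (F (Suc k))"
      using sobolev_chain_poly_approx[OF F eb] by blast
    have sq: "square_integrable (E i) (F 0)"
      by (rule square_integrable_lebI_subset[OF sobolev_chain_square_integrable[OF F]]) (use eb in auto)
    have "degree p \<le> k" using p(1) by auto
    from poly_proj_best[OF eb(2) sq this]
    have "l2n (E i) (\<lambda>y. F 0 y - poly (L2_proj x k (F 0) i) y) \<le> (x (Suc i) - x i) ^ Suc k * l2n (E i) (F (Suc k))"
      unfolding L2_proj_eq using p(2) by linarith
    also have "\<dots> \<le> h ^ Suc k * l2n (E i) (F (Suc k))"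
      by (intro mult_right_mono power_mono elem_le_h[OF i]) (use eb in auto)
    finally show "l2n (E i) (\<lambda>y. F 0 y - poly (L2_proj x k (F 0) i) y) \<le> h ^ Suc k * l2n (E i) (F (Suc k))" .
  qed (use h_pos in simp)
  then show ?thesis using norm_h_global[OF sobolev_chain_square_integrable[OF F], of "Suc k"] by simp
qed

end

section \<open>The error equation and the error estimate\<close>

lemma Young_weighted:
  fixes a p q :: real assumes "a > 0" shows "2 * (p * q) \<le> a * p\<^sup>2 + q\<^sup>2 / a"
proof -
  have "0 \<le> (a * p - q)\<^sup>2 / a" using assms by simp
  also have "\<dots> = a * p\<^sup>2 - 2 * (p * q) + q\<^sup>2 / a"
    using assms by (simp add: power2_diff power_mult_distrib power2_eq_square field_simps)
  finally show ?thesis by simp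
qed

text \<open>Doubling \<open>step\<close> makes \<open>2 * \<nu> * d^2\<close> of dissipation
  available. By Young's inequality one half pays for the terms in \<open>B * d\<close> and the other
  for \<open>c3 * (y * d)\<close>; what remains is quadratic in \<open>y\<close> and
  \<open>B\<close>, plus the truncation term \<open>\<tau> * I\<close>.\<close>

lemma energy_step_inequality:
  fixes \<nu> \<tau> y y0 d B I m X R c1 c2 c3 c4 :: real
  assumes nu: "\<nu> > 0" and \<tau>: "\<tau> > 0" and I: "0 \<le> I"
    and step: "(y\<^sup>2 - y0\<^sup>2) / 2 \<le> R - \<tau> * (\<nu> * (m + d\<^sup>2) + 1/3 * X)"
    and R: "\<bar>R\<bar> \<le> \<tau> * (sqrt \<tau> * sqrt I) * y" and m: "\<bar>m\<bar> \<le> 2 * (B * d)"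
    and X: "\<bar>X\<bar> \<le> 3 * (c1 * (B * y) + c2 * y\<^sup>2 + c3 * (y * d) + c4 * (B * d))"
  shows "y\<^sup>2 - y0\<^sup>2 \<le> \<tau> * (2 * (1 + c2 + c3\<^sup>2 / (2 * \<nu>)) * y\<^sup>2 + ((2 * \<nu> + c4)\<^sup>2 / \<nu> + c1\<^sup>2) * B\<^sup>2 + \<tau> * I)"
proof -
  have half: "A \<le> 2 * Z" if "A / 2 \<le> Z" for A Z :: real using that by simp
  have "- m \<le> 2 * (B * d)" using m by simp
  then have m': "- (\<nu> * m) \<le> \<nu> * (2 * (B * d))" using mult_left_mono[of "- m" "2 * (B * d)" \<nu>] nu by simp
  have "R - \<tau> * (\<nu> * (m + d\<^sup>2) + 1/3 * X)
      = R + \<tau> * (- (\<nu> * m) - \<nu> * d\<^sup>2 - 1/3 * X)"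
    by (simp add: algebra_simps)
  also have "\<dots> \<le> \<tau> * (sqrt \<tau> * sqrt I) * y + \<tau> * (\<nu> * (2 * (B * d)) - \<nu> * d\<^sup>2
      + (c1 * (B * y) + c2 * y\<^sup>2 + c3 * (y * d) + c4 * (B * d)))"
  proof (rule add_mono)
    show "R \<le> \<tau> * (sqrt \<tau> * sqrt I) * y" using R by simp
    have "- 1/3 * X \<le> c1 * (B * y) + c2 * y\<^sup>2 + c3 * (y * d) + c4 * (B * d)" using X by simp
    then show "\<tau> * (- (\<nu> * m) - \<nu> * d\<^sup>2 - 1/3 * X) \<le> \<tau> * (\<nu> * (2 * (B * d)) - \<nu> * d\<^sup>2
      + (c1 * (B * y) + c2 * y\<^sup>2 + c3 * (y * d) + c4 * (B * d)))"
      using m' \<tau> by (intro mult_left_mono) auto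
  qed
  finally have "y\<^sup>2 - y0\<^sup>2 \<le> 2 * (\<tau> * (sqrt \<tau> * sqrt I) * y + \<tau> * (\<nu> * (2 * (B * d)) - \<nu> * d\<^sup>2
      + (c1 * (B * y) + c2 * y\<^sup>2 + c3 * (y * d) + c4 * (B * d))))"
    by (rule half[OF order_trans[OF step]])
  then have 1: "y\<^sup>2 - y0\<^sup>2 \<le> \<tau> * (2 * ((sqrt \<tau> * sqrt I) * y) + 2 * (((2 * \<nu> + c4) * B) * d) - 2 * \<nu> * d\<^sup>2
      + 2 * ((c1 * B) * y) + 2 * c2 * y\<^sup>2 + 2 * ((c3 * y) * d))"
    by (simp add: algebra_simps)
  have a: "2 * ((sqrt \<tau> * sqrt I) * y) \<le> \<tau> * I + y\<^sup>2"
    using Young_weighted[of 1 "sqrt \<tau> * sqrt I" y] \<tau> I by (simp add: power_mult_distrib)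
  have b: "2 * (((2 * \<nu> + c4) * B) * d) \<le> \<nu> * d\<^sup>2 + (2 * \<nu> + c4)\<^sup>2 / \<nu> * B\<^sup>2"
    using Young_weighted[OF nu, of d "(2 * \<nu> + c4) * B"] by (simp add: power_mult_distrib mult.commute mult.left_commute)
  have c: "2 * ((c1 * B) * y) \<le> c1\<^sup>2 * B\<^sup>2 + y\<^sup>2"
    using Young_weighted[of 1 "c1 * B" y] by (simp add: power_mult_distrib)
  have e: "2 * ((c3 * y) * d) \<le> \<nu> * d\<^sup>2 + c3\<^sup>2 / \<nu> * y\<^sup>2"
    using Young_weighted[OF nu, of d "c3 * y"] by (simp add: power_mult_distrib mult.commute mult.left_commute)
  have "2 * ((sqrt \<tau> * sqrt I) * y) + 2 * (((2 * \<nu> + c4) * B) * d) - 2 * \<nu> * d\<^sup>2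
      + 2 * ((c1 * B) * y) + 2 * c2 * y\<^sup>2 + 2 * ((c3 * y) * d)
     \<le> \<tau> * I + 2 * y\<^sup>2 + (2 * \<nu> + c4)\<^sup>2 / \<nu> * B\<^sup>2 + c1\<^sup>2 * B\<^sup>2 + 2 * c2 * y\<^sup>2 + c3\<^sup>2 / \<nu> * y\<^sup>2"
    using a b c e by linarith
  also have "\<dots> = 2 * (1 + c2 + c3\<^sup>2 / (2 * \<nu>)) * y\<^sup>2 + ((2 * \<nu> + c4)\<^sup>2 / \<nu> + c1\<^sup>2) * B\<^sup>2 + \<tau> * I"
    using nu by (simp add: field_simps)
  finally show ?thesis using 1 \<tau> by (meson less_imp_le mult_left_mono order_trans)
qed

text \<open>The step is implicit, so \<open>e n\<close> occurs on the right and has to be absorbed: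
  for \<open>z = L * \<tau> \<le> 1/2\<close> one has
  \<open>1 / (1 - z) \<le> 1 + 2 * z \<le> exp (2 * z)\<close>. This is the source of the
  restriction on the step.\<close>

lemma discrete_Gronwall:
  fixes e G :: "nat \<Rightarrow> real"
  assumes e0: "e 0 = 0" and G: "\<And>n. 0 \<le> G n" and L: "0 \<le> L" and \<tau>: "0 \<le> \<tau>" "L * \<tau> \<le> 1/2" and e: "\<And>n. 0 \<le> e n"
    and step: "\<And>n. n \<in> {1..M} \<Longrightarrow> e n - e (n - 1) \<le> \<tau> * (L * e n + G n)"
  shows "n \<le> M \<Longrightarrow> e n \<le> exp (2 * L * \<tau> * real n) * (\<tau> * (\<Sum>j\<in>{1..n}. G j))"
proof (induction n)
  case 0
  then show ?case by (simp add: e0)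
next
  case (Suc n)
  define z where "z = L * \<tau>"
  have z: "0 \<le> z" "z \<le> 1/2" using L \<tau> by (auto simp: z_def)
  have "(1 - z) * e (Suc n) \<le> e n + \<tau> * G (Suc n)"
    using step[of "Suc n"] Suc.prems by (simp add: z_def algebra_simps)
  then have "(1 + 2 * z) * ((1 - z) * e (Suc n)) \<le> (1 + 2 * z) * (e n + \<tau> * G (Suc n))"
    using z by (intro mult_left_mono) auto
  moreover have "1 * e (Suc n) \<le> ((1 + 2 * z) * (1 - z)) * e (Suc n)"
  proof (rule mult_right_mono[OF _ e])
    have "0 \<le> z * (1 - 2 * z)" using z by simp
    then show "1 \<le> (1 + 2 * z) * (1 - z)" by (simp add: algebra_simps)
  qed
  ultimately have "e (Suc n) \<le> (1 + 2 * z) * (e n + \<tau> * G (Suc n))" by (simp add: mult.assoc)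
  also have "\<dots> \<le> exp (2 * z) * (e n + \<tau> * G (Suc n))"
    using e[of n] G[of "Suc n"] \<tau> by (intro mult_right_mono exp_ge_add_one_self) auto
  also have "\<dots> \<le> exp (2 * z) * (exp (2 * L * \<tau> * real n) * (\<tau> * (\<Sum>j\<in>{1..n}. G j)) + exp (2 * L * \<tau> * real n) * (\<tau> * G (Suc n)))"
  proof (intro mult_left_mono add_mono)
    show "e n \<le> exp (2 * L * \<tau> * real n) * (\<tau> * (\<Sum>j\<in>{1..n}. G j))" using Suc by simp
    have "1 * (\<tau> * G (Suc n)) \<le> exp (2 * L * \<tau> * real n) * (\<tau> * G (Suc n))"
      using L \<tau> G by (intro mult_right_mono) auto
    then show "\<tau> * G (Suc n) \<le> exp (2 * L * \<tau> * real n) * (\<tau> * G (Suc n))" by simp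
  qed simp
  also have "\<dots> = (exp (2 * z) * exp (2 * L * \<tau> * real n)) * (\<tau> * (\<Sum>j\<in>{1..Suc n}. G j))"
    by (simp add: algebra_simps)
  also have "exp (2 * z) * exp (2 * L * \<tau> * real n) = exp (2 * L * \<tau> * real (Suc n))"
    by (simp add: z_def exp_add[symmetric] algebra_simps)
  finally show ?case .
qed

lemma continuous_l2n_zero:
  fixes c :: "real \<Rightarrow> real"
  assumes c: "continuous_on {0..1} c" and z: "(\<integral>y. (c y)\<^sup>2 \<partial>lebI 0 1) = 0" and y: "y \<in> {0..1}"
  shows "c y = 0"
proof -
  have c2: "continuous_on {0..1} (\<lambda>y. (c y)\<^sup>2)" by (intro continuous_intros c)
  have "integral {0..1} (\<lambda>y. (c y)\<^sup>2) = 0" using integral_lebI_eq[OF integrable_continuous_lebI[OF c2]] z by simp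
  then have "\<forall>y\<in>{0..1}. (c y)\<^sup>2 = 0" using integral_eq_0_iff[OF c2] by auto
  then show ?thesis using y by auto
qed

locale burgers_k = burgers_regular "k + 2" T \<nu> g u
  for k :: nat and T \<nu> :: real and g :: "real \<Rightarrow> real" and u :: "real \<Rightarrow> real \<Rightarrow> real"
begin

text \<open>The simplifier must not rewrite the parameter \<open>k + 2\<close>: the facts of the locale would no longer match.\<close>

declare add_2_eq_Suc [simp del] add_2_eq_Suc' [simp del]

abbreviation "S t \<equiv> sobolev_norm (k + 2) (u t)"

text \<open>\<open>KQ\<close> and \<open>KD\<close> are sup bounds for the projections of
  \<open>u\<close> and \<open>u_x\<close>; \<open>2 * norm_bound\<close> is what the Sobolev
  embedding gives before projection.\<close>

definition "KQ = proj_bound k * (2 * norm_bound)"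
definition "KD = proj_bound (Suc k) * (2 * norm_bound)"
text \<open>The constants \<open>c1\<close> to \<open>c4\<close> are the coefficients of
  \<open>B * y\<close>, \<open>y^2\<close>, \<open>y * d\<close> and \<open>B * d\<close> in the
  convection error, divided by 3 because of the factor in the scheme.\<close>

definition "c1 = (2 * norm_bound + KD) / 3"
definition "c2 = KD / 3"
definition "c3 = KQ / 3"
text \<open>The power \<open>2 ^ (k + 3)\<close> belongs to the interpolation of \<open>u^2\<close>:
  its derivative is a sum of two products, each bounded by \<open>2 ^ k\<close> times two factors
  \<open>2 * S t\<close>.\<close>

definition "c4 = (KQ + 2 * norm_bound + 2 ^ (k + 3) * norm_bound) / 3"
definition "growth = 2 * (1 + c2 + c3\<^sup>2 / (2 * \<nu>))"
definition "spatial = (2 * \<nu> + c4)\<^sup>2 / \<nu> + c1\<^sup>2"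
definition "u_tt_energy r t = (\<integral>\<sigma>. (l2n (lebI 0 1) (u_tt \<sigma>))\<^sup>2 \<partial>lebI r t)"

lemma KQ_nonneg: "0 \<le> KQ" and KD_nonneg: "0 \<le> KD"
  unfolding KQ_def KD_def by (intro mult_nonneg_nonneg proj_bound_nonneg norm_bound_nonneg zero_le_numeral)+

lemma growth_ge: "2 \<le> growth"
  using KD_nonneg nu by (simp add: growth_def c2_def)

lemma spatial_nonneg: "0 \<le> spatial"
  using nu by (simp add: spatial_def)

lemma u_tt_energy_nonneg: "0 \<le> u_tt_energy r t"
  by (simp add: u_tt_energy_def)

lemma u_tt_energy_mono: "0 \<le> r \<Longrightarrow> t \<le> t' \<Longrightarrow> t' \<le> T \<Longrightarrow> u_tt_energy r t \<le> u_tt_energy 0 t'"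
  unfolding u_tt_energy_def
  by (rule integral_lebI_le[OF integrable_lebI_subset[OF u_tt_square_integrable]]) auto

lemma u_tt_energy_split: "0 \<le> t \<Longrightarrow> t \<le> t' \<Longrightarrow> t' \<le> T \<Longrightarrow> u_tt_energy 0 t' = u_tt_energy 0 t + u_tt_energy t t'"
  unfolding u_tt_energy_def
  by (rule integral_lebI_combine[OF integrable_lebI_subset[OF u_tt_square_integrable]]) auto

lemma D_continuous: "t \<in> {0..T} \<Longrightarrow> j < k + 2 \<Longrightarrow> continuous_on {0..1} (D t j)"
  by (rule sobolev_chain_continuous[OF D_chain])

lemma u_has_deriv: "t \<in> {0..T} \<Longrightarrow> y \<in> {0..1} \<Longrightarrow> (u t has_real_derivative D t 1 y) (at y within {0..1})"
  using sobolev_chain_has_deriv[OF D_chain, of t 0 y] D_0[of t] by simp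

lemma u_le: "t \<in> {0..T} \<Longrightarrow> y \<in> {0..1} \<Longrightarrow> \<bar>u t y\<bar> \<le> 2 * norm_bound"
  using D_sup[of t 0 y] D_0[of t] u_norm_bound[of t] by simp

lemma u_x_le: "t \<in> {0..T} \<Longrightarrow> y \<in> {0..1} \<Longrightarrow> \<bar>D t 1 y\<bar> \<le> 2 * norm_bound"
  using D_sup[of t 1 y] u_norm_bound[of t] by simp

lemma u_l2n_le: "t \<in> {0..T} \<Longrightarrow> l2n (lebI 0 1) (u t) \<le> norm_bound"
  using l2n_le_sobolev_norm[OF u_sobolev] u_norm_bound order_trans by blast

text \<open>If \<open>u\<^sub>t\<^sub>t\<close> vanishes on \<open>(0, \<delta>)\<close>, then \<open>u\<close> is affine in time there, while the dissipation
  \<open>\<parallel>u\<^sub>x\<parallel>\<^sup>2\<close> is quadratic in time and, by the energy identity, affine: so \<open>u\<close> vanishes.\<close>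

lemma zero_if_u_tt_zero:
  assumes \<delta>: "0 < \<delta>" "\<delta> \<le> T" and z: "u_tt_energy 0 \<delta> = 0" and y: "y \<in> {0..1}"
  shows "u 0 y = 0"
proof -
  \<comment> \<open>Three times are enough to see second differences, and \<open>a\<close>,
    \<open>2 * a\<close>, \<open>3 * a\<close> are positive, as the boundary values require.\<close>
  define a where "a = \<delta> / 3"
  have a: "a > 0" "3 * a \<le> T" "3 * a = \<delta>" using \<delta> by (auto simp: a_def)
  have mem: "0 \<in> {0..T}" "a \<in> {0..T}" "2 * a \<in> {0..T}" "3 * a \<in> {0..T}" using a by auto
  note uc = continuous_u_space
  \<comment> \<open>Without \<open>u_tt\<close> the bound on the truncation error is zero, for any
    two times in the interval.\<close>
  have affine: "pair (u t) \<psi> - pair (u r) \<psi> = - ((t - r) * flux_pair t \<psi>)"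
    if rt: "0 \<le> r" "r < t" "t \<le> 3 * a" and \<psi>: "continuous_on {0..1} \<psi>" for r t \<psi>
  proof -
    obtain B where B: "\<And>y. y \<in> {0..1} \<Longrightarrow> \<bar>\<psi> y\<bar> \<le> B" using continuous_bounded_interval[OF \<psi>] by blast
    have B': "\<bar>\<psi> y\<bar> \<le> B" if "y \<in> {0<..<1}" for y using B[of y] that by simp
    have "u_tt_energy r t = 0" using u_tt_energy_mono[of r t \<delta>] u_tt_energy_nonneg[of r t] z rt a \<delta> by simp
    then have "\<bar>pair (\<lambda>y. u t y - u r y) \<psi> + (t - r) * flux_pair t \<psi>\<bar> \<le> 0"
      using time_consistency[OF continuous_measurable_lebI[OF \<psi>] B', of r t] rt a by (simp add: u_tt_energy_def)
    moreover have "pair (\<lambda>y. u t y - u r y) \<psi> = pair (u t) \<psi> - pair (u r) \<psi>"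
      by (rule pair_diff[OF square_integrable_u square_integrable_u square_integrable_continuous[OF \<psi>]]) (use rt a in auto)
    ultimately show ?thesis by simp
  qed
  have cont: "continuous_on {0..1} (u 0)" "continuous_on {0..1} (u a)" "continuous_on {0..1} (u (2*a))" "continuous_on {0..1} (u (3*a))"
    using uc mem by auto
  have pi: "integrable (lebI 0 1) (\<lambda>y. u t y * \<psi> y)" if "t \<in> {0..T}" "continuous_on {0..1} \<psi>" for t \<psi>
    by (intro integrable_continuous_lebI continuous_intros uc that)
  have zero: "c y = 0" if c: "continuous_on {0..1} c" and p: "pair c c = 0" and y: "y \<in> {0..1}" for c y
    using continuous_l2n_zero[OF c _ y] p by (simp add: power2_eq_square)
  \<comment> \<open>Second difference of \<open>u\<close> in time; it vanishes because both
    increments ending at \<open>3 * a\<close> are governed by the flux at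
    \<open>3 * a\<close>.\<close>
  define v where "v y = u a y - 2 * u (2*a) y + u (3*a) y" for y
  have vc: "continuous_on {0..1} v" unfolding v_def by (intro continuous_intros cont)
  have pv: "pair v \<psi> = pair (u a) \<psi> - 2 * pair (u (2*a)) \<psi> + pair (u (3*a)) \<psi>" if \<psi>: "continuous_on {0..1} \<psi>" for \<psi>
    using pi[OF mem(2) \<psi>] pi[OF mem(3) \<psi>] pi[OF mem(4) \<psi>]
    by (simp add: v_def distrib_right left_diff_distrib mult.assoc)
  have v0: "v y = 0" if "y \<in> {0..1}" for y
  proof (rule zero[OF vc _ that])
    show "pair v v = 0" using affine[of "2*a" "3*a" v] affine[of a "3*a" v] a(1,2) vc by (simp add: pv[OF vc])
  qed
  \<comment> \<open>The increment over one step of length \<open>a\<close>. It represents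
    \<open>- a\<close> times the flux at each of the three times; pairing it with \<open>u\<close>
    at that time gives the dissipation there.\<close>
  define q where "q y = u (2*a) y - u a y" for y
  have qc: "continuous_on {0..1} q" unfolding q_def by (intro continuous_intros cont)
  have pq: "pair q \<psi> = pair (u (2*a)) \<psi> - pair (u a) \<psi>" if \<psi>: "continuous_on {0..1} \<psi>" for \<psi>
    using pi[OF mem(2) \<psi>] pi[OF mem(3) \<psi>] by (simp add: q_def left_diff_distrib)
  have q1: "pair q \<psi> = - (a * flux_pair a \<psi>)" and q2: "pair q \<psi> = - (a * flux_pair (2*a) \<psi>)"
    and q3: "pair q \<psi> = - (a * flux_pair (3*a) \<psi>)" if \<psi>: "continuous_on {0..1} \<psi>" for \<psi>
  proof -
    have v\<psi>: "pair v \<psi> = 0" by (rule integral_eq_zero_AE) (auto intro!: AE_I2 simp: v0)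
    show "pair q \<psi> = - (a * flux_pair (2*a) \<psi>)" using affine[of a "2*a" \<psi>] a \<psi> by (simp add: pq)
    moreover have "pair (u (2*a)) \<psi> - pair (u 0) \<psi> = - (2 * (a * flux_pair (2*a) \<psi>))"
      using affine[of 0 "2*a" \<psi>] a \<psi> by (simp add: mult.assoc)
    moreover have "pair (u a) \<psi> - pair (u 0) \<psi> = - (a * flux_pair a \<psi>)"
      using affine[of 0 a \<psi>] a \<psi> by simp
    ultimately show "pair q \<psi> = - (a * flux_pair a \<psi>)" unfolding pq[OF \<psi>] by linarith
    show "pair q \<psi> = - (a * flux_pair (3*a) \<psi>)"
      using affine[of "2*a" "3*a" \<psi>] a(1,2) \<psi> v\<psi> pv[OF \<psi>] by (simp add: pq)
  qed
  have energy: "flux_pair t (u t) = \<nu> * (\<integral>y. (D t 1 y)\<^sup>2 \<partial>lebI 0 1)" if "t \<in> {0<..T}" for t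
  proof -
    have t: "t \<in> {0..T}" using that by auto
    show ?thesis
      using sobolev_chain_energy[OF D_chain[OF t] s] u_boundary[OF that] by (simp add: flux_pair_def D_0[OF t])
  qed
  have D1c: "continuous_on {0..1} (D t 1)" if "t \<in> {0..T}" for t by (rule D_continuous[OF that]) simp
  have Dlin: "D a 1 y - 2 * D (2*a) 1 y + D (3*a) 1 y = 0" if y: "y \<in> {0..1}" for y
  proof -
    have "(v has_real_derivative D a 1 y - 2 * D (2*a) 1 y + D (3*a) 1 y) (at y within {0..1})"
      unfolding v_def by (intro derivative_intros DERIV_cmult u_has_deriv mem y)
    moreover have "(v has_real_derivative 0) (at y within {0..1})"
    proof -
      have "((\<lambda>y. 0) has_real_derivative 0) (at y within {0..1})" by simp
      then show ?thesis by (rule has_field_derivative_transform_within[of _ _ _ _ 1]) (use v0 y in auto)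
    qed
    ultimately show ?thesis
      using vector_derivative_unique_within_closed_interval[of 0 1 y v] y
      by (auto simp: has_real_derivative_iff_has_vector_derivative)
  qed
  have N: "(\<integral>y. (D a 1 y)\<^sup>2 \<partial>lebI 0 1) - 2 * (\<integral>y. (D (2*a) 1 y)\<^sup>2 \<partial>lebI 0 1) + (\<integral>y. (D (3*a) 1 y)\<^sup>2 \<partial>lebI 0 1) = 0"
  proof -
    \<comment> \<open>Since \<open>v\<close> vanishes, this pairing yields the second difference of
      the dissipation.\<close>
    have "0 = pair q v" by (subst eq_commute, rule integral_eq_zero_AE) (auto intro!: AE_I2 simp: v0)
    also have "pair q v = (\<integral>y. q y * u a y - 2 * (q y * u (2*a) y) + q y * u (3*a) y \<partial>lebI 0 1)"
      by (simp add: v_def algebra_simps)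
    also have "\<dots> = pair q (u a) - 2 * pair q (u (2*a)) + pair q (u (3*a))"
      by (subst Bochner_Integration.integral_add, (intro integrable_continuous_lebI continuous_intros cont qc)+,
          subst Bochner_Integration.integral_diff, (intro integrable_continuous_lebI continuous_intros cont qc)+) simp
    also have "\<dots> = - (a * \<nu>) * ((\<integral>y. (D a 1 y)\<^sup>2 \<partial>lebI 0 1) - 2 * (\<integral>y. (D (2*a) 1 y)\<^sup>2 \<partial>lebI 0 1) + (\<integral>y. (D (3*a) 1 y)\<^sup>2 \<partial>lebI 0 1))"
      using q1[OF cont(2)] q2[OF cont(3)] q3[OF cont(4)] energy[of a] energy[of "2*a"] energy[of "3*a"] a
      by (simp add: algebra_simps)
    finally show ?thesis using a nu by simp
  qed
  \<comment> \<open>The second difference of \<open>u_x\<close> vanishes too, so that of its squared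
    norm equals half the squared norm of \<open>D (3*a) 1 - D a 1\<close>.\<close>
  have "(\<integral>y. (D (3*a) 1 y - D a 1 y)\<^sup>2 \<partial>lebI 0 1) = 0"
  proof -
    have "(\<integral>y. (D (3*a) 1 y - D a 1 y)\<^sup>2 \<partial>lebI 0 1)
        = (\<integral>y. 2 * (D a 1 y)\<^sup>2 - 4 * (D (2*a) 1 y)\<^sup>2 + 2 * (D (3*a) 1 y)\<^sup>2 \<partial>lebI 0 1)"
    proof (rule Bochner_Integration.integral_cong[OF refl])
      fix y assume "y \<in> space (lebI 0 1)"
      then have D2: "D (2*a) 1 y = (D a 1 y + D (3*a) 1 y) / 2" using Dlin[of y] by simp
      have parallelogram: "(r - p)\<^sup>2 = 2 * p\<^sup>2 - 4 * ((p + r) / 2)\<^sup>2 + 2 * r\<^sup>2" for p r :: real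
        by (simp add: power2_eq_square field_simps)
      show "(D (3*a) 1 y - D a 1 y)\<^sup>2 = 2 * (D a 1 y)\<^sup>2 - 4 * (D (2*a) 1 y)\<^sup>2 + 2 * (D (3*a) 1 y)\<^sup>2"
        unfolding D2 by (rule parallelogram)
    qed
    also have "\<dots> = 2 * (\<integral>y. (D a 1 y)\<^sup>2 \<partial>lebI 0 1) - 4 * (\<integral>y. (D (2*a) 1 y)\<^sup>2 \<partial>lebI 0 1) + 2 * (\<integral>y. (D (3*a) 1 y)\<^sup>2 \<partial>lebI 0 1)"
      by (subst Bochner_Integration.integral_add, (intro integrable_continuous_lebI continuous_intros D1c mem)+,
          subst Bochner_Integration.integral_diff, (intro integrable_continuous_lebI continuous_intros D1c mem)+) simp
    finally show ?thesis using N by simp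
  qed
  then have Deq: "D (3*a) 1 y - D a 1 y = 0" if "y \<in> {0..1}" for y
    by (rule continuous_l2n_zero[OF continuous_on_diff[OF D1c[OF mem(4)] D1c[OF mem(2)]] _ that])
  have prim: "u t y = (\<integral>z. D t 1 z \<partial>lebI 0 y)" if "t \<in> {0<..T}" "y \<in> {0..1}" for t y
    using sobolev_chain_integral[OF D_chain, of t 0 0 y] that u_boundary[of t] D_0[of t] by simp
  have "u (3*a) y = u a y" if y: "y \<in> {0..1}" for y
  proof -
    have "(\<integral>z. D (3*a) 1 z \<partial>lebI 0 y) = (\<integral>z. D a 1 z \<partial>lebI 0 y)"
      by (rule Bochner_Integration.integral_cong[OF refl]) (use Deq y in auto)
    then show ?thesis using prim[of "3*a" y] prim[of a y] y a by simp
  qed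
  then have q0: "q y = 0" if "y \<in> {0..1}" for y using v0[OF that] that by (simp add: v_def q_def)
  have pq0: "pair q \<psi> = 0" for \<psi> by (rule integral_eq_zero_AE) (auto intro!: AE_I2 simp: q0)
  \<comment> \<open>Without an increment the flux is zero, and with it the dissipation at time
    \<open>a\<close>.\<close>
  have "(\<integral>y. (D a 1 y)\<^sup>2 \<partial>lebI 0 1) = 0"
    using q1[OF cont(2)] energy[of a] a nu pq0[of "u a"] by simp
  then have D10: "D a 1 y = 0" if "y \<in> {0..1}" for y
    by (rule continuous_l2n_zero[OF D1c[OF mem(2)] _ that])
  then have ua: "u a y = 0" if "y \<in> {0..1}" for y
  proof -
    have "(\<integral>z. D a 1 z \<partial>lebI 0 y) = 0"
      by (rule integral_eq_zero_AE, rule AE_I2, rule D10) (use that in auto)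
    then show ?thesis using prim[of a y] that a by simp
  qed
  \<comment> \<open>Back to time 0: the increment from there to \<open>a\<close> is governed by the
    same vanishing flux.\<close>
  have "pair (u 0) (u 0) = pair (u a) (u 0)"
    using affine[of 0 a "u 0"] q1[OF cont(1)] a pq0[of "u 0"] cont by simp
  also have "\<dots> = 0" by (rule integral_eq_zero_AE) (auto intro!: AE_I2 simp: ua)
  finally show ?thesis by (rule zero[OF cont(1) _ y])
qed

end

locale wg = burgers_k k T \<nu> g u + mesh N x
  for k :: nat and T \<nu> :: real and g :: "real \<Rightarrow> real" and u :: "real \<Rightarrow> real \<Rightarrow> real"
    and N :: nat and x :: "nat \<Rightarrow> real"
begin

text \<open>The part of the error that lives in the discrete space and obeys an evolution; the
  projection error is added at the very end.\<close>

definition "err t U = norm_h N x (\<lambda>i. poly (L2_proj x k (u t) i - inner_part U i))"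

definition "wg_residual \<tau> U Uold v =
    inner_h N x (\<lambda>i y. (poly (inner_part U i) y - poly (inner_part Uold i) y) / \<tau>) (\<lambda>i. poly (inner_part v i))
    + \<nu> * inner_h N x (\<lambda>i. poly (weak_diff x (Suc k) U i)) (\<lambda>i. poly (weak_diff x (Suc k) v i))
    + 1/3 * inner_h N x (\<lambda>i y. poly (inner_part U i) y * poly (weak_diff x (Suc k) U i) y) (\<lambda>i. poly (inner_part v i))
    - 1/3 * inner_h N x (\<lambda>i y. poly (inner_part U i) y * poly (inner_part U i) y) (\<lambda>i. poly (weak_diff x (Suc k) v i))"

lemma projection_error_u:
  assumes t: "t \<in> {0..T}"
  shows "norm_h N x (\<lambda>i y. u t y - poly (L2_proj x k (u t) i) y) \<le> h ^ Suc k * S t"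
proof -
  have "sobolev_chain (Suc k) (D t)" using D_chain[OF t] by (auto simp: sobolev_chain_def)
  from projection_error[OF this]
  have "norm_h N x (\<lambda>i y. u t y - poly (L2_proj x k (u t) i) y) \<le> h ^ Suc k * l2n (lebI 0 1) (D t (Suc k))"
    by (simp add: D_0[OF t])
  also have "\<dots> \<le> h ^ Suc k * S t" by (intro mult_left_mono D_norm t) (use h_pos in auto)
  finally show ?thesis .
qed

text \<open>The constants involve no bound on \<open>U\<close>: wherever the nonlinearity meets the
  discrete solution, the latter is written as projection minus error.\<close>

lemma step_error:
  assumes rt: "0 \<le> r" "r < t" "t \<le> T" and U: "U \<in> wg_space0 N k"
    and scheme: "\<And>v. v \<in> wg_space0 N k \<Longrightarrow> wg_residual (t - r) U Uold v = 0"
  shows "(err t U)\<^sup>2 - (err r Uold)\<^sup>2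
    \<le> (t - r) * (growth * (err t U)\<^sup>2 + spatial * (h ^ Suc k * S t)\<^sup>2 + (t - r) * u_tt_energy r t)"
proof -
  define \<tau> where "\<tau> = t - r"
  have \<tau>: "\<tau> > 0" using rt by (simp add: \<tau>_def)
  have tT: "t \<in> {0..T}" "r \<in> {0..T}" "t \<in> {0<..T}" using rt by auto
  define B where "B = h ^ Suc k * S t"
  have H0: "0 \<le> h ^ Suc k" using h_pos by simp
  have B0: "0 \<le> B" using H0 by (simp add: B_def)
  define K where "K = norm_bound"
  have K0: "0 \<le> K" by (simp add: K_def norm_bound_nonneg)
  define Q where "Q = L2_proj x k (u t)"
  define Qr where "Qr = L2_proj x k (u r)"
  \<comment> \<open>The test function is the full error including its nodal values; it lies in
    \<open>wg_space0\<close> because \<open>u t\<close> vanishes at the boundary for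
    \<open>t > 0\<close>.\<close>
  define V where "V = Weak_Fun (\<lambda>i. inner_part (Q_h x k (u t)) i - inner_part U i) (\<lambda>i. node_val (Q_h x k (u t)) i - node_val U i)"
  define e where "e = inner_part V"
  define e0 where "e0 i = Qr i - inner_part Uold i" for i
  define DQ where "DQ i = poly_proj (Suc k) (x i) (x (Suc i)) (D t 1)" for i
  define DU where "DU i = weak_diff x (Suc k) U i" for i
  define de where "de i = weak_diff x (Suc k) V i" for i
  have e_eq: "e i = Q i - inner_part U i" for i by (simp add: e_def V_def Q_h_def Q_def)
  have ut: "square_integrable (lebI 0 1) (u t)" "square_integrable (lebI 0 1) (u r)" using square_integrable_u tT by auto
  have uel: "square_integrable (E i) (u t)" "square_integrable (E i) (u r)" if i: "i \<in> {1..<N}" for i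
    using square_integrable_lebI_subset[OF ut(1)] square_integrable_lebI_subset[OF ut(2)] elem_bounds[OF i] by auto
  have Dc: "continuous_on {0..1} (D t 1)" by (rule D_continuous[OF tT(1)]) simp
  have de_eq: "de i = DQ i - DU i" if i: "i \<in> {1..<N}" for i
    using weak_diff_diff[OF i, of "Suc k" "Q_h x k (u t)" U] weak_diff_Q_h[OF i u_has_deriv[OF tT(1)] Dc, of k]
    by (simp add: de_def V_def DQ_def DU_def)
  have Qdeg: "degree (Q i) \<le> k" if i: "i \<in> {1..<N}" for i
    unfolding Q_def L2_proj_eq by (rule degree_poly_proj[OF elem_less[OF i] uel(1)[OF i]])
  have edeg: "degree (e i) \<le> k" if i: "i \<in> {1..<N}" for i
    unfolding e_eq using U i by (intro degree_diff_le Qdeg) (auto simp: wg_space0_def wg_space_def)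
  have V: "V \<in> wg_space0 N k"
    using edeg u_boundary[OF tT(3)] U ends by (auto simp: wg_space0_def wg_space_def V_def e_def Q_h_def)
  define y where "y = err t U"
  define y0 where "y0 = err r Uold"
  define d where "d = norm_h N x (\<lambda>i. poly (de i))"
  have y_eq: "y = norm_h N x (\<lambda>i. poly (e i))" by (simp add: y_def err_def e_eq Q_def)
  have y0_eq: "y0 = norm_h N x (\<lambda>i. poly (e0 i))" by (simp add: y0_def err_def e0_def Qr_def)
  have y_nn: "0 \<le> y" "0 \<le> y0" "0 \<le> d" by (simp_all add: y_eq y0_eq d_def)
  have bu: "bcont (\<lambda>i. u t)" by (rule bcont_global[OF continuous_u_space[OF tT(1)]])
  have bux: "bcont (\<lambda>i. D t 1)" by (rule bcont_global[OF Dc])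
  note bp = bcont_poly bcont_poly'
  note b2 = bcont_bl2[OF bp(1)] bcont_bl2[OF bp(2)] bcont_bl2[OF bu] bcont_bl2[OF bux]
  have ch2: "sobolev_chain k (\<lambda>j. D t (2 + j))"
    using sobolev_chain_shift[of 2 k "D t"] D_chain[OF tT(1)] by (simp add: add.commute)
  have sq2: "square_integrable (lebI 0 1) (D t 2)" by (rule sobolev_chain_square_integrable[OF D_chain[OF tT(1)]]) simp
  \<comment> \<open>The viscous flux: \<open>u_xx\<close> has \<open>k\<close> derivatives left, so
    the interpolation of \<open>u_x\<close> reaches order \<open>k + 1\<close>.\<close>
  obtain P where P: "\<And>i. i \<in> {1..<N} \<Longrightarrow> degree (P i) \<le> Suc k"
    "\<And>v. v \<in> wg_space0 N k \<Longrightarrow> inner_h N x (\<lambda>i. D t 2) (\<lambda>i. poly (inner_part v i)) = - inner_h N x (\<lambda>i. poly (P i)) (\<lambda>i. poly (weak_diff x (Suc k) v i))"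
    "norm_h N x (\<lambda>i y. D t 1 y - poly (P i) y) \<le> h ^ Suc k * l2n (lebI 0 1) (D t (2 + k))"
  proof (rule flux_interpolant[OF sq2 _ ch2])
    show "D t 1 b - D t 1 a = (\<integral>z. D t 2 z \<partial>lebI a b)" if "0 \<le> a" "a \<le> b" "b \<le> 1" for a b
      using sobolev_chain_integral[OF D_chain[OF tT(1)], of 1 a b] that by (simp add: numeral_2_eq_2)
  qed auto
  have PB: "norm_h N x (\<lambda>i y. D t 1 y - poly (P i) y) \<le> B"
    using P(3) mult_left_mono[OF D_norm[OF tT(1), of "2 + k"] H0] by (simp add: B_def add.commute)
  \<comment> \<open>The derivative of \<open>u^2\<close>, written as a sum of two products to suit
    the rules for \<open>derivs_bounded\<close>.\<close>
  define w2 where "w2 y = u t y * D t 1 y + u t y * D t 1 y" for y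
  have w2c: "continuous_on {0..1} w2" unfolding w2_def by (intro continuous_intros continuous_u_space[OF tT(1)] Dc)
  have db: "derivs_bounded k (D t i) (2 * S t)" if "i \<le> 1" for i
    by (rule sobolev_chain_derivs_bounded[OF D_chain[OF tT(1)] D_sup[OF tT(1)]]) (use that in auto)
  have "derivs_bounded k w2 (2 ^ k * (2 * S t * (2 * S t)) + 2 ^ k * (2 * S t * (2 * S t)))"
    unfolding w2_def using db[of 0] db[of 1] by (intro derivs_bounded_add derivs_bounded_mult) (simp_all add: D_0[OF tT(1)])
  then obtain G where G: "G 0 = w2" "sobolev_chain k G"
    "\<forall>y\<in>{0..1}. \<bar>G k y\<bar> \<le> 2 ^ k * (2 * S t * (2 * S t)) + 2 ^ k * (2 * S t * (2 * S t))"
    using derivs_bounded_sobolev_chain by blast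
  \<comment> \<open>Of the two factors \<open>S t\<close> one is replaced by \<open>K\<close>, which
    keeps the consistency error linear in \<open>S t\<close>.\<close>
  have Gk: "l2n (lebI 0 1) (G k) \<le> 2 ^ (k + 3) * K * S t"
  proof -
    define A where "A = 2 ^ k * (2 * S t * (2 * S t)) + 2 ^ k * (2 * S t * (2 * S t))"
    have A0: "0 \<le> A" by (simp add: A_def)
    have GA: "\<bar>G k y\<bar> \<le> A" if "y \<in> {0..1}" for y using G(3) that unfolding A_def by blast
    interpret finite_measure "lebI 0 1" by (rule finite_measure_lebI)
    have "l2n (lebI 0 1) (G k) \<le> l2n (lebI 0 1) (\<lambda>_. A)"
      by (rule l2n_mono(1)[OF square_integrable_measurable[OF sobolev_chain_square_integrable[OF G(2)]]])
         (use GA A0 in \<open>auto intro!: AE_I2 square_integrable_continuous\<close>)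
    also have "\<dots> = A" using A0 by (simp add: l2n_def measure_lebI)
    also have "A = 2 ^ (k + 3) * (S t * S t)" by (simp add: A_def power_add)
    also have "\<dots> \<le> 2 ^ (k + 3) * (K * S t)"
      using u_norm_bound[OF tT(1)] by (intro mult_left_mono mult_right_mono) (auto simp: K_def)
    finally show ?thesis by simp
  qed
  obtain P2 where P2: "\<And>i. i \<in> {1..<N} \<Longrightarrow> degree (P2 i) \<le> Suc k"
    "\<And>v. v \<in> wg_space0 N k \<Longrightarrow> inner_h N x (\<lambda>i. w2) (\<lambda>i. poly (inner_part v i)) = - inner_h N x (\<lambda>i. poly (P2 i)) (\<lambda>i. poly (weak_diff x (Suc k) v i))"
    "norm_h N x (\<lambda>i y. (u t y)\<^sup>2 - poly (P2 i) y) \<le> h ^ Suc k * l2n (lebI 0 1) (G k)"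
  proof (rule flux_interpolant[OF square_integrable_continuous[OF w2c] _ G(2,1)])
    fix a b :: real assume ab: "0 \<le> a" "a \<le> b" "b \<le> 1"
    have sub: "{a..b} \<subseteq> {0..1}" using ab by auto
    have "(\<integral>z. w2 z \<partial>lebI a b) = (u t b)\<^sup>2 - (u t a)\<^sup>2"
    proof (rule FTC_lebI[OF ab(2)])
      fix z assume z: "z \<in> {a..b}"
      have "(u t has_real_derivative D t 1 z) (at z within {a..b})"
        by (rule has_field_derivative_subset[OF u_has_deriv[OF tT(1)] sub]) (use z sub in auto)
      from DERIV_power[OF this, of 2] show "((\<lambda>y. (u t y)\<^sup>2) has_real_derivative w2 z) (at z within {a..b})"
        by (simp add: w2_def algebra_simps)
    qed (rule continuous_on_subset[OF w2c sub])
    then show "(u t b)\<^sup>2 - (u t a)\<^sup>2 = (\<integral>z. w2 z \<partial>lebI a b)" by simp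
  qed auto
  have P2B: "norm_h N x (\<lambda>i y. (u t y)\<^sup>2 - poly (P2 i) y) \<le> 2 ^ (k + 3) * K * B"
    using P2(3) mult_left_mono[OF Gk H0] by (simp add: B_def mult_ac)
  \<comment> \<open>The equation at time \<open>t\<close> with the difference quotient in place of
    the time derivative, multiplied by \<open>\<tau>\<close> and tested with the error.\<close>
  define R where "R = inner_h N x (\<lambda>i y. u t y - u r y) (\<lambda>i. poly (e i))
    + \<tau> * (inner_h N x (\<lambda>i y. u t y * D t 1 y) (\<lambda>i. poly (e i)) - \<nu> * inner_h N x (\<lambda>i. D t 2) (\<lambda>i. poly (e i)))"
  have R: "\<bar>R\<bar> \<le> \<tau> * (sqrt \<tau> * sqrt (u_tt_energy r t)) * y"
  proof -
    \<comment> \<open>\<open>glue e\<close> is bounded and measurable, which is what the truncation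
      estimate asks of its test function.\<close>
    obtain Bg where "\<And>z. \<bar>glue e z\<bar> \<le> Bg" using glue_bounded[of e] by blast
    from time_consistency[OF glue_measurable this rt]
    have "\<bar>pair (\<lambda>y. u t y - u r y) (glue e) + \<tau> * flux_pair t (glue e)\<bar>
        \<le> \<tau> * (sqrt \<tau> * sqrt (u_tt_energy r t)) * l2n (lebI 0 1) (glue e)"
      by (simp add: \<tau>_def u_tt_energy_def)
    moreover have "pair (\<lambda>y. u t y - u r y) (glue e) + \<tau> * flux_pair t (glue e) = R"
    proof -
      have s1: "square_integrable (lebI 0 1) (\<lambda>y. u t y - u r y)" by (intro square_integrable_diff ut)
      have s2: "square_integrable (lebI 0 1) (\<lambda>y. u t y * D t 1 y)"
        by (intro square_integrable_continuous continuous_intros continuous_u_space[OF tT(1)] Dc)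
      show ?thesis unfolding R_def flux_pair_def inner_h_glue[OF s1] inner_h_glue[OF s2] inner_h_glue[OF sq2] ..
    qed
    ultimately show ?thesis by (simp add: norm_h_glue y_eq)
  qed
  define p1 where "p1 = inner_h N x (\<lambda>i. poly (P i)) (\<lambda>i. poly (de i))"
  define p2 where "p2 = inner_h N x (\<lambda>i. poly (P2 i)) (\<lambda>i. poly (de i))"
  define n1 where "n1 = inner_h N x (\<lambda>i y. u t y * D t 1 y) (\<lambda>i. poly (e i))"
  define n2 where "n2 = inner_h N x (\<lambda>i y. poly (inner_part U i) y * poly (DU i) y) (\<lambda>i. poly (e i))"
  define n3 where "n3 = inner_h N x (\<lambda>i y. poly (inner_part U i) y * poly (inner_part U i) y) (\<lambda>i. poly (de i))"
  define d1 where "d1 = inner_h N x (\<lambda>i. poly (DU i)) (\<lambda>i. poly (de i))"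
  define a1 where "a1 = inner_h N x (\<lambda>i y. u t y - u r y) (\<lambda>i. poly (e i))"
  define s1 where "s1 = inner_h N x (\<lambda>i y. poly (inner_part U i) y - poly (inner_part Uold i) y) (\<lambda>i. poly (e i))"
  have m1: "inner_h N x (\<lambda>i. D t 2) (\<lambda>i. poly (e i)) = - p1"
    using P(2)[OF V] by (simp add: p1_def e_def de_def)
  have m2: "2 * n1 = - p2"
  proof -
    have "inner_h N x (\<lambda>i. w2) (\<lambda>i. poly (e i)) = 2 * n1"
      unfolding n1_def w2_def
      by (subst inner_h_add) (intro bcont_bl2 bcont_mult bu bux bp | simp)+
    then show ?thesis using P2(2)[OF V] by (simp add: p2_def e_def de_def)
  qed
  have sch: "s1 + \<tau> * (\<nu> * d1 + 1/3 * n2 - 1/3 * n3) = 0"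
  proof -
    have "inner_h N x (\<lambda>i y. (poly (inner_part U i) y - poly (inner_part Uold i) y) / \<tau>) (\<lambda>i. poly (e i)) = s1 / \<tau>"
      unfolding s1_def using inner_h_scale[of "1 / \<tau>"] by simp
    then have "s1 / \<tau> + \<nu> * d1 + 1/3 * n2 - 1/3 * n3 = 0"
      using scheme[OF V] by (simp add: wg_residual_def \<tau>_def[symmetric] e_def[symmetric] DU_def[symmetric] de_def[symmetric] d1_def n2_def n3_def)
    then have "\<tau> * (s1 / \<tau> + \<nu> * d1 + 1/3 * n2 - 1/3 * n3) = 0" by simp
    then show ?thesis using \<tau> by (simp add: algebra_simps)
  qed
  \<comment> \<open>The error has degree at most \<open>k\<close> on each element, so
    \<open>u\<close> may be replaced by its projection without remainder.\<close>
  have a1_eq: "a1 = inner_h N x (\<lambda>i y. poly (Q i) y - poly (Qr i) y) (\<lambda>i. poly (e i))"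
    unfolding a1_def inner_h_eq
  proof (rule sum.cong[OF refl])
    fix i assume i: "i \<in> {1..<N}"
    have "(\<integral>y. (u t y - u r y) * poly (e i) y \<partial>E i) = (\<integral>y. u t y * poly (e i) y \<partial>E i) - (\<integral>y. u r y * poly (e i) y \<partial>E i)"
      unfolding left_diff_distrib by (intro Bochner_Integration.integral_diff square_integrable_mult square_integrable_poly uel[OF i])
    also have "\<dots> = (\<integral>y. poly (Q i) y * poly (e i) y \<partial>E i) - (\<integral>y. poly (Qr i) y * poly (e i) y \<partial>E i)"
      unfolding Q_def Qr_def L2_proj_eq
      using poly_proj_inner[OF elem_less[OF i] uel(1)[OF i] edeg[OF i]] poly_proj_inner[OF elem_less[OF i] uel(2)[OF i] edeg[OF i]] by simp
    also have "\<dots> = (\<integral>y. (poly (Q i) y - poly (Qr i) y) * poly (e i) y \<partial>E i)"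
      unfolding left_diff_distrib by (intro Bochner_Integration.integral_diff[symmetric] integrable_poly_mult)
    finally show "(\<integral>y. (u t y - u r y) * poly (e i) y \<partial>E i) = (\<integral>y. (poly (Q i) y - poly (Qr i) y) * poly (e i) y \<partial>E i)" .
  qed
  have ee: "a1 - s1 = y\<^sup>2 - inner_h N x (\<lambda>i. poly (e0 i)) (\<lambda>i. poly (e i))"
  proof -
    have "a1 - s1 = inner_h N x (\<lambda>i z. (poly (Q i) z - poly (Qr i) z) - (poly (inner_part U i) z - poly (inner_part Uold i) z)) (\<lambda>i. poly (e i))"
      unfolding a1_eq s1_def by (intro inner_h_diff[symmetric] bcont_bl2 bcont_diff bp)
    also have "\<dots> = inner_h N x (\<lambda>i z. poly (e i) z - poly (e0 i) z) (\<lambda>i. poly (e i))"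
      by (rule inner_h_cong) (simp add: e_eq e0_def)
    also have "\<dots> = inner_h N x (\<lambda>i. poly (e i)) (\<lambda>i. poly (e i)) - inner_h N x (\<lambda>i. poly (e0 i)) (\<lambda>i. poly (e i))"
      by (intro inner_h_diff bcont_bl2 bp)
    finally show ?thesis by (simp add: y_eq norm_h_square)
  qed
  define m where "m = inner_h N x (\<lambda>i z. poly (P i) z - poly (DQ i) z) (\<lambda>i. poly (de i))"
  have pd: "p1 - d1 = m + d\<^sup>2"
  proof -
    have "p1 - d1 = inner_h N x (\<lambda>i z. poly (P i) z - poly (DU i) z) (\<lambda>i. poly (de i))"
      unfolding p1_def d1_def by (intro inner_h_diff[symmetric] bcont_bl2 bp)
    also have "\<dots> = inner_h N x (\<lambda>i z. (poly (P i) z - poly (DQ i) z) + poly (de i) z) (\<lambda>i. poly (de i))"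
      by (rule inner_h_cong) (simp add: de_eq)
    also have "\<dots> = m + inner_h N x (\<lambda>i. poly (de i)) (\<lambda>i. poly (de i))"
      unfolding m_def by (intro inner_h_add bcont_bl2 bcont_diff bp)
    finally show ?thesis by (simp add: d_def norm_h_square)
  qed
  define X1 where "X1 = inner_h N x (\<lambda>i z. u t z * D t 1 z - poly (Q i) z * poly (DQ i) z) (\<lambda>i. poly (e i))"
  define X2 where "X2 = inner_h N x (\<lambda>i z. poly (DQ i) z * poly (e i) z) (\<lambda>i. poly (e i))"
  define X3 where "X3 = inner_h N x (\<lambda>i z. poly (Q i) z * poly (e i) z) (\<lambda>i. poly (de i))"
  define X4 where "X4 = inner_h N x (\<lambda>i z. (poly (Q i) z)\<^sup>2 - poly (P2 i) z) (\<lambda>i. poly (de i))"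
  have bQ2: "bcont (\<lambda>i z. (poly (Q i) z)\<^sup>2)"
    using bcont_mult[OF bp(1)[of Q] bp(1)[of Q]] by (simp add: power2_eq_square)
  have nn: "(n1 - n2) - (p2 - n3) = X1 + X2 - X3 + X4"
  proof -
    \<comment> \<open>\<open>A\<close> contains the terms cubic in the error. It arises once from
      each half of the skew form and drops out of the difference.\<close>
    define A where "A = inner_h N x (\<lambda>i z. (poly (Q i) z - poly (e i) z) * poly (e i) z) (\<lambda>i. poly (de i))"
    have "n1 - n2 = inner_h N x (\<lambda>i z. u t z * D t 1 z - poly (inner_part U i) z * poly (DU i) z) (\<lambda>i. poly (e i))"
      unfolding n1_def n2_def by (intro inner_h_diff[symmetric] bcont_bl2 bcont_mult bp bu bux)
    also have "\<dots> = inner_h N x (\<lambda>i z. ((u t z * D t 1 z - poly (Q i) z * poly (DQ i) z) + poly (DQ i) z * poly (e i) z)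
        + (poly (Q i) z - poly (e i) z) * poly (de i) z) (\<lambda>i. poly (e i))"
      by (rule inner_h_cong) (simp add: e_eq de_eq algebra_simps)
    also have "\<dots> = X1 + X2 + inner_h N x (\<lambda>i z. (poly (Q i) z - poly (e i) z) * poly (de i) z) (\<lambda>i. poly (e i))"
      unfolding X1_def X2_def
      by (subst inner_h_add, (intro bcont_bl2 bcont_mult bcont_diff bcont_add bp bu bux)+,
          subst inner_h_add, (intro bcont_bl2 bcont_mult bcont_diff bcont_add bp bu bux)+) simp
    also have "inner_h N x (\<lambda>i z. (poly (Q i) z - poly (e i) z) * poly (de i) z) (\<lambda>i. poly (e i)) = A"
      unfolding A_def by (rule inner_h_cong) (simp add: mult_ac)
    finally have 1: "n1 - n2 = X1 + X2 + A" .
    have "p2 - n3 = inner_h N x (\<lambda>i z. poly (P2 i) z - poly (inner_part U i) z * poly (inner_part U i) z) (\<lambda>i. poly (de i))"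
      unfolding p2_def n3_def by (intro inner_h_diff[symmetric] bcont_bl2 bcont_mult bp)
    also have "\<dots> = inner_h N x (\<lambda>i z. (poly (Q i) z * poly (e i) z + (poly (Q i) z - poly (e i) z) * poly (e i) z)
         - ((poly (Q i) z)\<^sup>2 - poly (P2 i) z)) (\<lambda>i. poly (de i))"
      by (rule inner_h_cong) (simp add: e_eq power2_eq_square algebra_simps)
    also have "\<dots> = X3 + A - X4"
      unfolding X3_def X4_def A_def
      by (subst inner_h_diff, (intro bcont_bl2 bcont_mult bcont_diff bcont_add bp bQ2)+,
          subst inner_h_add, (intro bcont_bl2 bcont_mult bcont_diff bcont_add bp bQ2)+) simp
    finally show ?thesis using 1 by simp
  qed
  have main: "a1 - s1 = R - \<tau> * (\<nu> * (m + d\<^sup>2) + 1/3 * (X1 + X2 - X3 + X4))"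
  proof -
    have "R = a1 + \<tau> * (n1 + \<nu> * p1)" by (simp add: R_def a1_def n1_def m1)
    \<comment> \<open>The exact convection term is brought into the same split form as the discrete
      one, by way of the interpolated flux.\<close>
    moreover have "n1 = 1/3 * n1 - 1/3 * p2" using m2 by simp
    ultimately have "R = a1 + \<tau> * (1/3 * n1 - 1/3 * p2 + \<nu> * p1)" by metis
    with sch have "a1 - s1 = R - \<tau> * ((1/3 * n1 - 1/3 * p2 + \<nu> * p1) - (\<nu> * d1 + 1/3 * n2 - 1/3 * n3))"
      unfolding right_diff_distrib[of \<tau> "1/3 * n1 - 1/3 * p2 + \<nu> * p1"] by linarith
    also have "(1/3 * n1 - 1/3 * p2 + \<nu> * p1) - (\<nu> * d1 + 1/3 * n2 - 1/3 * n3) = \<nu> * (p1 - d1) + 1/3 * ((n1 - n2) - (p2 - n3))"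
      by (simp add: field_simps)
    finally have "a1 - s1 = R - \<tau> * (\<nu> * (p1 - d1) + 1/3 * ((n1 - n2) - (p2 - n3)))" .
    then show ?thesis by (simp only: pd nn)
  qed
  have uQ: "norm_h N x (\<lambda>i z. u t z - poly (Q i) z) \<le> B"
    unfolding Q_def B_def by (rule projection_error_u[OF tT(1)])
  have uxDQ: "norm_h N x (\<lambda>i z. D t 1 z - poly (DQ i) z) \<le> B"
  proof -
    \<comment> \<open>\<open>P i\<close> competes in the best approximation of degree
      \<open>k + 1\<close>, so its error already bounds that of the projection of
      \<open>u_x\<close>.\<close>
    have "norm_h N x (\<lambda>i z. D t 1 z - poly (DQ i) z) \<le> 1 * norm_h N x (\<lambda>i z. D t 1 z - poly (P i) z)"
    proof (rule norm_h_mono)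
      fix i assume i: "i \<in> {1..<N}"
      have sq: "square_integrable (E i) (D t 1)" by (rule bl2D[OF b2(4) i])
      show "l2n (E i) (\<lambda>z. D t 1 z - poly (DQ i) z) \<le> 1 * l2n (E i) (\<lambda>z. D t 1 z - poly (P i) z)"
        using poly_proj_best[OF elem_less[OF i] sq P(1)[OF i]] by (simp add: DQ_def)
    qed simp
    then show ?thesis using PB by simp
  qed
  have Qsup: "\<bar>poly (Q i) z\<bar> \<le> KQ" if i: "i \<in> {1..<N}" and z: "z \<in> {x i..x (Suc i)}" for i z
    unfolding Q_def L2_proj_eq KQ_def
    by (rule poly_proj_sup[OF elem_less[OF i] square_integrable_measurable[OF uel(1)[OF i]] _ z])
       (rule u_le[OF tT(1)], use elem_bounds[OF i] in auto)
  have DQsup: "\<bar>poly (DQ i) z\<bar> \<le> KD" if i: "i \<in> {1..<N}" and z: "z \<in> {x i..x (Suc i)}" for i z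
    unfolding DQ_def KD_def
    by (rule poly_proj_sup[OF elem_less[OF i] square_integrable_measurable[OF bl2D[OF b2(4) i]] _ z])
       (rule u_x_le[OF tT(1)], use elem_bounds[OF i] in auto)
  have usup: "\<bar>u t z\<bar> \<le> 2 * K" if i: "i \<in> {1..<N}" and z: "z \<in> {x i..x (Suc i)}" for i z
    unfolding K_def by (rule u_le[OF tT(1)]) (use elem_bounds[OF i] z in auto)
  have mB: "\<bar>m\<bar> \<le> 2 * (B * d)"
  proof -
    have "norm_h N x (\<lambda>i z. poly (P i) z - poly (DQ i) z)
        = norm_h N x (\<lambda>i z. (poly (P i) z - D t 1 z) + (D t 1 z - poly (DQ i) z))"
      by simp
    also have "\<dots> \<le> norm_h N x (\<lambda>i z. poly (P i) z - D t 1 z) + norm_h N x (\<lambda>i z. D t 1 z - poly (DQ i) z)"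
      by (intro norm_h_triangle bcont_bl2 bcont_diff bp bux)
    also have "\<dots> \<le> 2 * B" using PB uxDQ norm_h_minus_commute[of "\<lambda>i. poly (P i)" "\<lambda>i. D t 1"] by simp
    finally have "norm_h N x (\<lambda>i z. poly (P i) z - poly (DQ i) z) * d \<le> 2 * B * d"
      using y_nn by (intro mult_right_mono)
    moreover have "\<bar>m\<bar> \<le> norm_h N x (\<lambda>i z. poly (P i) z - poly (DQ i) z) * d"
      unfolding m_def d_def by (intro Cauchy_Schwarz_h bcont_bl2 bcont_diff bp)
    ultimately show ?thesis by simp
  qed
  have X1B: "\<bar>X1\<bar> \<le> (2 * K + KD) * (B * y)"
  proof -
    have "norm_h N x (\<lambda>i z. u t z * D t 1 z - poly (Q i) z * poly (DQ i) z)
        = norm_h N x (\<lambda>i z. u t z * (D t 1 z - poly (DQ i) z) + poly (DQ i) z * (u t z - poly (Q i) z))"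
      by (simp add: algebra_simps)
    also have "\<dots> \<le> norm_h N x (\<lambda>i z. u t z * (D t 1 z - poly (DQ i) z)) + norm_h N x (\<lambda>i z. poly (DQ i) z * (u t z - poly (Q i) z))"
      by (intro norm_h_triangle bcont_bl2 bcont_mult bcont_diff bp bu bux)
    also have "\<dots> \<le> 2 * K * norm_h N x (\<lambda>i z. D t 1 z - poly (DQ i) z) + KD * norm_h N x (\<lambda>i z. u t z - poly (Q i) z)"
    proof (rule add_mono)
      show "norm_h N x (\<lambda>i z. u t z * (D t 1 z - poly (DQ i) z)) \<le> 2 * K * norm_h N x (\<lambda>i z. D t 1 z - poly (DQ i) z)"
        by (rule norm_h_bounded_mult(1)[OF bcont_bl2[OF bcont_diff[OF bux bp(1)]] bu _ usup]) (use K0 in simp)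
      show "norm_h N x (\<lambda>i z. poly (DQ i) z * (u t z - poly (Q i) z)) \<le> KD * norm_h N x (\<lambda>i z. u t z - poly (Q i) z)"
        by (rule norm_h_bounded_mult(1)[OF _ bp(1)]) (use KD_nonneg DQsup in \<open>auto intro!: bcont_bl2 bcont_diff bp bu\<close>)
    qed
    also have "\<dots> \<le> 2 * K * B + KD * B"
      using K0 KD_nonneg by (intro add_mono mult_left_mono uxDQ uQ) auto
    finally have "norm_h N x (\<lambda>i z. u t z * D t 1 z - poly (Q i) z * poly (DQ i) z) * y \<le> (2 * K * B + KD * B) * y"
      using y_nn by (intro mult_right_mono)
    moreover have "\<bar>X1\<bar> \<le> norm_h N x (\<lambda>i z. u t z * D t 1 z - poly (Q i) z * poly (DQ i) z) * y"
      unfolding X1_def y_eq by (intro Cauchy_Schwarz_h bcont_bl2 bcont_mult bcont_diff bp bu bux)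
    ultimately show ?thesis by (simp add: algebra_simps)
  qed
  have X2B: "\<bar>X2\<bar> \<le> KD * y\<^sup>2"
  proof -
    have "\<bar>X2\<bar> \<le> norm_h N x (\<lambda>i z. poly (DQ i) z * poly (e i) z) * y"
      unfolding X2_def y_eq by (intro Cauchy_Schwarz_h bcont_bl2 bcont_mult bp)
    also have "\<dots> \<le> (KD * y) * y"
      unfolding y_eq
      by (intro mult_right_mono norm_h_bounded_mult(1)) (use KD_nonneg DQsup in \<open>auto intro!: bcont_bl2 bp\<close>)
    finally show ?thesis by (simp add: power2_eq_square mult.assoc)
  qed
  have X3B: "\<bar>X3\<bar> \<le> KQ * (y * d)"
  proof -
    have "\<bar>X3\<bar> \<le> norm_h N x (\<lambda>i z. poly (Q i) z * poly (e i) z) * d"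
      unfolding X3_def d_def by (intro Cauchy_Schwarz_h bcont_bl2 bcont_mult bp)
    also have "\<dots> \<le> (KQ * y) * d"
      unfolding y_eq
      by (intro mult_right_mono norm_h_bounded_mult(1)) (use KQ_nonneg Qsup y_nn in \<open>auto intro!: bcont_bl2 bp\<close>)
    finally show ?thesis by (simp add: mult.assoc)
  qed
  have X4B: "\<bar>X4\<bar> \<le> (KQ + 2 * K + 2 ^ (k + 3) * K) * (B * d)"
  proof -
    have bsum: "bcont (\<lambda>i z. - (poly (Q i) z + u t z))"
      using bcont_diff[OF bp(1)[of "\<lambda>_. 0"] bcont_add[OF bp(1)[of Q] bu]] by simp
    have bu2: "bcont (\<lambda>i z. (u t z)\<^sup>2)" using bcont_mult[OF bu bu] by (simp add: power2_eq_square)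
    have "norm_h N x (\<lambda>i z. (poly (Q i) z)\<^sup>2 - poly (P2 i) z)
        = norm_h N x (\<lambda>i z. (- (poly (Q i) z + u t z)) * (u t z - poly (Q i) z) + ((u t z)\<^sup>2 - poly (P2 i) z))"
      by (simp add: power2_eq_square algebra_simps)
    also have "\<dots> \<le> norm_h N x (\<lambda>i z. (- (poly (Q i) z + u t z)) * (u t z - poly (Q i) z)) + norm_h N x (\<lambda>i z. (u t z)\<^sup>2 - poly (P2 i) z)"
      by (intro norm_h_triangle bcont_bl2 bcont_mult[OF bsum] bcont_diff bp bu bu2)
    also have "\<dots> \<le> (KQ + 2 * K) * B + 2 ^ (k + 3) * K * B"
    proof (rule add_mono[OF _ P2B])
      have "norm_h N x (\<lambda>i z. (- (poly (Q i) z + u t z)) * (u t z - poly (Q i) z)) \<le> (KQ + 2 * K) * norm_h N x (\<lambda>i z. u t z - poly (Q i) z)"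
      proof (rule norm_h_bounded_mult(1)[OF _ bsum])
        show "bl2 (\<lambda>i z. u t z - poly (Q i) z)" by (intro bcont_bl2 bcont_diff bp bu)
        show "0 \<le> KQ + 2 * K" using KQ_nonneg K0 by simp
        show "\<bar>- (poly (Q i) z + u t z)\<bar> \<le> KQ + 2 * K" if "i \<in> {1..<N}" "z \<in> {x i..x (Suc i)}" for i z
          using Qsup[OF that] usup[OF that] by linarith
      qed
      also have "\<dots> \<le> (KQ + 2 * K) * B" using KQ_nonneg K0 by (intro mult_left_mono uQ) auto
      finally show "norm_h N x (\<lambda>i z. (- (poly (Q i) z + u t z)) * (u t z - poly (Q i) z)) \<le> (KQ + 2 * K) * B" .
    qed
    finally have "norm_h N x (\<lambda>i z. (poly (Q i) z)\<^sup>2 - poly (P2 i) z) * d \<le> ((KQ + 2 * K) * B + 2 ^ (k + 3) * K * B) * d"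
      using y_nn by (intro mult_right_mono)
    moreover have "\<bar>X4\<bar> \<le> norm_h N x (\<lambda>i z. (poly (Q i) z)\<^sup>2 - poly (P2 i) z) * d"
      unfolding X4_def d_def by (intro Cauchy_Schwarz_h bcont_bl2 bcont_diff bp bQ2)
    ultimately show ?thesis by (simp add: algebra_simps)
  qed
  have XB: "\<bar>X1 + X2 - X3 + X4\<bar> \<le> 3 * (c1 * (B * y) + c2 * y\<^sup>2 + c3 * (y * d) + c4 * (B * d))"
  proof -
    have "\<bar>X1 + X2 - X3 + X4\<bar> \<le> \<bar>X1\<bar> + \<bar>X2\<bar> + \<bar>X3\<bar> + \<bar>X4\<bar>" by linarith
    also have "\<dots> \<le> (2 * K + KD) * (B * y) + KD * y\<^sup>2 + KQ * (y * d) + (KQ + 2 * K + 2 ^ (k + 3) * K) * (B * d)"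
      using X1B X2B X3B X4B by linarith
    also have "\<dots> = 3 * c1 * (B * y) + 3 * c2 * y\<^sup>2 + 3 * c3 * (y * d) + 3 * c4 * (B * d)"
    proof -
      have c: "3 * c1 = 2 * K + KD" "3 * c2 = KD" "3 * c3 = KQ" "3 * c4 = KQ + 2 * K + 2 ^ (k + 3) * K"
        by (simp_all add: c1_def c2_def c3_def c4_def K_def)
      show ?thesis by (simp only: c)
    qed
    also have "\<dots> = 3 * (c1 * (B * y) + c2 * y\<^sup>2 + c3 * (y * d) + c4 * (B * d))" by (simp add: distrib_left mult.assoc)
    finally show ?thesis .
  qed
  \<comment> \<open>The mixed term in \<open>ee\<close> is at most half the sum of the two squares,
    as usual for a backward difference.\<close>
  have "(y\<^sup>2 - y0\<^sup>2) / 2 \<le> a1 - s1"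
  proof -
    have "inner_h N x (\<lambda>i. poly (e0 i)) (\<lambda>i. poly (e i)) \<le> y0 * y"
      using Cauchy_Schwarz_h[OF b2(2)[of e0] b2(2)[of e]] by (simp add: y0_eq y_eq)
    also have "\<dots> \<le> (y0\<^sup>2 + y\<^sup>2) / 2" using sum_squares_bound[of y0 y] by simp
    finally show ?thesis unfolding ee by (simp add: field_simps)
  qed
  then have "(y\<^sup>2 - y0\<^sup>2) / 2 \<le> R - \<tau> * (\<nu> * (m + d\<^sup>2) + 1/3 * (X1 + X2 - X3 + X4))" unfolding main .
  from energy_step_inequality[OF nu \<tau> u_tt_energy_nonneg this R mB XB]
  show ?thesis unfolding y_def y0_def \<tau>_def growth_def spatial_def B_def .
qed

end

section \<open>Stability and the estimate for small steps\<close>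

context wg
begin

text \<open>At step 0 only the interior parts are prescribed, since \<open>g\<close> is tied to
  \<open>u 0\<close> on the open interval alone. The zero weak functions then qualify as soon as
  \<open>u 0 = 0\<close>, whatever values \<open>g\<close> takes elsewhere.\<close>

definition wg_steps :: "real \<Rightarrow> nat \<Rightarrow> (nat \<Rightarrow> weak_fun) \<Rightarrow> bool" where
  "wg_steps \<tau> M U \<longleftrightarrow> (\<forall>i\<in>{1..<N}. inner_part (U 0) i = L2_proj x k g i) \<and>
   (\<forall>n\<in>{1..M}. U n \<in> wg_space0 N k \<and> (\<forall>v\<in>wg_space0 N k. wg_residual \<tau> (U n) (U (n - 1)) v = 0))"

lemma L2_proj_initial:
  assumes i: "i \<in> {1..<N}" shows "L2_proj x k g i = L2_proj x k (u 0) i"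
  unfolding L2_proj_eq by (rule poly_proj_cong) (use u_initial elem_bounds[OF i] in auto)

lemma norm_h_zero: "(\<And>i y. i \<in> {1..<N} \<Longrightarrow> y \<in> {x i<..<x (Suc i)} \<Longrightarrow> f i y = 0) \<Longrightarrow> norm_h N x f = 0"
  using inner_h_cong[of f f "\<lambda>_ _. 0" "\<lambda>_ _. 0"] by (simp add: norm_h_def inner_h_eq)

text \<open>Testing with the solution itself, the two nonlinear terms have the same integrand and
  cancel, and only dissipation is left. There is no restriction on the step size, hence the use for
  large steps.\<close>

lemma stability:
  assumes steps: "wg_steps \<tau> M U" and \<tau>: "\<tau> > 0"
  shows "n \<le> M \<Longrightarrow> norm_h N x (\<lambda>i. poly (inner_part (U n) i)) \<le> l2n (lebI 0 1) (u 0)"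
proof (induction n)
  case 0
  have sq: "square_integrable (lebI 0 1) (u 0)" using square_integrable_u T by simp
  have "norm_h N x (\<lambda>i. poly (inner_part (U 0) i)) \<le> 1 * norm_h N x (\<lambda>i. u 0)"
  proof (rule norm_h_mono)
    fix i assume i: "i \<in> {1..<N}"
    have "inner_part (U 0) i = L2_proj x k (u 0) i" using steps i L2_proj_initial[OF i] by (simp add: wg_steps_def)
    then show "l2n (E i) (poly (inner_part (U 0) i)) \<le> 1 * l2n (E i) (u 0)"
      using poly_proj_l2n_le[OF elem_less[OF i] bl2D[OF bl2_global[OF sq] i]] by (simp add: L2_proj_eq)
  qed simp
  then show ?case using norm_h_global[OF sq] by simp
next
  case (Suc n)
  define V where "V = U (Suc n)"
  define W where "W = U n"
  have "Suc n \<in> {1..M}" using Suc.prems by simp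
  then have "U (Suc n) \<in> wg_space0 N k" "\<forall>v\<in>wg_space0 N k. wg_residual \<tau> (U (Suc n)) (U (Suc n - 1)) v = 0"
    using steps unfolding wg_steps_def by blast+
  then have res: "wg_residual \<tau> V W V = 0" by (simp add: V_def W_def)
  define a where "a = norm_h N x (\<lambda>i. poly (inner_part V i))"
  define b where "b = norm_h N x (\<lambda>i. poly (inner_part W i))"
  have cancel: "inner_h N x (\<lambda>i y. poly (inner_part V i) y * poly (weak_diff x (Suc k) V i) y) (\<lambda>i. poly (inner_part V i))
     = inner_h N x (\<lambda>i y. poly (inner_part V i) y * poly (inner_part V i) y) (\<lambda>i. poly (weak_diff x (Suc k) V i))"
    by (rule inner_h_cong) (simp add: mult_ac)
  have "inner_h N x (\<lambda>i y. (poly (inner_part V i) y - poly (inner_part W i) y) / \<tau>) (\<lambda>i. poly (inner_part V i))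
      = (1 / \<tau>) * inner_h N x (\<lambda>i y. poly (inner_part V i) y - poly (inner_part W i) y) (\<lambda>i. poly (inner_part V i))"
    using inner_h_scale[of "1 / \<tau>"] by simp
  also have "inner_h N x (\<lambda>i y. poly (inner_part V i) y - poly (inner_part W i) y) (\<lambda>i. poly (inner_part V i))
      = a\<^sup>2 - inner_h N x (\<lambda>i. poly (inner_part W i)) (\<lambda>i. poly (inner_part V i))"
    unfolding a_def norm_h_square by (intro inner_h_diff bcont_bl2 bcont_poly bcont_poly')
  finally have "(1 / \<tau>) * (a\<^sup>2 - inner_h N x (\<lambda>i. poly (inner_part W i)) (\<lambda>i. poly (inner_part V i)))
      = - (\<nu> * (norm_h N x (\<lambda>i. poly (weak_diff x (Suc k) V i)))\<^sup>2)"
    using res unfolding wg_residual_def cancel norm_h_square by simp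
  also have "\<dots> \<le> 0" using nu by simp
  finally have "a\<^sup>2 \<le> inner_h N x (\<lambda>i. poly (inner_part W i)) (\<lambda>i. poly (inner_part V i))"
    using \<tau> by (simp add: divide_le_0_iff)
  also have "\<dots> \<le> b * a"
    using Cauchy_Schwarz_h[OF bcont_bl2[OF bcont_poly'] bcont_bl2[OF bcont_poly'], of "inner_part W" "inner_part V"]
    by (simp add: a_def b_def)
  finally have "a \<le> b"
    using norm_h_nonneg[of "\<lambda>i. poly (inner_part V i)"] norm_h_nonneg[of "\<lambda>i. poly (inner_part W i)"]
    unfolding a_def[symmetric] b_def[symmetric] by (cases "a = 0") (auto simp: power2_eq_square mult_le_cancel_right)
  then show ?case using Suc by (simp add: a_def b_def V_def W_def)
qed

definition "max_norm \<tau> n = Max ((\<lambda>j. (S (real j * \<tau>))\<^sup>2) ` {1..n})"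

lemma max_norm_ge: "j \<in> {1..n} \<Longrightarrow> (S (real j * \<tau>))\<^sup>2 \<le> max_norm \<tau> n"
  unfolding max_norm_def by (rule Max_ge) auto

lemma max_norm_nonneg: "1 \<le> n \<Longrightarrow> 0 \<le> max_norm \<tau> n"
  using max_norm_ge[of n n \<tau>] by (meson atLeastAtMost_iff order.refl order_trans zero_le_power2)

lemma error_small_steps:
  assumes M: "M \<ge> 1" and \<tau>: "\<tau> = T / real M" and small: "growth * \<tau> \<le> 1/2"
    and steps: "wg_steps \<tau> M U" and n: "n \<in> {1..M}"
  shows "(err (real n * \<tau>) (U n))\<^sup>2 \<le> exp (2 * growth * T) *
     (T * spatial * (h ^ Suc k)\<^sup>2 * max_norm \<tau> n + \<tau>\<^sup>2 * u_tt_energy 0 (real n * \<tau>))"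
proof -
  have \<tau>0: "\<tau> > 0" using T M by (simp add: \<tau>)
  have le_T: "real j * \<tau> \<le> T" if "j \<le> M" for j
  proof -
    have "real j * \<tau> \<le> real M * \<tau>" using that \<tau>0 by (intro mult_right_mono) auto
    also have "\<dots> = T" using M by (simp add: \<tau>)
    finally show ?thesis .
  qed
  define H where "H = h ^ Suc k"
  define G where "G j = spatial * (H * S (real j * \<tau>))\<^sup>2 + \<tau> * u_tt_energy (real (j - 1) * \<tau>) (real j * \<tau>)" for j
  have G0: "0 \<le> G j" for j using spatial_nonneg u_tt_energy_nonneg \<tau>0 by (simp add: G_def)
  have "(err (real n * \<tau>) (U n))\<^sup>2 \<le> exp (2 * growth * \<tau> * real n) * (\<tau> * (\<Sum>j\<in>{1..n}. G j))"
  proof (rule discrete_Gronwall[where M=M and e="\<lambda>n. (err (real n * \<tau>) (U n))\<^sup>2"])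
    \<comment> \<open>The interior initial value is the projection of \<open>u 0\<close>, so the
      discrete error starts from zero.\<close>
    have "err 0 (U 0) = 0"
      unfolding err_def using steps L2_proj_initial by (intro norm_h_zero) (auto simp: wg_steps_def)
    then show "(err (real 0 * \<tau>) (U 0))\<^sup>2 = 0" by simp
    fix j assume j: "j \<in> {1..M}"
    then have dt: "real j * \<tau> - real (j - 1) * \<tau> = \<tau>" by (simp add: of_nat_diff algebra_simps)
    have "(err (real j * \<tau>) (U j))\<^sup>2 - (err (real (j - 1) * \<tau>) (U (j - 1)))\<^sup>2
      \<le> (real j * \<tau> - real (j - 1) * \<tau>) * (growth * (err (real j * \<tau>) (U j))\<^sup>2 + spatial * (h ^ Suc k * S (real j * \<tau>))\<^sup>2
         + (real j * \<tau> - real (j - 1) * \<tau>) * u_tt_energy (real (j - 1) * \<tau>) (real j * \<tau>))"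
    proof (rule step_error)
      show "0 \<le> real (j - 1) * \<tau>" using \<tau>0 by simp
      show "real (j - 1) * \<tau> < real j * \<tau>" using dt \<tau>0 by linarith
      show "real j * \<tau> \<le> T" using le_T j by simp
      show "U j \<in> wg_space0 N k" using steps j by (simp add: wg_steps_def)
      show "wg_residual (real j * \<tau> - real (j - 1) * \<tau>) (U j) (U (j - 1)) v = 0" if "v \<in> wg_space0 N k" for v
        unfolding dt using steps j that by (simp add: wg_steps_def)
    qed
    then show "(err (real j * \<tau>) (U j))\<^sup>2 - (err (real (j - 1) * \<tau>) (U (j - 1)))\<^sup>2 \<le> \<tau> * (growth * (err (real j * \<tau>) (U j))\<^sup>2 + G j)"
      unfolding dt G_def H_def by (simp add: add.assoc)
  qed (use G0 growth_ge \<tau>0 small n in auto)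
  also have "\<dots> \<le> exp (2 * growth * T) * (T * spatial * H\<^sup>2 * max_norm \<tau> n + \<tau>\<^sup>2 * u_tt_energy 0 (real n * \<tau>))"
  proof (rule mult_mono)
    have "2 * growth * (real n * \<tau>) \<le> 2 * growth * T"
      using le_T[of n] n growth_ge by (intro mult_left_mono) auto
    then show "exp (2 * growth * \<tau> * real n) \<le> exp (2 * growth * T)" by (simp add: mult_ac)
    \<comment> \<open>The truncation energies of the single steps add up to one integral over the
      elapsed time.\<close>
    have energy: "j \<le> M \<Longrightarrow> (\<Sum>i\<in>{1..j}. u_tt_energy (real (i - 1) * \<tau>) (real i * \<tau>)) = u_tt_energy 0 (real j * \<tau>)" for j :: nat
    proof (induction j)
      case 0
      have "u_tt_energy 0 0 = 0" unfolding u_tt_energy_def by (rule integral_eq_zero_AE) (simp add: AE_lebI_iff)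
      then show ?case by simp
    next
      case (Suc j)
      have "u_tt_energy 0 (real (Suc j) * \<tau>) = u_tt_energy 0 (real j * \<tau>) + u_tt_energy (real j * \<tau>) (real (Suc j) * \<tau>)"
        by (rule u_tt_energy_split) (use \<tau>0 le_T[of "Suc j"] Suc.prems in \<open>auto simp: distrib_right\<close>)
      then show ?case using Suc by simp
    qed
    have "(\<Sum>j\<in>{1..n}. G j) = (\<Sum>j\<in>{1..n}. spatial * (H * S (real j * \<tau>))\<^sup>2) + \<tau> * u_tt_energy 0 (real n * \<tau>)"
      using energy[of n] n by (simp add: G_def sum.distrib sum_distrib_left[symmetric])
    also have "(\<Sum>j\<in>{1..n}. spatial * (H * S (real j * \<tau>))\<^sup>2) \<le> (\<Sum>j\<in>{1..n}. spatial * (H\<^sup>2 * max_norm \<tau> n))"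
      unfolding power_mult_distrib by (intro sum_mono mult_left_mono max_norm_ge spatial_nonneg) auto
    also have "\<dots> = real n * (spatial * (H\<^sup>2 * max_norm \<tau> n))" by simp
    finally have "(\<Sum>j\<in>{1..n}. G j) \<le> real n * (spatial * (H\<^sup>2 * max_norm \<tau> n)) + \<tau> * u_tt_energy 0 (real n * \<tau>)" by simp
    then have "\<tau> * (\<Sum>j\<in>{1..n}. G j) \<le> \<tau> * (real n * (spatial * (H\<^sup>2 * max_norm \<tau> n)) + \<tau> * u_tt_energy 0 (real n * \<tau>))"
      using \<tau>0 by (intro mult_left_mono) auto
    also have "\<dots> = (real n * \<tau>) * (spatial * (H\<^sup>2 * max_norm \<tau> n)) + \<tau>\<^sup>2 * u_tt_energy 0 (real n * \<tau>)"
      by (simp add: power2_eq_square algebra_simps)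
    also have "\<dots> \<le> T * (spatial * (H\<^sup>2 * max_norm \<tau> n)) + \<tau>\<^sup>2 * u_tt_energy 0 (real n * \<tau>)"
      using le_T[of n] n spatial_nonneg max_norm_nonneg[of n \<tau>] by (intro add_right_mono mult_right_mono) auto
    finally show "\<tau> * (\<Sum>j\<in>{1..n}. G j) \<le> T * spatial * H\<^sup>2 * max_norm \<tau> n + \<tau>\<^sup>2 * u_tt_energy 0 (real n * \<tau>)"
      by (simp add: mult.assoc)
    show "0 \<le> \<tau> * (\<Sum>j\<in>{1..n}. G j)" using \<tau>0 G0 by (simp add: sum_nonneg)
  qed simp
  finally show ?thesis unfolding H_def .
qed

lemma total_error_small_steps:
  assumes M: "M \<ge> 1" and \<tau>: "\<tau> = T / real M" and small: "growth * \<tau> \<le> 1/2"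
    and steps: "wg_steps \<tau> M U" and n: "n \<in> {1..M}"
  shows "(norm_h N x (\<lambda>i y. u (real n * \<tau>) y - poly (inner_part (U n) i) y))\<^sup>2
    \<le> (2 + 2 * exp (2 * growth * T) * (T * spatial + 1)) * ((h ^ Suc k)\<^sup>2 * max_norm \<tau> n + \<tau>\<^sup>2 * u_tt_energy 0 (real n * \<tau>))"
proof -
  define t where "t = real n * \<tau>"
  define H where "H = h ^ Suc k"
  have "real n * T / real M \<le> T" using T n M by (simp add: field_simps)
  then have t: "t \<in> {0..T}" using T n M by (simp add: t_def \<tau>)
  define Y where "Y = H\<^sup>2 * max_norm \<tau> n"
  define Z where "Z = \<tau>\<^sup>2 * u_tt_energy 0 t"
  have Y0: "0 \<le> Y" and Z0: "0 \<le> Z" using max_norm_nonneg[of n \<tau>] n u_tt_energy_nonneg by (auto simp: Y_def Z_def)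
  have p: "norm_h N x (\<lambda>i y. u t y - poly (inner_part (U n) i) y)
     = norm_h N x (\<lambda>i y. (u t y - poly (L2_proj x k (u t) i) y) + poly (L2_proj x k (u t) i - inner_part (U n) i) y)"
    by simp
  also have "\<dots> \<le> norm_h N x (\<lambda>i y. u t y - poly (L2_proj x k (u t) i) y) + err t (U n)"
    unfolding err_def by (intro norm_h_triangle bcont_bl2 bcont_diff bcont_poly bcont_poly' bcont_global continuous_u_space t)
  also have "\<dots> \<le> H * S t + err t (U n)" using projection_error_u[OF t] by (simp add: H_def)
  finally have "(norm_h N x (\<lambda>i y. u t y - poly (inner_part (U n) i) y))\<^sup>2 \<le> (H * S t + err t (U n))\<^sup>2"
    by (intro power_mono) auto
  also have "\<dots> \<le> 2 * (H * S t)\<^sup>2 + 2 * (err t (U n))\<^sup>2"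
    using sum_squares_bound[of "H * S t" "err t (U n)"] by (simp add: power2_sum)
  also have "\<dots> \<le> 2 * Y + 2 * (exp (2 * growth * T) * (T * spatial * Y + Z))"
  proof (intro add_mono mult_left_mono)
    show "(H * S t)\<^sup>2 \<le> Y" unfolding Y_def power_mult_distrib t_def by (intro mult_left_mono max_norm_ge) (use n in auto)
    show "(err t (U n))\<^sup>2 \<le> exp (2 * growth * T) * (T * spatial * Y + Z)"
      using error_small_steps[OF assms] by (simp add: t_def Y_def Z_def H_def mult.assoc)
  qed auto
  \<comment> \<open>Both contributions are enlarged until a single constant stands in front of
    \<open>Y + Z\<close>.\<close>
  also have "\<dots> \<le> 2 * (Y + Z) + 2 * (exp (2 * growth * T) * ((T * spatial + 1) * (Y + Z)))"
  proof (intro add_mono mult_left_mono)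
    have "0 \<le> T * spatial * Z" using T spatial_nonneg Z0 by simp
    then show "T * spatial * Y + Z \<le> (T * spatial + 1) * (Y + Z)" using Y0 by (simp add: algebra_simps)
  qed (use Z0 in auto)
  also have "\<dots> = (2 + 2 * exp (2 * growth * T) * (T * spatial + 1)) * (Y + Z)" by (simp add: algebra_simps)
  finally show ?thesis unfolding t_def Y_def Z_def H_def .
qed

lemma zero_steps:
  assumes g0: "\<And>y. y \<in> {0..1} \<Longrightarrow> u 0 y = 0"
  shows "wg_steps \<tau> M (\<lambda>_. Weak_Fun (\<lambda>_. 0) (\<lambda>_. 0))"
  unfolding wg_steps_def
proof (intro conjI ballI)
  fix i assume i: "i \<in> {1..<N}"
  \<comment> \<open>The projection of zero is zero because projecting does not increase the
    norm.\<close>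
  have "l2n (E i) (poly (poly_proj k (x i) (x (Suc i)) (\<lambda>_. 0))) \<le> l2n (E i) (\<lambda>_. 0)"
    by (rule poly_proj_l2n_le[OF elem_less[OF i]]) simp
  moreover have "l2n (E i) (\<lambda>_. 0) = 0" by (simp add: l2n_def)
  ultimately have "l2n (E i) (poly (poly_proj k (x i) (x (Suc i)) (\<lambda>_. 0))) = 0"
    using l2n_nonneg[of "E i" "poly (poly_proj k (x i) (x (Suc i)) (\<lambda>_. 0))"] by linarith
  then have "poly_proj k (x i) (x (Suc i)) (\<lambda>_. 0) = 0"
    using l2n_square[of "E i" "poly (poly_proj k (x i) (x (Suc i)) (\<lambda>_. 0))"]
    by (intro poly_zero_if_l2n_zero[OF elem_less[OF i]]) simp
  moreover have "poly_proj k (x i) (x (Suc i)) (u 0) = poly_proj k (x i) (x (Suc i)) (\<lambda>_. 0)"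
    by (rule poly_proj_cong) (use g0 elem_bounds[OF i] in auto)
  ultimately show "inner_part (Weak_Fun (\<lambda>_. 0) (\<lambda>_. 0)) i = L2_proj x k g i"
    using L2_proj_initial[OF i] by (simp add: L2_proj_eq)
next
  fix n show "Weak_Fun (\<lambda>_. 0) (\<lambda>_. 0) \<in> wg_space0 N k" by (simp add: wg_space0_def wg_space_def)
next
  fix n v
  have wd: "weak_diff x (Suc k) (Weak_Fun (\<lambda>_. 0) (\<lambda>_. 0)) i = 0" if "i \<in> {1..<N}" for i
    by (rule weak_diff_unique[OF that]) simp_all
  have "inner_h N x (\<lambda>i. poly (weak_diff x (Suc k) (Weak_Fun (\<lambda>_. 0) (\<lambda>_. 0)) i)) (\<lambda>i. poly (weak_diff x (Suc k) v i))
     = inner_h N x (\<lambda>i y. 0) (\<lambda>i y. 0)"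
    by (rule inner_h_cong) (simp add: wd)
  then show "wg_residual \<tau> (Weak_Fun (\<lambda>_. 0) (\<lambda>_. 0)) (Weak_Fun (\<lambda>_. 0) (\<lambda>_. 0)) v = 0"
    by (simp add: wg_residual_def inner_h_eq)
qed

end

context burgers_k
begin

text \<open>Uniqueness of the zero solution comes for free from the error estimate: \<open>U = 0\<close> solves the
  scheme on every mesh, so the error bound tends to \<open>\<parallel>u(t)\<parallel>\<^sup>2\<close> as the mesh is refined.\<close>

lemma zero_solution:
  assumes g0: "\<And>y. y \<in> {0..1} \<Longrightarrow> u 0 y = 0" and M: "M \<ge> 1" and n: "n \<in> {1..M}"
  shows "l2n (lebI 0 1) (u (real n * (T / real M))) = 0"
proof -
  define t where "t = real n * (T / real M)"
  have t: "t \<in> {0..T}" using T n M by (simp add: t_def field_simps)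
  define C where "C = 2 + 2 * exp (2 * growth * T) * (T * spatial + 1)"
  have C0: "0 \<le> C" using T spatial_nonneg by (simp add: C_def)
  \<comment> \<open>A crude constant: every power of the mesh size and of the step is weakened to
    \<open>1 / m\<close>.\<close>
  define Q where "Q = C * (norm_bound\<^sup>2 + T\<^sup>2 * u_tt_energy 0 T)"
  have le: "(l2n (lebI 0 1) (u t))\<^sup>2 \<le> Q / real m" if m: "m \<ge> 1" "2 * growth * T \<le> real m" for m :: nat
  proof -
    define N where "N = Suc m"
    \<comment> \<open>The uniform mesh with \<open>m\<close> elements; its nodes are numbered from
      1, hence the shift.\<close>
    define x where "x i = (real i - 1) / real m" for i :: nat
    have part: "is_partition N x" using m by (auto simp: is_partition_def N_def x_def field_simps)
    interpret wg k T \<nu> g u N x by unfold_locales (rule part)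
    have hm: "h \<le> 1 / real m"
      unfolding h_def mesh_size_def using m by (intro Max.boundedI) (auto simp: x_def N_def field_simps)
    \<comment> \<open>Refining the step by the factor \<open>m\<close> keeps \<open>t\<close> a grid
      time, now with index \<open>n * m\<close>, while the step tends to zero.\<close>
    define \<tau> where "\<tau> = T / real (M * m)"
    have Mm: "M * m \<ge> 1" using M m by simp
    have \<tau>m: "\<tau> \<le> T / real m"
    proof -
      have "m \<le> M * m" using M by simp
      then have "real m \<le> real (M * m)" by (simp only: of_nat_le_iff)
      then show ?thesis unfolding \<tau>_def using T m by (intro divide_left_mono) auto
    qed
    have \<tau>0: "0 \<le> \<tau>" using T by (simp add: \<tau>_def)
    have "growth * \<tau> \<le> growth * (T / real m)" using \<tau>m growth_ge by (intro mult_left_mono) auto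
    also have "\<dots> \<le> 1/2" using m by (simp add: field_simps)
    finally have small: "growth * \<tau> \<le> 1/2" .
    have nm: "n * m \<in> {1..M * m}" using n m by auto
    have tn: "real (n * m) * \<tau> = t" using m by (simp add: \<tau>_def t_def)
    have "(norm_h N x (\<lambda>i y. u t y))\<^sup>2 \<le> C * ((h ^ Suc k)\<^sup>2 * max_norm \<tau> (n * m) + \<tau>\<^sup>2 * u_tt_energy 0 t)"
      using total_error_small_steps[OF Mm \<tau>_def small zero_steps[OF g0] nm] unfolding tn C_def by simp
    also have "\<dots> \<le> C * (1 / real m * norm_bound\<^sup>2 + 1 / real m * (T\<^sup>2 * u_tt_energy 0 T))"
    proof (intro mult_left_mono add_mono C0)
      have h1: "1 / real m \<le> 1" using m by simp
      have hk: "h ^ Suc k \<le> 1"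
        using h_pos hm h1 by (intro power_le_one) auto
      have "(h ^ Suc k)\<^sup>2 \<le> h ^ Suc k" unfolding power2_eq_square using h_pos hk by (intro mult_left_le) auto
      also have "\<dots> = h * h ^ k" by simp
      also have "\<dots> \<le> h * 1" using h_pos hm h1 by (intro mult_left_mono power_le_one) auto
      finally have "(h ^ Suc k)\<^sup>2 \<le> 1 / real m" using hm by simp
      moreover have "max_norm \<tau> (n * m) \<le> norm_bound\<^sup>2"
        unfolding max_norm_def
      proof (rule Max.boundedI)
        fix z assume "z \<in> (\<lambda>j. (S (real j * \<tau>))\<^sup>2) ` {1..n * m}"
        then obtain j where j: "j \<in> {1..n * m}" "z = (S (real j * \<tau>))\<^sup>2" by blast
        have "real j \<le> real (n * m)" using j by (simp only: of_nat_le_iff atLeastAtMost_iff)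
        then have "real j * \<tau> \<le> real (n * m) * \<tau>" using \<tau>0 by (intro mult_right_mono)
        then have "real j * \<tau> \<in> {0..T}" using tn t \<tau>0 by auto
        then show "z \<le> norm_bound\<^sup>2" unfolding j(2) by (intro power_mono u_norm_bound) auto
      qed (use nm in auto)
      ultimately show "(h ^ Suc k)\<^sup>2 * max_norm \<tau> (n * m) \<le> 1 / real m * norm_bound\<^sup>2"
        using max_norm_nonneg[of "n * m" \<tau>] nm by (intro mult_mono) auto
      have "\<tau>\<^sup>2 \<le> (T / real m)\<^sup>2" using \<tau>m \<tau>0 by (intro power_mono)
      also have "\<dots> = T\<^sup>2 * ((1 / real m) * (1 / real m))" by (simp add: power2_eq_square)
      also have "\<dots> \<le> T\<^sup>2 * (1 / real m * 1)" using h1 by (intro mult_left_mono) auto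
      finally have "\<tau>\<^sup>2 * u_tt_energy 0 t \<le> T\<^sup>2 * (1 / real m * 1) * u_tt_energy 0 T"
        using u_tt_energy_mono[of 0 t T] t u_tt_energy_nonneg by (intro mult_mono) auto
      then show "\<tau>\<^sup>2 * u_tt_energy 0 t \<le> 1 / real m * (T\<^sup>2 * u_tt_energy 0 T)" by (simp add: mult_ac)
    qed
    also have "\<dots> = Q / real m" by (simp add: Q_def add_divide_distrib distrib_left)
    finally show ?thesis using norm_h_global[OF square_integrable_u[OF t]] by simp
  qed
  have "(\<lambda>m::nat. Q / real m) \<longlonglongrightarrow> 0" by (rule lim_const_over_n)
  moreover have "\<forall>\<^sub>F m in sequentially. (l2n (lebI 0 1) (u t))\<^sup>2 \<le> Q / real m"
  proof -
    obtain m0 :: nat where m0: "2 * growth * T \<le> real m0" using real_arch_simple by blast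
    show ?thesis
    proof (rule eventually_sequentiallyI[of "max 1 m0"])
      fix m assume "max 1 m0 \<le> m"
      then show "(l2n (lebI 0 1) (u t))\<^sup>2 \<le> Q / real m" using m0 by (intro le) auto
    qed
  qed
  ultimately have "(l2n (lebI 0 1) (u t))\<^sup>2 \<le> 0" by (rule tendsto_lowerbound) simp
  then show ?thesis by (simp add: t_def)
qed

end

section \<open>The estimate for all step sizes\<close>

lemma (in wg) wg_scheme_steps:
  assumes "wg_scheme k (Suc k) \<nu> \<tau> g N x M U"
  shows "wg_steps \<tau> M U"
  using assms unfolding wg_scheme_def wg_steps_def wg_residual_def Let_def by (auto simp: Q_h_def)

theorem theorem3:
  fixes k r :: nat and T \<nu> :: real
    and u :: "real \<Rightarrow> real \<Rightarrow> real" and g :: "real \<Rightarrow> real"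
  assumes "T > 0" and "\<nu> > 0" and "r = k + 1"
    and "burgers_solution (1 + r) T \<nu> g u"
  shows "\<exists>C::real. \<forall>N x M U \<tau>.
    is_partition N x \<longrightarrow> M \<ge> 1 \<longrightarrow> \<tau> = T / real M \<longrightarrow>
    wg_scheme k r \<nu> \<tau> g N x M U \<longrightarrow>
    (\<forall>n\<in>{1..M}.
       (norm_h N x (\<lambda>i y. u (real n * \<tau>) y - poly (inner_part (U n) i) y))\<^sup>2
       \<le> C * (mesh_size N x ^ (2 * (k + 1)) *
                 Max ((\<lambda>j. (sobolev_norm (k + 2) (u (real j * \<tau>)))\<^sup>2) ` {1..n})
               + \<tau>\<^sup>2 * (LINT s:{0<..<real n * \<tau>}|lebesgue.
                   (L2_norm (time_deriv (1 + r) T 2 u s))\<^sup>2)))"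
proof -
  have rk: "1 + r = k + 2" using assms(3) by simp
  interpret burgers_k k T \<nu> g u
    using assms(1,2,4) unfolding rk by unfold_locales auto
  define Cs where "Cs = 2 + 2 * exp (2 * growth * T) * (T * spatial + 1)"
  \<comment> \<open>Any step that violates the restriction in Gronwall's lemma exceeds
    \<open>1 / (2 * growth)\<close>, hence also \<open>\<delta>\<close>.\<close>
  define \<delta> where "\<delta> = min T (1 / (2 * growth))"
  define c where "c = u_tt_energy 0 \<delta>"
  have gr: "growth > 0" using growth_ge by simp
  have \<delta>: "0 < \<delta>" "\<delta> \<le> T" "\<delta> \<le> 1 / (2 * growth)" using T gr by (auto simp: \<delta>_def)
  have c0: "0 \<le> c" by (simp add: c_def u_tt_energy_nonneg)
  \<comment> \<open>The second entry depends on \<open>u\<close> through \<open>c\<close>, but not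
    on mesh, step or \<open>n\<close>. For \<open>c = 0\<close> the division gives 0, which does no
    harm because the error then vanishes.\<close>
  define C where "C = max Cs (4 * norm_bound\<^sup>2 / (\<delta>\<^sup>2 * c))"
  have Cs0: "0 \<le> Cs" using T spatial_nonneg by (simp add: Cs_def)
  have C0: "0 \<le> C" using Cs0 by (simp add: C_def)
  show ?thesis
  proof (rule exI[of _ C], intro allI impI ballI)
    fix N x M U \<tau> n
    assume part: "is_partition N x" and M: "M \<ge> 1" and \<tau>: "\<tau> = T / real M"
      and scheme: "wg_scheme k r \<nu> \<tau> g N x M U" and n: "n \<in> {1..M}"
    interpret wg k T \<nu> g u N x by unfold_locales (rule part)
    have steps: "wg_steps \<tau> M U" using scheme assms(3) by (intro wg_scheme_steps) simp
    define t where "t = real n * \<tau>"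
    have \<tau>0: "0 < \<tau>" using T M by (simp add: \<tau>)
    have t: "t \<in> {0..T}" "\<tau> \<le> t" using T n M by (auto simp: t_def \<tau> field_simps)
    define Z where "Z = (h ^ Suc k)\<^sup>2 * max_norm \<tau> n + \<tau>\<^sup>2 * u_tt_energy 0 t"
    have Z: "Z = mesh_size N x ^ (2 * (k + 1)) * Max ((\<lambda>j. (sobolev_norm (k + 2) (u (real j * \<tau>)))\<^sup>2) ` {1..n})
               + \<tau>\<^sup>2 * (LINT s:{0<..<real n * \<tau>}|lebesgue. (L2_norm (time_deriv (1 + r) T 2 u s))\<^sup>2)"
    proof -
      have "(h ^ Suc k)\<^sup>2 = mesh_size N x ^ (2 * (k + 1))"
        unfolding h_def power_mult[symmetric] by (simp add: mult.commute)
      then show ?thesis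
        unfolding Z_def rk
        by (simp add: max_norm_def u_tt_energy_def u_tt_def L2_norm_eq set_integral_lebesgue_on t_def)
    qed
    have Y0: "0 \<le> (h ^ Suc k)\<^sup>2 * max_norm \<tau> n" using max_norm_nonneg[of n \<tau>] n by simp
    have Z0: "0 \<le> Z" using Y0 u_tt_energy_nonneg by (simp add: Z_def)
    define V where "V = norm_h N x (\<lambda>i y. u t y - poly (inner_part (U n) i) y)"
    have V0: "0 \<le> V" by (simp add: V_def)
    have "V \<le> norm_h N x (\<lambda>i. u t) + norm_h N x (\<lambda>i. poly (- inner_part (U n) i))"
      using norm_h_triangle[OF bcont_bl2[OF bcont_global[OF continuous_u_space[OF t(1)]]] bcont_bl2[OF bcont_poly'[of "\<lambda>i. - inner_part (U n) i"]]]
      by (simp add: V_def)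
    also have "norm_h N x (\<lambda>i. poly (- inner_part (U n) i)) = norm_h N x (\<lambda>i. poly (inner_part (U n) i))"
      unfolding norm_h_eq by (rule L2_set_cong) (simp_all add: l2n_def)
    also have "\<dots> \<le> l2n (lebI 0 1) (u 0)" by (rule stability[OF steps \<tau>0]) (use n in simp)
    also have "norm_h N x (\<lambda>i. u t) = l2n (lebI 0 1) (u t)" by (rule norm_h_global[OF square_integrable_u[OF t(1)]])
    finally have V: "V \<le> l2n (lebI 0 1) (u t) + l2n (lebI 0 1) (u 0)" by simp
    consider "c = 0" | "c > 0" "growth * \<tau> \<le> 1/2" | "c > 0" "growth * \<tau> > 1/2" using c0 by linarith
    then have "V\<^sup>2 \<le> C * Z"
    proof cases
      case 1
      \<comment> \<open>Both terms of the stability bound for the error vanish in this case.\<close>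
      have z: "u 0 y = 0" if "y \<in> {0..1}" for y
        by (rule zero_if_u_tt_zero[OF \<delta>(1,2) _ that]) (use 1 in \<open>simp add: c_def\<close>)
      have "l2n (lebI 0 1) (u 0) = 0" using l2n_cong[of "lebI 0 1" "u 0" "\<lambda>_. 0"] z by (simp add: l2n_def)
      moreover have "l2n (lebI 0 1) (u t) = 0" using zero_solution[OF z M n] by (simp add: t_def \<tau>)
      ultimately have "V = 0" using V V0 by simp
      then show ?thesis using C0 Z0 by simp
    next
      case 2
      have "V\<^sup>2 \<le> Cs * Z"
        using total_error_small_steps[OF M \<tau> 2(2) steps n] by (simp add: V_def Z_def Cs_def t_def)
      also have "\<dots> \<le> C * Z" by (intro mult_right_mono Z0) (simp add: C_def)
      finally show ?thesis .
    next
      case 3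
      have \<delta>\<tau>: "\<delta> \<le> \<tau>"
      proof -
        have "1 / (2 * growth) \<le> \<tau>" using 3(2) gr by (simp add: field_simps)
        then show ?thesis using \<delta>(3) by simp
      qed
      \<comment> \<open>For large steps a fixed bound on the error meets a right hand side of at
        least \<open>\<delta>^2 * c\<close>, which is positive and available because
        \<open>\<delta> \<le> \<tau> \<le> t\<close>.\<close>
      have "V \<le> 2 * norm_bound" using V u_l2n_le[OF t(1)] u_l2n_le[of 0] T by simp
      then have "V\<^sup>2 \<le> (2 * norm_bound)\<^sup>2" using V0 by (intro power_mono)
      also have "\<dots> = (4 * norm_bound\<^sup>2 / (\<delta>\<^sup>2 * c)) * (\<delta>\<^sup>2 * c)"
        using \<delta>(1) 3(1) by (simp add: power_mult_distrib)
      also have "\<dots> \<le> C * Z"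
      proof (intro mult_mono C0)
        show "4 * norm_bound\<^sup>2 / (\<delta>\<^sup>2 * c) \<le> C" by (simp add: C_def)
        have "\<delta>\<^sup>2 * c \<le> \<tau>\<^sup>2 * u_tt_energy 0 t"
          unfolding c_def using \<delta>\<tau> \<delta>(1) t u_tt_energy_nonneg
          by (intro mult_mono power_mono u_tt_energy_mono) auto
        then show "\<delta>\<^sup>2 * c \<le> Z" using Y0 by (simp add: Z_def)
        show "0 \<le> \<delta>\<^sup>2 * c" using c0 by simp
      qed
      finally show ?thesis .
    qed
    then show "(norm_h N x (\<lambda>i y. u (real n * \<tau>) y - poly (inner_part (U n) i) y))\<^sup>2
       \<le> C * (mesh_size N x ^ (2 * (k + 1)) *
                 Max ((\<lambda>j. (sobolev_norm (k + 2) (u (real j * \<tau>)))\<^sup>2) ` {1..n})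
               + \<tau>\<^sup>2 * (LINT s:{0<..<real n * \<tau>}|lebesgue.
                   (L2_norm (time_deriv (1 + r) T 2 u s))\<^sup>2))"
      unfolding Z V_def t_def .
  qed
qed

end
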